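(* Let $\varphi[a_1,a_2,a_3,a_4](z)\in M_2(\Gamma_0(24),\chi_8)$ be any of the 8 theta products with $(a_1,a_2,a_3,a_4)$ in the table below. Then $$\varphi[a_1,a_2,a_3,a_4](z)=b_1E_{1,8}(z)+b_2E_{1,8}(3z)+b_3E_{8,1}(z)+b_4E_{8,1}(3z)+x_1B_1(q)+x_2B_2(q),$$ where the coefficients are given by the corresponding row: $$\begin{array}{c|cccccc} (a_1,a_2,a_3,a_4)&b_1&b_2&b_3&b_4&x_1&x_2\\ \hline (1,1,1,2)&8&0&-2&0&0&0\\ (1,1,3,6)&16/5&-24/5&-4/5&-6/5&8/5&0\\ (1,2,2,2)&4&0&-2&0&0&0\\ (1,2,3,3)&8/5&48/5&2/5&-12/5&-8/5&8/5\\ (1,2,6,6)&4/5&24/5&2/5&-12/5&8/5&-4/5\\ (2,2,3,6)&8/5&-12/5&-4/5&-6/5&0&-4/5\\ (3,3,3,6)&0&8&0&-2&0&0\\ (3,6,6,6)&0&4&0&-2&0&0 \end{array}$$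
   Context: Here $z\in\mathbb{H}$ (upper half plane) and $q=e^{2\pi i z}$; series in $q$ are regarded as functions of $z$. For $t\in\{1,8\}$, $\chi_t(m)=\left(\frac{t}{m}\right)$ (Kronecker symbol); $\chi_1$ is trivial. $M_2(\Gamma_0(24),\chi_8)$ is the space of weight 2 modular forms for $\Gamma_0(24)$ with multiplier system $\chi_8$. Ramanujan's theta function is $\varphi(z)=\sum_{n=-\infty}^{\infty}q^{n^2}$, and $\varphi[a_1,a_2,a_3,a_4](z)=\varphi(a_1z)\varphi(a_2z)\varphi(a_3z)\varphi(a_4z)$. For Dirichlet characters $\chi,\psi$ and $n\in\mathbb{N}$, $\sigma_{(\chi,\psi)}(n)=\sum_{1\le m\mid n}\chi(m)\psi(n/m)\,m$. Define $$E_{1,8}(z)=\sum_{n=1}^\infty\sigma_{(\chi_1,\chi_8)}(n)q^n,\qquad E_{8,1}(z)=-\tfrac12+\sum_{n=1}^\infty\sigma_{(\chi_8,\chi_1)}(n)q^n.$$ With the Dedekind eta function $\eta(z)=e^{\pi i z/12}\prod_{n=1}^\infty(1-e^{2\pi i n z})$, $$B_1(q)=\frac{\eta(z)\eta^4(6z)\eta^2(8z)}{\eta(2z)\eta(3z)\eta(12z)},\qquad B_2(q)=\frac{\eta^2(z)\eta(8z)\eta^4(12z)}{\eta(4z)\eta(6z)\eta(24z)}.$$ *)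

theory Defs
  imports "HOL-Complex_Analysis.Complex_Analysis" "HOL-Number_Theory.Number_Theory"
begin

definition upper_half_plane :: "complex set"
  where "upper_half_plane = {z. 0 < Im z}"

definition qexp :: "complex \<Rightarrow> complex"
  where "qexp z = exp (2 * of_real pi * \<i> * z)"

definition kronecker_prime :: "int \<Rightarrow> nat \<Rightarrow> int"
  where "kronecker_prime a p =
    (if p = 2 then (if even a then 0 else if a mod 8 \<in> {1, 7} then 1 else -1)
     else Legendre a (int p))"

text \<open>The factor \<open>kronecker_unit a m\<close> is $(a / u)$ for the sign $u$ of $m$.\<close>

definition kronecker_unit :: "int \<Rightarrow> int \<Rightarrow> int"
  where "kronecker_unit a m = (if m < 0 \<and> a < 0 then -1 else 1)"

definition kronecker :: "int \<Rightarrow> int \<Rightarrow> int"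
  where "kronecker a m =
    (if m = 0 then (if \<bar>a\<bar> = 1 then 1 else 0)
     else kronecker_unit a m *
       (\<Prod>p\<in>prime_factors (nat \<bar>m\<bar>). kronecker_prime a p ^ multiplicity p (nat \<bar>m\<bar>)))"

definition chi :: "int \<Rightarrow> int \<Rightarrow> complex"
  where "chi t m = of_int (kronecker t m)"

text \<open>The quadruple $(a,b,c,d)$ stands for the matrix with rows $(a,b)$ and $(c,d)$.\<close>

type_synonym mat2 = "int \<times> int \<times> int \<times> int"

definition SL2Z :: "mat2 set"
  where "SL2Z = {(a, b, c, d). a * d - b * c = 1}"

definition Gamma0 :: "nat \<Rightarrow> mat2 set"
  where "Gamma0 N = {(a, b, c, d). a * d - b * c = 1 \<and> int N dvd c}"

fun slash :: "int \<Rightarrow> (complex \<Rightarrow> complex) \<Rightarrow> mat2 \<Rightarrow> complex \<Rightarrow> complex"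
  where "slash k f (a, b, c, d) z =
    (of_int c * z + of_int d) powi (- k) *
    f ((of_int a * z + of_int b) / (of_int c * z + of_int d))"

fun lower_right :: "mat2 \<Rightarrow> int"
  where "lower_right (a, b, c, d) = d"

text \<open>
  Only the values of \<open>f\<close> on the upper half plane matter. The last condition is
  holomorphy at all cusps: every \<open>slash k f \<gamma>\<close> with \<open>\<gamma> \<in> SL2Z\<close> is bounded near
  $i\infty$, i.e. its Fourier expansion there has no negative exponents.
\<close>

definition modular_forms :: "int \<Rightarrow> nat \<Rightarrow> (int \<Rightarrow> complex) \<Rightarrow> (complex \<Rightarrow> complex) set"
  where "modular_forms k N \<epsilon> = {f.
    f holomorphic_on upper_half_plane \<and>
    (\<forall>\<gamma>\<in>Gamma0 N. \<forall>z\<in>upper_half_plane. slash k f \<gamma> z = \<epsilon> (lower_right \<gamma>) * f z) \<and>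
    (\<forall>\<gamma>\<in>SL2Z. \<exists>Y>0. \<exists>C. \<forall>z. Im z \<ge> Y \<longrightarrow> norm (slash k f \<gamma> z) \<le> C)}"

definition ramanujan_phi :: "complex \<Rightarrow> complex"
  where "ramanujan_phi z = (\<Sum>\<^sub>\<infinity>n::int. qexp z powi (n\<^sup>2))"

fun theta_product :: "nat \<times> nat \<times> nat \<times> nat \<Rightarrow> complex \<Rightarrow> complex"
  where "theta_product (a1, a2, a3, a4) z =
    ramanujan_phi (of_nat a1 * z) * ramanujan_phi (of_nat a2 * z) *
    ramanujan_phi (of_nat a3 * z) * ramanujan_phi (of_nat a4 * z)"

definition twisted_sigma :: "(int \<Rightarrow> complex) \<Rightarrow> (int \<Rightarrow> complex) \<Rightarrow> nat \<Rightarrow> complex"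
  where "twisted_sigma \<phi> \<psi> n =
    (\<Sum>m | 1 \<le> m \<and> m dvd n. \<phi> (int m) * \<psi> (int (n div m)) * of_nat m)"

definition E_1_8 :: "complex \<Rightarrow> complex"
  where "E_1_8 z = (\<Sum>n. twisted_sigma (chi 1) (chi 8) (Suc n) * qexp z ^ Suc n)"

definition E_8_1 :: "complex \<Rightarrow> complex"
  where "E_8_1 z = - 1 / 2 + (\<Sum>n. twisted_sigma (chi 8) (chi 1) (Suc n) * qexp z ^ Suc n)"

definition dedekind_eta :: "complex \<Rightarrow> complex"
  where "dedekind_eta z =
    exp (of_real pi * \<i> * z / 12) * (\<Prod>n. 1 - exp (2 * of_real pi * \<i> * of_nat (Suc n) * z))"

text \<open>The eta quotients are written as functions of \<open>z\<close> rather than of $q = e^{2\pi i z}$.\<close>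

definition B1 :: "complex \<Rightarrow> complex"
  where "B1 z =
    dedekind_eta z * dedekind_eta (6 * z) ^ 4 * dedekind_eta (8 * z) ^ 2 /
    (dedekind_eta (2 * z) * dedekind_eta (3 * z) * dedekind_eta (12 * z))"

definition B2 :: "complex \<Rightarrow> complex"
  where "B2 z =
    dedekind_eta z ^ 2 * dedekind_eta (8 * z) * dedekind_eta (12 * z) ^ 4 /
    (dedekind_eta (4 * z) * dedekind_eta (6 * z) * dedekind_eta (24 * z))"

text \<open>Rows $((a_1,a_2,a_3,a_4),(b_1,b_2,b_3,b_4,x_1,x_2))$.\<close>

definition theta_table ::
  "((nat \<times> nat \<times> nat \<times> nat) \<times>
    (complex \<times> complex \<times> complex \<times> complex \<times> complex \<times> complex)) set"
  where "theta_table =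
   {((1,1,1,2), (8,    0,     -2,   0,     0,    0)),
    ((1,1,3,6), (16/5, -24/5, -4/5, -6/5,  8/5,  0)),
    ((1,2,2,2), (4,    0,     -2,   0,     0,    0)),
    ((1,2,3,3), (8/5,  48/5,  2/5,  -12/5, -8/5, 8/5)),
    ((1,2,6,6), (4/5,  24/5,  2/5,  -12/5, 8/5,  -4/5)),
    ((2,2,3,6), (8/5,  -12/5, -4/5, -6/5,  0,    -4/5)),
    ((3,3,3,6), (0,    8,     0,    -2,    0,    0)),
    ((3,6,6,6), (0,    4,     0,    -2,    0,    0))}"

end

theory Submission
  imports Defs
begin

text \<open>A holomorphic function \<open>F\<close> on the upper half plane that transforms with weight \<open>k\<close> under
  \<open>Gamma0 24\<close>, has moderate growth at all cusps and whose \<open>q\<close>-expansion vanishes through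
  \<open>q^(4k)\<close> is zero (\<open>sturm_bound\<close>). Indeed \<open>Gamma0 24\<close> has 48 cosets in \<open>SL2Z\<close>; the product of
  the 48 transforms of \<open>F\<close>, divided by \<open>\<eta>^(96k)\<close>, has \<open>SL2Z\<close>-invariant modulus, and it tends to \<open>0\<close> at
  the cusp because \<open>\<eta>^(96k)\<close> vanishes there to order \<open>4k\<close> only. The maximum modulus principle on a fundamental
  domain makes it vanish. Hence two forms of weight 2 agree once nine coefficients do, and the theorem is reduced
  to showing that both sides are forms of weight 2 for \<open>Gamma0 24\<close> with character \<open>\<chi>\<^sub>8\<close>.

  The transformation laws all come from one function. For a lattice generated by \<open>1\<close> and \<open>z\<close> the sum
  \<open>\<Sum>m. \<pi>\<^sup>2 / sin\<^sup>2 (\<pi> (u + m z))\<close> is a Weierstrass function plus a constant, and under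
  \<open>z \<mapsto> -1/z\<close> it is homogeneous of weight 2 up to the anomaly \<open>-2\<pi>iz\<close>, which does not depend on
  \<open>u\<close> (\<open>wsum_S\<close>). At points of order 8 its values give \<open>E_1_8\<close> and \<open>E_8_1\<close> as differences, so that the
  anomaly cancels; at points of order 2 they give the quasimodular series \<open>E2\<close>, where it stays. As \<open>E2\<close> is the
  logarithmic derivative of \<open>\<eta>\<close>, the inversion law of \<open>\<eta>\<close> follows. Jacobi's triple product writes
  \<open>\<phi>\<close> as an eta quotient, and this gives the behaviour of \<open>\<phi>(z)\<^sup>2\<close> under \<open>Gamma0 4\<close> and of
  \<open>\<phi>(z) \<phi>(2z)\<close> under \<open>Gamma0 8\<close>, with the characters \<open>(-4/d)\<close> and \<open>(-8/d)\<close>, whose product is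
  \<open>\<chi>\<^sub>8\<close>. Each theta product of the table is of the form \<open>\<phi>(mz)\<^sup>2 \<phi>(nz) \<phi>(2nz)\<close>.

  The modularity of the eta quotients \<open>B1\<close> and \<open>B2\<close> is never established directly. Instead they are
  identified with forms already at hand. Let \<open>F\<close> be the combination of a theta product and Eisenstein series
  that ought to be \<open>8 B1\<close> or \<open>-4 B2\<close>. The logarithmic derivative of the eta quotient is an explicit
  combination \<open>L\<close> of the series \<open>E2 (\<delta> z)\<close>, and \<open>24 F'/(2\<pi>i) - F L\<close> is a form of weight 4,
  because the anomalies of \<open>F'\<close> and of \<open>L\<close> cancel (\<open>form24_logderiv_defect\<close>). Seventeen of its coefficients
  vanish, so it is zero; hence \<open>F\<close> is a constant multiple of the eta quotient, and the constant is the
  coefficient of \<open>q\<close> (\<open>eq_eta_quot_if_logderiv_defect_eq_0\<close>).\<close>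

section \<open>The squared cosecant\<close>

definition csc2 :: "complex \<Rightarrow> complex"
  where "csc2 w = (of_real pi / sin (of_real pi * w))\<^sup>2"

lemma sin_pi_eq_0_iff: "sin (of_real pi * w) = 0 \<longleftrightarrow> w \<in> \<int>" for w :: complex
  by (metis Ints_cases Ints_of_real mult.commute
    nonzero_mult_div_cancel_left of_real_divide of_real_eq_0_iff pi_neq_zero
    sin_eq_0 sin_int_times_real sin_npi_int sin_times_pi_eq_0)

lemma csc2_plus_1: "csc2 (w + 1) = csc2 w"
  by (simp add: csc2_def distrib_left sin_plus_pi)

lemma csc2_minus: "csc2 (- w) = csc2 w"
  by (simp add: csc2_def)

lemma csc2_plus_of_int: "csc2 (w + of_int n) = csc2 w"
proof (induction n rule: int_induct[where k=0])
  case (step1 i)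
  then show ?case using csc2_plus_1[of "w + of_int i"] by (simp add: add_ac)
next
  case (step2 i)
  then show ?case using csc2_plus_1[of "w + of_int (i - 1)"] by (simp add: algebra_simps)
qed auto

text \<open>Here \<open>\<bar>sin (\<pi> w)\<bar> \<ge> \<bar>sinh (\<pi> Im w)\<bar> \<ge> \<pi> \<bar>Im w\<bar>\<close>. This is what makes the sum over the rows of a
  lattice converge as fast as \<open>\<Sum>m. 1 / m\<^sup>2\<close>.\<close>

lemma norm_csc2_le:
  assumes "Im w \<noteq> 0"
  shows "norm (csc2 w) \<le> 1 / (Im w)\<^sup>2"
proof -
  define y where "y = pi * Im w"
  have "norm (sin (of_real pi * w)) ^ 2 = (exp (2 * y) + inverse (exp (2 * y)) - 2 * cos (2 * (pi * Re w))) / 4"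
    unfolding norm_sin_squared by (simp add: y_def)
  also have "\<dots> \<ge> (exp (2 * y) + inverse (exp (2 * y)) - 2) / 4"
    by simp
  also have "(exp (2 * y) + inverse (exp (2 * y)) - 2) / 4 = (sinh y)\<^sup>2"
    by (simp add: sinh_def power2_eq_square field_simps exp_minus flip: exp_add)
  finally have s: "norm (sin (of_real pi * w)) ^ 2 \<ge> (sinh y)\<^sup>2" .
  have *: "sinh x \<ge> x" if "x \<ge> 0" for x :: real
  proof -
    have "sinh 0 - 0 \<le> sinh x - x"
      by (rule DERIV_nonneg_imp_nondecreasing[OF that])
         (auto intro!: exI derivative_eq_intros simp: cosh_real_ge_1)
    thus ?thesis by simp
  qed
  have "y\<^sup>2 \<le> (sinh y)\<^sup>2"
    using *[of "\<bar>y\<bar>"] by (metis abs_ge_zero power2_abs power_mono sinh_real_abs)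
  with s have "norm (sin (of_real pi * w)) ^ 2 \<ge> y\<^sup>2" by linarith
  hence "pi\<^sup>2 / norm (sin (of_real pi * w)) ^ 2 \<le> pi\<^sup>2 / y\<^sup>2"
    using assms by (intro divide_left_mono) (auto simp: y_def sin_pi_eq_0_iff zero_less_mult_iff elim!: Ints_cases)
  also have "\<dots> = 1 / (Im w)\<^sup>2"
    by (simp add: y_def power_mult_distrib)
  finally show ?thesis
    by (simp add: csc2_def norm_divide norm_power power_divide)
qed

lemma summable_inverse_square_shift:
  "summable (\<lambda>k::nat. norm (1 / (w + of_nat k)\<^sup>2))" for w :: complex
proof (rule summable_comparison_test_ev)
  show "summable (\<lambda>n. 4 * (1 / real n ^ 2))"
    by (intro summable_mult) (use inverse_power_summable[of 2, where ?'a=real] in \<open>simp add: inverse_eq_divide\<close>)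
  show "\<forall>\<^sub>F n in sequentially. norm (norm (1 / (w + of_nat n)\<^sup>2)) \<le> 4 * (1 / real n ^ 2)"
    using eventually_gt_at_top[of "nat \<lceil>2 * norm w\<rceil> + 1"]
  proof eventually_elim
    case (elim n)
    hence n: "real n \<ge> 2 * norm w" "n > 0" by linarith+
    have "norm (w + of_nat n) \<ge> real n - norm w"
      by (metis add.commute norm_diff_ineq norm_of_nat)
    hence "norm (w + of_nat n) \<ge> real n / 2" using n by linarith
    hence "norm (w + of_nat n) ^ 2 \<ge> (real n / 2)^2" by (intro power_mono) auto
    hence "1 / norm (w + of_nat n) ^ 2 \<le> 1 / (real n / 2)^2"
      using n by (intro divide_left_mono mult_pos_pos zero_less_power) (auto intro: less_le_trans[of _ "real n / 2"])
    thus ?case by (simp add: norm_divide norm_power power_divide)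
  qed
qed

text \<open>Logarithmic differentiation of the reflection formula of the Gamma function.\<close>

lemma Digamma_reflection:
  fixes w :: complex
  assumes "w \<notin> \<int>"
  shows "(Digamma (1 - w) - Digamma w) * sin (of_real pi * w) = of_real pi * cos (of_real pi * w)"
proof -
  have w: "w \<notin> \<int>\<^sub>\<le>\<^sub>0" "1 - w \<notin> \<int>\<^sub>\<le>\<^sub>0"
    using assms nonpos_Ints_Int Ints_1 Ints_diff[of 1 "1-w"] by (auto dest!: nonpos_Ints_Int)
  have "((\<lambda>w. rGamma w * rGamma (1 - w)) has_field_derivative
          rGamma w * rGamma (1 - w) * (Digamma (1 - w) - Digamma w)) (at w)"
    by (rule derivative_eq_intros refl w)+ (use w in \<open>auto simp: algebra_simps\<close>)
  moreover have "((\<lambda>w. rGamma w * rGamma (1 - w)) has_field_derivative cos (of_real pi * w)) (at w)"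
    unfolding rGamma_reflection_complex by (auto intro!: derivative_eq_intros)
  ultimately have "rGamma w * rGamma (1 - w) * (Digamma (1 - w) - Digamma w) = cos (of_real pi * w)"
    by (rule DERIV_unique)
  thus ?thesis by (simp add: rGamma_reflection_complex field_simps)
qed

lemma open_Compl_Ints: "open (- (\<int> :: complex set))"
  by (intro open_Compl closed_Ints)

definition cotp :: "complex \<Rightarrow> complex"
  where "cotp w = of_real pi * cos (of_real pi * w) / sin (of_real pi * w)"

lemma has_field_derivative_cotp:
  assumes "w \<notin> \<int>"
  shows "(cotp has_field_derivative - csc2 w) (at w within A)"
proof -
  have nz: "sin (of_real pi * w) \<noteq> 0" using assms by (simp add: sin_pi_eq_0_iff)
  have gen: "p * (- (s * p)) * s - p * c * (c * p) = - (p\<^sup>2 * (s\<^sup>2 + c\<^sup>2))" for p s c :: complex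
    by (simp add: power2_eq_square algebra_simps)
  have "((\<lambda>w. of_real pi * cos (of_real pi * w) / sin (of_real pi * w)) has_field_derivative
      (of_real pi * (- (sin (of_real pi * w) * of_real pi)) * sin (of_real pi * w) -
       of_real pi * cos (of_real pi * w) * (cos (of_real pi * w) * of_real pi)) /
       (sin (of_real pi * w) * sin (of_real pi * w))) (at w within A)"
    using nz by (auto intro!: derivative_eq_intros)
  also have "of_real pi * (- (sin (of_real pi * w) * of_real pi)) * sin (of_real pi * w) -
       of_real pi * cos (of_real pi * w) * (cos (of_real pi * w) * of_real pi) =
       - (of_real pi ^ 2 * ((sin (of_real pi * w))^2 + (cos (of_real pi * w))^2))"
    by (rule gen)
  also have "- (of_real pi ^ 2 * ((sin (of_real pi * w))^2 + (cos (of_real pi * w))^2)) / (sin (of_real pi * w) * sin (of_real pi * w)) = - csc2 w"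
    by (simp add: csc2_def power_divide flip: power2_eq_square)
  finally show ?thesis by (simp add: cotp_def [abs_def])
qed

lemma Polygamma_1_reflection:
  assumes "w \<notin> \<int>"
  shows "Polygamma (Suc 0) w + Polygamma (Suc 0) (1 - w) = csc2 w"
proof -
  have w: "w \<notin> \<int>\<^sub>\<le>\<^sub>0" "1 - w \<notin> \<int>\<^sub>\<le>\<^sub>0"
    using assms nonpos_Ints_Int Ints_1 Ints_diff[of 1 "1-w"] by (auto dest!: nonpos_Ints_Int)
  have "((\<lambda>w. Digamma (1 - w) - Digamma w) has_field_derivative
          - Polygamma (Suc 0) (1 - w) - Polygamma (Suc 0) w) (at w)"
    by (rule derivative_eq_intros refl w)+ (use w in auto)
  moreover have "((\<lambda>w. Digamma (1 - w) - Digamma w) has_field_derivative - csc2 w) (at w)"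
  proof (rule has_field_derivative_transform_within_open)
    show "(cotp has_field_derivative - csc2 w) (at w)"
      by (rule has_field_derivative_cotp[OF assms])
    show "open (- (\<int> :: complex set))" by (rule open_Compl_Ints)
    show "w \<in> - \<int>" using assms by auto
    show "cotp w = Digamma (1 - w) - Digamma w" if "w \<in> - \<int>" for w :: complex
      using Digamma_reflection[of w] that by (simp add: cotp_def divide_eq_eq sin_pi_eq_0_iff)
  qed
  ultimately have "- Polygamma (Suc 0) (1 - w) - Polygamma (Suc 0) w = - csc2 w"
    by (rule DERIV_unique)
  thus ?thesis by (simp add: algebra_simps)
qed

text \<open>The terms with \<open>n \<ge> 0\<close> form the trigamma series at \<open>w\<close>, those with \<open>n < 0\<close> the one at \<open>1 - w\<close>, and
  the two values add up by the reflection formula.\<close>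

lemma csc2_partial_fractions:
  assumes "w \<notin> \<int>"
  shows "((\<lambda>n::int. 1 / (w + of_int n)\<^sup>2) has_sum csc2 w) UNIV"
proof -
  have w: "w \<notin> \<int>\<^sub>\<le>\<^sub>0" "1 - w \<notin> \<int>\<^sub>\<le>\<^sub>0"
    using assms nonpos_Ints_Int Ints_1 Ints_diff[of 1 "1-w"] by (auto dest!: nonpos_Ints_Int)
  have *: "((\<lambda>k::nat. 1 / (v + of_nat k)\<^sup>2) has_sum Polygamma (Suc 0) v) UNIV" if "v \<notin> \<int>\<^sub>\<le>\<^sub>0" for v :: complex
  proof (rule norm_summable_imp_has_sum[OF summable_inverse_square_shift])
    have "v \<noteq> 0" using that by auto
    thus "(\<lambda>k::nat. 1 / (v + of_nat k)\<^sup>2) sums Polygamma (Suc 0) v"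
      using Polygamma_LIMSEQ[of v 1] by (simp add: inverse_eq_divide power2_eq_square)
  qed
  have "((\<lambda>n::int. 1 / (w + of_int n)\<^sup>2) has_sum Polygamma (Suc 0) w) {0..}"
    using *[OF w(1)] 
    by (subst has_sum_reindex_bij_witness[of _ int nat "UNIV :: nat set"]) auto
  moreover have "((\<lambda>n::int. 1 / (w + of_int n)\<^sup>2) has_sum Polygamma (Suc 0) (1 - w)) {..<0}"
    using *[OF w(2)] 
    by (subst has_sum_reindex_bij_witness[of _ "\<lambda>k. - 1 - int k" "\<lambda>n. nat (- 1 - n)" "UNIV :: nat set"])
       (auto simp: power2_commute algebra_simps)
  ultimately have "((\<lambda>n::int. 1 / (w + of_int n)\<^sup>2) has_sum csc2 w) ({0..} \<union> {..<0})"
    unfolding Polygamma_1_reflection[OF assms, symmetric] by (intro has_sum_Un_disjoint) auto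
  moreover have "{0..} \<union> {..<0} = (UNIV :: int set)" by auto
  ultimately show ?thesis by simp
qed

lemma csc2_eq_exp:
  "csc2 w = - 4 * of_real pi ^ 2 * (qexp w / (1 - qexp w)\<^sup>2)"
proof -
  define e where "e = exp (\<i> * (of_real pi * w))"
  have q: "qexp w = e ^ 2" unfolding qexp_def e_def 
    by (simp add: power2_eq_square algebra_simps flip: exp_add)
  have e: "e \<noteq> 0" by (auto simp: e_def)
  have s: "sin (of_real pi * w) = (e - 1 / e) / (2 * \<i>)"
    by (simp add: sin_exp_eq e_def exp_minus inverse_eq_divide mult_ac)
  have "sin (of_real pi * w) ^ 2 = - ((1 - e^2)^2 / (4 * e^2))"
    unfolding s using e by (simp add: power2_eq_square field_simps)
  thus ?thesis unfolding csc2_def q using e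
    by (simp add: power_divide) 
qed

section \<open>Weierstrass sums over a lattice\<close>

text \<open>Up to an additive constant that depends on \<open>z\<close> only, this is the Weierstrass function of the lattice
  generated by \<open>1\<close> and \<open>z\<close>. The summation over the translates by integers has been carried out in closed form
  (Eisenstein summation), which leaves an absolutely convergent series.\<close>

definition wsum :: "complex \<Rightarrow> complex \<Rightarrow> complex"
  where "wsum u z = (\<Sum>\<^sub>\<infinity>m::int. csc2 (u + of_int m * z))"

definition off_lattice :: "complex \<Rightarrow> complex \<Rightarrow> bool"
  where "off_lattice u z \<longleftrightarrow> (\<forall>m n::int. u \<noteq> of_int m * z + of_int n)"

lemma off_latticeD: "off_lattice u z \<Longrightarrow> u + of_int m * z \<notin> \<int>"
proof
  assume *: "off_lattice u z" "u + of_int m * z \<in> \<int>"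
  then obtain n where "u + of_int m * z = of_int n" by (elim Ints_cases)
  hence "u = of_int (- m) * z + of_int n" by (simp add: algebra_simps)
  with * show False unfolding off_lattice_def by blast
qed

lemma summable_on_int_powr:
  assumes "p > 1"
  shows "(\<lambda>m::int. max 1 (real_of_int \<bar>m\<bar>) powr - p) summable_on UNIV"
proof -
  have "summable (\<lambda>n. real n powr - p)"
    using assms by (simp add: summable_real_powr_iff)
  hence *: "(\<lambda>n::nat. real n powr - p) summable_on UNIV"
    by (simp add: summable_on_UNIV_nonneg_real_iff)
  have "(\<lambda>m::int. max 1 (real_of_int \<bar>m\<bar>) powr - p) summable_on {1..} \<longleftrightarrow> (\<lambda>n::nat. real n powr - p) summable_on {1..}"
    by (rule summable_on_reindex_bij_witness[of _ int nat]) (auto simp: max_def)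
  hence 1: "(\<lambda>m::int. max 1 (real_of_int \<bar>m\<bar>) powr - p) summable_on {1..}"
    using summable_on_subset[OF *, of "{1..}"] by simp
  have "(\<lambda>m::int. max 1 (real_of_int \<bar>m\<bar>) powr - p) summable_on {..-1} \<longleftrightarrow>
        (\<lambda>m::int. max 1 (real_of_int \<bar>m\<bar>) powr - p) summable_on {1..}"
    by (rule summable_on_reindex_bij_witness[of _ uminus uminus]) auto
  hence 2: "(\<lambda>m::int. max 1 (real_of_int \<bar>m\<bar>) powr - p) summable_on {..-1}"
    using 1 by simp
  have "(\<lambda>m::int. max 1 (real_of_int \<bar>m\<bar>) powr - p) summable_on ({1..} \<union> {..-1} \<union> {0})"
    using 1 2 by (intro summable_on_Un_disjoint) auto
  also have "{1..} \<union> {..-1} \<union> {0} = (UNIV :: int set)" by force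
  finally show ?thesis .
qed

lemma csc2_row_bound:
  assumes "Im z > 0" "\<bar>Im u\<bar> \<le> A" "real_of_int \<bar>m\<bar> * Im z \<ge> 2 * A" "m \<noteq> 0"
  shows "norm (csc2 (u + of_int m * z)) \<le> 4 / (Im z)\<^sup>2 * max 1 (real_of_int \<bar>m\<bar>) powr -2"
proof -
  have 1: "\<bar>Im (u + of_int m * z)\<bar> \<ge> real_of_int \<bar>m\<bar> * Im z / 2"
  proof -
    have "\<bar>a + x\<bar> \<ge> \<bar>x\<bar> - \<bar>a\<bar>" for a x :: real by linarith
    from this[of "real_of_int m * Im z" "Im u"] show ?thesis
      using assms abs_mult[of "real_of_int m" "Im z"] by simp
  qed
  have 2: "real_of_int \<bar>m\<bar> * Im z / 2 > 0" using assms by simp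
  have "norm (csc2 (u + of_int m * z)) \<le> 1 / (Im (u + of_int m * z))\<^sup>2"
    by (rule norm_csc2_le) (use 1 2 in auto)
  also have "\<dots> \<le> 1 / (real_of_int \<bar>m\<bar> * Im z / 2)\<^sup>2"
  proof (rule divide_left_mono)
    have "(real_of_int \<bar>m\<bar> * Im z / 2)\<^sup>2 \<le> \<bar>Im (u + of_int m * z)\<bar>\<^sup>2"
      using 1 2 by (intro power_mono) auto
    thus *: "(real_of_int \<bar>m\<bar> * Im z / 2)\<^sup>2 \<le> (Im (u + of_int m * z))\<^sup>2"
      by simp
    have "0 < (real_of_int \<bar>m\<bar> * Im z / 2)\<^sup>2" using 2 by (rule zero_less_power)
    with * show "0 < (Im (u + of_int m * z))\<^sup>2 * (real_of_int \<bar>m\<bar> * Im z / 2)\<^sup>2"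
      by (intro mult_pos_pos) linarith+
  qed auto
  also have "\<dots> = 4 / (Im z)\<^sup>2 * max 1 (real_of_int \<bar>m\<bar>) powr -2"
    using assms(4) by (subst powr_minus) (auto simp: max_def field_simps power2_eq_square)
  finally show ?thesis .
qed

text \<open>On a compact set all but finitely many rows keep a distance from the real axis proportional to \<open>\<bar>m\<bar>\<close>; the
  remaining ones are bounded by compactness.\<close>

lemma csc2_row_majorant:
  assumes z: "Im z > 0" and Y: "compact Y" and off: "\<And>u. u \<in> Y \<Longrightarrow> off_lattice u z"
  shows "\<exists>M :: int \<Rightarrow> real. (\<forall>m. \<forall>u\<in>Y. norm (csc2 (u + of_int m * z)) \<le> M m) \<and> M summable_on UNIV"
proof -
  obtain A where A: "\<And>u. u \<in> Y \<Longrightarrow> norm u \<le> A"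
    using compact_imp_bounded[OF Y] unfolding bounded_iff by blast
  have "\<exists>B. \<forall>u\<in>Y. norm (csc2 (u + of_int m * z)) \<le> B" for m
  proof -
    have "continuous_on Y (\<lambda>u. csc2 (u + of_int m * z))"
      unfolding csc2_def using off_latticeD[OF off]
      by (intro continuous_intros) (auto simp: sin_pi_eq_0_iff)
    hence "bounded ((\<lambda>u. csc2 (u + of_int m * z)) ` Y)"
      using Y by (intro compact_imp_bounded compact_continuous_image)
    thus ?thesis unfolding bounded_iff by auto
  qed
  then obtain B where B: "\<And>m u. u \<in> Y \<Longrightarrow> norm (csc2 (u + of_int m * z)) \<le> B m" by metis
  define S where "S = {m::int. \<bar>m\<bar> \<le> \<lceil>2 * A / Im z\<rceil>} \<union> {0}"
  have fin: "finite S"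
    unfolding S_def by (rule finite_UnI, rule finite_subset[of _ "{-\<lceil>2 * A / Im z\<rceil>..\<lceil>2 * A / Im z\<rceil>}"]) auto
  define M where "M m = (if m \<in> S then B m else 4 / (Im z)\<^sup>2 * max 1 (real_of_int \<bar>m\<bar>) powr -2)" for m
  show ?thesis
  proof (intro exI[of _ M] conjI allI ballI)
    show "norm (csc2 (u + of_int m * z)) \<le> M m" if "u \<in> Y" for u m
    proof (cases "m \<in> S")
      case False
      have "real_of_int \<bar>m\<bar> \<ge> 2 * A / Im z" using False by (auto simp: S_def) linarith
      hence "real_of_int \<bar>m\<bar> * Im z \<ge> 2 * A" using z by (simp add: field_simps)
      thus ?thesis using csc2_row_bound[OF z, of u A m] A[OF that] False abs_Im_le_cmod[of u]
        by (auto simp: M_def S_def)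
    qed (use B[OF that] in \<open>auto simp: M_def\<close>)
    have "(\<lambda>m. 4 / (Im z)\<^sup>2 * max 1 (real_of_int \<bar>m\<bar>) powr -2) summable_on UNIV"
      by (intro summable_on_cmult_right summable_on_int_powr) auto
    hence "(\<lambda>m. 4 / (Im z)\<^sup>2 * max 1 (real_of_int \<bar>m\<bar>) powr -2) summable_on (- S)"
      by (rule summable_on_subset) auto
    also have "?this \<longleftrightarrow> M summable_on (- S)"
      by (intro summable_on_cong) (auto simp: M_def)
    finally have "M summable_on (- S)" .
    moreover have "M summable_on S" using fin by simp
    ultimately have "M summable_on (- S \<union> S)" by (rule summable_on_Un_disjoint) auto
    thus "M summable_on UNIV" by simp
  qed
qed

lemma wsum_abs_summable:
  assumes "Im z > 0" "off_lattice u z"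
  shows "(\<lambda>m::int. norm (csc2 (u + of_int m * z))) summable_on UNIV"
proof -
  have c: "compact {u}" by simp
  have off: "\<And>v. v \<in> {u} \<Longrightarrow> off_lattice v z" using assms by simp
  obtain M :: "int \<Rightarrow> real" where M: "\<forall>m. \<forall>v\<in>{u}. norm (csc2 (v + of_int m * z)) \<le> M m" "M summable_on UNIV"
    using csc2_row_majorant[OF assms(1) c off] by blast
  have M1: "norm (csc2 (u + of_int m * z)) \<le> M m" for m
    by (rule M(1)[THEN spec, THEN bspec]) simp
  show ?thesis
    using M(2) M1 by (rule Infinite_Sum.abs_summable_on_comparison_test')
qed

lemma wsum_has_sum:
  assumes "Im z > 0" "off_lattice u z"
  shows "((\<lambda>m::int. csc2 (u + of_int m * z)) has_sum wsum u z) UNIV"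
  unfolding wsum_def using wsum_abs_summable[OF assms]
  by (rule has_sum_infsum[OF abs_summable_summable])

lemma filterlim_symmetric_intervals:
  "filterlim (\<lambda>M::nat. {- int M..int M}) (finite_subsets_at_top UNIV) sequentially"
  unfolding filterlim_finite_subsets_at_top
proof safe
  fix X :: "int set" assume X: "finite X"
  show "\<forall>\<^sub>F M in sequentially. finite {- int M..int M} \<and> X \<subseteq> {- int M..int M} \<and> {- int M..int M} \<subseteq> UNIV"
    using eventually_ge_at_top[of "nat (Max (insert 0 (abs ` X)))"]
  proof eventually_elim
    case (elim M)
    have "- int M \<le> x \<and> x \<le> int M" if "x \<in> X" for x
    proof -
      have "\<bar>x\<bar> \<le> Max (insert 0 (abs ` X))"
        using X that by (intro Max_ge) auto
      thus ?thesis using elim by linarith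
    qed
    thus ?case by (simp add: subset_iff)
  qed
qed

lemma wsum_uniform_limit:
  assumes z: "Im z > 0" and Y: "compact Y" and off: "\<And>u. u \<in> Y \<Longrightarrow> off_lattice u z"
  shows "uniform_limit Y (\<lambda>M u. \<Sum>m=-int M..int M. csc2 (u + of_int m * z)) (\<lambda>u. wsum u z) sequentially"
proof -
  obtain M :: "int \<Rightarrow> real" where M: "\<forall>m. \<forall>u\<in>Y. norm (csc2 (u + of_int m * z)) \<le> M m" "M summable_on UNIV"
    using csc2_row_majorant[OF assms] by blast
  have "uniform_limit Y (\<lambda>X u. \<Sum>m\<in>X. csc2 (u + of_int m * z)) (\<lambda>u. wsum u z) (finite_subsets_at_top UNIV)"
    by (rule Weierstrass_m_test_general'[where M = M]) (use M wsum_has_sum[OF z off] in auto)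
  thus ?thesis
    by (rule filterlim_compose[OF _ filterlim_symmetric_intervals])
qed

lemma wsum_plus_1: "wsum (u + 1) z = wsum u z"
proof -
  have "csc2 (u + 1 + of_int m * z) = csc2 (u + of_int m * z)" for m
  proof -
    have "u + 1 + of_int m * z = u + of_int m * z + 1" by simp
    thus ?thesis by (simp only: csc2_plus_1)
  qed
  thus ?thesis by (simp add: wsum_def)
qed

lemma wsum_plus_period: "wsum (u + z) z = wsum u z"
  unfolding wsum_def
  by (rule infsum_reindex_bij_witness[of _ "\<lambda>m. m - 1" "\<lambda>m. m + 1"]) (simp_all add: algebra_simps)

lemma wsum_minus: "wsum (- u) z = wsum u z"
proof -
  have *: "csc2 (u + of_int (- m) * z) = csc2 (- u + of_int m * z)" for m
  proof -
    have "u + of_int (- m) * z = - (- u + of_int m * z)" by simp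
    thus ?thesis by (simp only: csc2_minus)
  qed
  show ?thesis unfolding wsum_def
    by (rule infsum_reindex_bij_witness[of _ uminus uminus], simp, simp, simp, simp, rule *)
qed

lemma wsum_period_plus_1: "wsum u (z + 1) = wsum u z"
proof -
  have "csc2 (u + of_int m * (z + 1)) = csc2 (u + of_int m * z)" for m
  proof -
    have "u + of_int m * (z + 1) = u + of_int m * z + of_int m" by (simp add: algebra_simps)
    thus ?thesis by (simp only: csc2_plus_of_int)
  qed
  thus ?thesis by (simp add: wsum_def)
qed

section \<open>The inversion law of the Weierstrass sums\<close>

lemma lattice_norm_bound:
  assumes "Im z > 0"
  obtains c where "0 < c" "c \<le> 1"
    "\<And>m n::int. c * max \<bar>real_of_int m\<bar> \<bar>real_of_int n\<bar> \<le> norm (of_int m * z + of_int n)"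
proof -
  define y where "y = Im z"
  have y: "y > 0" using assms by (simp add: y_def)
  define c where "c = min (min y (1 / (1 + norm z / y))) 1"
  have c: "c > 0" "c \<le> y" "c \<le> 1 / (1 + norm z / y)" "c \<le> 1" using y by (simp_all add: c_def add_pos_nonneg min_le_iff_disj)
  have "c * max \<bar>real_of_int m\<bar> \<bar>real_of_int n\<bar> \<le> norm (of_int m * z + of_int n)" for m n
  proof -
    define w where "w = of_int m * z + of_int n"
    have "\<bar>Im w\<bar> = y * \<bar>real_of_int m\<bar>" using y by (simp add: w_def y_def abs_mult)
    hence 1: "y * \<bar>real_of_int m\<bar> \<le> norm w" using abs_Im_le_cmod[of w] by simp
    have "norm (of_int n :: complex) = norm (w - of_int m * z)" by (simp add: w_def)
    also have "\<dots> \<le> norm w + \<bar>real_of_int m\<bar> * norm z"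
      using norm_triangle_ineq4[of w "of_int m * z"] by (simp add: norm_mult)
    also have "\<bar>real_of_int m\<bar> \<le> norm w / y" using 1 y by (simp add: field_simps)
    finally have "\<bar>real_of_int n\<bar> \<le> norm w * (1 + norm z / y)"
      by (simp add: mult_right_mono field_simps)
    hence "1 / (1 + norm z / y) * \<bar>real_of_int n\<bar> \<le> norm w"
      using y by (simp add: divide_le_eq add_pos_nonneg)
    hence 2: "c * \<bar>real_of_int n\<bar> \<le> norm w"
      using c(3) mult_right_mono[OF c(3), of "\<bar>real_of_int n\<bar>"] by simp
    have 3: "c * \<bar>real_of_int m\<bar> \<le> norm w"
      using 1 mult_right_mono[OF c(2), of "\<bar>real_of_int m\<bar>"] by simp
    show ?thesis using 2 3 by (auto simp: max_def w_def)
  qed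
  with c show ?thesis using that by blast
qed

text \<open>In a difference the leading term \<open>1 / w\<^sup>2\<close> drops out, and cubic decay is enough for absolute convergence over
  a lattice.\<close>

lemma inverse_square_diff_bound:
  fixes u v w :: complex
  assumes R: "norm w \<ge> 2 * (norm u + norm v) + 1"
  shows "norm (1 / (u + w)\<^sup>2 - 1 / (v + w)\<^sup>2) \<le> 48 * norm (v - u) / norm w ^ 3"
proof -
  have w: "norm w > 0" by (rule less_le_trans[OF _ R]) (simp add: add_nonneg_pos)
  have 1: "norm (u + w) \<ge> norm w / 2" "norm (v + w) \<ge> norm w / 2"
  proof -
    have *: "c / 2 \<le> c - a \<and> c / 2 \<le> c - b" if "a \<ge> 0" "b \<ge> 0" "2 * (a + b) + 1 \<le> c" for a b c :: real
      using that by simp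
    show "norm (u + w) \<ge> norm w / 2" "norm (v + w) \<ge> norm w / 2"
      using *[OF norm_ge_zero norm_ge_zero R] norm_diff_ineq[of w u] norm_diff_ineq[of w v]
      by (simp_all add: add.commute)
  qed
  hence nz: "u + w \<noteq> 0" "v + w \<noteq> 0" using w by auto
  have 2: "norm (u + v + 2 * w) \<le> 3 * norm w"
  proof -
    have "norm u + norm v \<le> 2 * (norm u + norm v) + 1" by simp
    hence "norm (u + v) \<le> norm w" using R by (rule order_trans[OF norm_triangle_ineq order_trans])
    thus ?thesis using norm_triangle_ineq[of "u + v" "2 * w"] by (simp add: norm_mult)
  qed
  have "1 / (u + w)\<^sup>2 - 1 / (v + w)\<^sup>2 = (v - u) * (u + v + 2 * w) / ((u + w)\<^sup>2 * (v + w)\<^sup>2)"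
    using nz by (simp add: field_simps) (simp add: power2_eq_square algebra_simps)
  also have "norm \<dots> = norm (v - u) * norm (u + v + 2 * w) / (norm (u + w) ^ 2 * norm (v + w) ^ 2)"
    by (simp add: norm_mult norm_divide norm_power)
  also have "\<dots> \<le> norm (v - u) * (3 * norm w) / ((norm w / 2) ^ 2 * (norm w / 2) ^ 2)"
    using 1 2 w by (intro frac_le mult_left_mono mult_mono power_mono) auto
  also have "\<dots> = 48 * norm (v - u) / norm w ^ 3"
    using w by (simp add: field_simps power2_eq_square power3_eq_cube)
  finally show ?thesis .
qed

text \<open>Lattice points with \<open>max \<bar>m\<bar> \<bar>n\<bar>\<close> large are dominated by a product of two convergent series in \<open>m\<close> and
  \<open>n\<close>.\<close>

lemma pair_abs_summable:
  assumes "Im z > 0"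
  shows "(\<lambda>(m::int, n::int). norm (1 / (u + (of_int m * z + of_int n))\<^sup>2 - 1 / (v + (of_int m * z + of_int n))\<^sup>2))
           summable_on UNIV \<times> UNIV"
proof -
  obtain c where c: "0 < c" "c \<le> 1"
    "\<And>m n::int. c * max \<bar>real_of_int m\<bar> \<bar>real_of_int n\<bar> \<le> norm (of_int m * z + of_int n)"
    using lattice_norm_bound[OF assms] by blast
  define R where "R = 2 * (norm u + norm v) + 1"
  have R: "R \<ge> 1" by (simp add: R_def)
  define p where "p m = max 1 (real_of_int \<bar>m\<bar>)" for m
  define D where "D = 48 * norm (v - u) * c powr -3"
  define g where "g = (\<lambda>(m::int, n::int). norm (1 / (u + (of_int m * z + of_int n))\<^sup>2 - 1 / (v + (of_int m * z + of_int n))\<^sup>2))"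
  define S where "S = {(m,n). norm (of_int m * z + of_int n) < R}"
  define N where "N = \<lceil>R / c\<rceil>"
  have "S \<subseteq> {-N..N} \<times> {-N..N}"
  proof (clarsimp simp: S_def)
    fix m n assume *: "norm (of_int m * z + of_int n) < R"
    have "max \<bar>real_of_int m\<bar> \<bar>real_of_int n\<bar> < R / c"
      using le_less_trans[OF c(3)[of m n] *] by (simp only: pos_less_divide_eq[OF c(1)] mult.commute[of _ c])
    hence "\<bar>real_of_int m\<bar> \<le> real_of_int N" "\<bar>real_of_int n\<bar> \<le> real_of_int N" unfolding N_def by linarith+
    thus "- N \<le> m \<and> m \<le> N \<and> - N \<le> n \<and> n \<le> N" by linarith
  qed
  hence fin: "finite S" by (rule finite_subset) auto
  define h where "h = (\<lambda>(m, n). D * (p m powr -(3/2) * p n powr -(3/2)))"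
  have "g summable_on (- S)"
  proof (rule summable_on_comparison_test)
    have p: "(\<lambda>m. p m powr -(3/2)) summable_on UNIV"
      unfolding p_def by (rule summable_on_int_powr) auto
    have "h summable_on UNIV \<times> UNIV"
      unfolding h_def
      by (rule summable_on_SigmaI[where g = "\<lambda>m. D * (p m powr -(3/2) * (\<Sum>\<^sub>\<infinity>n. p n powr -(3/2)))"])
         (use p in \<open>auto intro!: has_sum_cmult_right summable_on_cmult_right summable_on_cmult_left simp: D_def\<close>)
    thus "h summable_on - S" by (rule summable_on_subset) auto
    show "g x \<ge> 0" for x by (auto simp: g_def split: prod.splits)
    show "g x \<le> h x" if "x \<in> - S" for x
    proof -
      obtain m n where x: "x = (m, n)" by (cases x)
      define w where "w = of_int m * z + of_int n"
      have w: "norm w \<ge> R" using that by (simp add: S_def x w_def)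
      have w1: "norm w \<ge> 1" using w R by simp
      have "c * \<bar>real_of_int m\<bar> \<le> norm w" "c * \<bar>real_of_int n\<bar> \<le> norm w"
        unfolding w_def using c(1)
        by (auto intro!: order_trans[OF mult_left_mono[OF max.cobounded1] c(3)] order_trans[OF mult_left_mono[OF max.cobounded2] c(3)])
      hence "norm w \<ge> c * p m" "norm w \<ge> c * p n"
        using c(1,2) w1 by (auto simp: p_def max_def)
      hence "(c * p m) * (c * p n) \<le> norm w * norm w"
        using c by (intro mult_mono) (auto simp: p_def)
      hence "((c * p m) * (c * p n)) powr (3/2) \<le> (norm w * norm w) powr (3/2)"
        using c by (intro powr_mono2) (auto simp: p_def)
      also have "(norm w * norm w) powr (3/2) = norm w ^ 3"
        using w1 by (simp add: powr_mult flip: powr_realpow powr_add)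
      also have "((c * p m) * (c * p n)) powr (3/2) = c powr 3 * (p m powr (3/2) * p n powr (3/2))"
        using c by (simp add: powr_mult p_def flip: powr_add)
      finally have *: "c powr 3 * (p m powr (3/2) * p n powr (3/2)) \<le> norm w ^ 3" .
      have "g x \<le> 48 * norm (v - u) / norm w ^ 3"
        unfolding g_def x w_def[symmetric] prod.case
        by (rule inverse_square_diff_bound) (use w in \<open>auto simp: R_def\<close>)
      also have "\<dots> \<le> 48 * norm (v - u) / (c powr 3 * (p m powr (3/2) * p n powr (3/2)))"
      proof (rule divide_left_mono[OF *])
        have pos: "0 < c powr 3 * (p m powr (3/2) * p n powr (3/2))" using c by (simp add: p_def)
        show "0 < norm w ^ 3 * (c powr 3 * (p m powr (3/2) * p n powr (3/2)))"
          using less_le_trans[OF pos *] pos by (rule mult_pos_pos)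
      qed auto
      also have "\<dots> = h x"
        by (simp add: h_def x D_def powr_minus divide_simps)
      finally show ?thesis .
    qed
  qed
  moreover have "g summable_on S" using fin by simp
  ultimately have "g summable_on (- S \<union> S)" by (rule summable_on_Un_disjoint) auto
  thus ?thesis by (simp add: g_def)
qed

lemma wsum_diff_has_sum:
  assumes z: "Im z > 0" and "off_lattice u z" "off_lattice v z"
  shows "((\<lambda>(m::int, n::int). 1 / (u + (of_int m * z + of_int n))\<^sup>2 - 1 / (v + (of_int m * z + of_int n))\<^sup>2)
           has_sum (wsum u z - wsum v z)) (UNIV \<times> UNIV)"
proof (rule has_sum_SigmaI)
  show "((\<lambda>n. (\<lambda>(m, n). 1 / (u + (of_int m * z + of_int n))\<^sup>2 - 1 / (v + (of_int m * z + of_int n))\<^sup>2) (m, n))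
          has_sum (csc2 (u + of_int m * z) - csc2 (v + of_int m * z))) UNIV" for m :: int
    using has_sum_add[OF csc2_partial_fractions[of "u + of_int m * z"] 
       has_sum_uminusI[OF csc2_partial_fractions[of "v + of_int m * z"]]] assms
    by (simp add: off_latticeD add_ac)
  show "((\<lambda>m::int. csc2 (u + of_int m * z) - csc2 (v + of_int m * z)) has_sum (wsum u z - wsum v z)) UNIV"
    using has_sum_add[OF wsum_has_sum[OF z assms(2)] has_sum_uminusI[OF wsum_has_sum[OF z assms(3)]]] by simp
  show "(\<lambda>(m::int, n::int). 1 / (u + (of_int m * z + of_int n))\<^sup>2 - 1 / (v + (of_int m * z + of_int n))\<^sup>2) summable_on UNIV \<times> UNIV"
    by (rule abs_summable_summable) (use pair_abs_summable[OF z, of u v] in \<open>simp only: case_prod_unfold\<close>)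
qed

lemma Im_neg_inverse: "Im z > 0 \<Longrightarrow> Im (- 1 / z) > 0"
  by (simp add: Im_divide add_nonneg_pos)

lemma off_lattice_S:
  assumes "z \<noteq> 0" "off_lattice u z"
  shows "off_lattice (u / z) (- 1 / z)"
  unfolding off_lattice_def
proof safe
  fix m n :: int assume "u / z = of_int m * (- 1 / z) + of_int n"
  hence "u = of_int n * z + of_int (- m)" using assms(1) by (simp add: field_simps)
  with assms(2) show False unfolding off_lattice_def by blast
qed

text \<open>A difference is given by an absolutely convergent double series, in which the two generators of the lattice
  play symmetric roles. Only the Eisenstein summation of a single value distinguishes between them.\<close>

lemma wsum_S_diff:
  assumes z: "Im z > 0" and u: "off_lattice u z" and v: "off_lattice v z"
  shows "wsum (u / z) (- 1 / z) - wsum (v / z) (- 1 / z) = z\<^sup>2 * (wsum u z - wsum v z)"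
proof -
  have z0: "z \<noteq> 0" using z by auto
  define g where "g = (\<lambda>(m::int, n::int). 1 / (u + (of_int m * z + of_int n))\<^sup>2 - 1 / (v + (of_int m * z + of_int n))\<^sup>2)"
  have "((\<lambda>(m::int, n::int). 1 / (u / z + (of_int m * (- 1 / z) + of_int n))\<^sup>2 - 1 / (v / z + (of_int m * (- 1 / z) + of_int n))\<^sup>2)
           has_sum (wsum (u / z) (- 1 / z) - wsum (v / z) (- 1 / z))) (UNIV \<times> UNIV)"
    using off_lattice_S[OF z0] u v Im_neg_inverse[OF z] by (intro wsum_diff_has_sum) auto
  also have "?this \<longleftrightarrow> ((\<lambda>x. z\<^sup>2 * g x) has_sum (wsum (u / z) (- 1 / z) - wsum (v / z) (- 1 / z))) (UNIV \<times> UNIV)"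
  proof (rule has_sum_reindex_bij_witness[of _ "\<lambda>(m,n). (-n, m)" "\<lambda>(m,n). (n, -m)"])
    have *: "1 / (t / z + (of_int m * (- 1 / z) + of_int n))\<^sup>2 = z\<^sup>2 * (1 / (t + (of_int n * z + of_int (- m)))\<^sup>2)" for t and m n :: int
    proof -
      have "t / z + (of_int m * (- 1 / z) + of_int n) = (t + (of_int n * z + of_int (- m))) / z"
        using z0 by (simp add: field_simps)
      thus ?thesis by (simp add: power_divide)
    qed
    show "z\<^sup>2 * g (case a of (m,n) \<Rightarrow> (n, -m)) = (case a of (m,n) \<Rightarrow> 1 / (u / z + (of_int m * (- 1 / z) + of_int n))\<^sup>2 - 1 / (v / z + (of_int m * (- 1 / z) + of_int n))\<^sup>2)" for a
      by (cases a) (simp only: g_def prod.case * right_diff_distrib)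
  qed auto
  finally have "((\<lambda>x. z\<^sup>2 * g x) has_sum (wsum (u / z) (- 1 / z) - wsum (v / z) (- 1 / z))) (UNIV \<times> UNIV)" .
  moreover have "((\<lambda>x. z\<^sup>2 * g x) has_sum (z\<^sup>2 * (wsum u z - wsum v z))) (UNIV \<times> UNIV)"
    unfolding g_def using wsum_diff_has_sum[OF assms] by (rule has_sum_cmult_right)
  ultimately show ?thesis by (rule has_sum_unique)
qed

text \<open>The limit is read off from \<open>\<pi> cot (\<pi> w) = \<pi>i (q + 1) / (q - 1)\<close> with \<open>q = qexp w \<rightarrow> 0\<close>.\<close>

lemma tendsto_cotp_upper: "filterlim (\<lambda>n. Im (f n)) at_top sequentially \<Longrightarrow> (\<lambda>n::nat. cotp (f n)) \<longlonglongrightarrow> - (of_real pi * \<i>)"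
proof -
  assume f: "filterlim (\<lambda>n. Im (f n)) at_top sequentially"
  have "(\<lambda>n. exp (- (2 * pi * Im (f n)))) \<longlonglongrightarrow> 0"
    by (rule filterlim_compose[OF exp_at_bot], rule filterlim_compose[OF filterlim_uminus_at_bot_at_top],
        rule filterlim_tendsto_pos_mult_at_top[OF tendsto_const _ f]) auto
  hence q0: "(\<lambda>n. qexp (f n)) \<longlonglongrightarrow> 0"
    by (subst tendsto_norm_zero_iff[symmetric]) (simp add: qexp_def)
  have "cotp w = of_real pi * \<i> * (qexp w + 1) / (qexp w - 1)" for w
  proof -
    define e where "e = exp (\<i> * (of_real pi * w))"
    have q: "qexp w = e ^ 2" unfolding qexp_def e_def 
      by (simp add: power2_eq_square algebra_simps flip: exp_add)
    have e: "e \<noteq> 0" by (auto simp: e_def)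
    have "sin (of_real pi * w) = (e - 1 / e) / (2 * \<i>)" "cos (of_real pi * w) = (e + 1 / e) / 2"
      by (simp_all add: sin_exp_eq cos_exp_eq e_def exp_minus inverse_eq_divide mult_ac)
    moreover have "(e - 1 / e) = (e^2 - 1) / e" "(e + 1 / e) = (e^2 + 1) / e"
      using e by (simp_all add: field_simps power2_eq_square)
    ultimately have s: "sin (of_real pi * w) = ((e^2 - 1) / e) / (2 * \<i>)" and c: "cos (of_real pi * w) = ((e^2 + 1) / e) / 2"
      by simp_all
    have "p * ((b / e) / 2) / ((a / e) / (2 * \<i>)) = p * \<i> * b / a" for a b p
      using e by (cases "a = 0") (simp_all add: field_simps)
    thus ?thesis unfolding cotp_def s c q .
  qed
  moreover have "(\<lambda>n. of_real pi * \<i> * (qexp (f n) + 1) / (qexp (f n) - 1)) \<longlonglongrightarrow> of_real pi * \<i> * (0 + 1) / (0 - 1)"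
    by (intro tendsto_intros q0) auto
  ultimately show ?thesis by simp
qed

lemma cotp_minus: "cotp (- w) = - cotp w"
  by (simp add: cotp_def)

lemma cotp_plus_1: "cotp (w + 1) = cotp w"
  by (simp add: cotp_def distrib_left sin_plus_pi cos_plus_pi)

text \<open>The line through \<open>1/2\<close> in the direction \<open>z\<close> avoids the poles; it will be a path of integration.\<close>

lemma off_lattice_half_line: "Im z > 0 \<Longrightarrow> off_lattice (1 / 2 + of_real t * z) z"
  unfolding off_lattice_def
proof safe
  fix m n :: int assume z: "Im z > 0" and *: "1 / 2 + of_real t * z = of_int m * z + of_int n"
  have "Im (1 / 2 + of_real t * z) = Im (of_int m * z + of_int n)" using * by simp
  hence "t = m" using z by simp
  hence "(1 / 2 :: complex) = of_int n" using * by simp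
  hence "complex_of_int (2 * n) = of_int 1" by (simp add: mult.commute)
  hence "2 * n = 1" by (simp only: of_int_eq_iff)
  thus False by presburger
qed

lemma path_image_half_line:
  "u \<in> path_image (linepath (1 / 2) (1 / 2 + z)) \<Longrightarrow> \<exists>t. u = 1 / 2 + complex_of_real t * z"
proof -
  assume "u \<in> path_image (linepath (1 / 2) (1 / 2 + z))"
  then obtain t where "u = linepath (1 / 2) (1 / 2 + z) t" by (auto simp: path_image_def)
  also have "\<dots> = 1 / 2 + of_real t * z" by (simp add: linepath_def scaleR_conv_of_real field_simps)
  finally show ?thesis by blast
qed

lemma sum_symmetric_interval_telescope:
  fixes f :: "int \<Rightarrow> complex"
  shows "(\<Sum>m=-int M..int M. f m - f (m + 1)) = f (- int M) - f (int M + 1)"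
proof (induction M)
  case (Suc M)
  have "{-int (Suc M)..int (Suc M)} = insert (int M + 1) (insert (- int M - 1) {-int M..int M})"
    by auto
  moreover have "f (- int M - 1) = f (- 1 - int M)" by (rule arg_cong[of _ _ f]) simp
  ultimately show ?case using Suc.IH by (simp add: algebra_simps)
qed simp

text \<open>The integral of the row \<open>m\<close> is a difference of two consecutive values of \<open>\<pi> cot\<close>, so the sum telescopes. The
  two ends tend to \<open>\<plusminus>\<pi>i\<close>, which produces the nonzero value.\<close>

lemma wsum_contour_integral:
  assumes z: "Im z > 0"
  shows "((\<lambda>u. wsum u z) has_contour_integral (2 * of_real pi * \<i>)) (linepath (1 / 2) (1 / 2 + z))"
proof -
  define p where "p = linepath (1 / 2) (1 / 2 + z)"
  define f where "f = (\<lambda>M::nat. \<lambda>u. \<Sum>m=-int M..int M. csc2 (u + of_int m * z))"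
  have off: "off_lattice u z" if "u \<in> path_image p" for u
    using path_image_half_line[of u z] that off_lattice_half_line[OF z] by (auto simp: p_def)
  have f: "(f M has_contour_integral (cotp (1 / 2 - of_nat M * z) - cotp (1 / 2 + of_nat (Suc M) * z))) p" for M
  proof -
    have "((\<lambda>u. csc2 (u + of_int m * z)) has_contour_integral
           (- cotp (pathfinish p + of_int m * z) - (- cotp (pathstart p + of_int m * z)))) p" for m
    proof (rule contour_integral_primitive[where S = "path_image p" and f = "\<lambda>u. - cotp (u + of_int m * z)"])
      fix u assume "u \<in> path_image p"
      thus "((\<lambda>u. - cotp (u + of_int m * z)) has_field_derivative csc2 (u + of_int m * z)) (at u within path_image p)"
        using off_latticeD[OF off]
        by (auto intro!: derivative_eq_intros DERIV_chain2[OF has_field_derivative_cotp])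
    qed (auto simp: p_def)
    hence "((\<lambda>u. csc2 (u + of_int m * z)) has_contour_integral
           (- cotp (1 / 2 + z + of_int m * z) - (- cotp (1 / 2 + of_int m * z)))) p" for m
      by (simp add: p_def)
    hence "(f M has_contour_integral (\<Sum>m=-int M..int M. - cotp (1 / 2 + z + of_int m * z) - (- cotp (1 / 2 + of_int m * z)))) p"
      unfolding f_def by (intro has_contour_integral_sum) auto
    also have "(\<Sum>m=-int M..int M. - cotp (1 / 2 + z + of_int m * z) - (- cotp (1 / 2 + of_int m * z))) =
               (\<Sum>m=-int M..int M. cotp (1 / 2 + of_int m * z) - cotp (1 / 2 + of_int (m + 1) * z))"
      by (intro sum.cong) (auto simp: algebra_simps)
    also have "\<dots> = cotp (1 / 2 - of_nat M * z) - cotp (1 / 2 + of_nat (Suc M) * z)"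
      by (subst sum_symmetric_interval_telescope) (simp add: add_ac)
    finally show ?thesis .
  qed
  have lim: "uniform_limit (path_image p) f (\<lambda>u. wsum u z) sequentially"
    unfolding f_def by (rule wsum_uniform_limit[OF z]) (auto simp: p_def off[unfolded p_def])
  have int: "(\<lambda>u. wsum u z) contour_integrable_on p"
    and tends: "(\<lambda>M. contour_integral p (f M)) \<longlonglongrightarrow> contour_integral p (\<lambda>u. wsum u z)"
    by (rule contour_integral_uniform_limit[OF always_eventually lim, of "norm z"];
        use f in \<open>auto simp: p_def contour_integrable_on_def vector_derivative_linepath_at\<close>)+
  have "(\<lambda>M. cotp (1 / 2 - of_nat M * z) - cotp (1 / 2 + of_nat (Suc M) * z)) \<longlonglongrightarrow> of_real pi * \<i> - (- (of_real pi * \<i>))"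
  proof (intro tendsto_diff)
    have top: "filterlim (\<lambda>n. real n * Im z) at_top sequentially"
      using z filterlim_real_sequentially by (subst mult.commute, intro filterlim_tendsto_pos_mult_at_top[OF tendsto_const]) auto
    have "(\<lambda>M. - cotp (- (1 / 2) + of_nat M * z)) \<longlonglongrightarrow> - (- (of_real pi * \<i>))"
      using top by (intro tendsto_minus tendsto_cotp_upper) simp
    moreover have "- cotp (- (1 / 2) + of_nat M * z) = cotp (1 / 2 - of_nat M * z)" for M
      using cotp_minus[of "1 / 2 - of_nat M * z"] by simp
    ultimately show "(\<lambda>M. cotp (1 / 2 - of_nat M * z)) \<longlonglongrightarrow> of_real pi * \<i>" by simp
    have "(\<lambda>M. cotp (1 / 2 + of_nat M * z)) \<longlonglongrightarrow> - (of_real pi * \<i>)"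
      using top by (intro tendsto_cotp_upper) simp
    thus "(\<lambda>M. cotp (1 / 2 + of_nat (Suc M) * z)) \<longlonglongrightarrow> - (of_real pi * \<i>)"
      by (rule LIMSEQ_Suc)
  qed
  with tends have "contour_integral p (\<lambda>u. wsum u z) = of_real pi * \<i> - (- (of_real pi * \<i>))"
    using contour_integral_unique[OF f] by (intro LIMSEQ_unique[OF tends]) simp
  with has_contour_integral_integral[OF int] show ?thesis by (simp add: p_def mult_ac)
qed

text \<open>After division by \<open>z\<close> the same segment runs from a point to its translate by 1, which is a period of every
  single row. Hence nothing is left, in contrast to the untransformed sum.\<close>

lemma wsum_S_contour_integral:
  assumes z: "Im z > 0"
  shows "((\<lambda>u. wsum (u / z) (- 1 / z)) has_contour_integral 0) (linepath (1 / 2) (1 / 2 + z))"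
proof -
  define p where "p = linepath (1 / 2) (1 / 2 + z)"
  define z' where "z' = - 1 / z"
  have z': "Im z' > 0" unfolding z'_def by (rule Im_neg_inverse[OF z])
  have z0: "z \<noteq> 0" using z by auto
  define f where "f = (\<lambda>M::nat. \<lambda>u. \<Sum>m=-int M..int M. csc2 (u / z + of_int m * z'))"
  have off: "off_lattice (u / z) z'" if "u \<in> path_image p" for u
  proof -
    have "off_lattice u z"
      using path_image_half_line[of u z] that off_lattice_half_line[OF z] by (auto simp: p_def)
    thus ?thesis unfolding z'_def by (rule off_lattice_S[OF z0])
  qed
  have f: "(f M has_contour_integral 0) p" for M
  proof -
    have "((\<lambda>u. csc2 (u / z + of_int m * z')) has_contour_integral
           (- z * cotp (pathfinish p / z + of_int m * z') - (- z * cotp (pathstart p / z + of_int m * z')))) p" for m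
    proof (rule contour_integral_primitive[where S = "path_image p" and f = "\<lambda>u. - z * cotp (u / z + of_int m * z')"])
      fix u assume "u \<in> path_image p"
      thus "((\<lambda>u. - z * cotp (u / z + of_int m * z')) has_field_derivative csc2 (u / z + of_int m * z')) (at u within path_image p)"
        using off_latticeD[OF off] z0
        by (auto intro!: derivative_eq_intros DERIV_chain2[OF has_field_derivative_cotp])
    qed (auto simp: p_def)
    moreover have "- z * cotp (pathfinish p / z + of_int m * z') - (- z * cotp (pathstart p / z + of_int m * z')) = 0" for m
    proof -
      have "pathfinish p / z + of_int m * z' = pathstart p / z + of_int m * z' + 1"
        using z0 by (simp add: p_def field_simps)
      thus ?thesis by (simp only: cotp_plus_1 diff_self)
    qed
    ultimately have "((\<lambda>u. csc2 (u / z + of_int m * z')) has_contour_integral 0) p" for m by metis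
    hence "(f M has_contour_integral (\<Sum>m=-int M..int M. 0)) p"
      unfolding f_def by (intro has_contour_integral_sum) auto
    thus ?thesis by simp
  qed
  have "compact ((\<lambda>u. u / z) ` path_image p)"
    using z0 by (intro compact_continuous_image continuous_intros) (auto simp: p_def)
  hence "uniform_limit ((\<lambda>u. u / z) ` path_image p) (\<lambda>M u. \<Sum>m=-int M..int M. csc2 (u + of_int m * z')) (\<lambda>u. wsum u z') sequentially"
    by (rule wsum_uniform_limit[OF z']) (use off in auto)
  hence lim: "uniform_limit (path_image p) f (\<lambda>u. wsum (u / z) z') sequentially"
    by (simp add: uniform_limit_iff f_def)
  have int: "(\<lambda>u. wsum (u / z) z') contour_integrable_on p"
    and tends: "(\<lambda>M. contour_integral p (f M)) \<longlonglongrightarrow> contour_integral p (\<lambda>u. wsum (u / z) z')"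
    by (rule contour_integral_uniform_limit[OF always_eventually lim, of "norm z"];
        use f in \<open>auto simp: p_def contour_integrable_on_def vector_derivative_linepath_at\<close>)+
  have "contour_integral p (\<lambda>u. wsum (u / z) z') = 0"
    using contour_integral_unique[OF f] by (intro LIMSEQ_unique[OF tends]) simp
  with has_contour_integral_integral[OF int] show ?thesis by (simp add: p_def z'_def)
qed

text \<open>By \<open>wsum_S_diff\<close> the defect \<open>C\<close> is independent of the point, so it is found by integrating over the segment
  from \<open>1/2\<close> to \<open>1/2 + z\<close>, where both integrals are known.\<close>

theorem wsum_S:
  assumes z: "Im z > 0" and u: "off_lattice u z"
  shows "wsum (u / z) (- 1 / z) = z\<^sup>2 * wsum u z - 2 * of_real pi * \<i> * z"
proof -
  define p where "p = linepath (1 / 2) (1 / 2 + z)"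
  define C where "C = wsum (u / z) (- 1 / z) - z\<^sup>2 * wsum u z"
  have z0: "z \<noteq> 0" using z by auto
  have "((\<lambda>v. wsum (v / z) (- 1 / z) - z\<^sup>2 * wsum v z) has_contour_integral (0 - z\<^sup>2 * (2 * of_real pi * \<i>))) p"
    unfolding p_def
    by (intro has_contour_integral_diff has_contour_integral_lmul wsum_contour_integral wsum_S_contour_integral z)
  moreover have "wsum (v / z) (- 1 / z) - z\<^sup>2 * wsum v z = C" if "v \<in> path_image p" for v
  proof -
    have "off_lattice v z"
      using path_image_half_line[of v z] that off_lattice_half_line[OF z] by (auto simp: p_def)
    thus ?thesis using wsum_S_diff[OF z u, of v] by (simp add: C_def algebra_simps)
  qed
  ultimately have "((\<lambda>v. C) has_contour_integral (0 - z\<^sup>2 * (2 * of_real pi * \<i>))) p"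
    by (rule has_contour_integral_eq)
  moreover have "((\<lambda>v. C) has_contour_integral C * z) p"
    using has_contour_integral_const_linepath[where c = C and a = "1 / 2" and b = "1 / 2 + z"] by (simp only: p_def add_diff_cancel_left')
  ultimately have "C * z = 0 - z\<^sup>2 * (2 * of_real pi * \<i>)"
    by (rule has_contour_integral_unique[symmetric])
  hence "C * z = - (2 * of_real pi * \<i> * z) * z" by (simp add: power2_eq_square)
  hence "C = - (2 * of_real pi * \<i> * z)" using z0 by (simp only: mult_cancel_right) simp
  thus ?thesis by (simp add: C_def algebra_simps)
qed

section \<open>Moebius transformations and the modular group\<close>

definition mob :: "mat2 \<Rightarrow> complex \<Rightarrow> complex"
  where "mob \<gamma> z = (case \<gamma> of (a, b, c, d) \<Rightarrow> (of_int a * z + of_int b) / (of_int c * z + of_int d))"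

definition aut :: "mat2 \<Rightarrow> complex \<Rightarrow> complex"
  where "aut \<gamma> z = (case \<gamma> of (a, b, c, d) \<Rightarrow> of_int c * z + of_int d)"

definition mat_times :: "mat2 \<Rightarrow> mat2 \<Rightarrow> mat2"
  where "mat_times \<gamma> \<delta> = (case (\<gamma>, \<delta>) of ((a, b, c, d), (a', b', c', d')) \<Rightarrow>
    (a * a' + b * c', a * b' + b * d', c * a' + d * c', c * b' + d * d'))"

lemma Im_pos_linear_nonzero:
  assumes "Im z > 0" "c \<noteq> 0 \<or> d \<noteq> 0"
  shows "of_int c * z + of_int d \<noteq> 0"
proof
  assume *: "of_int c * z + of_int d = 0"
  hence "Im (of_int c * z + of_int d) = 0" by simp
  hence "c = 0" using assms(1) by simp
  with * assms(2) show False by simp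
qed

lemma SL2Z_iff: "(a, b, c, d) \<in> SL2Z \<longleftrightarrow> a * d - b * c = 1"
  by (simp add: SL2Z_def)

lemma aut_nonzero:
  assumes "\<gamma> \<in> SL2Z" "Im z > 0"
  shows "aut \<gamma> z \<noteq> 0"
proof -
  obtain a b c d where \<gamma>: "\<gamma> = (a, b, c, d)" by (cases \<gamma>)
  have "c \<noteq> 0 \<or> d \<noteq> 0" using assms(1) by (auto simp: \<gamma> SL2Z_iff)
  thus ?thesis using Im_pos_linear_nonzero[OF assms(2)] by (simp add: aut_def \<gamma>)
qed

lemma Im_mob_general:
  fixes a b c d :: int
  assumes "of_int c * z + of_int d \<noteq> (0 :: complex)"
  shows "Im ((of_int a * z + of_int b) / (of_int c * z + of_int d)) =
         of_int (a * d - b * c) * Im z / (norm (of_int c * z + of_int d))\<^sup>2"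
  by (simp add: Im_divide cmod_power2 algebra_simps)

lemma Im_mob:
  assumes "\<gamma> \<in> SL2Z" "Im z > 0"
  shows "Im (mob \<gamma> z) = Im z / (norm (aut \<gamma> z))\<^sup>2"
proof -
  obtain a b c d where \<gamma>: "\<gamma> = (a, b, c, d)" by (cases \<gamma>)
  have det: "a * d - b * c = 1" using assms(1) by (simp add: \<gamma> SL2Z_iff)
  have "of_int c * z + of_int d \<noteq> 0" using aut_nonzero[OF assms] by (simp add: \<gamma> aut_def)
  from Im_mob_general[OF this, of a b] show ?thesis
    by (simp only: \<gamma> mob_def aut_def prod.case det of_int_1 mult_1)
qed

lemma Im_mob_pos: "\<gamma> \<in> SL2Z \<Longrightarrow> Im z > 0 \<Longrightarrow> Im (mob \<gamma> z) > 0"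
  by (simp add: Im_mob aut_nonzero)

lemma mat_times_SL2Z: "\<gamma> \<in> SL2Z \<Longrightarrow> \<delta> \<in> SL2Z \<Longrightarrow> mat_times \<gamma> \<delta> \<in> SL2Z"
proof -
  assume *: "\<gamma> \<in> SL2Z" "\<delta> \<in> SL2Z"
  obtain a b c d where \<gamma>: "\<gamma> = (a, b, c, d)" by (cases \<gamma>)
  obtain a' b' c' d' where \<delta>: "\<delta> = (a', b', c', d')" by (cases \<delta>)
  have "(a * a' + b * c') * (c * b' + d * d') - (a * b' + b * d') * (c * a' + d * c') =
        (a * d - b * c) * (a' * d' - b' * c')" by (simp add: algebra_simps)
  thus ?thesis using * by (simp add: \<gamma> \<delta> SL2Z_iff mat_times_def)
qed

lemma aut_mat_times:
  assumes "\<gamma> \<in> SL2Z" "\<delta> \<in> SL2Z" "Im z > 0"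
  shows "aut (mat_times \<gamma> \<delta>) z = aut \<gamma> (mob \<delta> z) * aut \<delta> z"
  using aut_nonzero[OF assms(2,3)]
  by (auto simp: aut_def mob_def mat_times_def field_simps split: prod.splits)

lemma mob_mat_times:
  assumes "\<gamma> \<in> SL2Z" "\<delta> \<in> SL2Z" "Im z > 0"
  shows "mob (mat_times \<gamma> \<delta>) z = mob \<gamma> (mob \<delta> z)"
proof -
  obtain a b c d where \<gamma>: "\<gamma> = (a, b, c, d)" by (cases \<gamma>)
  obtain a' b' c' d' where \<delta>: "\<delta> = (a', b', c', d')" by (cases \<delta>)
  define w where "w = of_int c' * z + of_int d'"
  have w: "w \<noteq> 0" using aut_nonzero[OF assms(2,3)] by (simp add: \<delta> aut_def w_def)
  have *: "of_int (p * a' + q * c') * z + of_int (p * b' + q * d') =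
        w * (of_int p * ((of_int a' * z + of_int b') / w) + of_int q)" for p q
    using w by (simp add: field_simps) (simp add: w_def algebra_simps)
  show ?thesis
    unfolding \<gamma> \<delta> mob_def mat_times_def prod.case * using w by (simp add: w_def)
qed

text \<open>Euclid's algorithm on the lower row: translations reduce \<open>d\<close> modulo \<open>c\<close>, and \<open>S\<close> exchanges the two.\<close>

lemma SL2Z_induct [consumes 1, case_names one T T_inv S]:
  assumes "(a, b, c, d) \<in> SL2Z"
  assumes one: "P 1 0 0 1"
  assumes T: "\<And>a b c d. (a, b, c, d) \<in> SL2Z \<Longrightarrow> P a b c d \<Longrightarrow> P a (a + b) c (c + d)"
  assumes T': "\<And>a b c d. (a, b, c, d) \<in> SL2Z \<Longrightarrow> P a b c d \<Longrightarrow> P a (b - a) c (d - c)"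
  assumes S: "\<And>a b c d. (a, b, c, d) \<in> SL2Z \<Longrightarrow> P a b c d \<Longrightarrow> P b (- a) d (- c)"
  shows "P a b c d"
proof -
  have Tn: "P a (b + n * a) c (d + n * c)" if "P a b c d" "(a, b, c, d) \<in> SL2Z" for a b c d n
  proof (induction n rule: int_induct[where k = 0])
    case (step1 i)
    have "(a, b + i * a, c, d + i * c) \<in> SL2Z" using that(2) by (simp add: SL2Z_iff algebra_simps)
    from T[OF this step1.IH] show ?case by (simp add: algebra_simps)
  next
    case (step2 i)
    have "(a, b + i * a, c, d + i * c) \<in> SL2Z" using that(2) by (simp add: SL2Z_iff algebra_simps)
    from T'[OF this step2.IH] show ?case by (simp add: algebra_simps)
  qed (use that in auto)
  have S3: "P a b c d" if "P b (- a) d (- c)" "(a, b, c, d) \<in> SL2Z" for a b c d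
    using S[OF _ S[OF _ S[OF _ that(1)]]] that(2) by (simp add: SL2Z_iff algebra_simps)
  from assms(1) show ?thesis
  proof (induction "nat \<bar>c\<bar>" arbitrary: a b c d rule: less_induct)
    case less
    show ?case
    proof (cases "c = 0")
      case True
      hence "a * d = 1" using less.prems by (simp add: SL2Z_iff)
      hence ad: "a = 1 \<and> d = 1 \<or> a = -1 \<and> d = -1" by (simp add: zmult_eq_1_iff)
      have m1: "P (- 1) 0 0 (- 1)"
        using S[OF _ S[OF _ one]] by (simp add: SL2Z_iff)
      from ad show ?thesis
      proof
        assume "a = 1 \<and> d = 1"
        thus ?thesis using Tn[OF one, of b] True by (simp add: SL2Z_iff)
      next
        assume "a = -1 \<and> d = -1"
        thus ?thesis using Tn[OF m1, of "- b"] True by (simp add: SL2Z_iff)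
      qed
    next
      case False
      define n where "n = d div c"
      define r where "r = d mod c"
      have d: "d = r + n * c" by (simp add: n_def r_def)
      have r: "\<bar>r\<bar> < \<bar>c\<bar>" using False by (simp add: r_def abs_mod_less)
      define b' where "b' = b - n * a"
      have mem: "(a, b', c, r) \<in> SL2Z" using less.prems by (simp add: SL2Z_iff d b'_def algebra_simps)
      have "P b' (- a) r (- c)"
        by (rule less.hyps) (use r mem in \<open>auto simp: SL2Z_iff algebra_simps\<close>)
      hence "P a b' c r" using mem by (rule S3)
      from Tn[OF this mem, of n] show ?thesis by (simp add: d b'_def)
    qed
  qed
qed

section \<open>Values of the Weierstrass sums at points of order 8\<close>

text \<open>The order 8 is dictated by the modulus of the character; points of order 2 occur among these with \<open>r\<close> and
  \<open>s\<close> divisible by 4.\<close>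

definition divval :: "int \<Rightarrow> int \<Rightarrow> complex \<Rightarrow> complex"
  where "divval r s z = wsum ((of_int r * z + of_int s) / 8) z"

lemma divval_add_8: "divval (r + 8 * i) (s + 8 * j) z = divval r s z"
proof -
  have 1: "wsum (u + of_int j) z = wsum u z" for u j
  proof (induction j rule: int_induct[where k = 0])
    case (step1 i) thus ?case using wsum_plus_1[of "u + of_int i" z] by (simp add: add_ac)
  next
    case (step2 i) thus ?case using wsum_plus_1[of "u + of_int (i - 1)" z] by (simp add: algebra_simps)
  qed auto
  have 2: "wsum (u + of_int j * z) z = wsum u z" for u j
  proof (induction j rule: int_induct[where k = 0])
    case (step1 i) thus ?case using wsum_plus_period[of "u + of_int i * z" z] by (simp add: algebra_simps)
  next
    case (step2 i) thus ?case using wsum_plus_period[of "u + of_int (i - 1) * z" z] by (simp add: algebra_simps)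
  qed auto
  have "(of_int (r + 8 * i) * z + of_int (s + 8 * j)) / 8 = (of_int r * z + of_int s) / 8 + of_int i * z + of_int j"
    by (simp add: field_simps)
  thus ?thesis by (simp only: divval_def 1 2)
qed

lemma divval_cong:
  assumes "[r = r'] (mod 8)" "[s = s'] (mod 8)"
  shows "divval r s z = divval r' s' z"
proof -
  obtain i j where "r' = r + 8 * i" "s' = s + 8 * j"
    using assms by (metis cong_iff_lin)
  thus ?thesis by (simp add: divval_add_8)
qed

lemma divval_minus: "divval (- r) (- s) z = divval r s z"
proof -
  have "(of_int (- r) * z + of_int (- s)) / 8 = - ((of_int r * z + of_int s) / 8)" by (simp add: field_simps)
  thus ?thesis by (simp only: divval_def wsum_minus)
qed

lemma divval_T: "divval r s (z + 1) = divval r (r + s) z"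
proof -
  have "(of_int r * (z + 1) + of_int s) / 8 = (of_int r * z + of_int (r + s)) / 8" by (simp add: algebra_simps)
  thus ?thesis by (simp only: divval_def wsum_period_plus_1)
qed

lemma off_lattice_divval:
  assumes "Im z > 0" "\<not> (8 dvd r \<and> 8 dvd s)"
  shows "off_lattice ((of_int r * z + of_int s) / 8) z"
  unfolding off_lattice_def
proof safe
  fix m n :: int assume "(of_int r * z + of_int s) / 8 = of_int m * z + of_int n"
  hence "of_int (r - 8 * m) * z + of_int (s - 8 * n) = 0" by (simp add: field_simps)
  hence "r - 8 * m = 0 \<and> s - 8 * n = 0"
    using Im_pos_linear_nonzero[OF assms(1), of "r - 8 * m" "s - 8 * n"] by blast
  hence "8 dvd r \<and> 8 dvd s" by simp
  with assms(2) show False by simp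
qed

lemma divval_S:
  assumes "Im z > 0" "\<not> (8 dvd r \<and> 8 dvd s)"
  shows "divval r s (- 1 / z) = z\<^sup>2 * divval s (- r) z - 2 * of_real pi * \<i> * z"
proof -
  have "(of_int r * (- 1 / z) + of_int s) / 8 = ((of_int s * z + of_int (- r)) / 8) / z"
  proof -
    have "z \<noteq> 0" using assms(1) by auto
    thus ?thesis by (simp add: field_simps)
  qed
  moreover have "off_lattice ((of_int s * z + of_int (- r)) / 8) z"
    by (rule off_lattice_divval) (use assms in auto)
  ultimately show ?thesis
    using wsum_S[OF assms(1)] by (simp only: divval_def)
qed

lemma mod_8_pair_SL2Z:
  assumes "a * d - b * c = (1 :: int)" "8 dvd r * a + s * c" "8 dvd r * b + s * d"
  shows "8 dvd r \<and> 8 dvd s"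
proof -
  have "r * (a * d - b * c) = (r * a + s * c) * d - (r * b + s * d) * c"
       "s * (a * d - b * c) = (r * b + s * d) * a - (r * a + s * c) * b"
    by (simp_all add: algebra_simps)
  with assms show ?thesis by (metis dvd_diff dvd_mult2 mult.right_neutral)
qed

text \<open>The anomaly does not involve \<open>(r, s)\<close>, so a difference of two values is modular of weight 2, up to the
  permutation of the points of order 8.\<close>

theorem divval_mob:
  assumes "(a, b, c, d) \<in> SL2Z" "Im z > 0" "\<not> (8 dvd r \<and> 8 dvd s)"
  shows "divval r s (mob (a, b, c, d) z) =
           (of_int c * z + of_int d)\<^sup>2 * divval (r * a + s * c) (r * b + s * d) z
           - 2 * of_real pi * \<i> * of_int c * (of_int c * z + of_int d)"
  using assms(1,2)
proof (induction arbitrary: z rule: SL2Z_induct)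
  case one
  thus ?case by (simp add: mob_def)
next
  case (T a b c d)
  have "mob (a, a + b, c, c + d) z = mob (a, b, c, d) (z + 1)" by (simp add: mob_def algebra_simps)
  also have "divval r s \<dots> = (of_int c * (z + 1) + of_int d)\<^sup>2 * divval (r * a + s * c) (r * b + s * d) (z + 1)
      - 2 * of_real pi * \<i> * of_int c * (of_int c * (z + 1) + of_int d)"
    by (rule T.IH) (use T.prems in simp)
  also have "of_int c * (z + 1) + of_int d = of_int c * z + of_int (c + d)" by (simp add: algebra_simps)
  also have "divval (r * a + s * c) (r * b + s * d) (z + 1) = divval (r * a + s * c) (r * (a + b) + s * (c + d)) z"
    unfolding divval_T by (simp add: algebra_simps)
  finally show ?case .
next
  case (T_inv a b c d)
  have "mob (a, b - a, c, d - c) z = mob (a, b, c, d) (z - 1)" by (simp add: mob_def algebra_simps)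
  moreover have "divval r' s' (z - 1) = divval r' (s' - r') z" for r' s'
    using divval_T[of r' "s' - r'" "z - 1"] by simp
  ultimately show ?case using T_inv.IH[of "z - 1"] T_inv.prems by (simp add: algebra_simps)
next
  case (S a b c d)
  have z0: "z \<noteq> 0" using S.prems by auto
  have nz: "of_int d * z - of_int c \<noteq> 0"
  proof -
    have "d \<noteq> 0 \<or> - c \<noteq> 0" using S.hyps by (auto simp: SL2Z_iff)
    from Im_pos_linear_nonzero[OF S.prems this] show ?thesis by simp
  qed
  have "mob (b, - a, d, - c) z = mob (a, b, c, d) (- 1 / z)"
    using z0 nz by (simp add: mob_def field_simps)
  also have "divval r s \<dots> = (of_int c * (- 1 / z) + of_int d)\<^sup>2 * divval (r * a + s * c) (r * b + s * d) (- 1 / z)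
           - 2 * of_real pi * \<i> * of_int c * (of_int c * (- 1 / z) + of_int d)"
    by (rule S.IH) (rule Im_neg_inverse[OF S.prems])
  also have "divval (r * a + s * c) (r * b + s * d) (- 1 / z) =
       z\<^sup>2 * divval (r * b + s * d) (- (r * a + s * c)) z - 2 * of_real pi * \<i> * z"
    using assms(3) S.hyps mod_8_pair_SL2Z[of a d b c r s] by (intro divval_S S.prems) (auto simp: SL2Z_iff)
  also have "of_int c * (- 1 / z) + of_int d = (of_int d * z + of_int (- c)) / z"
    using z0 by (simp add: field_simps)
  also have "((of_int d * z + of_int (- c)) / z)\<^sup>2 * (z\<^sup>2 * divval (r * b + s * d) (- (r * a + s * c)) z - 2 * of_real pi * \<i> * z)
           - 2 * of_real pi * \<i> * of_int c * ((of_int d * z + of_int (- c)) / z) =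
       (of_int d * z + of_int (- c))\<^sup>2 * divval (r * b + s * d) (- (r * a + s * c)) z
           - 2 * of_real pi * \<i> * of_int d * (of_int d * z + of_int (- c))"
    using z0 by (simp add: field_simps power2_eq_square)
  finally show ?case by (simp add: algebra_simps)
qed

section \<open>The quadratic character modulo 8\<close>

text \<open>The Kronecker symbol \<open>(8/m)\<close>, and equally \<open>(2/m)\<close>, in closed form.\<close>

definition kron8 :: "int \<Rightarrow> int"
  where "kron8 m = (if even m then 0 else if m mod 8 \<in> {1, 7} then 1 else -1)"

lemma kron8_mod: "kron8 (m mod 8) = kron8 m"
  by (simp add: kron8_def dvd_mod_iff)

lemma kron8_mult: "kron8 (m * n) = kron8 m * kron8 n"
proof -
  have "kron8 ((m mod 8) * (n mod 8) mod 8) = kron8 (m mod 8) * kron8 (n mod 8)"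
  proof -
    have "\<forall>x\<in>set [0..7]. \<forall>y\<in>set [0..7]. kron8 (x * y mod 8) = kron8 x * kron8 y" by code_simp
    moreover have "m mod 8 \<in> set [0..7]" "n mod 8 \<in> set [0..7]"
      using pos_mod_bound[of 8 m] pos_mod_bound[of 8 n] by (simp_all add: set_upto)
    ultimately show ?thesis by blast
  qed
  thus ?thesis by (simp add: kron8_mod mod_mult_eq)
qed

lemma kron8_minus: "kron8 (- m) = kron8 m"
  using kron8_mult[of "-1" m] by (simp add: kron8_def)

lemma kron8_power: "kron8 (m ^ n) = kron8 m ^ n"
  by (induction n) (simp_all add: kron8_mult, simp add: kron8_def)

lemma kron8_prod: "kron8 (\<Prod>i\<in>A. f i) = (\<Prod>i\<in>A. kron8 (f i))"
  by (induction A rule: infinite_finite_induct) (simp_all add: kron8_mult, simp_all add: kron8_def)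

text \<open>The second supplement to quadratic reciprocity, by Gauss's lemma: one counts the multiples \<open>2x\<close> with
  \<open>x \<le> (p-1)/2\<close> that exceed \<open>(p-1)/2\<close>.\<close>

lemma Legendre_2:
  assumes p: "prime p" "p > (2 :: nat)"
  shows "Legendre 2 (int p) = kron8 (int p)"
proof -
  have odd: "odd p" using p prime_odd_nat by auto
  interpret GAUSS p 2
  proof
    show "[2 \<noteq> 0] (mod int p)"
      using p by (auto simp: cong_0_iff zdvd_not_zless)
  qed (use p in auto)
  define h where "h = (int p - 1) div 2"
  have ph: "int p = 2 * h + 1" using odd unfolding h_def by presburger
  have h0: "h > 0" using p ph by linarith
  have "B = (\<lambda>x. x * 2) ` {0<..h}" by (simp add: B_def A_def h_def)
  moreover have "C = B"
    unfolding C_def calculation using ph by (force simp: image_iff)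
  ultimately have "E = (\<lambda>x. x * 2) ` {h div 2<..h}"
    unfolding E_def h_def[symmetric] by (auto simp: image_iff) 
  hence "card E = card {h div 2<..h}"
    by (simp add: card_image inj_on_def)
  hence cE: "card E = nat (h - h div 2)" by simp
  have "Legendre 2 (int p) = (-1) ^ nat (h - h div 2)"
    using gauss_lemma cE by simp
  also have "\<dots> = kron8 (int p)"
  proof (cases "int p mod 8 \<in> {1, 7}")
    case True
    hence "h mod 4 = 0 \<or> h mod 4 = 3" unfolding ph by simp presburger
    hence "even (h - h div 2)" by presburger
    hence "even (nat (h - h div 2))" using h0 by (simp add: even_nat_iff)
    thus ?thesis using True odd by (simp add: kron8_def)
  next
    case False
    hence "h mod 4 = 1 \<or> h mod 4 = 2" unfolding ph by simp presburger
    hence "odd (h - h div 2)" by presburger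
    hence "odd (nat (h - h div 2))" using h0 by (simp add: even_nat_iff)
    thus ?thesis using False odd by (simp add: kron8_def)
  qed
  finally show ?thesis .
qed

lemma Legendre_8:
  assumes p: "prime p" "p > (2 :: nat)"
  shows "Legendre 8 (int p) = kron8 (int p)"
proof -
  define h where "h = (p - 1) div 2"
  have 1: "[Legendre 8 (int p) = 8 ^ h] (mod int p)" "[Legendre 2 (int p) = 2 ^ h] (mod int p)"
    using euler_criterion[OF p] by (simp_all add: h_def)
  have "(8 :: int) ^ h = (2 ^ h) ^ 3"
  proof -
    have "(8 :: int) = 2 ^ 3" by simp
    thus ?thesis by (simp only: power_mult[symmetric] mult.commute)
  qed
  hence "[Legendre 8 (int p) = Legendre 2 (int p) ^ 3] (mod int p)"
    using cong_trans[OF 1(1)] cong_pow[OF cong_sym[OF 1(2)], of 3] by metis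
  hence "int p dvd Legendre 8 (int p) - Legendre 2 (int p) ^ 3"
    by (simp add: cong_iff_dvd_diff)
  moreover have L: "Legendre 8 (int p) \<in> {-1, 0, 1}" "Legendre 2 (int p) \<in> {-1, 0, 1}"
    by (auto simp: Legendre_def)
  moreover have "Legendre 2 (int p) ^ 3 = Legendre 2 (int p)"
    using L(2) by auto
  ultimately have dvd: "int p dvd Legendre 8 (int p) - Legendre 2 (int p)" by simp
  have "\<bar>Legendre 8 (int p) - Legendre 2 (int p)\<bar> < int p"
    using L p by auto
  hence "Legendre 8 (int p) - Legendre 2 (int p) = 0"
    using dvd_imp_le_int[OF _ dvd] by fastforce
  thus ?thesis using Legendre_2[OF p] by simp
qed

lemma kronecker_prime_8: "prime p \<Longrightarrow> kronecker_prime 8 p = kron8 (int p)"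
  using Legendre_8[of p] prime_ge_2_nat[of p] by (cases "p = 2") (simp_all add: kronecker_prime_def, simp add: kron8_def)

lemma chi_8: "chi 8 m = of_int (kron8 m)"
proof (cases "m = 0")
  case True
  thus ?thesis by (simp add: chi_def kronecker_def kron8_def)
next
  case False
  define n where "n = nat \<bar>m\<bar>"
  have n: "n > 0" using False by (simp add: n_def)
  have "kronecker 8 m = (\<Prod>p\<in>prime_factors n. kron8 (int p) ^ multiplicity p n)"
    using False unfolding kronecker_def kronecker_unit_def n_def
    by (auto intro!: prod.cong simp: kronecker_prime_8 in_prime_factors_iff)
  also have "\<dots> = kron8 (int (\<Prod>p\<in>prime_factors n. p ^ multiplicity p n))"
    by (simp add: kron8_prod kron8_power)
  also have "(\<Prod>p\<in>prime_factors n. p ^ multiplicity p n) = n"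
    using n by (simp add: prod_prime_factors)
  also have "kron8 (int n) = kron8 m"
    using kron8_minus[of m] by (simp add: n_def abs_if)
  finally show ?thesis by (simp add: chi_def)
qed

lemma chi_1: "m > 0 \<Longrightarrow> chi 1 (int m) = 1"
proof -
  assume m: "m > 0"
  have "kronecker_prime 1 p = 1" if "prime p" for p
  proof -
    have "\<not> [1 = 0] (mod int p)" using that by (auto simp: cong_0_iff dest: prime_gt_1_nat)
    moreover have "QuadRes (int p) 1" by (auto simp: QuadRes_def intro!: exI[of _ 1])
    ultimately show ?thesis by (simp add: kronecker_prime_def Legendre_def)
  qed
  hence "kronecker 1 (int m) = 1" using m unfolding kronecker_def kronecker_unit_def
    by (auto intro!: prod.neutral simp: in_prime_factors_iff)
  thus ?thesis by (simp add: chi_def)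
qed

lemma norm_chi_8_le: "norm (chi 8 m) \<le> 1"
  by (auto simp: chi_8 kron8_def)

section \<open>Lambert series\<close>

lemma has_sum_geometric_deriv:
  fixes x :: "'a :: {real_normed_field, banach}"
  assumes "norm x < 1"
  shows "((\<lambda>m. of_nat m * x ^ m) has_sum x / (1 - x)\<^sup>2) {1..}"
proof -
  have "(\<lambda>n. of_nat n * x ^ n) sums (x / (1 - x)\<^sup>2)"
  proof -
    have "(\<lambda>n. x * (of_nat (Suc n) * x ^ n)) sums (x * (1 / (1 - x)^2))"
      using geometric_deriv_sums[OF assms] by (intro sums_mult) (simp add: power2_eq_square)
    hence "(\<lambda>n. of_nat (Suc n) * x ^ Suc n) sums (x / (1 - x)^2)" by (simp add: mult_ac)
    thus ?thesis by (subst (asm) sums_Suc_iff) simp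
  qed
  moreover have "summable (\<lambda>n. norm (of_nat n * x ^ n))"
  proof -
    have "summable (\<lambda>n. norm x * (of_nat (Suc n) * norm x ^ n))"
      using geometric_deriv_sums[of "norm x"] assms by (intro summable_mult) (auto simp: sums_iff)
    hence "summable (\<lambda>n. norm (of_nat (Suc n) * x ^ Suc n))" by (simp add: norm_mult norm_power mult_ac del: of_nat_Suc)
    thus ?thesis by (subst (asm) summable_Suc_iff)
  qed
  ultimately have "((\<lambda>n. of_nat n * x ^ n) has_sum x / (1 - x)\<^sup>2) UNIV"
    by (intro norm_summable_imp_has_sum)
  also have "?this \<longleftrightarrow> ?thesis"
    by (rule has_sum_cong_neutral) (auto simp: not_less_eq_eq)
  finally show ?thesis .
qed

text \<open>Summation by rows, that is first over \<open>m\<close>, gives the values of \<open>csc2\<close>; collecting the terms with the same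
  product \<open>m k\<close> gives the divisor sums.\<close>

definition lambert :: "(nat \<Rightarrow> complex) \<Rightarrow> (nat \<Rightarrow> complex) \<Rightarrow> complex \<Rightarrow> complex"
  where "lambert a b q = (\<Sum>\<^sub>\<infinity>(m, k)\<in>{1..} \<times> {1..}. a m * b k * q ^ (m * k))"

lemma lambert_abs_summable:
  fixes q :: complex
  assumes q: "norm q < 1" and a: "\<And>m. norm (a m) \<le> real m" and b: "\<And>m. norm (b m) \<le> real m"
  shows "(\<lambda>p. norm ((\<lambda>(m, k). a m * b k * q ^ (m * k)) p)) summable_on {1..} \<times> {1..}"
proof -
  define r where "r = max (norm q) (1/2)"
  have r: "r > 0" "r < 1" "norm q \<le> r" using q by (auto simp: r_def)
  have S: "((\<lambda>m. real m * r ^ m) summable_on {1..})"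
    using has_sum_geometric_deriv[of r] r by (auto dest!: has_sum_imp_summable)
  have "(\<lambda>(m, k). inverse r * (real m * r ^ m) * (real k * r ^ k)) summable_on {1..} \<times> {1..}"
    by (rule summable_on_SigmaI[where g = "\<lambda>m. inverse r * (real m * r ^ m) * (\<Sum>\<^sub>\<infinity>k\<in>{1..}. real k * r ^ k)"])
       (use S r in \<open>auto intro!: has_sum_cmult_right summable_on_cmult_left summable_on_cmult_right\<close>)
  thus ?thesis
  proof (rule Infinite_Sum.abs_summable_on_comparison_test'[where f = "(\<lambda>(m, k). a m * b k * q ^ (m * k))"])
    fix p :: "nat \<times> nat" assume "p \<in> {1..} \<times> {1..}"
    then obtain m k where p: "p = (m, k)" "m \<ge> 1" "k \<ge> 1" by auto
    have mk: "m * k + 1 \<ge> m + k"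
    proof -
      obtain m' k' where "m = Suc m'" "k = Suc k'" using p by (metis Suc_le_D One_nat_def)
      thus ?thesis by simp
    qed
    have "norm q ^ (m * k) \<le> r ^ (m * k)" using r by (intro power_mono) auto
    also have "\<dots> = r ^ (m * k + 1) / r" using r by simp
    also have "\<dots> \<le> r ^ (m + k) / r" using r mk by (intro divide_right_mono power_decreasing) auto
    finally have "norm (a m) * norm (b k) * norm q ^ (m * k) \<le> real m * real k * (r ^ (m + k) / r)"
      using a[of m] b[of k] by (intro mult_mono) auto
    thus "norm ((\<lambda>(m, k). a m * b k * q ^ (m * k)) p) \<le> (\<lambda>(m, k). inverse r * (real m * r ^ m) * (real k * r ^ k)) p"
      by (simp add: p norm_mult norm_power power_add divide_inverse mult_ac)
  qed
qed

lemma lambert_has_sum: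
  assumes "norm q < 1" "\<And>m. norm (a m) \<le> real m" "\<And>m. norm (b m) \<le> real m"
  shows "((\<lambda>(m, k). a m * b k * q ^ (m * k)) has_sum lambert a b q) ({1..} \<times> {1..})"
  unfolding lambert_def by (rule has_sum_infsum[OF abs_summable_summable[OF lambert_abs_summable[OF assms]]])

lemma lambert_commute: "lambert a b q = lambert b a q"
  unfolding lambert_def
  by (rule infsum_reindex_bij_witness[of _ "\<lambda>(m,k). (k,m)" "\<lambda>(m,k). (k,m)"]) (auto simp: mult_ac)

lemma lambert_has_sum_rows:
  assumes "norm q < 1" "\<And>m. norm (a m) \<le> real m" "\<And>m. norm (b m) \<le> real m"
  assumes row: "\<And>k. k \<ge> 1 \<Longrightarrow> ((\<lambda>m. a m * (q ^ k) ^ m) has_sum g k) {1..}"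
  shows "((\<lambda>k. b k * g k) has_sum lambert a b q) {1..}"
proof (rule has_sum_SigmaD)
  show "((\<lambda>(k, m). b k * a m * q ^ (k * m)) has_sum lambert a b q) (Sigma {1..} (\<lambda>_. {1..}))"
    using lambert_has_sum[OF assms(1,3,2)] by (simp add: lambert_commute[of a b])
  show "((\<lambda>m. case (k, m) of (k, m) \<Rightarrow> b k * a m * q ^ (k * m)) has_sum b k * g k) {1..}" if "k \<in> {1..}" for k
    using has_sum_cmult_right[OF row[of k], of "b k"] that by (simp add: power_mult mult_ac)
qed

lemma lambert_has_sum_divisors:
  assumes "norm q < 1" "\<And>m. norm (a m) \<le> real m" "\<And>m. norm (b m) \<le> real m"
  shows "((\<lambda>n. (\<Sum>m | m dvd n. a m * b (n div m)) * q ^ n) has_sum lambert a b q) {1..}"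
proof (rule has_sum_SigmaD)
  have "((\<lambda>(m, k). a m * b k * q ^ (m * k)) has_sum lambert a b q) ({1..} \<times> {1..})"
    by (rule lambert_has_sum[OF assms])
  also have "?this \<longleftrightarrow> ((\<lambda>(n, m). a m * b (n div m) * q ^ n) has_sum lambert a b q) (Sigma {1..} (\<lambda>n. {m. m dvd n}))"
    by (rule has_sum_reindex_bij_witness[of _ "\<lambda>(n, m). (m, n div m)" "\<lambda>(m, k). (m * k, m)"])
       (auto simp: dvd_def)
  finally show "((\<lambda>(n, m). a m * b (n div m) * q ^ n) has_sum lambert a b q) (Sigma {1..} (\<lambda>n. {m. m dvd n}))" .
  show "((\<lambda>m. case (n, m) of (n, m) \<Rightarrow> a m * b (n div m) * q ^ n) has_sum (\<Sum>m | m dvd n. a m * b (n div m)) * q ^ n) {m. m dvd n}"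
    if "n \<in> {1..}" for n
    by (rule has_sum_finiteI) (use that in \<open>auto simp: sum_distrib_right finite_divisors_nat\<close>)
qed

lemma has_sum_imp_sums_Suc:
  fixes f :: "nat \<Rightarrow> complex"
  assumes "(f has_sum S) {1..}"
  shows "(\<lambda>n. f (Suc n)) sums S"
proof -
  have "(f has_sum S) {1..} \<longleftrightarrow> ((\<lambda>n. f (Suc n)) has_sum S) UNIV"
    by (rule has_sum_reindex_bij_witness[of _ Suc "\<lambda>n. n - 1"]) auto
  thus ?thesis using assms has_sum_imp_sums by blast
qed

section \<open>Eisenstein series as division values\<close>

lemma norm_qexp: "norm (qexp z) = exp (- (2 * pi * Im z))"
  by (simp add: qexp_def)

lemma norm_qexp_less_1: "Im z > 0 \<Longrightarrow> norm (qexp z) < 1"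
  by (simp add: norm_qexp)

lemma qexp_nonzero [simp]: "qexp z \<noteq> 0"
  by (simp add: qexp_def)

lemma qexp_add: "qexp (u + v) = qexp u * qexp v"
  by (simp add: qexp_def exp_add ring_distribs)

lemma qexp_minus: "qexp (- u) = inverse (qexp u)"
  by (simp add: qexp_def exp_minus)

lemma qexp_of_nat_mult: "qexp (of_nat n * z) = qexp z ^ n"
  by (simp add: qexp_def mult_ac flip: exp_of_nat_mult)

lemma qexp_numeral_mult: "qexp (numeral n * z) = qexp z ^ numeral n"
  using qexp_of_nat_mult[of "numeral n" z] by simp

lemma qexp_plus_1: "qexp (z + 1) = qexp z"
  by (simp add: qexp_def ring_distribs exp_add mult_ac)

text \<open>The generating function \<open>\<Sum>m. m x^m\<close>, which is \<open>csc2\<close> in terms of the exponential.\<close>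

definition geo2 :: "complex \<Rightarrow> complex" where "geo2 x = x / (1 - x)\<^sup>2"

lemma csc2_eq_geo2: "csc2 w = - 4 * of_real pi ^ 2 * geo2 (qexp w)"
  by (simp add: csc2_eq_exp geo2_def)

text \<open>The rows \<open>m\<close> and \<open>-m\<close> are put together by the symmetry of \<open>csc2\<close>.\<close>

lemma wsum_has_sum_nat:
  assumes "Im z > 0" "off_lattice u z"
  shows "((\<lambda>m::nat. csc2 (u + of_nat m * z) + csc2 (- u + of_nat m * z)) has_sum (wsum u z - csc2 u)) {1..}"
proof -
  define f where "f = (\<lambda>m::int. csc2 (u + of_int m * z))"
  have S: "f summable_on UNIV" using wsum_has_sum[OF assms] by (auto simp: f_def dest: has_sum_imp_summable)
  define A B where "A = infsum f {1..}" and "B = infsum f {..-1}"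
  have A: "(f has_sum A) {1..}" unfolding A_def by (rule has_sum_infsum[OF summable_on_subset[OF S]]) auto
  have B: "(f has_sum B) {..-1}" unfolding B_def by (rule has_sum_infsum[OF summable_on_subset[OF S]]) auto
  have 0: "(f has_sum csc2 u) {0}" by (rule has_sum_finiteI) (auto simp: f_def)
  have "(f has_sum (csc2 u + (A + B))) ({0} \<union> ({1..} \<union> {..-1}))"
    by (intro has_sum_Un_disjoint A B 0) auto
  also have "{0} \<union> ({1..} \<union> {..-1}) = (UNIV :: int set)" by force
  finally have AB: "wsum u z - csc2 u = A + B"
    using wsum_has_sum[OF assms] unfolding f_def by (metis has_sum_unique add_diff_cancel_left')
  have "(f has_sum A) {1..} \<longleftrightarrow> ((\<lambda>m::nat. csc2 (u + of_nat m * z)) has_sum A) {1..}"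
    by (rule has_sum_reindex_bij_witness[of _ int nat]) (auto simp: f_def)
  moreover have "(f has_sum B) {..-1} \<longleftrightarrow> ((\<lambda>m::nat. csc2 (- u + of_nat m * z)) has_sum B) {1..}"
  proof (rule has_sum_reindex_bij_witness[of _ "\<lambda>m. - int m" "\<lambda>n. nat (- n)"])
    fix a :: int assume "a \<in> {..-1}"
    hence "- u + of_nat (nat (- a)) * z = - (u + of_int a * z)" by simp
    thus "csc2 (- u + of_nat (nat (- a)) * z) = f a" by (simp only: csc2_minus f_def)
  qed auto
  ultimately show ?thesis using A B unfolding AB by (intro has_sum_add) auto
qed

lemma twisted_sigma_eq:
  assumes "n > 0"
  shows "twisted_sigma \<phi> \<psi> n = (\<Sum>m | m dvd n. (\<phi> (int m) * of_nat m) * \<psi> (int (n div m)))"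
proof -
  have "{m. 1 \<le> m \<and> m dvd n} = {m. m dvd n}" using assms by (auto intro: Suc_leI dvd_pos_nat)
  thus ?thesis by (simp add: twisted_sigma_def mult_ac)
qed

text \<open>The trivial character. Its value at 0 is 0, so that it is bounded by the identity function, as \<open>lambert\<close>
  requires.\<close>

definition one_pos :: "nat \<Rightarrow> complex" where "one_pos k = (if k = 0 then 0 else 1)"

lemma E_1_8_eq_lambert:
  assumes "Im z > 0"
  shows "E_1_8 z = lambert of_nat (\<lambda>k. chi 8 (int k)) (qexp z)"
proof -
  have n: "norm (chi 8 (int m)) \<le> real m" for m
    using norm_chi_8_le[of "int m"] by (cases m) (auto simp: chi_8 kron8_def)
  have "((\<lambda>n. (\<Sum>m | m dvd n. of_nat m * chi 8 (int (n div m))) * qexp z ^ n) has_sum lambert of_nat (\<lambda>k. chi 8 (int k)) (qexp z)) {1..}"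
    by (rule lambert_has_sum_divisors) (use n norm_qexp_less_1[OF assms] in auto)
  from has_sum_imp_sums_Suc[OF this]
  have "(\<lambda>n. (\<Sum>m | m dvd Suc n. of_nat m * chi 8 (int (Suc n div m))) * qexp z ^ Suc n) sums lambert of_nat (\<lambda>k. chi 8 (int k)) (qexp z)" .
  moreover have "(\<Sum>m | m dvd Suc n. of_nat m * chi 8 (int (Suc n div m))) = twisted_sigma (chi 1) (chi 8) (Suc n)" for n
    by (subst twisted_sigma_eq) (auto intro!: sum.cong simp: chi_1 dvd_pos_nat)
  ultimately show ?thesis by (simp only: E_1_8_def sums_iff)
qed

lemma E_8_1_eq_lambert:
  assumes "Im z > 0"
  shows "E_8_1 z = - 1 / 2 + lambert (\<lambda>m. chi 8 (int m) * of_nat m) one_pos (qexp z)"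
proof -
  have n: "norm (chi 8 (int m) * of_nat m) \<le> real m" for m
    using norm_chi_8_le[of "int m"] by (simp add: norm_mult mult_left_le_one_le)
  have "((\<lambda>n. (\<Sum>m | m dvd n. (chi 8 (int m) * of_nat m) * one_pos (n div m)) * qexp z ^ n) has_sum lambert (\<lambda>m. chi 8 (int m) * of_nat m) one_pos (qexp z)) {1..}"
    by (rule lambert_has_sum_divisors) (use n norm_qexp_less_1[OF assms] in \<open>auto simp: one_pos_def\<close>)
  from has_sum_imp_sums_Suc[OF this]
  have "(\<lambda>n. (\<Sum>m | m dvd Suc n. (chi 8 (int m) * of_nat m) * one_pos (Suc n div m)) * qexp z ^ Suc n) sums lambert (\<lambda>m. chi 8 (int m) * of_nat m) one_pos (qexp z)" .
  moreover have "(\<Sum>m | m dvd Suc n. (chi 8 (int m) * of_nat m) * one_pos (Suc n div m)) = twisted_sigma (chi 8) (chi 1) (Suc n)" for n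
  proof -
    have "one_pos (Suc n div m) = chi 1 (int (Suc n div m))" if "m dvd Suc n" for m
    proof -
      have "m > 0" using that by (metis dvd_0_left_iff gr0I nat.distinct(1))
      hence "Suc n div m > 0" using that by (simp add: div_greater_zero_iff dvd_imp_le)
      thus ?thesis by (simp only: chi_1) (simp add: one_pos_def)
    qed
    thus ?thesis by (subst twisted_sigma_eq) (auto intro!: sum.cong)
  qed
  ultimately show ?thesis by (simp only: E_8_1_def sums_iff)
qed

lemma lambert_of_nat_rows:
  assumes "Im z > 0" "\<And>m. norm (b m) \<le> real m"
  shows "((\<lambda>k. b k * geo2 (qexp z ^ k)) has_sum lambert of_nat b (qexp z)) {1..}"
proof (rule lambert_has_sum_rows)
  show "((\<lambda>m. of_nat m * (qexp z ^ k) ^ m) has_sum geo2 (qexp z ^ k)) {1..}" if "k \<ge> 1" for k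
    unfolding geo2_def
  proof (rule has_sum_geometric_deriv)
    show "norm (qexp z ^ k) < 1"
      using norm_qexp_less_1[OF assms(1)] that by (simp add: norm_power power_less_one_iff)
  qed
qed (use assms norm_qexp_less_1 in auto)

lemma csc2_of_nat_mult: "csc2 (of_nat k * z) = - 4 * of_real pi ^ 2 * geo2 (qexp z ^ k)"
  by (simp only: csc2_eq_geo2 qexp_of_nat_mult)

text \<open>Here \<open>\<chi>\<^sub>8\<close> weights the rows \<open>csc2 (k z)\<close>. It is 1 on the classes \<open>\<plusminus>1\<close> and -1 on the classes
  \<open>\<plusminus>3\<close> modulo 8, and the rows with \<open>k\<close> in the classes \<open>\<plusminus>r\<close> add up to the division value at
  \<open>r z\<close> for the lattice generated by \<open>1\<close> and \<open>8 z\<close>.\<close>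

theorem E_1_8_eq_divval:
  assumes z: "Im z > 0"
  shows "- 4 * of_real pi ^ 2 * E_1_8 z = divval 1 0 (8 * z) - divval 3 0 (8 * z)"
proof -
  define f where "f = (\<lambda>k::nat. csc2 (of_nat k * z))"
  have z8: "Im (8 * z) > 0" using z by simp
  have nrm: "norm (chi 8 (int m)) \<le> real m" for m
    using norm_chi_8_le[of "int m"] by (cases m) (auto simp: chi_8 kron8_def)
  have 1: "((\<lambda>k. chi 8 (int k) * f k) has_sum (- 4 * of_real pi ^ 2 * E_1_8 z)) {1..}"
  proof -
    have "chi 8 (int k) * f k = - 4 * of_real pi ^ 2 * (chi 8 (int k) * geo2 (qexp z ^ k))" for k
      unfolding f_def csc2_of_nat_mult by (simp only: mult_ac)
    thus ?thesis using has_sum_cmult_right[OF lambert_of_nat_rows[OF z nrm], of "- 4 * of_real pi ^ 2"]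
      by (simp only: E_1_8_eq_lambert[OF z])
  qed
  have 2: "(f has_sum divval (int r) 0 (8 * z)) {k. k mod 8 \<in> {r, 8 - r}}" if r: "r \<in> {1, 3}" for r :: nat
  proof -
    have "((\<lambda>m::int. csc2 ((of_int (int r) * (8 * z) + of_int 0) / 8 + of_int m * (8 * z))) has_sum divval (int r) 0 (8 * z)) UNIV"
      unfolding divval_def
      by (intro wsum_has_sum z8 off_lattice_divval) (use r in \<open>auto simp: zdvd_not_zless\<close>)
    also have "?this \<longleftrightarrow> (f has_sum divval (int r) 0 (8 * z)) {k. k mod 8 \<in> {r, 8 - r}}"
    proof (rule has_sum_reindex_bij_witness[of _ "\<lambda>k. (if k mod 8 = r then int (k div 8) else - int (k div 8) - 1)" "\<lambda>m. nat \<bar>8 * m + int r\<bar>"])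
      fix m :: int
      show "f (nat \<bar>8 * m + int r\<bar>) = csc2 ((of_int (int r) * (8 * z) + of_int 0) / 8 + of_int m * (8 * z))"
      proof (cases "m \<ge> 0")
        case True
        hence "of_nat (nat \<bar>8 * m + int r\<bar>) * z = (of_int (int r) * (8 * z) + of_int 0) / 8 + of_int m * (8 * z)"
          by (simp add: algebra_simps)
        thus ?thesis by (simp only: f_def)
      next
        case False
        hence "8 * m + int r < 0" using r by auto
        hence "of_nat (nat \<bar>8 * m + int r\<bar>) * z = - ((of_int (int r) * (8 * z) + of_int 0) / 8 + of_int m * (8 * z))"
          by (simp add: algebra_simps)
        thus ?thesis by (simp only: f_def csc2_minus)
      qed
      have N: "nat \<bar>8 * m + int r\<bar> = (if m \<ge> 0 then r + 8 * nat m else (8 - r) + 8 * nat (- m - 1))"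
        using r by auto
      show "nat \<bar>8 * m + int r\<bar> \<in> {k. k mod 8 \<in> {r, 8 - r}}"
        unfolding N using r by auto
      show "(if nat \<bar>8 * m + int r\<bar> mod 8 = r then int (nat \<bar>8 * m + int r\<bar> div 8) else - int (nat \<bar>8 * m + int r\<bar> div 8) - 1) = m"
        unfolding N using r by auto
    next
      fix k assume "k \<in> {k. k mod 8 \<in> {r, 8 - r}}"
      moreover have "8 * int (k div 8) + int (k mod 8) = int k"
        by (metis mult_div_mod_eq of_nat_add of_nat_mult of_nat_numeral)
      hence "nat (8 * int (k div 8) + int (k mod 8)) = k" by simp
      ultimately show "nat \<bar>8 * (if k mod 8 = r then int (k div 8) else - int (k div 8) - 1) + int r\<bar> = k"
        using r by auto
    qed auto
    finally show ?thesis .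
  qed
  have "((\<lambda>k. chi 8 (int k) * f k) has_sum divval 1 0 (8 * z)) {k. k mod 8 \<in> {1, 7}}"
  proof -
    have "chi 8 (int k) = 1" if "k mod 8 \<in> {1, 7}" for k
      using that by (auto simp: chi_8 kron8_def) presburger+
    thus ?thesis using 2[of 1] by (subst has_sum_cong[of _ _ f]) auto
  qed
  moreover have "((\<lambda>k. chi 8 (int k) * f k) has_sum (- divval 3 0 (8 * z))) {k. k mod 8 \<in> {3, 5}}"
  proof -
    have "chi 8 (int k) = - 1" if "k mod 8 \<in> {3, 5}" for k
      using that by (auto simp: chi_8 kron8_def) presburger+
    thus ?thesis using has_sum_uminusI[OF 2[of 3]] by (subst has_sum_cong[of _ _ "\<lambda>k. - f k"]) auto
  qed
  ultimately have "((\<lambda>k. chi 8 (int k) * f k) has_sum (divval 1 0 (8 * z) + - divval 3 0 (8 * z))) ({k. k mod 8 \<in> {1, 7}} \<union> {k. k mod 8 \<in> {3, 5}})"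
    by (rule has_sum_Un_disjoint) auto
  also have "?this \<longleftrightarrow> ((\<lambda>k. chi 8 (int k) * f k) has_sum (divval 1 0 (8 * z) + - divval 3 0 (8 * z))) {1..}"
  proof (rule has_sum_cong_neutral)
    fix k :: nat assume "k \<in> {1..} - ({k. k mod 8 \<in> {1, 7}} \<union> {k. k mod 8 \<in> {3, 5}})"
    hence "even k" by auto presburger
    thus "chi 8 (int k) * f k = 0" by (simp add: chi_8 kron8_def)
  next
    fix k :: nat assume "k \<in> ({k. k mod 8 \<in> {1, 7}} \<union> {k. k mod 8 \<in> {3, 5}}) - {1..}"
    thus "chi 8 (int k) * f k = 0" by auto
  qed auto
  finally show ?thesis using has_sum_unique[OF 1] by simp
qed

text \<open>The primitive eighth root of unity \<open>exp (2\<pi>i/8)\<close>.\<close>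

definition zeta8 :: complex where "zeta8 = (1 + \<i>) / of_real (sqrt 2)"

lemma zeta8_square: "zeta8\<^sup>2 = \<i>"
proof -
  have "complex_of_real (sqrt 2) ^ 2 = 2" by (simp flip: of_real_power)
  thus ?thesis by (simp add: zeta8_def power_divide power2_eq_square algebra_simps)
qed

lemma zeta8_nonzero: "zeta8 \<noteq> 0"
  using zeta8_square by auto

lemma qexp_eighth: "qexp (1 / 8) = zeta8"
proof -
  have "qexp (1 / 8) = cis (pi / 4)" by (simp add: qexp_def cis_conv_exp mult_ac)
  also have "\<dots> = of_real (sqrt 2 / 2) + \<i> * of_real (sqrt 2 / 2)"
    by (simp add: complex_eq_iff cos_45 sin_45)
  also have "sqrt 2 / 2 = 1 / sqrt 2" by (simp add: real_div_sqrt)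
  finally show ?thesis by (simp add: zeta8_def add_divide_distrib)
qed

lemma zeta8_powers: "zeta8 ^ 3 = \<i> * zeta8" "inverse zeta8 = - \<i> * zeta8" "inverse (zeta8 ^ 3) = - zeta8"
proof -
  show 3: "zeta8 ^ 3 = \<i> * zeta8" by (simp add: power3_eq_cube zeta8_square flip: power2_eq_square)
  have zz: "zeta8 * zeta8 = \<i>" using zeta8_square by (simp add: power2_eq_square)
  show "inverse zeta8 = - \<i> * zeta8" by (rule inverse_unique) (simp add: zz algebra_simps)
  show "inverse (zeta8 ^ 3) = - zeta8" unfolding 3 by (rule inverse_unique) (simp add: zz algebra_simps)
qed

text \<open>The Gauss sum of \<open>\<chi>\<^sub>8\<close>, of absolute value \<open>sqrt 8\<close>.\<close>

lemma gauss_sum_8: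
  "zeta8 ^ n + (- \<i> * zeta8) ^ n - (\<i> * zeta8) ^ n - (- zeta8) ^ n = 2 * of_real (sqrt 2) * of_int (kron8 (int n))"
proof -
  define k r where "k = n div 4" and "r = n mod 4"
  have n: "n = r + 4 * k" by (simp add: k_def r_def)
  have z4: "zeta8 ^ 4 = -1"
    using zeta8_square by (simp add: power2_eq_square numeral_eq_Suc mult_ac)
  have pw: "x ^ n = x ^ r * (x ^ 4) ^ k" for x :: complex by (simp add: n power_add power_mult)
  have i4: "(- \<i>) ^ 4 = 1" "\<i> ^ 4 = 1" by (simp_all add: numeral_eq_Suc)
  have fours: "(- \<i> * zeta8) ^ 4 = -1" "(\<i> * zeta8) ^ 4 = -1" "(- zeta8) ^ 4 = -1"
    using z4 i4 by (simp_all add: power_mult_distrib)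
  have kr: "kron8 (int n) = kron8 (int r) * (-1) ^ k"
  proof -
    have "kron8 (x + 4) = - kron8 x" if "x \<ge> 0" for x
    proof -
      have "\<forall>x\<in>set [0..7]. kron8 (x + 4) = - kron8 x" by code_simp
      moreover have "x mod 8 \<in> set [0..7]" using pos_mod_bound[of 8 x] by (simp add: set_upto)
      ultimately have "kron8 (x mod 8 + 4) = - kron8 (x mod 8)" by blast
      thus ?thesis using kron8_mod[of "x mod 8 + 4"] kron8_mod[of "x + 4"] by (simp add: kron8_mod mod_simps)
    qed
    hence "kron8 (int (r + 4 * j)) = kron8 (int r) * (-1) ^ j" for j
    proof (induction j)
      case (Suc j)
      have eq: "int (r + 4 * Suc j) = int (r + 4 * j) + 4" by simp
      have "kron8 (int (r + 4 * j) + 4) = - kron8 (int (r + 4 * j))"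
        by (rule Suc.prems) simp
      hence "kron8 (int (r + 4 * Suc j)) = - kron8 (int (r + 4 * j))"
        by (simp only: eq)
      also have "\<dots> = kron8 (int r) * (-1) ^ Suc j"
        by (subst Suc.IH[OF Suc.prems]) simp_all
      finally show ?case .
    qed simp
    thus ?thesis by (simp only: n)
  qed
  have s2: "complex_of_real (sqrt 2) * complex_of_real (sqrt 2) = 2"
    by (simp flip: of_real_mult)
  have "r < 4" by (simp add: r_def)
  hence "r = 0 \<or> r = 1 \<or> r = 2 \<or> r = 3" by auto
  hence "zeta8 ^ r + (- \<i> * zeta8) ^ r - (\<i> * zeta8) ^ r - (- zeta8) ^ r = 2 * of_real (sqrt 2) * of_int (kron8 (int r))"
    using s2
    by (elim disjE) (simp_all add: kron8_def zeta8_def power2_eq_square power3_eq_cube field_simps)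
  moreover have "zeta8 ^ n + (- \<i> * zeta8) ^ n - (\<i> * zeta8) ^ n - (- zeta8) ^ n =
       (zeta8 ^ r + (- \<i> * zeta8) ^ r - (\<i> * zeta8) ^ r - (- zeta8) ^ r) * (-1) ^ k"
    by (simp only: pw fours z4 distrib_right left_diff_distrib)
  ultimately show ?thesis by (simp add: kr)
qed

lemma has_sum_geo2: "norm x < 1 \<Longrightarrow> ((\<lambda>m. of_nat m * x ^ m) has_sum geo2 x) {1..}"
  unfolding geo2_def by (rule has_sum_geometric_deriv)

text \<open>The character now sits on the summation inside each row. Expanding it by the Gauss sum turns the row into
  values of \<open>csc2\<close> at \<open>j/8 + k z\<close> with \<open>j\<close> odd, which are the rows of the division values at the points
  \<open>j/8\<close>. The row \<open>k = 0\<close> accounts for the constant term.\<close>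

theorem E_8_1_eq_divval:
  assumes z: "Im z > 0"
  shows "divval 0 1 z - divval 0 3 z = - 8 * of_real (sqrt 2) * of_real pi ^ 2 * E_8_1 z"
proof -
  define q where "q = qexp z"
  have q: "norm q < 1" using norm_qexp_less_1[OF z] by (simp add: q_def)
  define g where "g = (\<lambda>k. geo2 (zeta8 * q ^ k) + geo2 (- \<i> * zeta8 * q ^ k) - geo2 (\<i> * zeta8 * q ^ k) - geo2 (- zeta8 * q ^ k))"
  define s where "s = complex_of_real (sqrt 2)"
  have ss: "s * s = 2" by (simp add: s_def flip: of_real_mult)
  have s0: "s \<noteq> 0" using ss by auto
  have nz: "norm zeta8 = 1"
  proof -
    have "norm zeta8 ^ 2 = 1" using zeta8_square by (metis norm_power norm_ii)
    thus ?thesis by (metis norm_ge_zero power2_eq_1_iff le_minus_one_simps(3) order_less_le_trans not_le zero_less_one)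
  qed
  have nrm: "norm (chi 8 (int m) * of_nat m) \<le> real m" for m
    using norm_chi_8_le[of "int m"] by (simp add: norm_mult mult_left_le_one_le)
  have A: "((\<lambda>k. one_pos k * (g k / (2 * s))) has_sum lambert (\<lambda>m. chi 8 (int m) * of_nat m) one_pos q) {1..}"
  proof (rule lambert_has_sum_rows)
    fix k :: nat assume k: "k \<ge> 1"
    have qk: "norm (q ^ k) < 1" using q k by (simp add: norm_power power_less_one_iff)
    have "((\<lambda>m. of_nat m * (zeta8 * q ^ k) ^ m + of_nat m * (- \<i> * zeta8 * q ^ k) ^ m
             + - (of_nat m * (\<i> * zeta8 * q ^ k) ^ m) + - (of_nat m * (- zeta8 * q ^ k) ^ m)) has_sum
            (geo2 (zeta8 * q ^ k) + geo2 (- \<i> * zeta8 * q ^ k) + - geo2 (\<i> * zeta8 * q ^ k) + - geo2 (- zeta8 * q ^ k))) {1..}"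
      by (intro has_sum_add has_sum_uminusI has_sum_geo2) (use qk nz in \<open>auto simp: norm_mult\<close>)
    also have "(geo2 (zeta8 * q ^ k) + geo2 (- \<i> * zeta8 * q ^ k) + - geo2 (\<i> * zeta8 * q ^ k) + - geo2 (- zeta8 * q ^ k)) = g k"
      by (simp add: g_def)
    also have "(\<lambda>m. of_nat m * (zeta8 * q ^ k) ^ m + of_nat m * (- \<i> * zeta8 * q ^ k) ^ m
             + - (of_nat m * (\<i> * zeta8 * q ^ k) ^ m) + - (of_nat m * (- zeta8 * q ^ k) ^ m)) =
           (\<lambda>m. (2 * s) * (chi 8 (int m) * of_nat m * (q ^ k) ^ m))"
    proof
      fix m
      have "of_nat m * (zeta8 * q ^ k) ^ m + of_nat m * (- \<i> * zeta8 * q ^ k) ^ m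
             + - (of_nat m * (\<i> * zeta8 * q ^ k) ^ m) + - (of_nat m * (- zeta8 * q ^ k) ^ m) =
            of_nat m * (q ^ k) ^ m * (zeta8 ^ m + (- \<i> * zeta8) ^ m - (\<i> * zeta8) ^ m - (- zeta8) ^ m)"
        unfolding power_mult_distrib[of _ "q ^ k"] by (simp add: ring_distribs)
      also have "\<dots> = (2 * s) * (chi 8 (int m) * of_nat m * (q ^ k) ^ m)"
        unfolding gauss_sum_8 by (simp add: chi_8 s_def)
      finally show "of_nat m * (zeta8 * q ^ k) ^ m + of_nat m * (- \<i> * zeta8 * q ^ k) ^ m
             + - (of_nat m * (\<i> * zeta8 * q ^ k) ^ m) + - (of_nat m * (- zeta8 * q ^ k) ^ m) = (2 * s) * (chi 8 (int m) * of_nat m * (q ^ k) ^ m)" .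
    qed
    finally have "((\<lambda>m. 1 / (2 * s) * ((2 * s) * (chi 8 (int m) * of_nat m * (q ^ k) ^ m))) has_sum 1 / (2 * s) * g k) {1..}"
      by (rule has_sum_cmult_right)
    thus "((\<lambda>m. chi 8 (int m) * of_nat m * (q ^ k) ^ m) has_sum g k / (2 * s)) {1..}"
      using s0 by (simp add: field_simps)
  qed (use q nrm in \<open>auto simp: one_pos_def\<close>)
  have "((\<lambda>k. (- 8 * s * of_real pi ^ 2) * (one_pos k * (g k / (2 * s)))) has_sum (- 8 * s * of_real pi ^ 2) * (E_8_1 z + 1 / 2)) {1..}"
  proof -
    have "E_8_1 z + 1 / 2 = lambert (\<lambda>m. chi 8 (int m) * of_nat m) one_pos q"
      by (simp add: E_8_1_eq_lambert[OF z] q_def)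
    thus ?thesis using has_sum_cmult_right[OF A, of "- 8 * s * of_real pi ^ 2"] by (simp only:)
  qed
  also have "?this \<longleftrightarrow> ((\<lambda>k. - 4 * of_real pi ^ 2 * g k) has_sum (- 8 * s * of_real pi ^ 2) * (E_8_1 z + 1 / 2)) {1..}"
    using s0 by (intro has_sum_cong) (auto simp: one_pos_def field_simps)
  finally have B: "((\<lambda>k. - 4 * of_real pi ^ 2 * g k) has_sum (- 8 * s * of_real pi ^ 2) * (E_8_1 z + 1 / 2)) {1..}" .
  have e3: "qexp (3 / 8) = \<i> * zeta8" using qexp_numeral_mult[of "Num.num.Bit1 Num.num.One" "1/8"] by (simp add: qexp_eighth zeta8_powers)
  have row: "((\<lambda>m::nat. - 4 * of_real pi ^ 2 * (geo2 (x * q ^ m) + geo2 (inverse x * q ^ m))) has_sum (divval 0 r z - csc2 (of_int r / 8))) {1..}"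
    if "\<not> 8 dvd r" "x = qexp (of_int r / 8)" for r :: int and x
  proof -
    have "((\<lambda>m::nat. csc2 ((of_int 0 * z + of_int r) / 8 + of_nat m * z) + csc2 (- ((of_int 0 * z + of_int r) / 8) + of_nat m * z)) has_sum
            (divval 0 r z - csc2 ((of_int 0 * z + of_int r) / 8))) {1..}"
      unfolding divval_def by (intro wsum_has_sum_nat z off_lattice_divval) (use that in auto)
    moreover have "(of_int 0 * z + of_int r) / 8 = of_int r / 8" by simp
    ultimately show ?thesis
      unfolding csc2_eq_geo2[of "of_int r / 8 + w" for w] csc2_eq_geo2[of "- (of_int r / 8) + w" for w]
      by (simp only: csc2_eq_geo2[of "of_int r / 8 + w" for w] csc2_eq_geo2[of "- (of_int r / 8) + w" for w]
            qexp_add qexp_minus qexp_of_nat_mult that(2) q_def ring_distribs)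
  qed
  have "((\<lambda>m. - 4 * of_real pi ^ 2 * (geo2 (zeta8 * q ^ m) + geo2 (inverse zeta8 * q ^ m)) + - (- 4 * of_real pi ^ 2 * (geo2 (\<i> * zeta8 * q ^ m) + geo2 (inverse (\<i> * zeta8) * q ^ m))))
          has_sum (divval 0 1 z - csc2 (of_int 1 / 8) + - (divval 0 3 z - csc2 (of_int 3 / 8)))) {1..}"
    by (intro has_sum_add has_sum_uminusI row) (auto simp: qexp_eighth e3)
  moreover have "inverse (\<i> * zeta8) = - zeta8" using zeta8_powers by simp
  ultimately have "((\<lambda>k. - 4 * of_real pi ^ 2 * g k) has_sum (divval 0 1 z - csc2 (of_int 1 / 8) + - (divval 0 3 z - csc2 (of_int 3 / 8)))) {1..}"
    by (simp add: zeta8_powers(2) g_def algebra_simps)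
  from has_sum_unique[OF this B]
  have C: "divval 0 1 z - divval 0 3 z = csc2 (1 / 8) - csc2 (3 / 8) + (- 8 * s * of_real pi ^ 2) * (E_8_1 z + 1 / 2)"
    by (simp add: algebra_simps)
  have "csc2 (1 / 8) - csc2 (3 / 8) = 4 * s * of_real pi ^ 2"
  proof -
    have zs: "zeta8 = (1 + \<i>) / s" by (simp add: zeta8_def s_def)
    have g1: "geo2 x = 1 / (inverse x + x - 2)" if "x \<noteq> 0" for x
    proof -
      have "inverse x + x - 2 = (1 - x)\<^sup>2 / x" using that by (simp add: field_simps power2_eq_square)
      thus ?thesis by (simp add: geo2_def)
    qed
    have "inverse zeta8 + zeta8 = s" "inverse (\<i> * zeta8) + \<i> * zeta8 = - s"
      using ss s0 zeta8_powers by (simp_all add: zs field_simps)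
    hence "geo2 zeta8 = 1 / (s - 2)" "geo2 (\<i> * zeta8) = 1 / (- s - 2)"
      using g1[of zeta8] g1[of "\<i> * zeta8"] zeta8_nonzero by simp_all
    moreover have "s - 2 \<noteq> 0" using ss by auto
    moreover have "- s - 2 \<noteq> 0"
    proof
      assume "- s - 2 = 0"
      hence "- (- s) = - 2" by simp
      thus False using ss by simp
    qed
    moreover have "1 / (s - 2) - 1 / (- s - 2) = - s"
    proof -
      have "(s - 2) * (- s - 2) = 2" using ss by (simp add: algebra_simps)
      hence "1 / (s - 2) - 1 / (- s - 2) = ((- s - 2) - (s - 2)) / 2"
        using calculation by (simp add: diff_divide_eq_iff divide_diff_eq_iff)
      thus ?thesis by simp
    qed
    ultimately have "geo2 zeta8 - geo2 (\<i> * zeta8) = - s" by simp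
    moreover have "csc2 (1 / 8) - csc2 (3 / 8) = - 4 * of_real pi ^ 2 * (geo2 zeta8 - geo2 (\<i> * zeta8))"
      by (simp add: csc2_eq_geo2 qexp_eighth e3 algebra_simps)
    ultimately show ?thesis by simp
  qed
  with C show ?thesis by (simp add: s_def algebra_simps)
qed

section \<open>The quasimodular Eisenstein series of weight 2\<close>

text \<open>The three points of order 2 are permuted by the modular group, so their sum reproduces itself together with
  three times the anomaly of a single value.\<close>

definition E2 :: "complex \<Rightarrow> complex"
  where "E2 z = (divval 0 4 z + divval 4 0 z + divval 4 4 z) / of_real pi ^ 2"

text \<open>The duplication formula lets the sums over points of order 2 be expressed by the single sum over \<open>csc2 (k z)\<close>.\<close>

lemma csc2_duplication:
  assumes "Im w \<noteq> 0"
  shows "csc2 w + csc2 (w + 1 / 2) = 4 * csc2 (2 * w)"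
proof -
  define x where "x = qexp w"
  have "norm x \<noteq> 1" using assms by (simp add: x_def norm_qexp)
  hence x: "x \<noteq> 1" "x \<noteq> -1" by auto
  have half: "qexp (1 / 2) = - 1" by (simp add: qexp_def exp_pi_i mult_ac)
  have *: "geo2 x + geo2 (- x) = 4 * geo2 (x\<^sup>2)"
  proof -
    from x have nz: "(1 - x)\<^sup>2 \<noteq> 0" "(1 + x)\<^sup>2 \<noteq> 0" by (auto simp: add_eq_0_iff)
    have sq: "(1 - x\<^sup>2)\<^sup>2 = (1 - x)\<^sup>2 * (1 + x)\<^sup>2" by (simp add: power2_eq_square algebra_simps)
    have "x / a + (- x) / b = 4 * (x\<^sup>2 / (a * b))" if "a \<noteq> 0" "b \<noteq> 0" "b - a = 4 * x" for a b
    proof -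
      have "x / a + (- x) / b = x * (b - a) / (a * b)" using that(1,2) by (simp add: field_simps)
      thus ?thesis by (simp add: that(3) power2_eq_square)
    qed
    from this[OF nz] have "x / (1 - x)\<^sup>2 + (- x) / (1 + x)\<^sup>2 = 4 * (x\<^sup>2 / ((1 - x)\<^sup>2 * (1 + x)\<^sup>2))"
      by (simp add: power2_eq_square algebra_simps)
    thus ?thesis by (simp only: geo2_def diff_minus_eq_add sq)
  qed
  have "qexp (w + 1 / 2) = - x" "qexp (2 * w) = x\<^sup>2"
    by (simp_all add: qexp_add half x_def qexp_numeral_mult)
  hence "csc2 w + csc2 (w + 1 / 2) = - 4 * of_real pi ^ 2 * (geo2 x + geo2 (- x))"
        "csc2 (2 * w) = - 4 * of_real pi ^ 2 * geo2 (x\<^sup>2)"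
    by (simp_all only: csc2_eq_geo2 x_def[symmetric] distrib_left)
  thus ?thesis by (simp add: *)
qed

text \<open>The sum \<open>G\<close> of all \<open>csc2 (k z)\<close> is split into the parts with odd and with even \<open>k\<close>. The value at \<open>1/2\<close>, and
  the sum of the two other values, are combinations of these parts, and only \<open>G\<close> survives in the total.\<close>

theorem E2_eq_lambert:
  assumes z: "Im z > 0"
  shows "E2 z = 1 - 24 * lambert of_nat one_pos (qexp z)"
proof -
  define f where "f = (\<lambda>k::nat. csc2 (of_nat k * z))"
  define G where "G = - 4 * of_real pi ^ 2 * lambert of_nat one_pos (qexp z)"
  have "((\<lambda>k. - 4 * of_real pi ^ 2 * (one_pos k * geo2 (qexp z ^ k))) has_sum G) {1..}"
    unfolding G_def
    by (intro has_sum_cmult_right lambert_of_nat_rows z) (auto simp: one_pos_def)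
  also have "?this \<longleftrightarrow> (f has_sum G) {1..}"
    by (intro has_sum_cong) (auto simp: one_pos_def f_def csc2_of_nat_mult)
  finally have G: "(f has_sum G) {1..}" .
  define Od Ev where "Od = infsum f {k. odd k}" and "Ev = infsum f {k. even k \<and> k \<ge> 1}"
  have Od: "(f has_sum Od) {k. odd k}" unfolding Od_def
    by (rule has_sum_infsum[OF summable_on_subset[OF has_sum_imp_summable[OF G]]]) (auto elim: oddE)
  have Ev: "(f has_sum Ev) {k. even k \<and> k \<ge> 1}" unfolding Ev_def
    by (rule has_sum_infsum[OF summable_on_subset[OF has_sum_imp_summable[OF G]]]) auto
  have "(f has_sum (Od + Ev)) ({k. odd k} \<union> {k. even k \<and> k \<ge> 1})"
    by (intro has_sum_Un_disjoint Od Ev) auto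
  also have "{k. odd k} \<union> {k. even k \<and> k \<ge> 1} = {1::nat..}" by (auto elim: oddE)
  finally have GOE: "G = Od + Ev" using has_sum_unique[OF G] by simp
  have Y: "divval 0 4 z - of_real pi ^ 2 = 2 * (4 * Ev - G)"
  proof -
    have *: "((\<lambda>m::nat. csc2 ((of_int 0 * z + of_int 4) / 8 + of_nat m * z) + csc2 (- ((of_int 0 * z + of_int 4) / 8) + of_nat m * z)) has_sum
            (divval 0 4 z - csc2 ((of_int 0 * z + of_int 4) / 8))) {1..}"
      unfolding divval_def by (intro wsum_has_sum_nat z off_lattice_divval) auto
    have t: "csc2 ((of_int 0 * z + of_int 4) / 8 + of_nat m * z) + csc2 (- ((of_int 0 * z + of_int 4) / 8) + of_nat m * z) =
          2 * (4 * f (2 * m) + - f m)" if "m \<in> {1..}" for m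
    proof -
      have "csc2 (- (1 / 2) + of_nat m * z) = csc2 (1 / 2 + of_nat m * z)"
        using csc2_plus_1[of "- (1 / 2) + of_nat m * z"] by (simp add: algebra_simps)
      moreover have "csc2 (1 / 2 + of_nat m * z) = 4 * f (2 * m) - f m"
        using csc2_duplication[of "of_nat m * z"] that z by (simp add: f_def algebra_simps)
      ultimately show ?thesis by simp
    qed
    have "(f has_sum Ev) {k. even k \<and> k \<ge> 1} \<longleftrightarrow> ((\<lambda>m. f (2 * m)) has_sum Ev) {1..}"
      by (rule has_sum_reindex_bij_witness[of _ "\<lambda>m. 2 * m" "\<lambda>k. k div 2"]) auto
    with Ev have "((\<lambda>m. 2 * (4 * f (2 * m) + - f m)) has_sum 2 * (4 * Ev + - G)) {1..}"
      by (intro has_sum_cmult_right has_sum_add has_sum_uminusI G) auto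
    also have "?this \<longleftrightarrow> ((\<lambda>m::nat. csc2 ((of_int 0 * z + of_int 4) / 8 + of_nat m * z) + csc2 (- ((of_int 0 * z + of_int 4) / 8) + of_nat m * z)) has_sum 2 * (4 * Ev + - G)) {1..}"
      by (rule has_sum_cong) (simp only: t)
    finally have "divval 0 4 z - csc2 ((of_int 0 * z + of_int 4) / 8) = 2 * (4 * Ev + - G)"
      by (rule has_sum_unique[OF *])
    moreover have "csc2 ((of_int 0 * z + of_int 4) / 8) = of_real pi ^ 2"
    proof -
      have "sin (complex_of_real pi / 2) = 1" using sin_of_real[of "pi / 2"] by simp
      thus ?thesis by (simp add: csc2_def)
    qed
    ultimately show ?thesis by simp
  qed
  have X: "divval 4 0 z + divval 4 4 z = 8 * Od"
  proof -
    define h where "h = (\<lambda>m::int. 4 * csc2 (of_int (2 * m + 1) * z))"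
    have "((\<lambda>m::int. csc2 ((of_int 4 * z + of_int 0) / 8 + of_int m * z) + csc2 ((of_int 4 * z + of_int 4) / 8 + of_int m * z))
             has_sum (divval 4 0 z + divval 4 4 z)) UNIV"
      unfolding divval_def by (intro has_sum_add wsum_has_sum z off_lattice_divval) auto
    also have "(\<lambda>m::int. csc2 ((of_int 4 * z + of_int 0) / 8 + of_int m * z) + csc2 ((of_int 4 * z + of_int 4) / 8 + of_int m * z)) = h"
    proof
      fix m :: int
      have "2 * ((of_int 4 * z + of_int 0) / 8 + of_int m * z) = of_int (2 * m + 1) * z"
           "(of_int 4 * z + of_int 4) / 8 + of_int m * z = (of_int 4 * z + of_int 0) / 8 + of_int m * z + 1 / 2"
        by (simp_all add: field_simps)
      moreover have nz: "Im ((of_int 4 * z + of_int 0) / 8 + of_int m * z) \<noteq> 0"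
      proof
        assume "Im ((of_int 4 * z + of_int 0) / 8 + of_int m * z) = 0"
        hence "(real_of_int (2 * m + 1)) * Im z = 0" by (simp add: field_simps)
        hence "2 * m + 1 = 0" using z by (simp only: mult_eq_0_iff of_int_eq_0_iff) auto
        thus False by presburger
      qed
      ultimately show "csc2 ((of_int 4 * z + of_int 0) / 8 + of_int m * z) + csc2 ((of_int 4 * z + of_int 4) / 8 + of_int m * z) = h m"
        using csc2_duplication[OF nz] by (simp only: h_def)
    qed
    finally have H: "(h has_sum (divval 4 0 z + divval 4 4 z)) UNIV" .
    have Od4: "((\<lambda>k. 4 * f k) has_sum 4 * Od) {k. odd k}" by (rule has_sum_cmult_right[OF Od])
    have "((\<lambda>k. 4 * f k) has_sum 4 * Od) {k. odd k} \<longleftrightarrow> (h has_sum 4 * Od) {0..}"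
    proof (rule has_sum_reindex_bij_witness[of _ "\<lambda>m. nat (2 * m + 1)" "\<lambda>k. int k div 2"])
      fix k :: nat assume "k \<in> {k. odd k}"
      then obtain j where k: "k = 2 * j + 1" by (auto elim: oddE)
      have "of_int (2 * (int k div 2) + 1) * z = of_nat k * z" by (simp add: k algebra_simps)
      thus "h (int k div 2) = 4 * f k" by (simp only: h_def f_def)
    qed (auto elim!: oddE simp: even_nat_iff)
    moreover have "((\<lambda>k. 4 * f k) has_sum 4 * Od) {k. odd k} \<longleftrightarrow> (h has_sum 4 * Od) {..<0}"
    proof (rule has_sum_reindex_bij_witness[of _ "\<lambda>m. nat (- 2 * m - 1)" "\<lambda>k. - (int k div 2) - 1"])
      fix k :: nat assume "k \<in> {k. odd k}"
      then obtain j where k: "k = 2 * j + 1" by (auto elim: oddE)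
      have "of_int (2 * (- (int k div 2) - 1) + 1) * z = - (of_nat k * z)" by (simp add: k algebra_simps)
      thus "h (- (int k div 2) - 1) = 4 * f k" by (simp only: h_def f_def csc2_minus)
    qed (auto elim!: oddE simp: even_nat_iff)
    ultimately have "(h has_sum (4 * Od + 4 * Od)) ({0..} \<union> {..<0})"
      using Od4 by (intro has_sum_Un_disjoint) auto
    moreover have "{0..} \<union> {..<0} = (UNIV :: int set)" by auto
    ultimately show ?thesis using has_sum_unique[OF H, of "4 * Od + 4 * Od"] by simp
  qed
  have "divval 0 4 z + divval 4 0 z + divval 4 4 z = of_real pi ^ 2 + 6 * G"
    using X Y GOE by (simp add: algebra_simps)
  thus ?thesis by (simp add: E2_def G_def field_simps)
qed

section \<open>The Dedekind eta function\<close>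

definition euler_prod :: "complex \<Rightarrow> complex"
  where "euler_prod q = (\<Prod>n. 1 - q ^ Suc n)"

lemma convergent_euler_prod:
  fixes q :: complex
  assumes "norm q < 1"
  shows "convergent_prod (\<lambda>n. 1 - q ^ Suc n)"
proof (rule abs_convergent_prod_imp_convergent_prod, rule summable_imp_abs_convergent_prod)
  have "summable (\<lambda>n. norm q ^ Suc n)"
    using assms by (subst summable_Suc_iff) (simp add: summable_geometric)
  thus "summable (\<lambda>n. norm (1 - q ^ Suc n - 1))" by (simp add: norm_power norm_mult)
qed

lemma euler_factor_nonzero:
  fixes q :: complex
  assumes "norm q < 1"
  shows "1 - q ^ Suc n \<noteq> 0"
proof
  assume "1 - q ^ Suc n = 0"
  hence "norm (q ^ Suc n) = 1" by (metis norm_one right_minus_eq)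
  moreover have "norm (q ^ Suc n) < 1" using assms by (simp only: norm_power power_less_one_iff norm_ge_zero) simp
  ultimately show False by simp
qed

lemma euler_prod_nonzero: "norm q < 1 \<Longrightarrow> euler_prod q \<noteq> 0"
  unfolding euler_prod_def by (intro prodinf_nonzero convergent_euler_prod euler_factor_nonzero) auto

lemma euler_prod_LIMSEQ:
  assumes "norm q < 1"
  shows "(\<lambda>N. \<Prod>n<N. 1 - q ^ Suc n) \<longlonglongrightarrow> euler_prod q"
proof -
  have "(\<lambda>N. \<Prod>n\<le>N. 1 - q ^ Suc n) \<longlonglongrightarrow> euler_prod q"
    unfolding euler_prod_def by (rule convergent_prod_LIMSEQ[OF convergent_euler_prod[OF assms]])
  thus ?thesis by (subst (asm) lessThan_Suc_atMost[symmetric]) (subst (asm) filterlim_sequentially_Suc)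
qed

lemma euler_prod_uniform_limit:
  assumes "r < 1"
  shows "uniform_limit (cball 0 r) (\<lambda>N q. \<Prod>n<N. 1 - q ^ Suc n) euler_prod sequentially"
proof -
  have "uniformly_convergent_on (cball 0 r) (\<lambda>N q. \<Prod>n<N. 1 - q ^ Suc n :: complex)"
  proof (rule uniformly_convergent_on_prod')
    show "uniformly_convergent_on (cball 0 r) (\<lambda>N q::complex. \<Sum>n<N. norm (1 - q ^ Suc n - 1))"
    proof (rule Weierstrass_m_test')
      fix n and q :: complex assume q: "q \<in> cball 0 r"
      thus "norm (norm (1 - q ^ Suc n - 1)) \<le> max 0 r ^ Suc n"
        using power_mono[of "norm q" "max 0 r" "Suc n"] by (simp add: norm_power norm_mult)
    next
      show "summable (\<lambda>n. max 0 r ^ Suc n)"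
        using assms by (subst summable_Suc_iff) (simp add: summable_geometric)
    qed
  qed (auto intro!: continuous_intros)
  then obtain l where l: "uniform_limit (cball 0 r) (\<lambda>N q. \<Prod>n<N. 1 - q ^ Suc n :: complex) l sequentially"
    unfolding uniformly_convergent_on_def by blast
  have "l q = euler_prod q" if "q \<in> cball 0 r" for q
  proof -
    have "(\<lambda>N. \<Prod>n<N. 1 - q ^ Suc n) \<longlonglongrightarrow> l q" by (rule tendsto_uniform_limitI[OF l that])
    moreover have "(\<lambda>N. \<Prod>n<N. 1 - q ^ Suc n) \<longlonglongrightarrow> euler_prod q"
      using that assms by (intro euler_prod_LIMSEQ) auto
    ultimately show ?thesis by (rule LIMSEQ_unique)
  qed
  thus ?thesis using l by (subst (asm) uniform_limit_cong'[of _ _ _ l euler_prod]) auto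
qed

lemma euler_prod_holomorphic: "euler_prod holomorphic_on ball 0 1"
proof (rule holomorphic_uniform_sequence[where f = "\<lambda>N q. \<Prod>n<N. 1 - q ^ Suc n"])
  fix x :: complex assume x: "x \<in> ball 0 1"
  define d where "d = (1 - norm x) / 2"
  have sub: "cball x d \<subseteq> cball 0 ((1 + norm x) / 2)"
  proof
    fix y assume "y \<in> cball x d"
    hence "dist 0 y \<le> norm x + d" using dist_triangle[of 0 y x] by simp
    thus "y \<in> cball 0 ((1 + norm x) / 2)" by (simp add: d_def field_simps)
  qed
  moreover have "cball 0 ((1 + norm x) / 2) \<subseteq> (ball 0 1 :: complex set)" using x by auto
  moreover have "uniform_limit (cball x d) (\<lambda>N q. \<Prod>n<N. 1 - q ^ Suc n) euler_prod sequentially"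
    by (rule uniform_limit_on_subset[OF euler_prod_uniform_limit sub]) (use x in auto)
  ultimately show "\<exists>d>0. cball x d \<subseteq> ball 0 1 \<and> uniform_limit (cball x d) (\<lambda>N q. \<Prod>n<N. 1 - q ^ Suc n) euler_prod sequentially"
    using x by (intro exI[of _ d]) (auto simp: d_def)
qed (auto intro!: holomorphic_intros)

text \<open>Logarithmic differentiation is legitimate because the partial products converge locally uniformly.\<close>

lemma euler_prod_logderiv:
  assumes "norm q < 1"
  shows "(\<lambda>n. - of_nat (Suc n) * q ^ n / (1 - q ^ Suc n)) sums (deriv euler_prod q / euler_prod q)"
proof -
  define r where "r = (1 + norm q) / 2"
  have r: "norm q < r" "r < 1" using assms by (auto simp: r_def)
  have "(\<lambda>n. deriv (\<lambda>q. 1 - q ^ Suc n) q / (1 - q ^ Suc n)) sums (deriv euler_prod q / euler_prod q)"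
  proof (rule logderiv_prodinf_complex_uniform_limit[where A = "ball 0 r"])
    show "uniform_limit (ball 0 r) (\<lambda>n x. \<Prod>k<n. 1 - x ^ Suc k) euler_prod sequentially"
      by (rule uniform_limit_on_subset[OF euler_prod_uniform_limit[OF r(2)]]) auto
  qed (use r euler_prod_nonzero[OF assms] in \<open>auto intro!: holomorphic_intros\<close>)
  moreover have "deriv (\<lambda>q. 1 - q ^ Suc n) q = - of_nat (Suc n) * q ^ n" for n
    by (rule DERIV_imp_deriv) (auto intro!: derivative_eq_intros simp del: power_Suc of_nat_Suc)
  ultimately show ?thesis by (simp only:)
qed

lemma dedekind_eta_eq: "dedekind_eta z = exp (of_real pi * \<i> * z / 12) * euler_prod (qexp z)"
proof -
  have "exp (2 * of_real pi * \<i> * of_nat (Suc n) * z) = qexp z ^ Suc n" for n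
    unfolding qexp_of_nat_mult[symmetric] by (simp add: qexp_def mult_ac)
  thus ?thesis by (simp only: dedekind_eta_def euler_prod_def)
qed

lemma dedekind_eta_nonzero: "Im z > 0 \<Longrightarrow> dedekind_eta z \<noteq> 0"
  by (simp add: dedekind_eta_eq euler_prod_nonzero norm_qexp_less_1)

lemma has_field_derivative_qexp [derivative_intros]:
  "(f has_field_derivative f') (at x within A) \<Longrightarrow>
   ((\<lambda>x. qexp (f x)) has_field_derivative 2 * of_real pi * \<i> * f' * qexp (f x)) (at x within A)"
  unfolding qexp_def by (auto intro!: derivative_eq_intros)

text \<open>The factor \<open>exp (\<pi>iz/12)\<close> contributes the constant term of \<open>E2\<close>, and the product contributes its Lambert
  series, in the form that is summed over rows.\<close>

theorem has_field_derivative_dedekind_eta: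
  assumes z: "Im z > 0"
  shows "(dedekind_eta has_field_derivative (of_real pi * \<i> / 12 * E2 z * dedekind_eta z)) (at z)"
proof -
  define q where "q = qexp z"
  have q: "norm q < 1" using norm_qexp_less_1[OF z] by (simp add: q_def)
  define L where "L = lambert of_nat one_pos q"
  have "((\<lambda>k. of_nat k * (q ^ k / (1 - q ^ k))) has_sum lambert one_pos of_nat q) {1..}"
  proof (rule lambert_has_sum_rows)
    fix k :: nat assume k: "k \<ge> 1"
    have "norm (q ^ k) < 1" using q k by (simp add: norm_power power_less_one_iff)
    hence "((\<lambda>m. (q ^ k) ^ m) has_sum q ^ k / (1 - q ^ k)) {1..}"
      by (rule has_sum_geometric_from_1)
    also have "?this \<longleftrightarrow> ((\<lambda>m. one_pos m * (q ^ k) ^ m) has_sum q ^ k / (1 - q ^ k)) {1..}"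
      by (intro has_sum_cong) (auto simp: one_pos_def)
    finally show "((\<lambda>m. one_pos m * (q ^ k) ^ m) has_sum q ^ k / (1 - q ^ k)) {1..}" .
  qed (use q in \<open>auto simp: one_pos_def\<close>)
  hence "(\<lambda>n. of_nat (Suc n) * (q ^ Suc n / (1 - q ^ Suc n))) sums L"
    unfolding L_def lambert_commute[of one_pos] by (rule has_sum_imp_sums_Suc)
  moreover have "(\<lambda>n. - q * (- of_nat (Suc n) * q ^ n / (1 - q ^ Suc n))) sums (- q * (deriv euler_prod q / euler_prod q))"
    by (rule sums_mult[OF euler_prod_logderiv[OF q]])
  moreover have "- q * (- of_nat (Suc n) * q ^ n / (1 - q ^ Suc n)) = of_nat (Suc n) * (q ^ Suc n / (1 - q ^ Suc n))" for n
    by (simp only: power_Suc) (simp del: of_nat_Suc)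
  ultimately have "L = - q * (deriv euler_prod q / euler_prod q)"
    by (simp only: sums_iff)
  hence D: "q * deriv euler_prod q = - L * euler_prod q"
    using euler_prod_nonzero[OF q] by (simp add: field_simps)
  have dP: "(euler_prod has_field_derivative deriv euler_prod q) (at q)"
    using q by (intro holomorphic_derivI[OF euler_prod_holomorphic]) auto
  have dC: "((\<lambda>z. euler_prod (qexp z)) has_field_derivative (deriv euler_prod q * (2 * of_real pi * \<i> * 1 * q))) (at z)"
    unfolding q_def
    by (rule DERIV_chain2[where f = euler_prod and g = qexp, OF dP[unfolded q_def]]) (auto intro!: derivative_eq_intros)
  have dE: "((\<lambda>z. exp (of_real pi * \<i> * z / 12)) has_field_derivative of_real pi * \<i> / 12 * exp (of_real pi * \<i> * z / 12)) (at z)"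
    by (auto intro!: derivative_eq_intros)
  have "((\<lambda>z. exp (of_real pi * \<i> * z / 12) * euler_prod (qexp z)) has_field_derivative
           (of_real pi * \<i> / 12 * exp (of_real pi * \<i> * z / 12)) * euler_prod q +
            (deriv euler_prod q * (2 * of_real pi * \<i> * 1 * q)) * exp (of_real pi * \<i> * z / 12)) (at z)"
    using DERIV_mult[OF dE dC] by (simp add: q_def)
  also have "(of_real pi * \<i> / 12 * exp (of_real pi * \<i> * z / 12)) * euler_prod q +
            (deriv euler_prod q * (2 * of_real pi * \<i> * 1 * q)) * exp (of_real pi * \<i> * z / 12) =
       (of_real pi * \<i> / 12 * exp (of_real pi * \<i> * z / 12)) * euler_prod q +
        2 * of_real pi * \<i> * exp (of_real pi * \<i> * z / 12) * (q * deriv euler_prod q)"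
    by (simp add: mult_ac)
  also have "\<dots> = of_real pi * \<i> / 12 * E2 z * dedekind_eta z"
    unfolding D E2_eq_lambert[OF z] dedekind_eta_eq q_def[symmetric] L_def[symmetric]
    by (simp add: field_simps)
  finally show ?thesis by (simp only: dedekind_eta_eq[abs_def])
qed

lemma divval_parity:
  "divval (4 * x) (4 * y) z = divval (if even x then 0 else 4) (if even y then 0 else 4) z"
proof (rule divval_cong)
  have "[4 * x = (if even x then 0 else 4)] (mod 8)" for x :: int
    by (auto simp: cong_def elim!: evenE oddE)
  thus "[4 * x = (if even x then 0 else 4)] (mod 8)" "[4 * y = (if even y then 0 else 4)] (mod 8)" by auto
qed

theorem E2_mob:
  assumes "(a, b, c, d) \<in> SL2Z" "Im z > 0"
  shows "E2 (mob (a, b, c, d) z) =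
           (of_int c * z + of_int d)\<^sup>2 * E2 z - 6 * \<i> / of_real pi * of_int c * (of_int c * z + of_int d)"
proof -
  define w where "w = of_int c * z + of_int d"
  have n: "\<not> (8 dvd (0::int) \<and> 8 dvd (4::int))" "\<not> (8 dvd (4::int) \<and> 8 dvd (0::int))" "\<not> (8 dvd (4::int) \<and> 8 dvd (4::int))"
    by simp_all
  have "E2 (mob (a, b, c, d) z) = (w\<^sup>2 * (divval (4 * c) (4 * d) z + divval (4 * a) (4 * b) z + divval (4 * (a + c)) (4 * (b + d)) z)
           - 6 * of_real pi * \<i> * of_int c * w) / of_real pi ^ 2"
    unfolding E2_def divval_mob[OF assms n(1)] divval_mob[OF assms n(2)] divval_mob[OF assms n(3)] w_def[symmetric]
    by (simp add: algebra_simps)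
  also have "divval (4 * c) (4 * d) z + divval (4 * a) (4 * b) z + divval (4 * (a + c)) (4 * (b + d)) z =
        divval 0 4 z + divval 4 0 z + divval 4 4 z"
  proof -
    have "odd (a * d - b * c)" using assms(1) by (simp add: SL2Z_iff)
    thus ?thesis unfolding divval_parity
      by (cases "even a"; cases "even b"; cases "even c"; cases "even d") simp_all
  qed
  also have "(w\<^sup>2 * X - 6 * of_real pi * \<i> * of_int c * w) / of_real pi ^ 2 =
               w\<^sup>2 * (X / of_real pi ^ 2) - 6 * \<i> / of_real pi * of_int c * w" for X
    by (simp add: field_simps power2_eq_square)
  finally show ?thesis by (simp only: E2_def w_def)
qed

lemma dedekind_eta_plus_1: "dedekind_eta (z + 1) = exp (of_real pi * \<i> / 12) * dedekind_eta z"
  by (simp add: dedekind_eta_eq qexp_plus_1 ring_distribs add_divide_distrib exp_add)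

text \<open>Both sides have the same logarithmic derivative, by the transformation law of \<open>E2\<close>, and they agree at the
  fixed point \<open>\<i>\<close>.\<close>

theorem dedekind_eta_S:
  assumes z: "Im z > 0"
  shows "dedekind_eta (- 1 / z) = csqrt (- \<i> * z) * dedekind_eta z"
proof -
  define H where "H = {z. Im z > 0}"
  have conv: "convex H" unfolding H_def by (rule convex_halfspace_Im_gt)
  define F where "F = (\<lambda>z. dedekind_eta (- 1 / z) / (csqrt (- \<i> * z) * dedekind_eta z))"
  have "(F has_field_derivative 0) (at z within H)" if "z \<in> H" for z
  proof -
    have z: "Im z > 0" using that by (simp add: H_def)
    have z0: "z \<noteq> 0" using z by auto
    have sq: "- \<i> * z \<notin> \<real>\<^sub>\<le>\<^sub>0" using z by (auto simp: complex_nonpos_Reals_iff)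
    define s where "s = csqrt (- \<i> * z)"
    have ss: "s * s = - \<i> * z" unfolding s_def by (metis power2_csqrt power2_eq_square)
    have s0: "s \<noteq> 0" using ss z0 by auto
    define k where "k = of_real pi * \<i> / (12 :: complex)"
    have e0: "dedekind_eta z \<noteq> 0" by (rule dedekind_eta_nonzero[OF z])
    have d1: "((\<lambda>z. dedekind_eta (- 1 / z)) has_field_derivative (k * E2 (- 1 / z) * dedekind_eta (- 1 / z)) * (1 / z\<^sup>2)) (at z within H)"
      unfolding k_def
      by (rule DERIV_chain2[where f = dedekind_eta and g = "\<lambda>z. - 1 / z", OF has_field_derivative_dedekind_eta[OF Im_neg_inverse[OF z]]])
         (use z0 in \<open>auto intro!: derivative_eq_intros simp: power2_eq_square\<close>)
    have d2: "((\<lambda>z. csqrt (- \<i> * z)) has_field_derivative - \<i> / (2 * s)) (at z within H)"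
      unfolding s_def by (rule has_field_derivative_csqrt') (use sq in \<open>auto intro!: derivative_eq_intros\<close>)
    have d3: "(dedekind_eta has_field_derivative k * E2 z * dedekind_eta z) (at z within H)"
      unfolding k_def using has_field_derivative_dedekind_eta[OF z] by (rule has_field_derivative_at_within)
    have E: "E2 (- 1 / z) = z\<^sup>2 * E2 z - 6 * \<i> / of_real pi * z"
      using E2_mob[of 0 "-1" 1 0 z] z by (simp add: SL2Z_iff mob_def)
    have kE: "k * E2 (- 1 / z) * (1 / z\<^sup>2) = k * E2 z + 1 / (2 * z)"
      unfolding E k_def using z0 by (simp add: field_simps power2_eq_square)
    have "(F has_field_derivative
        ((k * E2 (- 1 / z) * dedekind_eta (- 1 / z)) * (1 / z\<^sup>2) * (s * dedekind_eta z) -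
          dedekind_eta (- 1 / z) * (- \<i> / (2 * s) * dedekind_eta z + k * E2 z * dedekind_eta z * s)) /
        ((s * dedekind_eta z) * (s * dedekind_eta z))) (at z within H)"
      unfolding F_def s_def
      by (rule DERIV_divide DERIV_mult d1 d2[unfolded s_def] d3)+ (use s0 e0 in \<open>auto simp: s_def\<close>)
    moreover have "(k * E2 (- 1 / z) * dedekind_eta (- 1 / z)) * (1 / z\<^sup>2) * (s * dedekind_eta z) -
          dedekind_eta (- 1 / z) * (- \<i> / (2 * s) * dedekind_eta z + k * E2 z * dedekind_eta z * s) = 0"
    proof -
      have "- \<i> / (2 * s) = s / (2 * z)" using ss s0 z0 by (simp add: field_simps)
      hence "(k * E2 (- 1 / z) * dedekind_eta (- 1 / z)) * (1 / z\<^sup>2) * (s * dedekind_eta z) -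
          dedekind_eta (- 1 / z) * (- \<i> / (2 * s) * dedekind_eta z + k * E2 z * dedekind_eta z * s) =
        dedekind_eta (- 1 / z) * s * dedekind_eta z * ((k * E2 (- 1 / z) * (1 / z\<^sup>2)) - (1 / (2 * z) + k * E2 z))"
        by (simp only:) (simp add: algebra_simps)
      thus ?thesis unfolding kE by simp
    qed
    ultimately show ?thesis by simp
  qed
  from has_field_derivative_zero_constant[OF conv this] obtain C where C: "\<And>z. z \<in> H \<Longrightarrow> F z = C" by blast
  have "F \<i> = 1" by (simp add: F_def dedekind_eta_nonzero)
  hence "F z = 1" using C[of \<i>] C[of z] z by (simp add: H_def)
  thus ?thesis unfolding F_def by (simp add: divide_eq_1_iff)
qed

text \<open>Taking absolute values removes the multiplier system of 24th roots of unity.\<close>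

lemma norm_dedekind_eta_mob:
  assumes "\<gamma> \<in> SL2Z" "Im z > 0"
  shows "norm (dedekind_eta (mob \<gamma> z)) ^ 2 = norm (aut \<gamma> z) * norm (dedekind_eta z) ^ 2"
proof -
  have T: "norm (dedekind_eta (z + 1)) = norm (dedekind_eta z)" for z
    by (simp add: dedekind_eta_plus_1 norm_mult)
  obtain a b c d where \<gamma>: "\<gamma> = (a, b, c, d)" by (cases \<gamma>)
  have "norm (dedekind_eta (mob (a, b, c, d) z)) ^ 2 = norm (aut (a, b, c, d) z) * norm (dedekind_eta z) ^ 2"
    using assms[unfolded \<gamma>]
  proof (induction arbitrary: z rule: SL2Z_induct)
    case one thus ?case by (simp add: mob_def aut_def)
  next
    case (T a b c d)
    have "mob (a, a + b, c, c + d) z = mob (a, b, c, d) (z + 1)" "aut (a, a + b, c, c + d) z = aut (a, b, c, d) (z + 1)"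
      by (simp_all add: mob_def aut_def algebra_simps)
    thus ?case using T.IH[of "z + 1"] T.prems \<open>\<And>z. norm (dedekind_eta (z + 1)) = norm (dedekind_eta z)\<close> by simp
  next
    case (T_inv a b c d)
    have "mob (a, b - a, c, d - c) z = mob (a, b, c, d) (z - 1)" "aut (a, b - a, c, d - c) z = aut (a, b, c, d) (z - 1)"
      by (simp_all add: mob_def aut_def algebra_simps)
    moreover have "norm (dedekind_eta (z - 1)) = norm (dedekind_eta z)"
      using \<open>\<And>z. norm (dedekind_eta (z + 1)) = norm (dedekind_eta z)\<close>[of "z - 1"] by simp
    ultimately show ?case using T_inv.IH[of "z - 1"] T_inv.prems by simp
  next
    case (S a b c d)
    have z0: "z \<noteq> 0" using S.prems by auto
    have 1: "aut (b, - a, d, - c) z = z * aut (a, b, c, d) (- 1 / z)"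
      using z0 by (simp add: aut_def field_simps)
    have "mob (b, - a, d, - c) z = ((of_int b * z + of_int (- a)) / z) / ((of_int d * z + of_int (- c)) / z)"
      using z0 by (simp add: mob_def)
    also have "(of_int b * z + of_int (- a)) / z = of_int a * (- 1 / z) + of_int b" using z0 by (simp add: field_simps)
    also have "(of_int d * z + of_int (- c)) / z = of_int c * (- 1 / z) + of_int d" using z0 by (simp add: field_simps)
    finally have 2: "mob (b, - a, d, - c) z = mob (a, b, c, d) (- 1 / z)" by (simp add: mob_def)
    have "norm (csqrt (- \<i> * z)) ^ 2 = norm z"
      by (metis norm_power power2_csqrt norm_mult norm_minus_cancel norm_ii mult_1)
    thus ?case unfolding 1 2 S.IH[OF Im_neg_inverse[OF S.prems]] dedekind_eta_S[OF S.prems]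
      by (simp add: norm_mult power_mult_distrib)
  qed
  thus ?thesis by (simp only: \<gamma>)
qed

section \<open>Jacobi's product for the theta series\<close>

text \<open>Gaussian binomial coefficients, by the recursion of Pascal's triangle.\<close>

fun qbinom :: "complex \<Rightarrow> nat \<Rightarrow> nat \<Rightarrow> complex" where
  "qbinom Q n 0 = 1"
| "qbinom Q 0 (Suc k) = 0"
| "qbinom Q (Suc n) (Suc k) = qbinom Q n (Suc k) + Q ^ (n - k) * qbinom Q n k"

lemma qbinom_eq_0: "n < k \<Longrightarrow> qbinom Q n k = 0"
  by (induction Q n k rule: qbinom.induct) auto

lemma q_binomial_theorem:
  "(\<Prod>k<N. 1 + x * p ^ (2 * k)) = (\<Sum>j\<le>N. p ^ (j * (j - 1)) * qbinom (p\<^sup>2) N j * x ^ j)"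
proof (induction N)
  case (Suc N)
  have gen: "A * (b1 + B * b0) * (x * y) = A * b1 * (x * y) + x * C * (D * b0 * y)" if "A * B = C * D" for A B C D b0 b1 x y :: complex
  proof -
    have "A * (b1 + B * b0) * (x * y) = A * b1 * (x * y) + (A * B) * (b0 * x * y)" by (simp add: algebra_simps)
    thus ?thesis unfolding that by (simp add: mult_ac)
  qed
  have "(\<Sum>j\<le>Suc N. p ^ (j * (j - 1)) * qbinom (p\<^sup>2) (Suc N) j * x ^ j) =
        1 + (\<Sum>j\<le>N. p ^ (Suc j * j) * qbinom (p\<^sup>2) (Suc N) (Suc j) * x ^ Suc j)"
    by (subst sum.atMost_Suc_shift) simp
  also have "(\<Sum>j\<le>N. p ^ (Suc j * j) * qbinom (p\<^sup>2) (Suc N) (Suc j) * x ^ Suc j) =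
        (\<Sum>j\<le>N. p ^ (Suc j * j) * qbinom (p\<^sup>2) N (Suc j) * x ^ Suc j) +
        (\<Sum>j\<le>N. x * p ^ (2 * N) * (p ^ (j * (j - 1)) * qbinom (p\<^sup>2) N j * x ^ j))"
    unfolding sum.distrib[symmetric]
  proof (rule sum.cong)
    fix j assume "j \<in> {..N}"
    hence "Suc j * j + 2 * (N - j) = 2 * N + j * (j - 1)" by (cases j) (auto simp: algebra_simps)
    hence "p ^ (Suc j * j) * (p\<^sup>2) ^ (N - j) = p ^ (2 * N) * p ^ (j * (j - 1))"
      by (simp only: power_mult[symmetric] power_add[symmetric])
    thus "p ^ (Suc j * j) * qbinom (p\<^sup>2) (Suc N) (Suc j) * x ^ Suc j =
       p ^ (Suc j * j) * qbinom (p\<^sup>2) N (Suc j) * x ^ Suc j + x * p ^ (2 * N) * (p ^ (j * (j - 1)) * qbinom (p\<^sup>2) N j * x ^ j)"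
      using gen[of "p ^ (Suc j * j)" "(p\<^sup>2) ^ (N - j)" "p ^ (2 * N)" "p ^ (j * (j - 1))" "qbinom (p\<^sup>2) N (Suc j)" "qbinom (p\<^sup>2) N j" x "x ^ j"]
      by (simp only: qbinom.simps power_Suc)
  qed simp
  also have "1 + ((\<Sum>j\<le>N. p ^ (Suc j * j) * qbinom (p\<^sup>2) N (Suc j) * x ^ Suc j) + (\<Sum>j\<le>N. x * p ^ (2 * N) * (p ^ (j * (j - 1)) * qbinom (p\<^sup>2) N j * x ^ j))) =
        (\<Sum>j\<le>Suc N. p ^ (j * (j - 1)) * qbinom (p\<^sup>2) N j * x ^ j) + x * p ^ (2 * N) * (\<Sum>j\<le>N. p ^ (j * (j - 1)) * qbinom (p\<^sup>2) N j * x ^ j)"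
    by (subst sum.atMost_Suc_shift) (simp add: sum_distrib_left)
  also have "(\<Sum>j\<le>Suc N. p ^ (j * (j - 1)) * qbinom (p\<^sup>2) N j * x ^ j) = (\<Sum>j\<le>N. p ^ (j * (j - 1)) * qbinom (p\<^sup>2) N j * x ^ j)"
    by (simp add: qbinom_eq_0)
  finally show ?case using Suc.IH by (simp add: algebra_simps)
qed simp

definition qpoch :: "complex \<Rightarrow> nat \<Rightarrow> complex" where "qpoch Q n = (\<Prod>k<n. 1 - Q ^ Suc k)"

lemma qpoch_Suc: "qpoch Q (Suc n) = qpoch Q n * (1 - Q ^ Suc n)"
  by (simp add: qpoch_def)

lemma qpoch_0 [simp]: "qpoch Q 0 = 1"
  by (simp add: qpoch_def)

lemma qbinom_closed_form: "k \<le> n \<Longrightarrow> qbinom Q n k * qpoch Q k * qpoch Q (n - k) = qpoch Q n"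
proof (induction n arbitrary: k)
  case (Suc n)
  show ?case
  proof (cases k)
    case (Suc j)
    show ?thesis
    proof (cases "k = Suc n")
      case True
      hence "j = n" using Suc by simp
      hence "qbinom Q (Suc n) k * qpoch Q k * qpoch Q (Suc n - k) = (qbinom Q n n * qpoch Q n) * (1 - Q ^ Suc n)"
        using True by (simp add: qbinom_eq_0 qpoch_Suc mult_ac)
      also have "qbinom Q n n * qpoch Q n = qpoch Q n" using Suc.IH[of n] by simp
      finally show ?thesis by (simp add: qpoch_Suc)
    next
      case False
      hence k: "Suc j \<le> n" "j \<le> n" using Suc.prems Suc by auto
      define m where "m = n - Suc j"
      have n: "n - j = Suc m" "Suc n - k = Suc m" "n - Suc j = m" "n = Suc j + m" using k Suc by (auto simp: m_def)
      have 1: "qbinom Q n (Suc j) * qpoch Q (Suc j) * qpoch Q m = qpoch Q n"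
        using Suc.IH[OF k(1)] n by simp
      have 2: "qbinom Q n j * qpoch Q j * qpoch Q (Suc m) = qpoch Q n"
        using Suc.IH[OF k(2)] n by simp
      have "qbinom Q (Suc n) k * qpoch Q k * qpoch Q (Suc n - k) =
            (qbinom Q n (Suc j) * qpoch Q (Suc j) * qpoch Q m) * (1 - Q ^ Suc m) +
            Q ^ Suc m * (qbinom Q n j * qpoch Q j * qpoch Q (Suc m)) * (1 - Q ^ Suc j)"
        by (simp add: Suc n(1) n(3) qpoch_Suc[of Q m] qpoch_Suc[of Q j] algebra_simps)
      also have "\<dots> = qpoch Q n * ((1 - Q ^ Suc m) + Q ^ Suc m * (1 - Q ^ Suc j))"
        unfolding 1 2 by (simp add: algebra_simps)
      also have "(1 - Q ^ Suc m) + Q ^ Suc m * (1 - Q ^ Suc j) = 1 - Q ^ Suc n"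
        by (simp add: n(4) power_add algebra_simps)
      finally show ?thesis by (simp add: qpoch_Suc)
    qed
  qed simp
qed simp

lemma qpoch_LIMSEQ: "norm Q < 1 \<Longrightarrow> qpoch Q \<longlonglongrightarrow> euler_prod Q"
  using euler_prod_LIMSEQ[of Q] by (simp add: qpoch_def[abs_def])

lemma qpoch_nonzero: "norm Q < 1 \<Longrightarrow> qpoch Q n \<noteq> 0"
  unfolding qpoch_def using euler_factor_nonzero by (auto simp del: power_Suc)

lemma qbinom_central:
  assumes "norm Q < 1" "i \<le> n"
  shows "qbinom Q (2 * n) (n + i) = qpoch Q (2 * n) / (qpoch Q (n + i) * qpoch Q (n - i))"
        "qbinom Q (2 * n) (n - i) = qpoch Q (2 * n) / (qpoch Q (n + i) * qpoch Q (n - i))"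
proof -
  have "2 * n - (n + i) = n - i" "2 * n - (n - i) = n + i" using assms(2) by auto
  thus "qbinom Q (2 * n) (n + i) = qpoch Q (2 * n) / (qpoch Q (n + i) * qpoch Q (n - i))"
       "qbinom Q (2 * n) (n - i) = qpoch Q (2 * n) / (qpoch Q (n + i) * qpoch Q (n - i))"
    using qbinom_closed_form[of "n + i" "2 * n" Q] qbinom_closed_form[of "n - i" "2 * n" Q] assms
    by (auto simp: field_simps qpoch_nonzero)
qed

text \<open>A finite form of Jacobi's triple product. In the \<open>q\<close>-binomial theorem with \<open>2n\<close> factors the argument is chosen
  such that the factors pair off symmetrically, and the exponents become squares centred at \<open>n\<close>.\<close>

lemma finite_theta_product:
  assumes p: "p \<noteq> 0" and n: "n > 0"
  shows "(\<Prod>i<n. 1 + p ^ (2 * i + 1)) ^ 2 = (\<Sum>j\<le>2 * n. qbinom (p\<^sup>2) (2 * n) j * p ^ ((nat \<bar>int j - int n\<bar>)\<^sup>2))"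
proof -
  \<comment> \<open>With this argument the factors with \<open>k < n\<close> and those with \<open>k \<ge> n\<close> agree up to powers of \<open>p\<close>.\<close>
  define x where "x = p / p ^ (2 * n)"
  have low: "(\<Prod>k<n. 1 + x * p ^ (2 * k)) = (\<Prod>i<n. 1 + p ^ (2 * i + 1)) / p ^ (n\<^sup>2)"
  proof -
    have "(\<Prod>k<n. 1 + x * p ^ (2 * k)) = (\<Prod>i<n. 1 + x * p ^ (2 * (n - Suc i)))"
      by (rule prod.nat_diff_reindex[symmetric])
    also have "\<dots> = (\<Prod>i<n. (1 + p ^ (2 * i + 1)) / p ^ (2 * i + 1))"
    proof (rule prod.cong)
      fix i assume "i \<in> {..<n}"
      hence "2 * n + 1 = (2 * (n - Suc i) + 1 + 1) + (2 * i + 1)" by auto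
      hence "p ^ (2 * n + 1) = p ^ ((2 * (n - Suc i) + 1 + 1) + (2 * i + 1))" by (rule arg_cong)
      hence "p ^ (2 * n) * p = (p ^ (2 * (n - Suc i)) * p * p ^ (2 * i + 1)) * p"
        by (simp only: power_add power_one_right mult_ac)
      hence *: "p ^ (2 * n) = p ^ (2 * (n - Suc i)) * p * p ^ (2 * i + 1)"
        using p by (simp only: mult_cancel_right) simp
      have "x * p ^ (2 * (n - Suc i)) = 1 / p ^ (2 * i + 1)"
        using p by (simp only: x_def *) (simp add: field_simps)
      thus "1 + x * p ^ (2 * (n - Suc i)) = (1 + p ^ (2 * i + 1)) / p ^ (2 * i + 1)"
        using p by (simp add: field_simps)
    qed simp
    also have "\<dots> = (\<Prod>i<n. 1 + p ^ (2 * i + 1)) / (\<Prod>i<n. p ^ (2 * i + 1))"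
      by (rule prod_dividef)
    also have "(\<Prod>i<n. p ^ (2 * i + 1)) = p ^ (n\<^sup>2)"
    proof (induction n)
      case (Suc n)
      have "(Suc n)\<^sup>2 = n\<^sup>2 + (2 * n + 1)" by (simp add: power2_eq_square)
      thus ?case using Suc.IH by (simp only: prod.lessThan_Suc power_add)
    qed simp
    finally show ?thesis .
  qed
  have high: "(\<Prod>k\<in>{n..<2*n}. 1 + x * p ^ (2 * k)) = (\<Prod>i<n. 1 + p ^ (2 * i + 1))"
  proof -
    have "(\<Prod>k\<in>{n..<2*n}. 1 + x * p ^ (2 * k)) = (\<Prod>i<n. 1 + x * p ^ (2 * (i + n)))"
      using prod.shift_bounds_nat_ivl[of "\<lambda>k. 1 + x * p ^ (2 * k)" 0 n n] by (simp add: atLeast0LessThan mult_2)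
    also have "\<dots> = (\<Prod>i<n. 1 + p ^ (2 * i + 1))"
      using p by (intro prod.cong) (auto simp: x_def power_add field_simps mult_2)
    finally show ?thesis .
  qed
  have "{..<2 * n} = {..<n} \<union> {n..<2 * n}" by auto
  hence "(\<Prod>k<2 * n. 1 + x * p ^ (2 * k)) = (\<Prod>k<n. 1 + x * p ^ (2 * k)) * (\<Prod>k\<in>{n..<2*n}. 1 + x * p ^ (2 * k))"
    by (simp add: prod.union_disjoint ivl_disj_int)
  hence "(\<Prod>k<2 * n. 1 + x * p ^ (2 * k)) = (\<Prod>i<n. 1 + p ^ (2 * i + 1)) ^ 2 / p ^ (n\<^sup>2)"
    unfolding low high by (simp add: power2_eq_square)
  hence "(\<Prod>i<n. 1 + p ^ (2 * i + 1)) ^ 2 = p ^ (n\<^sup>2) * (\<Prod>k<2 * n. 1 + x * p ^ (2 * k))"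
    using p by simp
  also have "\<dots> = (\<Sum>j\<le>2 * n. p ^ (n\<^sup>2) * (p ^ (j * (j - 1)) * qbinom (p\<^sup>2) (2 * n) j * x ^ j))"
    unfolding q_binomial_theorem by (simp add: sum_distrib_left)
  also have "\<dots> = (\<Sum>j\<le>2 * n. qbinom (p\<^sup>2) (2 * n) j * p ^ ((nat \<bar>int j - int n\<bar>)\<^sup>2))"
  proof (rule sum.cong)
    fix j
    have "int (n\<^sup>2 + j * (j - 1) + j) = int ((nat \<bar>int j - int n\<bar>)\<^sup>2 + 2 * n * j)"
      by (cases j) (auto simp: power2_eq_square algebra_simps abs_if)
    hence "n\<^sup>2 + j * (j - 1) + j = (nat \<bar>int j - int n\<bar>)\<^sup>2 + 2 * n * j" by (simp only: of_nat_eq_iff)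
    hence "p ^ (n\<^sup>2) * p ^ (j * (j - 1)) * p ^ j = p ^ ((nat \<bar>int j - int n\<bar>)\<^sup>2) * (p ^ (2 * n)) ^ j"
      by (simp only: power_add[symmetric] power_mult[symmetric])
    hence "p ^ (n\<^sup>2) * p ^ (j * (j - 1)) * x ^ j = p ^ ((nat \<bar>int j - int n\<bar>)\<^sup>2)"
      using p by (simp add: x_def power_divide)
    thus "p ^ (n\<^sup>2) * (p ^ (j * (j - 1)) * qbinom (p\<^sup>2) (2 * n) j * x ^ j) = qbinom (p\<^sup>2) (2 * n) j * p ^ ((nat \<bar>int j - int n\<bar>)\<^sup>2)"
      by (metis mult.commute mult.left_commute)
  qed simp
  finally show ?thesis .
qed

lemma sum_around_middle:
  fixes g :: "nat \<Rightarrow> complex"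
  shows "(\<Sum>j\<le>2 * n. g j) = g n + (\<Sum>i<n. g (n + Suc i) + g (n - Suc i))"
proof -
  have "{..2 * n} = {..<n} \<union> {n..<Suc (2 * n)}" by auto
  hence "(\<Sum>j\<le>2 * n. g j) = (\<Sum>j<n. g j) + (\<Sum>j\<in>{n..<Suc (2 * n)}. g j)"
    by (simp only:) (intro sum.union_disjoint, auto)
  also have "(\<Sum>j<n. g j) = (\<Sum>i<n. g (n - Suc i))"
    by (rule sum.nat_diff_reindex[symmetric])
  also have "(\<Sum>j\<in>{n..<Suc (2 * n)}. g j) = (\<Sum>i<Suc n. g (i + n))"
    using sum.shift_bounds_nat_ivl[of g 0 n "Suc n"] by (simp add: atLeast0LessThan mult_2)
  also have "\<dots> = g n + (\<Sum>i<n. g (n + Suc i))"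
    by (subst sum.lessThan_Suc_shift) (simp add: add_ac)
  finally show ?thesis by (simp add: sum.distrib algebra_simps)
qed

text \<open>The two-sided series \<open>\<Sum>n. p^(n\<^sup>2)\<close>, with the terms for \<open>n\<close> and \<open>-n\<close> combined.\<close>

definition theta_series :: "complex \<Rightarrow> complex"
  where "theta_series p = 1 + 2 * (\<Sum>k. p ^ ((Suc k)\<^sup>2))"

text \<open>The limit of the finite product formula. The central Gaussian binomial coefficients are bounded and tend to
  the inverse of the Euler product, so Tannery's theorem applies.\<close>

lemma theta_series_eq_product:
  assumes p: "p \<noteq> 0" "norm p < 1"
  assumes L: "(\<lambda>n. \<Prod>i<n. 1 + p ^ (2 * i + 1)) \<longlonglongrightarrow> L"
  shows "theta_series p = euler_prod (p\<^sup>2) * L\<^sup>2"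
proof -
  define Q where "Q = p\<^sup>2"
  have Q: "norm Q < 1" using p by (simp add: Q_def norm_power power_less_one_iff)
  have eQ: "euler_prod Q \<noteq> 0" by (rule euler_prod_nonzero[OF Q])
  define c where "c n i = qpoch Q (2 * n) / (qpoch Q (n + i) * qpoch Q (n - i))" for n i
  define a where "a k n = (if k < n then 2 * c n (Suc k) * p ^ ((Suc k)\<^sup>2) else 0)" for k n
  have fin: "(\<Prod>i<n. 1 + p ^ (2 * i + 1)) ^ 2 = c n 0 + (\<Sum>k. a k n)" if n: "n > 0" for n
  proof -
    have "(\<Prod>i<n. 1 + p ^ (2 * i + 1)) ^ 2 = (\<Sum>j\<le>2 * n. qbinom Q (2 * n) j * p ^ ((nat \<bar>int j - int n\<bar>)\<^sup>2))"
      unfolding Q_def by (rule finite_theta_product[OF p(1) n])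
    also have "\<dots> = c n 0 + (\<Sum>i<n. a i n)"
      unfolding sum_around_middle
    proof (intro arg_cong2[of _ _ _ _ "(+)"] sum.cong refl)
      show "qbinom Q (2 * n) n * p ^ (nat \<bar>int n - int n\<bar>)\<^sup>2 = c n 0"
        using qbinom_central(1)[OF Q, of 0 n] by (simp add: c_def)
      fix i assume i: "i \<in> {..<n}"
      have 1: "nat \<bar>int (n + Suc i) - int n\<bar> = Suc i" "nat \<bar>int (n - Suc i) - int n\<bar> = Suc i"
        using i by auto
      show "qbinom Q (2 * n) (n + Suc i) * p ^ (nat \<bar>int (n + Suc i) - int n\<bar>)\<^sup>2 +
            qbinom Q (2 * n) (n - Suc i) * p ^ (nat \<bar>int (n - Suc i) - int n\<bar>)\<^sup>2 = a i n"
        unfolding 1 using i qbinom_central[OF Q, of "Suc i" n] by (simp add: a_def c_def mult_ac)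
    qed
    also have "(\<Sum>i<n. a i n) = (\<Sum>k. a k n)"
      by (rule suminf_finite[symmetric]) (auto simp: a_def)
    finally show ?thesis .
  qed
  have qp: "qpoch Q \<longlonglongrightarrow> euler_prod Q" by (rule qpoch_LIMSEQ[OF Q])
  have climit: "(\<lambda>n. c n i) \<longlonglongrightarrow> 1 / euler_prod Q" for i
  proof -
    have 1: "(\<lambda>n. qpoch Q (2 * n)) \<longlonglongrightarrow> euler_prod Q"
      by (rule filterlim_compose[OF qp]) (rule mult_nat_left_at_top, simp)
    have 2: "(\<lambda>n. qpoch Q (n + i)) \<longlonglongrightarrow> euler_prod Q"
      using qp by (rule LIMSEQ_ignore_initial_segment)
    have 3: "(\<lambda>n. qpoch Q (n - i)) \<longlonglongrightarrow> euler_prod Q"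
      by (rule filterlim_compose[OF qp filterlim_minus_const_nat_at_top])
    show ?thesis unfolding c_def using tendsto_divide[OF 1 tendsto_mult[OF 2 3]] eQ by simp
  qed
  obtain A where A: "\<And>n. norm (qpoch Q n) \<le> A" "A > 0"
    using convergent_imp_Bseq[OF convergentI[OF qp]] unfolding Bseq_def by blast
  have iq: "(\<lambda>n. inverse (qpoch Q n)) \<longlonglongrightarrow> inverse (euler_prod Q)"
    by (rule tendsto_inverse[OF qp eQ])
  obtain B where B: "\<And>n. norm (inverse (qpoch Q n)) \<le> B" "B > 0"
    using convergent_imp_Bseq[OF convergentI[OF iq]] unfolding Bseq_def by blast
  have cbound: "norm (c n i) \<le> A * (B * B)" for n i
  proof -
    have "norm (c n i) = norm (qpoch Q (2 * n)) * (norm (inverse (qpoch Q (n + i))) * norm (inverse (qpoch Q (n - i))))"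
      by (simp add: c_def divide_inverse norm_mult)
    also have "\<dots> \<le> A * (B * B)" using A B by (intro mult_mono) auto
    finally show ?thesis .
  qed
  have "(\<lambda>n. \<Sum>k. a k n) \<longlonglongrightarrow> (\<Sum>k. 2 * (1 / euler_prod Q) * p ^ ((Suc k)\<^sup>2))"
  proof (rule tannerys_theorem[THEN conjunct2, THEN conjunct2])
    fix k
    have "(\<lambda>n. 2 * c n (Suc k) * p ^ ((Suc k)\<^sup>2)) \<longlonglongrightarrow> 2 * (1 / euler_prod Q) * p ^ ((Suc k)\<^sup>2)"
      by (intro tendsto_intros climit)
    moreover have "\<forall>\<^sub>F n in sequentially. 2 * c n (Suc k) * p ^ ((Suc k)\<^sup>2) = a k n"
      using eventually_gt_at_top[of k] by eventually_elim (simp add: a_def)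
    ultimately show "(\<lambda>n. a k n) \<longlonglongrightarrow> 2 * (1 / euler_prod Q) * p ^ ((Suc k)\<^sup>2)"
      by (rule Lim_transform_eventually)
  next
    show "\<forall>\<^sub>F (k, n) in sequentially \<times>\<^sub>F sequentially. norm (a k n) \<le> (2 * (A * (B * B))) * norm p ^ Suc k"
    proof (rule always_eventually, clarify)
      fix k n :: nat
      have AB: "0 \<le> A * (B * B)" using A B by simp
      have "norm p ^ ((Suc k)\<^sup>2) \<le> norm p ^ Suc k"
        using p by (intro power_decreasing) (auto simp: power2_eq_square)
      hence "norm (2 * c n (Suc k) * p ^ ((Suc k)\<^sup>2)) \<le> (2 * (A * (B * B))) * norm p ^ Suc k"
        using cbound[of n "Suc k"] AB by (simp only: norm_mult norm_power) (intro mult_mono; simp)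
      moreover have "0 \<le> (2 * (A * (B * B))) * norm p ^ Suc k" using A B by simp
      ultimately show "norm (a k n) \<le> (2 * (A * (B * B))) * norm p ^ Suc k" by (simp add: a_def)
    qed
    have "summable (\<lambda>k. norm p ^ Suc k)" using p by (subst summable_Suc_iff) (simp add: summable_geometric)
    thus "summable (\<lambda>k. (2 * (A * (B * B))) * norm p ^ Suc k)" by (rule summable_mult)
  qed auto
  hence lim1: "(\<lambda>n. c n 0 + (\<Sum>k. a k n)) \<longlonglongrightarrow> 1 / euler_prod Q + (\<Sum>k. 2 * (1 / euler_prod Q) * p ^ ((Suc k)\<^sup>2))"
    by (intro tendsto_add climit)
  have lim2: "(\<lambda>n. (\<Prod>i<n. 1 + p ^ (2 * i + 1)) ^ 2) \<longlonglongrightarrow> L\<^sup>2" by (intro tendsto_power L)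
  have ev: "\<forall>\<^sub>F n in sequentially. (\<Prod>i<n. 1 + p ^ (2 * i + 1)) ^ 2 = c n 0 + (\<Sum>k. a k n)"
    using eventually_gt_at_top[of 0] by eventually_elim (rule fin)
  have "L\<^sup>2 = 1 / euler_prod Q + (\<Sum>k. 2 * (1 / euler_prod Q) * p ^ ((Suc k)\<^sup>2))"
    by (rule LIMSEQ_unique[OF Lim_transform_eventually[OF lim2 ev] lim1])
  also have "(\<Sum>k. 2 * (1 / euler_prod Q) * p ^ ((Suc k)\<^sup>2)) = 2 * (1 / euler_prod Q) * (\<Sum>k. p ^ ((Suc k)\<^sup>2))"
  proof (rule suminf_mult)
    show "summable (\<lambda>k. p ^ ((Suc k)\<^sup>2))"
    proof (rule summable_comparison_test)
      show "summable (\<lambda>k. norm p ^ Suc k)" using p by (subst summable_Suc_iff) (simp add: summable_geometric)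
      show "\<exists>N. \<forall>k\<ge>N. norm (p ^ ((Suc k)\<^sup>2)) \<le> norm p ^ Suc k"
        unfolding norm_power using p by (intro exI[of _ 0] allI impI power_decreasing) (auto simp: power2_eq_square)
    qed
  qed
  finally have "euler_prod Q * L\<^sup>2 = theta_series p"
    using eQ by (simp add: theta_series_def field_simps)
  thus ?thesis by (simp add: Q_def)
qed

text \<open>The even factors of the Euler product of \<open>q\<close> form the Euler product of \<open>q\<^sup>2\<close>.\<close>

lemma odd_prod_LIMSEQ:
  assumes "norm q < 1"
  shows "(\<lambda>n. \<Prod>i<n. 1 - q ^ (2 * i + 1)) \<longlonglongrightarrow> euler_prod q / euler_prod (q\<^sup>2)"
proof -
  have q2: "norm (q\<^sup>2) < 1" using assms by (simp add: norm_power power_less_one_iff)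
  have "qpoch q (2 * n) = (\<Prod>i<n. 1 - q ^ (2 * i + 1)) * qpoch (q\<^sup>2) n" for n
  proof (induction n)
    case (Suc n)
    have "qpoch q (2 * Suc n) = qpoch q (2 * n) * (1 - q ^ Suc (2 * n)) * (1 - q ^ Suc (Suc (2 * n)))"
      by (simp add: qpoch_def)
    also have "q ^ Suc (Suc (2 * n)) = (q\<^sup>2) ^ Suc n"
      by (simp only: power_mult[symmetric]) simp
    finally show ?case unfolding Suc.IH qpoch_Suc by (simp add: mult_ac)
  qed simp
  hence eq: "(\<Prod>i<n. 1 - q ^ (2 * i + 1)) = qpoch q (2 * n) / qpoch (q\<^sup>2) n" for n
    using qpoch_nonzero[OF q2, of n] by (simp add: field_simps)
  have "(\<lambda>n. qpoch q (2 * n)) \<longlonglongrightarrow> euler_prod q"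
    by (rule filterlim_compose[OF qpoch_LIMSEQ[OF assms]]) (rule mult_nat_left_at_top, simp)
  thus ?thesis unfolding eq
    by (rule tendsto_divide[OF _ qpoch_LIMSEQ[OF q2] euler_prod_nonzero[OF q2]])
qed

theorem theta_series_minus:
  assumes "q \<noteq> 0" "norm q < 1"
  shows "theta_series (- q) = euler_prod q ^ 2 / euler_prod (q\<^sup>2)"
proof -
  have q2: "norm (q\<^sup>2) < 1" using assms by (simp add: norm_power power_less_one_iff)
  have "(\<lambda>n. \<Prod>i<n. 1 + (- q) ^ (2 * i + 1)) \<longlonglongrightarrow> euler_prod q / euler_prod (q\<^sup>2)"
    using odd_prod_LIMSEQ[OF assms(2)] by simp
  from theta_series_eq_product[OF _ _ this] show ?thesis
    using assms euler_prod_nonzero[OF q2] by (simp add: power2_eq_square)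
qed

theorem theta_series_plus:
  assumes "q \<noteq> 0" "norm q < 1"
  shows "theta_series q = euler_prod (q\<^sup>2) ^ 5 / (euler_prod q ^ 2 * euler_prod (q ^ 4) ^ 2)"
proof -
  have q2: "norm (q\<^sup>2) < 1" and q4: "norm (q ^ 4) < 1" using assms by (simp_all add: norm_power power_less_one_iff)
  note nz = euler_prod_nonzero[OF assms(2)] euler_prod_nonzero[OF q2] euler_prod_nonzero[OF q4]
  have "(\<lambda>n. (\<Prod>i<n. 1 - (q\<^sup>2) ^ (2 * i + 1)) / (\<Prod>i<n. 1 - q ^ (2 * i + 1))) \<longlonglongrightarrow>
           (euler_prod (q\<^sup>2) / euler_prod ((q\<^sup>2)\<^sup>2)) / (euler_prod q / euler_prod (q\<^sup>2))"
    using nz by (intro tendsto_divide odd_prod_LIMSEQ q2 assms) auto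
  also have "(\<lambda>n. (\<Prod>i<n. 1 - (q\<^sup>2) ^ (2 * i + 1)) / (\<Prod>i<n. 1 - q ^ (2 * i + 1))) = (\<lambda>n. \<Prod>i<n. 1 + q ^ (2 * i + 1))"
  proof
    fix n
    have "1 - q ^ (2 * i + 1) \<noteq> 0" for i using euler_factor_nonzero[OF assms(2), of "2 * i"] by simp
    moreover have "1 - (q\<^sup>2) ^ (2 * i + 1) = (1 + q ^ (2 * i + 1)) * (1 - q ^ (2 * i + 1))" for i
    proof -
      have "(q\<^sup>2) ^ (2 * i + 1) = q ^ (2 * i + 1) * q ^ (2 * i + 1)"
        by (simp only: power_mult[symmetric] power_add[symmetric]) (simp add: algebra_simps)
      thus ?thesis by (simp add: algebra_simps)
    qed
    ultimately show "(\<Prod>i<n. 1 - (q\<^sup>2) ^ (2 * i + 1)) / (\<Prod>i<n. 1 - q ^ (2 * i + 1)) = (\<Prod>i<n. 1 + q ^ (2 * i + 1))"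
      unfolding prod_dividef[symmetric] by (intro prod.cong) auto
  qed
  finally have "(\<lambda>n. \<Prod>i<n. 1 + q ^ (2 * i + 1)) \<longlonglongrightarrow> (euler_prod (q\<^sup>2) / euler_prod (q ^ 4)) / (euler_prod q / euler_prod (q\<^sup>2))"
    by simp
  from theta_series_eq_product[OF assms this] show ?thesis
    using nz by (simp add: field_simps power2_eq_square eval_nat_numeral)
qed

lemma ramanujan_phi_eq_theta_series:
  assumes "norm (qexp z) < 1"
  shows "ramanujan_phi z = theta_series (qexp z)"
proof -
  define q where "q = qexp z"
  have q: "norm q < 1" using assms by (simp add: q_def)
  define f where "f = (\<lambda>n::int. q powi (n\<^sup>2))"
  define S where "S = (\<Sum>k. q ^ ((Suc k)\<^sup>2))"
  have sn: "summable (\<lambda>k. norm (q ^ ((Suc k)\<^sup>2)))"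
  proof (rule summable_comparison_test)
    show "summable (\<lambda>k. norm q ^ Suc k)" using q by (subst summable_Suc_iff) (simp add: summable_geometric)
    have *: "norm q ^ ((Suc k)\<^sup>2) \<le> norm q ^ Suc k" for k
      using q by (intro power_decreasing) (auto simp: power2_eq_square)
    show "\<exists>N. \<forall>k\<ge>N. norm (norm (q ^ ((Suc k)\<^sup>2))) \<le> norm q ^ Suc k"
      by (intro exI[of _ 0] allI impI, subst real_norm_def, subst abs_norm_cancel, subst norm_power, rule *)
  qed
  have S: "((\<lambda>k. q ^ ((Suc k)\<^sup>2)) has_sum S) UNIV"
    unfolding S_def by (rule norm_summable_imp_has_sum[OF sn summable_sums[OF summable_norm_cancel[OF sn]]])
  have fq: "f (int k) = q ^ (k\<^sup>2)" "f (- int k) = q ^ (k\<^sup>2)" for k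
    by (simp_all add: f_def flip: of_nat_power)
  have "((\<lambda>k. q ^ ((Suc k)\<^sup>2)) has_sum S) UNIV \<longleftrightarrow> (f has_sum S) {1..}"
  proof (rule has_sum_reindex_bij_witness[of _ "\<lambda>n. nat (n - 1)" "\<lambda>k. int (Suc k)"])
    show "f (int (Suc k)) = q ^ ((Suc k)\<^sup>2)" for k by (rule fq)
  qed auto
  moreover have "((\<lambda>k. q ^ ((Suc k)\<^sup>2)) has_sum S) UNIV \<longleftrightarrow> (f has_sum S) {..-1}"
  proof (rule has_sum_reindex_bij_witness[of _ "\<lambda>n. nat (- n - 1)" "\<lambda>k. - int (Suc k)"])
    show "f (- int (Suc k)) = q ^ ((Suc k)\<^sup>2)" for k by (rule fq)
  qed auto
  moreover have "(f has_sum 1) {0}" by (rule has_sum_finiteI) (auto simp: f_def)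
  ultimately have "(f has_sum (1 + (S + S))) ({0} \<union> ({1..} \<union> {..-1}))"
    using S by (intro has_sum_Un_disjoint) auto
  also have "{0} \<union> ({1..} \<union> {..-1}) = (UNIV :: int set)" by force
  finally show ?thesis
    by (simp add: ramanujan_phi_def theta_series_def f_def q_def S_def infsumI)
qed

theorem ramanujan_phi_eq_eta:
  assumes z: "Im z > 0"
  shows "ramanujan_phi z = dedekind_eta (2 * z) ^ 5 / (dedekind_eta z ^ 2 * dedekind_eta (4 * z) ^ 2)"
proof -
  define e where "e = exp (of_real pi * \<i> * z / 12)"
  have e: "exp (of_real pi * \<i> * (2 * z) / 12) = e ^ 2" "exp (of_real pi * \<i> * (4 * z) / 12) = e ^ 4"
    unfolding e_def exp_of_nat_mult[symmetric] by (simp_all add: field_simps)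
  have e0: "e \<noteq> 0" by (simp add: e_def)
  have gen: "A ^ 5 / (B ^ 2 * C ^ 2) = (e ^ 2 * A) ^ 5 / ((e * B) ^ 2 * (e ^ 4 * C) ^ 2)" for A B C :: complex
  proof -
    have "(e ^ 2 * A) ^ 5 = e ^ 10 * A ^ 5" by (simp add: power_mult_distrib flip: power_mult)
    moreover have "(e * B) ^ 2 * (e ^ 4 * C) ^ 2 = e ^ 10 * (B ^ 2 * C ^ 2)"
    proof -
      have "(e * B) ^ 2 * (e ^ 4 * C) ^ 2 = (e ^ 2 * (e ^ 4) ^ 2) * (B ^ 2 * C ^ 2)"
        by (simp add: power_mult_distrib mult_ac)
      also have "e ^ 2 * (e ^ 4) ^ 2 = e ^ 10" by (simp flip: power_mult power_add)
      finally show ?thesis .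
    qed
    ultimately show ?thesis using e0 by simp
  qed
  have "ramanujan_phi z = euler_prod ((qexp z)\<^sup>2) ^ 5 / (euler_prod (qexp z) ^ 2 * euler_prod (qexp z ^ 4) ^ 2)"
    using norm_qexp_less_1[OF z] by (simp add: ramanujan_phi_eq_theta_series theta_series_plus)
  also have "\<dots> = dedekind_eta (2 * z) ^ 5 / (dedekind_eta z ^ 2 * dedekind_eta (4 * z) ^ 2)"
    unfolding dedekind_eta_eq qexp_numeral_mult e e_def[symmetric] by (rule gen)
  finally show ?thesis .
qed

theorem ramanujan_phi_half_shift:
  assumes z: "Im z > 0"
  shows "ramanujan_phi (z + 1 / 2) = dedekind_eta z ^ 2 / dedekind_eta (2 * z)"
proof -
  define e where "e = exp (of_real pi * \<i> * z / 12)"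
  have e: "exp (of_real pi * \<i> * (2 * z) / 12) = e ^ 2"
    unfolding e_def exp_of_nat_mult[symmetric] by (simp_all add: field_simps)
  have e0: "e \<noteq> 0" by (simp add: e_def)
  have half: "qexp (1 / 2) = - 1" by (simp add: qexp_def exp_pi_i mult_ac)
  have "ramanujan_phi (z + 1 / 2) = euler_prod (qexp z) ^ 2 / euler_prod ((qexp z)\<^sup>2)"
    using norm_qexp_less_1[OF z] by (subst ramanujan_phi_eq_theta_series) (auto simp: qexp_add half theta_series_minus)
  also have "\<dots> = dedekind_eta z ^ 2 / dedekind_eta (2 * z)"
    unfolding dedekind_eta_eq qexp_numeral_mult e e_def[symmetric]
    using e0 by (simp add: power_mult_distrib)
  finally show ?thesis .
qed

section \<open>Theta functions under congruence subgroups\<close>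

text \<open>In the right half plane both roots have arguments below \<open>\<pi>/4\<close> in absolute value, so their product stays on
  the principal branch.\<close>

lemma csqrt_mult_right_half:
  assumes "Re a > 0" "Re b > 0"
  shows "csqrt a * csqrt b = csqrt (a * b)"
proof -
  have *: "Re (csqrt a) > \<bar>Im (csqrt a)\<bar>" if "Re a > 0" for a
  proof -
    define s where "s = csqrt a"
    have "s\<^sup>2 = a" and s0: "Re s \<ge> 0" using csqrt_principal[of a] by (auto simp: s_def)
    hence "Re a = (Re s)\<^sup>2 - (Im s)\<^sup>2" by (metis Re_power2)
    hence "\<bar>Im s\<bar>\<^sup>2 < (Re s)\<^sup>2" using that by simp
    hence "\<bar>Im s\<bar> < Re s" using s0 by (rule power2_less_imp_less)
    thus ?thesis by (simp only: s_def)
  qed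
  define x1 y1 x2 y2 where "x1 = Re (csqrt a)" and "y1 = Im (csqrt a)" and "x2 = Re (csqrt b)" and "y2 = Im (csqrt b)"
  have "\<bar>y1 * y2\<bar> < x1 * x2"
    unfolding abs_mult using *[OF assms(1)] *[OF assms(2)]
    by (intro mult_strict_mono') (auto simp: x1_def x2_def y1_def y2_def)
  hence "Re (csqrt a * csqrt b) > 0" by (simp add: x1_def x2_def y1_def y2_def)
  hence "csqrt ((csqrt a * csqrt b)\<^sup>2) = csqrt a * csqrt b" by (intro csqrt_square) auto
  thus ?thesis by (simp add: power_mult_distrib)
qed

lemma ramanujan_phi_periodic: "ramanujan_phi (z + 1) = ramanujan_phi z"
  by (simp add: ramanujan_phi_def qexp_plus_1)

lemma csqrt_times_self: "csqrt w * csqrt w = w"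
  by (metis power2_csqrt power2_eq_square)

lemma Im_minus_inverse_4: "Im z > 0 \<Longrightarrow> Im (- 1 / (4 * z)) > 0"
  using Im_neg_inverse[of "4 * z"] by simp

lemma ramanujan_phi_S:
  assumes z: "Im z > 0"
  shows "ramanujan_phi (- 1 / (4 * z)) = csqrt (- 2 * \<i> * z) * ramanujan_phi z"
proof -
  have z0: "z \<noteq> 0" using z by auto
  have z': "Im (- 1 / (4 * z)) > 0" by (rule Im_minus_inverse_4[OF z])
  define s where "s = csqrt (- 2 * \<i> * z)"
  have ss: "s * s = - 2 * \<i> * z" unfolding s_def by (rule csqrt_times_self)
  have s0: "s \<noteq> 0" using ss z0 by auto
  have 1: "dedekind_eta (2 * (- 1 / (4 * z))) = s * dedekind_eta (2 * z)"
    using dedekind_eta_S[of "2 * z"] z by (simp add: s_def mult_ac)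
  have 2: "dedekind_eta (- 1 / (4 * z)) ^ 2 = (- 4 * \<i> * z) * dedekind_eta (4 * z) ^ 2"
    using dedekind_eta_S[of "4 * z"] z by (simp add: power_mult_distrib mult_ac)
  have 3: "dedekind_eta (4 * (- 1 / (4 * z))) ^ 2 = (- \<i> * z) * dedekind_eta z ^ 2"
    using dedekind_eta_S[OF z] by (simp add: power_mult_distrib)
  have s5: "s ^ 5 / ((- 4 * \<i> * z) * (- \<i> * z)) = s"
  proof -
    have "s ^ 5 = s * (s * s) * (s * s)" by (simp add: eval_nat_numeral)
    also have "\<dots> = s * ((- 4 * \<i> * z) * (- \<i> * z))" unfolding ss by (simp add: algebra_simps)
    finally show ?thesis using z0 by simp
  qed
  have "ramanujan_phi (- 1 / (4 * z)) = (s * dedekind_eta (2 * z)) ^ 5 / (((- 4 * \<i> * z) * dedekind_eta (4 * z) ^ 2) * ((- \<i> * z) * dedekind_eta z ^ 2))"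
    unfolding ramanujan_phi_eq_eta[OF z'] 1 2 3 ..
  also have "\<dots> = s ^ 5 / ((- 4 * \<i> * z) * (- \<i> * z)) * (dedekind_eta (2 * z) ^ 5 / (dedekind_eta z ^ 2 * dedekind_eta (4 * z) ^ 2))"
    by (simp add: power_mult_distrib mult_ac)
  finally show ?thesis unfolding s5 ramanujan_phi_eq_eta[OF z, symmetric] by (simp add: s_def)
qed

text \<open>Half of Jacobi's \<open>\<theta>\<^sub>2\<close> at the argument \<open>2z\<close>, where \<open>\<phi>(z) = \<theta>\<^sub>3(2z)\<close>.\<close>

definition theta_two :: "complex \<Rightarrow> complex"
  where "theta_two z = dedekind_eta (4 * z) ^ 2 / dedekind_eta (2 * z)"

lemma theta_two_minus_1: "theta_two (z - 1) = - \<i> * theta_two z"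
proof -
  define e where "e = exp (of_real pi * \<i> / 12)"
  have T: "dedekind_eta (w + of_nat n) = e ^ n * dedekind_eta w" for w n
  proof (induction n)
    case (Suc n)
    have "w + of_nat (Suc n) = (w + of_nat n) + 1" by simp
    thus ?case using Suc.IH by (simp only: dedekind_eta_plus_1 e_def) simp
  qed simp
  have 4: "dedekind_eta (4 * z) = e ^ 4 * dedekind_eta (4 * (z - 1))"
    using T[of "4 * (z - 1)" 4] by simp
  have 2: "dedekind_eta (2 * z) = e ^ 2 * dedekind_eta (2 * (z - 1))"
    using T[of "2 * (z - 1)" 2] by simp
  have "e ^ 6 = cis (pi / 2)" unfolding e_def cis_conv_exp exp_of_nat_mult[symmetric] by (simp add: field_simps)
  hence e6: "e ^ 6 = \<i>" by simp
  have e0: "e \<noteq> 0" by (simp add: e_def)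
  have "theta_two z = e ^ 6 * theta_two (z - 1)"
  proof -
    have "(e ^ 4 * A) ^ 2 / (e ^ 2 * B) = e ^ 6 * (A ^ 2 / B)" for A B :: complex
    proof -
      have "e ^ 8 = e ^ 2 * e ^ 6" by (simp flip: power_add)
      hence h: "(e ^ 4 * A) ^ 2 = e ^ 2 * (e ^ 6 * A ^ 2)" by (simp add: power_mult_distrib flip: power_mult)
      show ?thesis unfolding h by (subst nonzero_mult_divide_mult_cancel_left) (use e0 in simp_all)
    qed
    thus ?thesis unfolding theta_two_def 4 2 .
  qed
  thus ?thesis by (simp add: e6)
qed

text \<open>The inversion exchanges \<open>\<theta>\<^sub>2\<close> and \<open>\<theta>\<^sub>4\<close>; the latter is \<open>\<phi>(z + 1/2)\<close>.\<close>

lemma theta_four_S: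
  assumes z: "Im z > 0"
  shows "ramanujan_phi (- 1 / (4 * z) + 1 / 2) = 2 * csqrt (- 2 * \<i> * z) * theta_two z"
    and "2 * theta_two (- 1 / (4 * z)) = csqrt (- 2 * \<i> * z) * ramanujan_phi (z + 1 / 2)"
proof -
  have z0: "z \<noteq> 0" using z by auto
  have z': "Im (- 1 / (4 * z)) > 0" by (rule Im_minus_inverse_4[OF z])
  define s where "s = csqrt (- 2 * \<i> * z)"
  have ss: "s * s = - 2 * \<i> * z" unfolding s_def by (rule csqrt_times_self)
  have s0: "s \<noteq> 0" using ss z0 by auto
  have 1: "dedekind_eta (2 * (- 1 / (4 * z))) = s * dedekind_eta (2 * z)"
    using dedekind_eta_S[of "2 * z"] z by (simp add: s_def mult_ac)
  have 2: "dedekind_eta (- 1 / (4 * z)) ^ 2 = 2 * (s * s) * dedekind_eta (4 * z) ^ 2"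
    using dedekind_eta_S[of "4 * z"] z unfolding ss by (simp add: power_mult_distrib mult_ac)
  have 3: "2 * dedekind_eta (4 * (- 1 / (4 * z))) ^ 2 = (s * s) * dedekind_eta z ^ 2"
    using dedekind_eta_S[OF z] unfolding ss by (simp add: power_mult_distrib)
  show "ramanujan_phi (- 1 / (4 * z) + 1 / 2) = 2 * csqrt (- 2 * \<i> * z) * theta_two z"
    unfolding ramanujan_phi_half_shift[OF z'] 1 2 theta_two_def s_def[symmetric] using s0 by simp
  have "2 * theta_two (- 1 / (4 * z)) = (2 * dedekind_eta (4 * (- 1 / (4 * z))) ^ 2) / dedekind_eta (2 * (- 1 / (4 * z)))"
    by (simp add: theta_two_def)
  thus "2 * theta_two (- 1 / (4 * z)) = csqrt (- 2 * \<i> * z) * ramanujan_phi (z + 1 / 2)"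
    unfolding 1 3 ramanujan_phi_half_shift[OF z] s_def[symmetric] using s0 by simp
qed

text \<open>The map \<open>z \<mapsto> z/(4z+1)\<close> is the translation by \<open>-1\<close> conjugated by the involution \<open>z \<mapsto> -1/(4z)\<close>.\<close>

lemma ramanujan_phi_U:
  assumes z: "Im z > 0"
  shows "ramanujan_phi (z / (4 * z + 1)) = csqrt (4 * z + 1) * ramanujan_phi z"
proof -
  have z0: "z \<noteq> 0" using z by auto
  define w where "w = - 1 / (4 * z) - 1"
  have w: "Im w > 0" using Im_minus_inverse_4[OF z] by (simp add: w_def)
  have w0: "w \<noteq> 0" using w by auto
  have w4: "- 4 * z * w = 4 * z + 1" using z0 by (simp add: w_def field_simps)
  have "- 1 / (4 * w) = z / (4 * z + 1)" unfolding w4[symmetric] using z0 w0 by (simp add: field_simps)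
  hence "ramanujan_phi (z / (4 * z + 1)) = csqrt (- 2 * \<i> * w) * ramanujan_phi w"
    using ramanujan_phi_S[OF w] by simp
  also have "ramanujan_phi w = ramanujan_phi (- 1 / (4 * z))"
    using ramanujan_phi_periodic[of w] by (simp add: w_def)
  also have "\<dots> = csqrt (- 2 * \<i> * z) * ramanujan_phi z" by (rule ramanujan_phi_S[OF z])
  also have "csqrt (- 2 * \<i> * w) * (csqrt (- 2 * \<i> * z) * ramanujan_phi z) = csqrt ((- 2 * \<i> * w) * (- 2 * \<i> * z)) * ramanujan_phi z"
    by (subst csqrt_mult_right_half[symmetric]) (use z w in auto)
  also have "(- 2 * \<i> * w) * (- 2 * \<i> * z) = 4 * z + 1" unfolding w4[symmetric] by (simp add: algebra_simps)
  finally show ?thesis .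
qed

text \<open>The same with the translation by \<open>-2\<close>. The sign in the second equation arises because the conjugation passes
  through \<open>\<theta>\<^sub>2\<close>, which is multiplied by \<open>(-i)\<^sup>2\<close>.\<close>

lemma ramanujan_phi_U2:
  assumes z: "Im z > 0"
  shows "ramanujan_phi (z / (8 * z + 1)) = csqrt (8 * z + 1) * ramanujan_phi z"
    and "ramanujan_phi (z / (8 * z + 1) + 1 / 2) = - csqrt (8 * z + 1) * ramanujan_phi (z + 1 / 2)"
proof -
  have z0: "z \<noteq> 0" using z by auto
  define w where "w = - 1 / (4 * z) - 2"
  have w: "Im w > 0" using Im_minus_inverse_4[OF z] by (simp add: w_def)
  have w0: "w \<noteq> 0" using w by auto
  have w4: "- 4 * z * w = 8 * z + 1" using z0 by (simp add: w_def field_simps)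
  have zw: "- 1 / (4 * w) = z / (8 * z + 1)" unfolding w4[symmetric] using z0 w0 by (simp add: field_simps)
  have w1: "w = - 1 / (4 * z) - 1 - 1" by (simp add: w_def)
  have prod: "csqrt (- 2 * \<i> * w) * csqrt (- 2 * \<i> * z) = csqrt (8 * z + 1)"
  proof -
    have "(- 2 * \<i> * w) * (- 2 * \<i> * z) = 8 * z + 1" unfolding w4[symmetric] by (simp add: algebra_simps)
    hence "csqrt ((- 2 * \<i> * w) * (- 2 * \<i> * z)) = csqrt (8 * z + 1)" by (simp only:)
    thus ?thesis using csqrt_mult_right_half[of "- 2 * \<i> * w" "- 2 * \<i> * z"] z w by simp
  qed
  have "ramanujan_phi (z / (8 * z + 1)) = csqrt (- 2 * \<i> * w) * ramanujan_phi w"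
    using ramanujan_phi_S[OF w] zw by simp
  also have "ramanujan_phi w = ramanujan_phi (- 1 / (4 * z))"
    using ramanujan_phi_periodic[of w] ramanujan_phi_periodic[of "w + 1"] by (simp add: w1)
  also have "\<dots> = csqrt (- 2 * \<i> * z) * ramanujan_phi z" by (rule ramanujan_phi_S[OF z])
  finally show "ramanujan_phi (z / (8 * z + 1)) = csqrt (8 * z + 1) * ramanujan_phi z"
    unfolding prod[symmetric] by (simp add: mult_ac)
  have "ramanujan_phi (z / (8 * z + 1) + 1 / 2) = csqrt (- 2 * \<i> * w) * (2 * theta_two w)"
    using theta_four_S(1)[OF w, unfolded zw] by (simp add: mult_ac)
  also have "2 * theta_two w = - (2 * theta_two (- 1 / (4 * z)))"
    unfolding w1 theta_two_minus_1 by simp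
  also have "\<dots> = - (csqrt (- 2 * \<i> * z) * ramanujan_phi (z + 1 / 2))"
    unfolding theta_four_S(2)[OF z] ..
  finally show "ramanujan_phi (z / (8 * z + 1) + 1 / 2) = - csqrt (8 * z + 1) * ramanujan_phi (z + 1 / 2)"
    unfolding prod[symmetric] by (simp add: mult_ac)
qed

text \<open>A Euclidean algorithm inside \<open>Gamma0 4\<close>. Translations reduce \<open>d\<close> modulo \<open>c\<close> to at most \<open>\<bar>c\<bar>/2\<close>, with
  strict inequality because \<open>d\<close> is odd and \<open>4\<close> divides \<open>c\<close>; then powers of \<open>U\<close> reduce \<open>c\<close> modulo \<open>4d\<close>
  to a value below \<open>\<bar>c\<bar>\<close>.\<close>

lemma Gamma0_4_induct [consumes 2, case_names one minus_one T T_inv U U_inv]: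
  assumes "a * d - b * c = (1 :: int)" "4 dvd c"
  assumes one: "P 1 0 0 1" and minus_one: "P (-1) 0 0 (-1)"
  assumes T: "\<And>a b c d. a * d - b * c = 1 \<Longrightarrow> 4 dvd c \<Longrightarrow> P a b c d \<Longrightarrow> P a (a + b) c (c + d)"
  assumes T': "\<And>a b c d. a * d - b * c = 1 \<Longrightarrow> 4 dvd c \<Longrightarrow> P a b c d \<Longrightarrow> P a (b - a) c (d - c)"
  assumes U: "\<And>a b c d. a * d - b * c = 1 \<Longrightarrow> 4 dvd c \<Longrightarrow> P a b c d \<Longrightarrow> P (a + 4 * b) b (c + 4 * d) d"
  assumes U': "\<And>a b c d. a * d - b * c = 1 \<Longrightarrow> 4 dvd c \<Longrightarrow> P a b c d \<Longrightarrow> P (a - 4 * b) b (c - 4 * d) d"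
  shows "P a b c d"
proof -
  have Tn: "P a (b + n * a) c (d + n * c)" if "P a b c d" "a * d - b * c = 1" "4 dvd c" for a b c d n
  proof (induction n rule: int_induct[where k = 0])
    case (step1 i)
    have "a * (d + i * c) - (b + i * a) * c = 1" using that(2) by (simp add: algebra_simps)
    from T[OF this that(3) step1.IH] show ?case by (simp add: algebra_simps)
  next
    case (step2 i)
    have "a * (d + i * c) - (b + i * a) * c = 1" using that(2) by (simp add: algebra_simps)
    from T'[OF this that(3) step2.IH] show ?case by (simp add: algebra_simps)
  qed (use that in auto)
  have Un: "P (a + n * (4 * b)) b (c + n * (4 * d)) d" if "P a b c d" "a * d - b * c = 1" "4 dvd c" for a b c d n
  proof (induction n rule: int_induct[where k = 0])
    case (step1 i)
    have "(a + i * (4 * b)) * d - b * (c + i * (4 * d)) = 1" using that(2) by (simp add: algebra_simps)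
    moreover have "4 dvd c + i * (4 * d)" using that(3) by simp
    ultimately show ?case using U[OF _ _ step1.IH] by (simp add: algebra_simps)
  next
    case (step2 i)
    have "(a + i * (4 * b)) * d - b * (c + i * (4 * d)) = 1" using that(2) by (simp add: algebra_simps)
    moreover have "4 dvd c + i * (4 * d)" using that(3) by simp
    ultimately show ?case using U'[OF _ _ step2.IH] by (simp add: algebra_simps)
  qed (use that in auto)
  have near: "\<exists>n. \<bar>x - n * m\<bar> * 2 \<le> m" if "m > 0" for x m :: int
  proof (intro exI)
    define r where "r = (2 * x + m) div (2 * m)"
    have "2 * x + m = (2 * m) * r + (2 * x + m) mod (2 * m)" by (simp add: r_def)
    moreover have "0 \<le> (2 * x + m) mod (2 * m)" "(2 * x + m) mod (2 * m) < 2 * m" using that by auto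
    ultimately show "\<bar>x - r * m\<bar> * 2 \<le> m" by (auto simp: algebra_simps abs_if)
  qed
  from assms(1,2) show ?thesis
  proof (induction "nat \<bar>c\<bar>" arbitrary: a b c d rule: less_induct)
    case less
    show ?case
    proof (cases "c = 0")
      case True
      hence "a * d = 1" using less.prems by simp
      hence "a = 1 \<and> d = 1 \<or> a = -1 \<and> d = -1" by (simp add: zmult_eq_1_iff)
      thus ?thesis
        using Tn[OF one, of b] Tn[OF minus_one, of "- b"] True by auto
    next
      case False
      \<comment> \<open>Division with remainder of least absolute value, for a divisor of either sign.\<close>
      obtain n0 where n0: "\<bar>d - n0 * \<bar>c\<bar>\<bar> * 2 \<le> \<bar>c\<bar>" using near[of "\<bar>c\<bar>" d] False by auto
      define n where "n = n0 * sgn c"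
      define r where "r = d - n * c"
      have "n * c = n0 * \<bar>c\<bar>" by (simp add: n_def abs_sgn mult_ac)
      hence r: "\<bar>r\<bar> * 2 \<le> \<bar>c\<bar>" using n0 by (simp add: r_def)
      define b' where "b' = b - n * a"
      have det: "a * r - b' * c = 1" using less.prems by (simp add: r_def b'_def algebra_simps)
      have "odd r"
      proof
        assume "even r"
        moreover have "even c" using less.prems by auto
        ultimately have "even (a * r - b' * c)" by simp
        thus False using det by simp
      qed
      hence r0: "r \<noteq> 0" by auto
      have "\<bar>r\<bar> * 2 \<noteq> \<bar>c\<bar>"
      proof
        assume "\<bar>r\<bar> * 2 = \<bar>c\<bar>"
        moreover obtain k where "c = 4 * k" using less.prems by auto
        ultimately have "\<bar>r\<bar> = 2 * \<bar>k\<bar>" by (simp add: abs_mult)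
        hence "even r" by presburger
        with \<open>odd r\<close> show False by simp
      qed
      with r have r: "\<bar>r\<bar> * 2 < \<bar>c\<bar>" by simp
      obtain m0 where m0: "\<bar>c - m0 * (4 * \<bar>r\<bar>)\<bar> * 2 \<le> 4 * \<bar>r\<bar>" using near[of "4 * \<bar>r\<bar>" c] r0 by auto
      define m where "m = m0 * sgn r"
      define c' where "c' = c - m * (4 * r)"
      have "m * (4 * r) = m0 * (4 * \<bar>r\<bar>)" by (simp add: m_def abs_sgn mult_ac)
      hence c': "\<bar>c'\<bar> < \<bar>c\<bar>" using m0 r by (simp add: c'_def)
      have det': "(a - m * (4 * b')) * r - b' * c' = 1" using det by (simp add: c'_def algebra_simps)
      have dvd': "4 dvd c'" using less.prems by (simp add: c'_def)
      have "P (a - m * (4 * b')) b' c' r" by (rule less.hyps) (use c' det' dvd' in auto)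
      from Un[OF this det' dvd', of m] have "P a b' c r" by (simp add: c'_def)
      from Tn[OF this det less.prems(2), of n] show ?thesis by (simp add: r_def b'_def)
    qed
  qed
qed

text \<open>The Kronecker symbol \<open>(-4/d)\<close>.\<close>

definition chi_m4 :: "int \<Rightarrow> int"
  where "chi_m4 d = (if d mod 4 = 1 then 1 else if d mod 4 = 3 then -1 else 0)"

text \<open>The Kronecker symbol \<open>(-8/d)\<close>.\<close>

definition chi_m8 :: "int \<Rightarrow> int"
  where "chi_m8 d = (if d mod 8 \<in> {1, 3} then 1 else if d mod 8 \<in> {5, 7} then -1 else 0)"

lemma chi_m4_mult_chi_m8: "chi_m4 d * chi_m8 d = kron8 d"
proof -
  have "\<forall>x\<in>set [0..7]. chi_m4 x * chi_m8 x = kron8 x" by code_simp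
  moreover have "d mod 8 \<in> set [0..7]" using pos_mod_bound[of 8 d] by (simp add: set_upto)
  ultimately have "chi_m4 (d mod 8) * chi_m8 (d mod 8) = kron8 (d mod 8)" by blast
  moreover have "chi_m4 (d mod 8) = chi_m4 d" by (simp add: chi_m4_def mod_mod_cancel)
  moreover have "chi_m8 (d mod 8) = chi_m8 d" by (simp add: chi_m8_def)
  ultimately show ?thesis by (simp add: kron8_mod)
qed

lemma chi_m4_add_4: "4 dvd c \<Longrightarrow> chi_m4 (d + c) = chi_m4 d"
  by (auto simp: chi_m4_def elim!: dvdE)

lemma chi_m8_cong: "[d = d'] (mod 8) \<Longrightarrow> chi_m8 d = chi_m8 d'"
  by (simp add: chi_m8_def cong_def)

lemma chi_m8_add_4: "odd d \<Longrightarrow> chi_m8 (d + 4) = - chi_m8 d"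
proof -
  assume "odd d"
  hence "d mod 8 = 1 \<or> d mod 8 = 3 \<or> d mod 8 = 5 \<or> d mod 8 = 7" by presburger
  thus ?thesis
    by (elim disjE) (auto simp: chi_m8_def mod_add_left_eq[of d 8 4, symmetric])
qed

lemma Gamma0_4_odd:
  assumes "a * d - b * c = (1 :: int)" "4 dvd c"
  shows "odd a" "odd d"
proof -
  have "even c" using assms(2) by (auto elim!: dvdE)
  moreover have "a * d = 1 + b * c" using assms(1) by simp
  ultimately have "odd (a * d)" by simp
  thus "odd a" "odd d" by auto
qed

lemma chi_m8_U:
  assumes "a * d - b * c = 1" "4 dvd c" "e = 1 \<or> e = -1"
  shows "chi_m8 (d - b * (c + 4 * e * d)) = (if even b then 1 else -1) * chi_m8 (d - b * c)"
proof (cases "even b")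
  case True
  then obtain k where "b = 2 * k" by auto
  hence "(d - b * (c + 4 * e * d)) - (d - b * c) = 8 * (- k * e * d)" by (simp add: algebra_simps)
  hence "chi_m8 (d - b * (c + 4 * e * d)) = chi_m8 (d - b * c)"
    by (intro chi_m8_cong) (simp only: cong_iff_dvd_diff dvd_triv_left)
  thus ?thesis using True by simp
next
  case False
  have odd_d: "odd d" by (rule Gamma0_4_odd[OF assms(1,2)])
  have "even c" using assms(2) by (auto elim!: dvdE)
  hence o: "odd (d - b * c)" using odd_d by simp
  have "odd (b * e * d)" using False odd_d assms(3) by auto
  then obtain k where k: "b * e * d = 2 * k + 1" by (elim oddE)
  have "(d - b * (c + 4 * e * d)) - (d - b * c + 4) = - 4 * (b * e * d) - 4" by (simp add: algebra_simps)
  also have "\<dots> = 8 * (- k - 1)" unfolding k by simp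
  finally have "chi_m8 (d - b * (c + 4 * e * d)) = chi_m8 (d - b * c + 4)"
    by (intro chi_m8_cong) (simp only: cong_iff_dvd_diff dvd_triv_left)
  thus ?thesis using chi_m8_add_4[OF o] False by simp
qed

lemma mob_T: "mob (a, a + b, c, c + d) z = mob (a, b, c, d) (z + 1)"
  and aut_T: "of_int c * z + of_int (c + d) = of_int c * (z + 1) + of_int d"
  by (simp_all add: mob_def algebra_simps)

lemma mob_T_inv: "mob (a, b - a, c, d - c) z = mob (a, b, c, d) (z - 1)"
  and aut_T_inv: "of_int c * z + of_int (d - c) = of_int c * (z - 1) + of_int d"
  by (simp_all add: mob_def algebra_simps)

lemma mob_U:
  assumes "Im z > 0"
  shows "mob (a + n * b, b, c + n * d, d) z = mob (a, b, c, d) (z / (of_int n * z + 1))"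
    and "of_int (c + n * d) * z + of_int d = (of_int n * z + 1) * (of_int c * (z / (of_int n * z + 1)) + of_int d)"
proof -
  have nz: "of_int n * z + 1 \<noteq> 0" using Im_pos_linear_nonzero[OF assms(1), of n 1] by simp
  have *: "of_int (p + n * q) * z + of_int q = (of_int n * z + 1) * (of_int p * (z / (of_int n * z + 1)) + of_int q)" for p q
    using nz by (simp add: field_simps) 
  show "of_int (c + n * d) * z + of_int d = (of_int n * z + 1) * (of_int c * (z / (of_int n * z + 1)) + of_int d)" by (rule *)
  show "mob (a + n * b, b, c + n * d, d) z = mob (a, b, c, d) (z / (of_int n * z + 1))"
    unfolding mob_def prod.case * using nz by simp
qed

lemma Im_U_pos: "Im z > 0 \<Longrightarrow> Im (z / (of_int n * z + 1)) > 0"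
proof -
  assume z: "Im z > 0"
  have "(1, 0, n, 1) \<in> SL2Z" by (simp add: SL2Z_iff)
  from Im_mob_pos[OF this z] show ?thesis by (simp add: mob_def)
qed

lemma csqrt_mult_self: "csqrt w * a * (csqrt w * b) = w * (a * b)"
proof -
  have "csqrt w * a * (csqrt w * b) = (csqrt w * csqrt w) * (a * b)" by (simp only: mult_ac)
  thus ?thesis by (simp only: csqrt_times_self)
qed

lemma U_inverse:
  fixes n :: int
  assumes "Im z > 0"
  defines "w \<equiv> z / (of_int (- n) * z + 1)"
  shows "z = w / (of_int n * w + 1)" "of_int (- n) * z + 1 = 1 / (of_int n * w + 1)" "of_int n * w + 1 \<noteq> 0"
proof -
  have nz: "of_int (- n) * z + 1 \<noteq> 0" using Im_pos_linear_nonzero[OF assms(1), of "- n" 1] by simp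
  have *: "of_int n * w + 1 = 1 / (of_int (- n) * z + 1)" using nz by (simp add: w_def field_simps)
  show "of_int n * w + 1 \<noteq> 0" "of_int (- n) * z + 1 = 1 / (of_int n * w + 1)" using nz by (simp_all add: *)
  show "z = w / (of_int n * w + 1)" using nz by (simp add: * ) (simp add: w_def)
qed

theorem ramanujan_phi_squared_modular:
  assumes "a * d - b * c = 1" "4 dvd c" "Im z > 0"
  shows "ramanujan_phi (mob (a, b, c, d) z) ^ 2 = of_int (chi_m4 d) * (of_int c * z + of_int d) * ramanujan_phi z ^ 2"
  using assms
proof (induction arbitrary: z rule: Gamma0_4_induct)
  case one thus ?case by (simp add: mob_def chi_m4_def)
next
  case minus_one thus ?case by (simp add: mob_def chi_m4_def)
next
  case (T a b c d)
  thus ?case using T.IH[of "z + 1"] unfolding mob_T aut_T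
    by (simp add: ramanujan_phi_periodic chi_m4_add_4 add.commute[of c d])
next
  case (T_inv a b c d)
  have "chi_m4 (d - c) = chi_m4 d" using chi_m4_add_4[of c "d - c"] T_inv.hyps by simp
  thus ?case using T_inv.IH[of "z - 1"] T_inv.prems ramanujan_phi_periodic[of "z - 1"] unfolding mob_T_inv aut_T_inv by simp
next
  case (U a b c d)
  define w where "w = z / (of_int 4 * z + 1)"
  have w: "Im w > 0" unfolding w_def by (rule Im_U_pos[OF U.prems])
  have "ramanujan_phi w ^ 2 = (4 * z + 1) * ramanujan_phi z ^ 2"
    using ramanujan_phi_U[OF U.prems] by (simp add: w_def power_mult_distrib)
  thus ?case using U.IH[OF w] mob_U(1)[OF U.prems, of a 4 b c d] mob_U(2)[OF U.prems, of c 4 d] unfolding w_def[symmetric] by (simp add: mult_ac)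
next
  case (U_inv a b c d)
  define w where "w = z / (of_int (-4) * z + 1)"
  have w: "Im w > 0" unfolding w_def by (rule Im_U_pos[OF U_inv.prems])
  note inv = U_inverse[OF U_inv.prems, of 4, folded w_def]
  have "ramanujan_phi z ^ 2 = (of_int 4 * w + 1) * ramanujan_phi w ^ 2"
    by (subst inv(1)) (use ramanujan_phi_U[OF w] in \<open>simp add: power_mult_distrib\<close>)
  hence "ramanujan_phi w ^ 2 = (of_int (- 4) * z + 1) * ramanujan_phi z ^ 2"
    unfolding inv(2) using inv(3) by simp
  thus ?case using U_inv.IH[OF w] mob_U(1)[OF U_inv.prems, of a "-4" b c d] mob_U(2)[OF U_inv.prems, of c "-4" d] unfolding w_def[symmetric] by (simp add: mult_ac)
qed

text \<open>The products \<open>\<phi>(z) \<phi>(2z)\<close> and \<open>\<phi>(z + 1/2) \<phi>(2z)\<close> in the variable \<open>w = 2z\<close>. In terms of \<open>w\<close> the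
  group is \<open>Gamma0 4\<close>, for which generators are available, but \<open>w \<mapsto> w + 1\<close> exchanges the two products, so
  they have to be treated together.\<close>

definition phi_pair :: "int \<Rightarrow> complex \<Rightarrow> complex"
  where "phi_pair b w = ramanujan_phi (if even b then w / 2 else w / 2 + 1 / 2) * ramanujan_phi w"

lemma phi_pair_T: "phi_pair b (w + 1) = phi_pair (b + 1) w"
  using ramanujan_phi_periodic[of w] ramanujan_phi_periodic[of "w / 2"]
  by (auto simp: phi_pair_def add_divide_distrib algebra_simps)

lemma phi_pair_U:
  assumes w: "Im w > 0"
  shows "phi_pair b (w / (4 * w + 1)) = (if even b then 1 else -1) * (4 * w + 1) * phi_pair b w"
proof -
  define z where "z = w / 2"
  have z: "Im z > 0" using w by (simp add: z_def)
  have w8: "4 * w + 1 = 8 * z + 1" by (simp add: z_def)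
  have half: "w / (4 * w + 1) / 2 = z / (8 * z + 1)" unfolding w8 by (simp add: z_def)
  show ?thesis
    unfolding phi_pair_def half ramanujan_phi_U[OF w] z_def[symmetric]
    using ramanujan_phi_U2[OF z] csqrt_mult_self[of "8 * z + 1" "ramanujan_phi z" "ramanujan_phi w"]
      csqrt_mult_self[of "8 * z + 1" "ramanujan_phi (z + 1 / 2)" "ramanujan_phi w"]
    by (simp add: w8 csqrt_times_self)
qed

text \<open>The parity of \<open>b\<close> tells which of the two products results. Replacing \<open>d\<close> by \<open>d - b c\<close> in the character
  accounts for the sign that \<open>U\<close> produces when \<open>b\<close> is odd.\<close>

lemma phi_pair_modular:
  assumes "a * d - b * c = 1" "4 dvd c" "Im w > 0"
  shows "phi_pair 0 (mob (a, b, c, d) w) = of_int (chi_m8 (d - b * c)) * (of_int c * w + of_int d) * phi_pair b w"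
  using assms
proof (induction arbitrary: w rule: Gamma0_4_induct)
  case one thus ?case by (simp add: mob_def chi_m8_def)
next
  case minus_one thus ?case by (simp add: mob_def chi_m8_def)
next
  case (T a b c d)
  have ac: "8 dvd c * (a - 1)"
  proof -
    have "odd a" using Gamma0_4_odd(1)[OF T.hyps] .
    then obtain i where "a - 1 = 2 * i" by (metis oddE add_diff_cancel_right')
    moreover obtain j where "c = 4 * j" using T.hyps by auto
    ultimately show ?thesis by simp
  qed
  have "chi_m8 (c + d - (a + b) * c) = chi_m8 (d - b * c)"
  proof (rule chi_m8_cong)
    have "c + d - (a + b) * c - (d - b * c) = - (c * (a - 1))" by (simp add: algebra_simps)
    thus "[c + d - (a + b) * c = d - b * c] (mod 8)" using ac by (simp only: cong_iff_dvd_diff dvd_minus_iff)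
  qed
  moreover have "phi_pair (a + b) w = phi_pair b (w + 1)"
  proof -
    have "odd a" using Gamma0_4_odd(1)[OF T.hyps] .
    hence "phi_pair (a + b) w = phi_pair (b + 1) w" by (simp add: phi_pair_def)
    thus ?thesis by (simp add: phi_pair_T)
  qed
  ultimately show ?case using T.IH[of "w + 1"] T.prems unfolding mob_T aut_T by simp
next
  case (T_inv a b c d)
  have odd: "odd a" using Gamma0_4_odd(1)[OF T_inv.hyps] .
  have ac: "8 dvd c * (a - 1)"
  proof -
    obtain i where "a - 1 = 2 * i" using odd by (metis oddE add_diff_cancel_right')
    moreover obtain j where "c = 4 * j" using T_inv.hyps by auto
    ultimately show ?thesis by simp
  qed
  have "chi_m8 (d - c - (b - a) * c) = chi_m8 (d - b * c)"
  proof (rule chi_m8_cong)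
    have "d - c - (b - a) * c - (d - b * c) = c * (a - 1)" by (simp add: algebra_simps)
    thus "[d - c - (b - a) * c = d - b * c] (mod 8)" using ac by (simp only: cong_iff_dvd_diff)
  qed
  moreover have "phi_pair (b - a) w = phi_pair b (w - 1)"
    using phi_pair_T[of b "w - 1"] phi_pair_T[of "b - 1" "w - 1"] odd by (simp add: phi_pair_def)
  ultimately show ?case using T_inv.IH[of "w - 1"] T_inv.prems unfolding mob_T_inv aut_T_inv by simp
next
  case (U a b c d)
  define v where "v = w / (of_int 4 * w + 1)"
  have v: "Im v > 0" unfolding v_def by (rule Im_U_pos[OF U.prems])
  have chi: "of_int (chi_m8 (d - b * (c + 4 * d))) = (if even b then 1 else -1) * (of_int (chi_m8 (d - b * c)) :: complex)"
    using chi_m8_U[of a d b c 1] U.hyps by simp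
  have pv: "phi_pair b v = (if even b then 1 else -1) * (of_int 4 * w + 1) * phi_pair b w"
    using phi_pair_U[OF U.prems, of b] by (simp add: v_def)
  have au: "of_int (c + 4 * d) * w + of_int d = (of_int 4 * w + 1) * (of_int c * v + of_int d)"
    unfolding v_def by (rule mob_U(2)[OF U.prems])
  have mo: "mob (a + 4 * b, b, c + 4 * d, d) w = mob (a, b, c, d) v"
    unfolding v_def by (rule mob_U(1)[OF U.prems])
  show ?case unfolding mo U.IH[OF v] au chi pv by (simp add: mult_ac)
next
  case (U_inv a b c d)
  define v where "v = w / (of_int (- 4) * w + 1)"
  have v: "Im v > 0" unfolding v_def by (rule Im_U_pos[OF U_inv.prems])
  note inv = U_inverse[OF U_inv.prems, of 4, folded v_def]
  have chi: "of_int (chi_m8 (d - b * (c - 4 * d))) = (if even b then 1 else -1) * (of_int (chi_m8 (d - b * c)) :: complex)"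
    using chi_m8_U[of a d b c "-1"] U_inv.hyps by simp
  have pw: "phi_pair b w = (if even b then 1 else -1) * (of_int 4 * v + 1) * phi_pair b v"
    using phi_pair_U[OF v, of b] inv(1) by simp
  have pv: "phi_pair b v = (if even b then 1 else -1) * (of_int (- 4) * w + 1) * phi_pair b w"
    unfolding pw inv(2) using inv(3) by simp
  have au: "of_int (c - 4 * d) * w + of_int d = (of_int (- 4) * w + 1) * (of_int c * v + of_int d)"
    using mob_U(2)[OF U_inv.prems, of c "- 4" d] by (simp add: v_def)
  have mo: "mob (a - 4 * b, b, c - 4 * d, d) w = mob (a, b, c, d) v"
    using mob_U(1)[OF U_inv.prems, of a "- 4" b c d] by (simp add: v_def)
  show ?case unfolding mo U_inv.IH[OF v] au chi by (subst pv) (simp add: mult_ac)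
qed

text \<open>Passing from \<open>z\<close> to \<open>w = 2z\<close> doubles \<open>b\<close> and halves \<open>c\<close>, so the product returns to itself.\<close>

theorem ramanujan_phi_pair_modular:
  assumes "a * d - b * c = 1" "8 dvd c" "Im z > 0"
  shows "ramanujan_phi (mob (a, b, c, d) z) * ramanujan_phi (2 * mob (a, b, c, d) z) =
           of_int (chi_m8 d) * (of_int c * z + of_int d) * (ramanujan_phi z * ramanujan_phi (2 * z))"
proof -
  obtain c' where c': "c = 2 * c'" "4 dvd c'" using assms(2) by (auto elim!: dvdE)
  have det: "a * d - (2 * b) * c' = 1" using assms(1) by (simp add: c')
  have "mob (a, 2 * b, c', d) (2 * z) = 2 * mob (a, b, c, d) z"
    by (simp add: mob_def c' algebra_simps add_divide_distrib)
  moreover have "chi_m8 (d - 2 * b * c') = chi_m8 d"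
    using c'(2) by (intro chi_m8_cong) (auto simp: cong_iff_dvd_diff elim!: dvdE)
  ultimately show ?thesis
    using phi_pair_modular[OF det c'(2), of "2 * z"] assms(3)
    by (simp add: phi_pair_def c' mult_ac)
qed

section \<open>Moderate growth at the cusps\<close>

text \<open>Boundedness near the cusp of all transforms of weight \<open>k\<close>. Only absolute values enter, so \<open>k\<close> may be
  half-integral and factors can be treated one at a time.\<close>

definition tempered :: "real \<Rightarrow> (complex \<Rightarrow> complex) \<Rightarrow> bool"
  where "tempered k f \<longleftrightarrow>
    (\<forall>\<gamma>\<in>SL2Z. \<exists>Y>0. \<exists>C\<ge>0. \<forall>z. Im z \<ge> Y \<longrightarrow> norm (f (mob \<gamma> z)) \<le> C * norm (aut \<gamma> z) powr k)"

lemma temperedI: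
  assumes "\<And>\<gamma>. \<gamma> \<in> SL2Z \<Longrightarrow> \<exists>Y>0. \<exists>C. \<forall>z. Im z \<ge> Y \<longrightarrow> norm (f (mob \<gamma> z)) \<le> C * norm (aut \<gamma> z) powr k"
  shows "tempered k f"
  unfolding tempered_def
proof
  fix \<gamma> assume "\<gamma> \<in> SL2Z"
  from assms[OF this] obtain Y C where *: "Y > 0" "\<forall>z. Im z \<ge> Y \<longrightarrow> norm (f (mob \<gamma> z)) \<le> C * norm (aut \<gamma> z) powr k" by blast
  have "\<forall>z. Im z \<ge> Y \<longrightarrow> norm (f (mob \<gamma> z)) \<le> max 0 C * norm (aut \<gamma> z) powr k"
    using *(2) by (meson max.cobounded2 mult_right_mono order_trans powr_ge_zero)
  thus "\<exists>Y>0. \<exists>C\<ge>0. \<forall>z. Im z \<ge> Y \<longrightarrow> norm (f (mob \<gamma> z)) \<le> C * norm (aut \<gamma> z) powr k"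
    using *(1) by (intro exI[of _ Y] conjI exI[of _ "max 0 C"]) auto
qed

lemma tempered_mult:
  assumes "tempered k f" "tempered l g"
  shows "tempered (k + l) (\<lambda>z. f z * g z)"
proof (rule temperedI)
  fix \<gamma> assume \<gamma>: "\<gamma> \<in> SL2Z"
  obtain Y1 C1 where 1: "Y1 > 0" "C1 \<ge> 0" "\<And>z. Im z \<ge> Y1 \<Longrightarrow> norm (f (mob \<gamma> z)) \<le> C1 * norm (aut \<gamma> z) powr k"
    using assms(1) \<gamma> unfolding tempered_def by blast
  obtain Y2 C2 where 2: "Y2 > 0" "C2 \<ge> 0" "\<And>z. Im z \<ge> Y2 \<Longrightarrow> norm (g (mob \<gamma> z)) \<le> C2 * norm (aut \<gamma> z) powr l"
    using assms(2) \<gamma> unfolding tempered_def by blast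
  have "norm (f (mob \<gamma> z) * g (mob \<gamma> z)) \<le> (C1 * C2) * norm (aut \<gamma> z) powr (k + l)" if "Im z \<ge> max Y1 Y2" for z
  proof -
    have "norm (f (mob \<gamma> z) * g (mob \<gamma> z)) \<le> (C1 * norm (aut \<gamma> z) powr k) * (C2 * norm (aut \<gamma> z) powr l)"
      unfolding norm_mult using 1 2 that by (intro mult_mono) auto
    thus ?thesis by (simp add: powr_add mult_ac)
  qed
  thus "\<exists>Y>0. \<exists>C. \<forall>z. Im z \<ge> Y \<longrightarrow> norm (f (mob \<gamma> z) * g (mob \<gamma> z)) \<le> C * norm (aut \<gamma> z) powr (k + l)"
    using 1 by (intro exI[of _ "max Y1 Y2"] conjI exI[of _ "C1 * C2"]) auto
qed

lemma tempered_add: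
  assumes "tempered k f" "tempered k g"
  shows "tempered k (\<lambda>z. f z + g z)"
proof (rule temperedI)
  fix \<gamma> assume \<gamma>: "\<gamma> \<in> SL2Z"
  obtain Y1 C1 where 1: "Y1 > 0" "C1 \<ge> 0" "\<And>z. Im z \<ge> Y1 \<Longrightarrow> norm (f (mob \<gamma> z)) \<le> C1 * norm (aut \<gamma> z) powr k"
    using assms(1) \<gamma> unfolding tempered_def by blast
  obtain Y2 C2 where 2: "Y2 > 0" "C2 \<ge> 0" "\<And>z. Im z \<ge> Y2 \<Longrightarrow> norm (g (mob \<gamma> z)) \<le> C2 * norm (aut \<gamma> z) powr k"
    using assms(2) \<gamma> unfolding tempered_def by blast
  have "norm (f (mob \<gamma> z) + g (mob \<gamma> z)) \<le> (C1 + C2) * norm (aut \<gamma> z) powr k" if "Im z \<ge> max Y1 Y2" for z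
    using norm_triangle_ineq[of "f (mob \<gamma> z)" "g (mob \<gamma> z)"] 1(3)[of z] 2(3)[of z] that by (simp add: distrib_right)
  thus "\<exists>Y>0. \<exists>C. \<forall>z. Im z \<ge> Y \<longrightarrow> norm (f (mob \<gamma> z) + g (mob \<gamma> z)) \<le> C * norm (aut \<gamma> z) powr k"
    using 1 by (intro exI[of _ "max Y1 Y2"] conjI exI[of _ "C1 + C2"]) auto
qed

lemma tempered_cmult:
  assumes "tempered k f"
  shows "tempered k (\<lambda>z. c * f z)"
proof (rule temperedI)
  fix \<gamma> assume \<gamma>: "\<gamma> \<in> SL2Z"
  obtain Y1 C1 where 1: "Y1 > 0" "C1 \<ge> 0" "\<And>z. Im z \<ge> Y1 \<Longrightarrow> norm (f (mob \<gamma> z)) \<le> C1 * norm (aut \<gamma> z) powr k"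
    using assms(1) \<gamma> unfolding tempered_def by blast
  have "norm (c * f (mob \<gamma> z)) \<le> (norm c * C1) * norm (aut \<gamma> z) powr k" if "Im z \<ge> Y1" for z
    using mult_left_mono[OF 1(3)[OF that], of "norm c"] by (simp add: norm_mult mult_ac)
  thus "\<exists>Y>0. \<exists>C. \<forall>z. Im z \<ge> Y \<longrightarrow> norm (c * f (mob \<gamma> z)) \<le> C * norm (aut \<gamma> z) powr k"
    using 1 by (intro exI[of _ Y1] conjI exI[of _ "norm c * C1"]) auto
qed

text \<open>The Hermite normal form of the product of \<open>diag (n, 1)\<close> and \<open>\<gamma>\<close>. It shows what \<open>f (n z)\<close> does at the cusp
  \<open>\<gamma>\<infinity>\<close> in terms of \<open>f\<close> at the cusp \<open>\<gamma>'\<infinity>\<close>.\<close>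

lemma dilation_hermite:
  assumes "\<gamma> \<in> SL2Z" "n > 0"
  obtains \<gamma>' :: mat2 and A D B :: int
  where "\<gamma>' \<in> SL2Z" "A > 0" "D > 0" "A * D = int n"
    "\<And>z. Im z > 0 \<Longrightarrow> of_nat n * mob \<gamma> z = mob \<gamma>' ((of_int A * z + of_int B) / of_int D)"
    "\<And>z. Im z > 0 \<Longrightarrow> aut \<gamma> z = of_int D * aut \<gamma>' ((of_int A * z + of_int B) / of_int D)"
    "fst (snd (snd \<gamma>)) = A * fst (snd (snd \<gamma>'))"
proof -
  obtain a b c d where \<gamma>: "\<gamma> = (a, b, c, d)" by (cases \<gamma>)
  have det: "a * d - b * c = 1" using assms by (simp add: \<gamma> SL2Z_iff)
  \<comment> \<open>The first column of the product is \<open>(n a, c)\<close>; a matrix in \<open>SL2Z\<close> sends \<open>(A, 0)\<close> to it.\<close>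
  define A where "A = gcd (int n * a) c"
  have "int n * a \<noteq> 0 \<or> c \<noteq> 0" using det assms(2) by auto
  hence A: "A > 0" by (auto simp: A_def gcd_pos_int)
  obtain p r where p: "int n * a = A * p" and r: "c = A * r" unfolding A_def by (meson dvdE gcd_dvd1 gcd_dvd2)
  have "gcd (A * p) (A * r) = gcd (int n * a) c" by (simp only: p r)
  hence "A = gcd (A * p) (A * r)" by (simp only: A_def)
  also have "\<dots> = A * gcd p r" using A by (simp add: gcd_mult_left)
  finally have "gcd p r = 1" using A by simp
  moreover obtain y x where "y * p + x * r = gcd p r" using bezout_int by blast
  ultimately have "p * y + r * x = 1" by (simp add: mult_ac)
  define x' where "x' = - x"
  have yx: "p * y - x' * r = 1" using \<open>p * y + r * x = 1\<close> by (simp add: x'_def mult_ac)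
  define \<gamma>' where "\<gamma>' = (p, x', r, y)"
  define D where "D = p * d - r * (int n * b)"
  define B where "B = y * (int n * b) - x' * d"
  have AD: "A * D = int n"
  proof -
    have "A * D = (A * p) * d - (A * r) * (int n * b)" by (simp add: D_def algebra_simps)
    also have "\<dots> = int n * (a * d - b * c)" unfolding p[symmetric] r[symmetric] by (simp add: algebra_simps)
    finally show ?thesis by (simp add: det)
  qed
  have D: "D > 0" using AD A assms(2) by (metis of_nat_0_less_iff zero_less_mult_pos)
  have e1: "p * B + x' * D = int n * b" 
  proof -
    have "p * B + x' * D = (p * y - x' * r) * (int n * b)" by (simp add: B_def D_def algebra_simps)
    thus ?thesis by (simp add: yx)
  qed
  have e2: "r * B + y * D = d"
  proof -
    have "r * B + y * D = (p * y - x' * r) * d" by (simp add: B_def D_def algebra_simps)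
    thus ?thesis by (simp add: yx)
  qed
  have \<gamma>': "\<gamma>' \<in> SL2Z" using yx by (simp add: \<gamma>'_def SL2Z_iff)
  have num: "of_int D * (of_int p * ((of_int A * z + of_int B) / of_int D) + of_int x') = of_nat n * (of_int a * z + of_int b)" for z :: complex
  proof -
    have "of_int D * (of_int p * ((of_int A * z + of_int B) / of_int D) + of_int x') = of_int (A * p) * z + of_int (p * B + x' * D)"
      using D by (simp add: field_simps)
    also have "\<dots> = of_nat n * (of_int a * z + of_int b)" unfolding p[symmetric] e1 by (simp add: algebra_simps)
    finally show ?thesis .
  qed
  have den: "of_int D * (of_int r * ((of_int A * z + of_int B) / of_int D) + of_int y) = of_int c * z + of_int d" for z :: complex
  proof -
    have "of_int D * (of_int r * ((of_int A * z + of_int B) / of_int D) + of_int y) = of_int (A * r) * z + of_int (r * B + y * D)"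
      using D by (simp add: field_simps)
    also have "\<dots> = of_int c * z + of_int d" unfolding r[symmetric] e2 ..
    finally show ?thesis .
  qed
  show ?thesis
  proof (rule that[OF \<gamma>' A D AD])
    fix z :: complex
    show "aut \<gamma> z = of_int D * aut \<gamma>' ((of_int A * z + of_int B) / of_int D)"
      unfolding \<gamma> \<gamma>'_def aut_def prod.case den ..
    have "mob \<gamma>' ((of_int A * z + of_int B) / of_int D) =
         (of_int D * (of_int p * ((of_int A * z + of_int B) / of_int D) + of_int x')) /
         (of_int D * (of_int r * ((of_int A * z + of_int B) / of_int D) + of_int y))"
      using D by (simp add: mob_def \<gamma>'_def)
    also have "\<dots> = of_nat n * mob \<gamma> z" unfolding num den by (simp add: \<gamma> mob_def)
    finally show "of_nat n * mob \<gamma> z = mob \<gamma>' ((of_int A * z + of_int B) / of_int D)" ..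
  next
    show "fst (snd (snd \<gamma>)) = A * fst (snd (snd \<gamma>'))" by (simp add: \<gamma> \<gamma>'_def r)
  qed
qed

lemma tempered_dilation:
  assumes "tempered k f" "n > 0"
  shows "tempered k (\<lambda>z. f (of_nat n * z))"
proof (rule temperedI)
  fix \<gamma> assume \<gamma>: "\<gamma> \<in> SL2Z"
  obtain \<gamma>' A D B where h: "\<gamma>' \<in> SL2Z" "A > 0" "D > 0"
    "\<And>z. Im z > 0 \<Longrightarrow> of_nat n * mob \<gamma> z = mob \<gamma>' ((of_int A * z + of_int B) / of_int D)"
    "\<And>z. Im z > 0 \<Longrightarrow> aut \<gamma> z = of_int D * aut \<gamma>' ((of_int A * z + of_int B) / of_int D)"
    using dilation_hermite[OF \<gamma> assms(2)] by metis
  obtain Y C where Y: "Y > 0" "C \<ge> 0" "\<And>z. Im z \<ge> Y \<Longrightarrow> norm (f (mob \<gamma>' z)) \<le> C * norm (aut \<gamma>' z) powr k"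
    using assms(1) h(1) unfolding tempered_def by blast
  define Y' where "Y' = Y * real_of_int D / real_of_int A"
  have Y': "Y' > 0" using Y h by (simp add: Y'_def)
  have "norm (f (of_nat n * mob \<gamma> z)) \<le> (C * real_of_int D powr - k) * norm (aut \<gamma> z) powr k" if z: "Im z \<ge> Y'" for z
  proof -
    have z0: "Im z > 0" using z Y' by simp
    define w where "w = (of_int A * z + of_int B) / of_int D"
    have iw: "Im w = real_of_int A * Im z / real_of_int D" using h(3) by (simp add: w_def Im_divide power2_eq_square)
    have "Y * real_of_int D \<le> Im z * real_of_int A" using z h(2) by (simp add: Y'_def pos_divide_le_eq)
    hence "Im w \<ge> Y" unfolding iw using h(3) by (simp add: pos_le_divide_eq mult_ac)
    hence "norm (f (mob \<gamma>' w)) \<le> C * norm (aut \<gamma>' w) powr k" by (rule Y(3))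
    moreover have "norm (aut \<gamma> z) powr k = real_of_int D powr k * norm (aut \<gamma>' w) powr k"
      using h(5)[OF z0] h(3) by (simp add: w_def norm_mult powr_mult)
    ultimately show ?thesis using h(4)[OF z0] h(3)
      by (simp add: w_def powr_minus field_simps)
  qed
  thus "\<exists>Y>0. \<exists>C. \<forall>z. Im z \<ge> Y \<longrightarrow> norm (f (of_nat n * mob \<gamma> z)) \<le> C * norm (aut \<gamma> z) powr k"
    using Y' by blast
qed

section \<open>Growth of the theta function\<close>

text \<open>Jacobi's theta constants \<open>\<theta>\<^sub>2\<close>, \<open>\<theta>\<^sub>3\<close>, \<open>\<theta>\<^sub>4\<close>. Up to factors of modulus 1 they are permuted by the modular
  group: \<open>S\<close> exchanges 2 and 4, and \<open>T\<close> exchanges 3 and 4.\<close>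

definition theta_vec :: "nat \<Rightarrow> complex \<Rightarrow> complex" where
  "theta_vec i z = (if i = 2 then 2 * theta_two (z / 2) else if i = 3 then ramanujan_phi (z / 2) else ramanujan_phi (z / 2 + 1 / 2))"

lemma theta_vec_S:
  assumes "Im z > 0" "i \<in> {2, 3, 4}"
  shows "theta_vec i (- 1 / z) = csqrt (- \<i> * z) * theta_vec (6 - i) z"
proof -
  have z: "Im (z / 2) > 0" using assms by simp
  have e: "- 1 / z / 2 = - 1 / (4 * (z / 2))" "- 2 * \<i> * (z / 2) = - \<i> * z" by simp_all
  have "theta_vec i (- 1 / z) = (if i = 2 then 2 * theta_two (- 1 / (4 * (z / 2))) else
      if i = 3 then ramanujan_phi (- 1 / (4 * (z / 2))) else ramanujan_phi (- 1 / (4 * (z / 2)) + 1 / 2))"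
    unfolding theta_vec_def e(1) ..
  thus ?thesis using assms(2) unfolding ramanujan_phi_S[OF z] theta_four_S[OF z] e(2)
    by (auto simp: theta_vec_def)
qed

lemma norm_theta_vec_T:
  assumes "Im z > 0" "i \<in> {2, 3, 4}"
  shows "norm (theta_vec i (z + 1)) = norm (theta_vec (if i = 2 then 2 else 7 - i) z)"
proof -
  have T: "norm (dedekind_eta (w + 1)) = norm (dedekind_eta w)" for w by (simp add: dedekind_eta_plus_1 norm_mult)
  have "norm (theta_two ((z + 1) / 2)) = norm (theta_two (z / 2))"
  proof -
    have *: "4 * ((z + 1) / 2) = 2 * z + 1 + 1" "2 * ((z + 1) / 2) = z + 1" "4 * (z / 2) = 2 * z" "2 * (z / 2) = z"
      by simp_all
    show ?thesis by (simp only: theta_two_def * norm_divide norm_power T)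
  qed
  moreover have "ramanujan_phi ((z + 1) / 2 + 1 / 2) = ramanujan_phi (z / 2)"
    using ramanujan_phi_periodic[of "z / 2"] by (simp add: add_divide_distrib add_ac)
  ultimately show ?thesis using assms(2)
    by (auto simp: theta_vec_def norm_mult add_divide_distrib)
qed

lemma norm_theta_vec_mob:
  assumes "\<gamma> \<in> SL2Z" "i \<in> {2, 3, 4}"
  shows "\<exists>j\<in>{2, 3, 4}. \<forall>z. Im z > 0 \<longrightarrow> norm (theta_vec i (mob \<gamma> z)) ^ 2 = norm (aut \<gamma> z) * norm (theta_vec j z) ^ 2"
proof -
  obtain a b c d where \<gamma>: "\<gamma> = (a, b, c, d)" by (cases \<gamma>)
  have "\<exists>j\<in>{2, 3, 4}. \<forall>z. Im z > 0 \<longrightarrow> norm (theta_vec i (mob (a, b, c, d) z)) ^ 2 = norm (aut (a, b, c, d) z) * norm (theta_vec j z) ^ 2"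
    using assms(1)[unfolded \<gamma>]
  proof (induction rule: SL2Z_induct)
    case one
    show ?case using assms(2) by (intro bexI[of _ i]) (auto simp: mob_def aut_def)
  next
    case (T a b c d)
    then obtain j where j: "j \<in> {2, 3, 4}" "\<And>z. Im z > 0 \<Longrightarrow> norm (theta_vec i (mob (a, b, c, d) z)) ^ 2 = norm (aut (a, b, c, d) z) * norm (theta_vec j z) ^ 2" by blast
    have "aut (a, a + b, c, c + d) z = aut (a, b, c, d) (z + 1)" for z by (simp add: aut_def algebra_simps)
    thus ?case using j norm_theta_vec_T[OF _ j(1)]
      by (intro bexI[of _ "if j = 2 then 2 else 7 - j"]) (auto simp: mob_T)
  next
    case (T_inv a b c d)
    then obtain j where j: "j \<in> {2, 3, 4}" "\<And>z. Im z > 0 \<Longrightarrow> norm (theta_vec i (mob (a, b, c, d) z)) ^ 2 = norm (aut (a, b, c, d) z) * norm (theta_vec j z) ^ 2" by blast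
    define j' where "j' = (if j = 2 then 2 else 7 - j)"
    have j': "j' \<in> {2, 3, 4}" "(if j' = 2 then 2 else 7 - j') = j" using j(1) by (auto simp: j'_def)
    have "aut (a, b - a, c, d - c) z = aut (a, b, c, d) (z - 1)" for z by (simp add: aut_def algebra_simps)
    moreover have "norm (theta_vec j (z - 1)) = norm (theta_vec j' z)" if "Im z > 0" for z
      using norm_theta_vec_T[OF _ j'(1), of "z - 1"] j'(2) that by simp
    ultimately show ?case using j j'(1)
      by (intro bexI[of _ j']) (auto simp: mob_T_inv)
  next
    case (S a b c d)
    then obtain j where j: "j \<in> {2, 3, 4}" "\<And>z. Im z > 0 \<Longrightarrow> norm (theta_vec i (mob (a, b, c, d) z)) ^ 2 = norm (aut (a, b, c, d) z) * norm (theta_vec j z) ^ 2" by blast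
    have "norm (theta_vec i (mob (b, - a, d, - c) z)) ^ 2 = norm (aut (b, - a, d, - c) z) * norm (theta_vec (6 - j) z) ^ 2" if z: "Im z > 0" for z
    proof -
      have z0: "z \<noteq> 0" using z by auto
      have 1: "aut (b, - a, d, - c) z = z * aut (a, b, c, d) (- 1 / z)"
        using z0 by (simp add: aut_def field_simps)
      have "mob (b, - a, d, - c) z = ((of_int b * z + of_int (- a)) / z) / ((of_int d * z + of_int (- c)) / z)"
        using z0 by (simp add: mob_def)
      also have "(of_int b * z + of_int (- a)) / z = of_int a * (- 1 / z) + of_int b" using z0 by (simp add: field_simps)
      also have "(of_int d * z + of_int (- c)) / z = of_int c * (- 1 / z) + of_int d" using z0 by (simp add: field_simps)
      finally have 2: "mob (b, - a, d, - c) z = mob (a, b, c, d) (- 1 / z)" by (simp add: mob_def)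
      have "norm (csqrt (- \<i> * z)) ^ 2 = norm z"
        by (metis norm_power power2_csqrt norm_mult norm_minus_cancel norm_ii mult_1)
      thus ?thesis unfolding 1 2 j(2)[OF Im_neg_inverse[OF z]] theta_vec_S[OF z j(1)]
        by (simp add: norm_mult power_mult_distrib)
    qed
    thus ?case using j(1) by (intro bexI[of _ "6 - j"]) auto
  qed
  thus ?thesis by (simp only: \<gamma>)
qed

lemma euler_prod_bounds:
  assumes "0 \<le> r" "r < 1"
  shows "\<exists>l u. l > 0 \<and> u > 0 \<and> (\<forall>q. norm q \<le> r \<longrightarrow> l \<le> norm (euler_prod q) \<and> norm (euler_prod q) \<le> u)"
proof -
  have cont: "continuous_on (cball 0 r) (\<lambda>q. norm (euler_prod q))"
    using holomorphic_on_imp_continuous_on[OF euler_prod_holomorphic] assms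
    by (intro continuous_on_norm) (auto intro: continuous_on_subset)
  have ne: "cball 0 r \<noteq> ({} :: complex set)" using assms by auto
  obtain a where a: "a \<in> cball 0 r" "\<And>q. q \<in> cball 0 r \<Longrightarrow> norm (euler_prod a) \<le> norm (euler_prod q)"
    using continuous_attains_inf[OF compact_cball ne cont] by blast
  obtain b where b: "b \<in> cball 0 r" "\<And>q. q \<in> cball 0 r \<Longrightarrow> norm (euler_prod q) \<le> norm (euler_prod b)"
    using continuous_attains_sup[OF compact_cball ne cont] by blast
  have "euler_prod a \<noteq> 0" "euler_prod b \<noteq> 0" using a(1) b(1) assms by (auto intro!: euler_prod_nonzero)
  with a b show ?thesis by (intro exI[of _ "norm (euler_prod a)"] exI[of _ "norm (euler_prod b)"]) auto
qed

lemma norm_qexp_le: "Im z \<ge> Y \<Longrightarrow> norm (qexp z) \<le> exp (- (2 * pi * Y))"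
  by (simp add: norm_qexp)

lemma ramanujan_phi_bounded: 
  assumes "Y > 0"
  shows "\<exists>C. \<forall>z. Im z \<ge> Y \<longrightarrow> norm (ramanujan_phi z) \<le> C"
proof -
  define r where "r = exp (- (2 * pi * Y))"
  have r: "0 < r" "r < 1" using assms by (auto simp: r_def)
  have sm: "summable (\<lambda>k. r ^ Suc k)" using r by (subst summable_Suc_iff) (simp add: summable_geometric)
  have "norm (ramanujan_phi z) \<le> 1 + 2 * (\<Sum>k. r ^ Suc k)" if z: "Im z \<ge> Y" for z
  proof -
    have q: "norm (qexp z) \<le> r" unfolding r_def by (rule norm_qexp_le[OF z])
    have "norm (\<Sum>k. qexp z ^ ((Suc k)\<^sup>2)) \<le> (\<Sum>k. r ^ Suc k)"
    proof (rule norm_suminf_le[OF _ sm])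
      fix k
      have "norm (qexp z) ^ ((Suc k)\<^sup>2) \<le> r ^ ((Suc k)\<^sup>2)" using q by (intro power_mono) auto
      also have "\<dots> \<le> r ^ Suc k" using r by (intro power_decreasing) (auto simp: power2_eq_square)
      finally show "norm (qexp z ^ ((Suc k)\<^sup>2)) \<le> r ^ Suc k" by (simp only: norm_power)
    qed
    hence "norm (theta_series (qexp z)) \<le> 1 + 2 * (\<Sum>k. r ^ Suc k)"
      unfolding theta_series_def by (intro order_trans[OF norm_triangle_ineq] add_mono) (simp_all add: norm_mult)
    thus ?thesis using q r by (subst ramanujan_phi_eq_theta_series) auto
  qed
  thus ?thesis by blast
qed

lemma theta_two_bounded:
  assumes "Y > 0"
  shows "\<exists>C. \<forall>z. Im z \<ge> Y \<longrightarrow> norm (theta_two z) \<le> C"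
proof -
  define r where "r = exp (- (2 * pi * Y))"
  have r: "0 < r" "r < 1" using assms by (auto simp: r_def)
  obtain l u where lu: "l > 0" "u > 0" "\<And>q. norm q \<le> r \<Longrightarrow> l \<le> norm (euler_prod q) \<and> norm (euler_prod q) \<le> u"
    using euler_prod_bounds[OF less_imp_le[OF r(1)] r(2)] by blast
  have "norm (theta_two z) \<le> u ^ 2 / l" if z: "Im z \<ge> Y" for z
  proof -
    have z0: "Im z > 0" using z assms by simp
    have q: "norm (qexp z) \<le> r" unfolding r_def by (rule norm_qexp_le[OF z])
    hence qn: "norm (qexp z ^ n) \<le> r" if "n \<ge> 1" for n
      using power_decreasing[of 1 n "norm (qexp z)"] that r by (simp add: norm_power)
    have e: "norm (exp (of_real pi * \<i> * (4 * z) / 12)) ^ 2 / norm (exp (of_real pi * \<i> * (2 * z) / 12)) \<le> 1"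
    proof -
      have "norm (exp (of_real pi * \<i> * (4 * z) / 12)) ^ 2 / norm (exp (of_real pi * \<i> * (2 * z) / 12)) = exp (- (pi * Im z / 2))"
        by (simp add: exp_diff[symmetric] exp_of_nat_mult[symmetric] power2_eq_square exp_add[symmetric])
      also have "\<dots> \<le> 1" using z0 by simp
      finally show ?thesis .
    qed
    have "norm (theta_two z) = (norm (exp (of_real pi * \<i> * (4 * z) / 12)) ^ 2 / norm (exp (of_real pi * \<i> * (2 * z) / 12))) *
            (norm (euler_prod (qexp z ^ 4)) ^ 2 / norm (euler_prod (qexp z ^ 2)))"
      unfolding theta_two_def dedekind_eta_eq qexp_numeral_mult by (simp only: norm_divide norm_mult norm_power power_mult_distrib times_divide_times_eq)
    also have "\<dots> \<le> 1 * (u ^ 2 / l)"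
      using e lu qn[of 4] qn[of 2] by (intro mult_mono frac_le power_mono) auto
    finally show ?thesis by simp
  qed
  thus ?thesis by blast
qed

lemma theta_vec_bounded:
  assumes "i \<in> {2, 3, 4}"
  shows "\<exists>C. \<forall>z. Im z \<ge> 1 \<longrightarrow> norm (theta_vec i z) \<le> C"
proof -
  obtain C1 where C1: "\<And>z. Im z \<ge> 1/2 \<Longrightarrow> norm (ramanujan_phi z) \<le> C1" using ramanujan_phi_bounded[of "1/2"] by auto
  obtain C2 where C2: "\<And>z. Im z \<ge> 1/2 \<Longrightarrow> norm (theta_two z) \<le> C2" using theta_two_bounded[of "1/2"] by auto
  have "norm (theta_vec i z) \<le> max C1 (2 * C2)" if "Im z \<ge> 1" for z
    using C1[of "z / 2"] C1[of "z / 2 + 1 / 2"] C2[of "z / 2"] that assms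
    by (auto simp: theta_vec_def norm_mult max_def)
  thus ?thesis by blast
qed

theorem ramanujan_phi_tempered: "tempered (1/2) ramanujan_phi"
proof -
  have "tempered (1/2) (theta_vec 3)"
  proof (rule temperedI)
    fix \<gamma> assume \<gamma>: "\<gamma> \<in> SL2Z"
    obtain j where j: "j \<in> {2, 3, 4}" "\<And>z. Im z > 0 \<Longrightarrow> norm (theta_vec 3 (mob \<gamma> z)) ^ 2 = norm (aut \<gamma> z) * norm (theta_vec j z) ^ 2"
      using norm_theta_vec_mob[OF \<gamma>, of 3] by blast
    obtain C where C: "\<And>z. Im z \<ge> 1 \<Longrightarrow> norm (theta_vec j z) \<le> C" using theta_vec_bounded[OF j(1)] by blast
    have "norm (theta_vec 3 (mob \<gamma> z)) \<le> C * norm (aut \<gamma> z) powr (1/2)" if z: "Im z \<ge> 1" for z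
    proof -
      have "norm (theta_vec 3 (mob \<gamma> z)) = sqrt (norm (theta_vec 3 (mob \<gamma> z)) ^ 2)" by simp
      also have "\<dots> = norm (aut \<gamma> z) powr (1/2) * norm (theta_vec j z)"
        using z by (subst j(2)) (auto simp: real_sqrt_mult powr_half_sqrt)
      also have "\<dots> \<le> norm (aut \<gamma> z) powr (1/2) * C" using C[OF z] by (intro mult_left_mono) auto
      finally show ?thesis by (simp add: mult_ac)
    qed
    thus "\<exists>Y>0. \<exists>C. \<forall>z. Im z \<ge> Y \<longrightarrow> norm (theta_vec 3 (mob \<gamma> z)) \<le> C * norm (aut \<gamma> z) powr (1/2)"
      by (intro exI[of _ 1]) auto
  qed
  from tempered_dilation[OF this, of 2] show ?thesis by (simp add: theta_vec_def)
qed

section \<open>Growth of the division values\<close>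

text \<open>In the rows at nonzero height \<open>r/8 + m\<close> the terms decrease with \<open>Im z\<close>, so the bounds at height 1 give a
  majorant; if \<open>8\<close> divides \<open>r\<close>, the one row on the real axis does not depend on \<open>z\<close>.\<close>

lemma divval_bounded:
  assumes "\<not> (8 dvd r \<and> 8 dvd s)"
  shows "\<exists>C. \<forall>z. Im z \<ge> 1 \<longrightarrow> norm (divval r s z) \<le> C"
proof -
  have key: "\<exists>C. \<forall>z. Im z \<ge> 1 \<longrightarrow> norm (divval r s z) \<le> C"
    if M: "M summable_on UNIV" "\<And>m z. Im z \<ge> 1 \<Longrightarrow> norm (csc2 ((of_int r * z + of_int s) / 8 + of_int m * z)) \<le> M m"
    for M :: "int \<Rightarrow> real" and r s
  proof (intro exI allI impI)
    fix z assume z: "Im z \<ge> 1"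
    show "norm (divval r s z) \<le> infsum M UNIV"
    proof -
      have "(\<lambda>m. norm (csc2 ((of_int r * z + of_int s) / 8 + of_int m * z))) summable_on UNIV"
        using M(1) M(2)[OF z] by (rule Infinite_Sum.abs_summable_on_comparison_test')
      from has_sum_infsum[OF abs_summable_summable[OF this]] show ?thesis
        unfolding divval_def wsum_def by (rule norm_infsum_le[OF _ has_sum_infsum[OF M(1)]]) (rule M(2)[OF z])
    qed
  qed
  have Im: "Im ((of_int r * z + of_int s) / 8 + of_int m * z) = (real_of_int r / 8 + real_of_int m) * Im z" for r s m :: int and z
    by (simp add: field_simps)
  have sq: "1 / ((x * y)\<^sup>2) \<le> 1 / x\<^sup>2" if "x \<noteq> 0" "y \<ge> 1" for x y :: real
  proof -
    have "1\<^sup>2 \<le> y\<^sup>2" using that by (intro power_mono) auto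
    hence "x\<^sup>2 * 1 \<le> x\<^sup>2 * y\<^sup>2" by (intro mult_left_mono) auto
    thus ?thesis using that by (intro divide_left_mono) (auto simp: power_mult_distrib)
  qed
  show ?thesis
  proof (cases "8 dvd r")
    case False
    define x where "x = real_of_int r / 8"
    have x: "x + real_of_int m \<noteq> 0" for m
    proof
      assume "x + real_of_int m = 0"
      hence "real_of_int (r + 8 * m) = 0" by (simp add: x_def)
      hence "r = 8 * (- m)" by linarith
      thus False using False by simp
    qed
    have "complex_of_real x \<notin> \<int>"
    proof
      assume "complex_of_real x \<in> \<int>"
      then obtain k where "complex_of_real x = of_int k" by (elim Ints_cases)
      hence "x = of_int k" by (metis of_real_eq_iff of_real_of_int_eq)
      thus False using x[of "- k"] by simp
    qed
    from csc2_partial_fractions[OF this]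
    have "(\<lambda>m::int. 1 / (complex_of_real x + of_int m)\<^sup>2) summable_on UNIV" by (rule has_sum_imp_summable)
    hence "(\<lambda>m::int. norm (1 / (complex_of_real x + of_int m)\<^sup>2)) summable_on UNIV"
      by (simp only: summable_on_iff_abs_summable_on_complex)
    moreover have "norm (1 / (complex_of_real x + of_int m)\<^sup>2) = 1 / (x + real_of_int m)\<^sup>2" for m
    proof -
      have "complex_of_real x + of_int m = of_real (x + real_of_int m)" by simp
      thus ?thesis by (simp only: norm_divide norm_power norm_of_real norm_one power2_abs)
    qed
    ultimately have S: "(\<lambda>m::int. 1 / (x + real_of_int m)\<^sup>2) summable_on UNIV" by simp
    show ?thesis
    proof (rule key[OF S])
      fix m :: int and z assume z: "Im z \<ge> 1"
      have "norm (csc2 ((of_int r * z + of_int s) / 8 + of_int m * z)) \<le> 1 / ((x + real_of_int m) * Im z)\<^sup>2"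
        using norm_csc2_le[of "(of_int r * z + of_int s) / 8 + of_int m * z"] x[of m] z unfolding Im x_def by simp
      also have "\<dots> \<le> 1 / (x + real_of_int m)\<^sup>2" by (rule sq[OF x z])
      finally show "norm (csc2 ((of_int r * z + of_int s) / 8 + of_int m * z)) \<le> 1 / (x + real_of_int m)\<^sup>2" .
    qed
  next
    case True
    define M where "M = (\<lambda>m::int. (max 1 (real_of_int \<bar>m\<bar>)) powr -2 + (if m = 0 then norm (csc2 (of_int s / 8)) else 0))"
    have S: "M summable_on UNIV"
      unfolding M_def
    proof (rule summable_on_add)
      show "(\<lambda>m::int. max 1 (real_of_int \<bar>m\<bar>) powr -2) summable_on UNIV" by (rule summable_on_int_powr) simp
      show "(\<lambda>m::int. if m = 0 then norm (csc2 (of_int s / 8)) else 0) summable_on UNIV"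
        by (rule finite_nonzero_values_imp_summable_on) (rule finite_subset[of _ "{0}"], auto)
    qed
    have "\<exists>C. \<forall>z. Im z \<ge> 1 \<longrightarrow> norm (divval 0 s z) \<le> C"
    proof (rule key[OF S])
      fix m :: int and z assume z: "Im z \<ge> 1"
      show "norm (csc2 ((of_int 0 * z + of_int s) / 8 + of_int m * z)) \<le> M m"
      proof (cases "m = 0")
        case False
        have "norm (csc2 ((of_int 0 * z + of_int s) / 8 + of_int m * z)) \<le> 1 / (real_of_int m * Im z)\<^sup>2"
          using norm_csc2_le[of "(of_int 0 * z + of_int s) / 8 + of_int m * z"] False z unfolding Im by simp
        also have "\<dots> \<le> 1 / (real_of_int m)\<^sup>2" using False z by (intro sq) auto
        also have "\<dots> = M m" using False by (auto simp: M_def powr_minus max_def divide_inverse)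
        finally show ?thesis .
      qed (simp add: M_def)
    qed
    moreover have "divval r s z = divval 0 s z" for z
      using True by (intro divval_cong) (auto simp: cong_0_iff)
    ultimately show ?thesis by simp
  qed
qed

lemma divval_diff_tempered:
  assumes "\<not> (8 dvd r \<and> 8 dvd s)" "\<not> (8 dvd r' \<and> 8 dvd s')"
  shows "tempered 2 (\<lambda>z. divval r s z - divval r' s' z)"
proof (rule temperedI)
  fix \<gamma> assume "\<gamma> \<in> SL2Z"
  then obtain a b c d where \<gamma>: "\<gamma> = (a, b, c, d)" "(a, b, c, d) \<in> SL2Z" by (cases \<gamma>) auto
  have det: "a * d - b * c = 1" using \<gamma>(2) by (simp add: SL2Z_iff)
  obtain C1 where C1: "\<And>z. Im z \<ge> 1 \<Longrightarrow> norm (divval (r * a + s * c) (r * b + s * d) z) \<le> C1"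
    using divval_bounded[of "r * a + s * c" "r * b + s * d"] mod_8_pair_SL2Z[OF det, of r s] assms(1) by blast
  obtain C2 where C2: "\<And>z. Im z \<ge> 1 \<Longrightarrow> norm (divval (r' * a + s' * c) (r' * b + s' * d) z) \<le> C2"
    using divval_bounded[of "r' * a + s' * c" "r' * b + s' * d"] mod_8_pair_SL2Z[OF det, of r' s'] assms(2) by blast
  have "norm (divval r s (mob \<gamma> z) - divval r' s' (mob \<gamma> z)) \<le> (C1 + C2) * norm (aut \<gamma> z) powr 2" if z: "Im z \<ge> 1" for z
  proof -
    have z0: "Im z > 0" using z by simp
    have a0: "norm (aut \<gamma> z) > 0" using aut_nonzero[of \<gamma> z] \<gamma> z0 by simp
    have "divval r s (mob \<gamma> z) - divval r' s' (mob \<gamma> z) =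
        (aut \<gamma> z)\<^sup>2 * (divval (r * a + s * c) (r * b + s * d) z - divval (r' * a + s' * c) (r' * b + s' * d) z)"
      unfolding \<gamma>(1) divval_mob[OF \<gamma>(2) z0 assms(1)] divval_mob[OF \<gamma>(2) z0 assms(2)]
      by (simp add: aut_def algebra_simps)
    also have "norm \<dots> \<le> norm (aut \<gamma> z) ^ 2 * (C1 + C2)"
      unfolding norm_mult norm_power
      by (intro mult_left_mono order_trans[OF norm_triangle_ineq4] add_mono C1 C2 z) auto
    also have "norm (aut \<gamma> z) ^ 2 = norm (aut \<gamma> z) powr 2" using a0 by simp
    finally show ?thesis by (simp add: mult_ac)
  qed
  thus "\<exists>Y>0. \<exists>C. \<forall>z. Im z \<ge> Y \<longrightarrow> norm (divval r s (mob \<gamma> z) - divval r' s' (mob \<gamma> z)) \<le> C * norm (aut \<gamma> z) powr 2"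
    by (intro exI[of _ 1]) auto
qed

section \<open>A maximum principle for the modular group\<close>

text \<open>Among the finitely many values \<open>\<bar>c z + d\<bar> \<le> 1\<close> the least one is chosen; then the translate has
  \<open>\<bar>w\<bar> \<ge> 1\<close>, since otherwise \<open>S\<close> would lower the value. The bound \<open>1/2\<close> for the height is a rounding of
  \<open>sqrt 3 / 2\<close>.\<close>

lemma SL2Z_fundamental:
  assumes z: "Im z > 0"
  shows "\<exists>\<gamma>\<in>SL2Z. \<bar>Re (mob \<gamma> z)\<bar> \<le> 1 / 2 \<and> Im (mob \<gamma> z) \<ge> 1 / 2"
proof -
  obtain c where c: "0 < c" "c \<le> 1"
    "\<And>m n::int. c * max \<bar>real_of_int m\<bar> \<bar>real_of_int n\<bar> \<le> norm (of_int m * z + of_int n)"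
    using lattice_norm_bound[OF z] by blast
  define N where "N = \<lceil>1 / c\<rceil>"
  define V where "V = {norm (aut \<gamma> z) | \<gamma>. \<gamma> \<in> SL2Z \<and> norm (aut \<gamma> z) \<le> 1}"
  have "V \<subseteq> (\<lambda>(m, n). norm (of_int m * z + of_int n)) ` ({-N..N} \<times> {-N..N})"
  proof
    fix x assume "x \<in> V"
    then obtain p q m n where *: "x = norm (of_int m * z + of_int n)" "norm (of_int m * z + of_int n) \<le> 1"
      unfolding V_def by (auto simp: aut_def)
    have "max \<bar>real_of_int m\<bar> \<bar>real_of_int n\<bar> \<le> 1 / c"
      using order_trans[OF c(3)[of m n] *(2)] by (simp only: pos_le_divide_eq[OF c(1)] mult.commute[of _ c])
    hence "\<bar>real_of_int m\<bar> \<le> real_of_int N" "\<bar>real_of_int n\<bar> \<le> real_of_int N" unfolding N_def by linarith+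
    hence "m \<in> {-N..N}" "n \<in> {-N..N}" by auto
    thus "x \<in> (\<lambda>(m, n). norm (of_int m * z + of_int n)) ` ({-N..N} \<times> {-N..N})" using * by auto
  qed
  hence fin: "finite V" by (rule finite_subset) auto
  have "1 \<in> V" unfolding V_def by (intro CollectI exI[of _ "(1, 0, 0, 1)"]) (simp add: aut_def SL2Z_iff)
  hence ne: "V \<noteq> {}" by auto
  obtain \<gamma>0 where g0: "\<gamma>0 \<in> SL2Z" "norm (aut \<gamma>0 z) = Min V" using Min_in[OF fin ne] unfolding V_def by auto
  have min: "norm (aut \<gamma>0 z) \<le> norm (aut \<gamma> z)" if "\<gamma> \<in> SL2Z" for \<gamma>
  proof (cases "norm (aut \<gamma> z) \<le> 1")
    case True
    hence "norm (aut \<gamma> z) \<in> V" unfolding V_def using that by blast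
    thus ?thesis unfolding g0(2) by (rule Min_le[OF fin])
  next
    case False
    thus ?thesis using Min_le[OF fin \<open>1 \<in> V\<close>] g0(2) by simp
  qed
  define k where "k = - round (Re (mob \<gamma>0 z))"
  define T :: mat2 where "T = (1, k, 0, 1)"
  have T: "T \<in> SL2Z" by (simp add: T_def SL2Z_iff)
  define \<gamma> where "\<gamma> = mat_times T \<gamma>0"
  have \<gamma>: "\<gamma> \<in> SL2Z" unfolding \<gamma>_def by (rule mat_times_SL2Z[OF T g0(1)])
  define w where "w = mob \<gamma> z"
  have w: "w = mob \<gamma>0 z + of_int k" "aut \<gamma> z = aut \<gamma>0 z"
    unfolding w_def \<gamma>_def mob_mat_times[OF T g0(1) z] aut_mat_times[OF T g0(1) z] by (simp_all add: T_def mob_def aut_def)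
  have Imw: "Im w > 0" unfolding w_def by (rule Im_mob_pos[OF \<gamma> z])
  have re: "\<bar>Re w\<bar> \<le> 1 / 2"
    using of_int_round_abs_le[of "Re (mob \<gamma>0 z)"] by (simp add: w(1) k_def abs_minus_commute)
  define S :: mat2 where "S = (0, -1, 1, 0)"
  have S: "S \<in> SL2Z" by (simp add: S_def SL2Z_iff)
  have "norm (aut \<gamma>0 z) \<le> norm (aut (mat_times S \<gamma>) z)" by (rule min[OF mat_times_SL2Z[OF S \<gamma>]])
  also have "\<dots> = norm w * norm (aut \<gamma>0 z)"
    unfolding aut_mat_times[OF S \<gamma> z] w(2) by (simp add: S_def aut_def w_def norm_mult)
  finally have "norm w \<ge> 1" using aut_nonzero[OF g0(1) z] by simp
  hence "1 \<le> norm w ^ 2" by simp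
  also have "\<dots> = \<bar>Re w\<bar> ^ 2 + Im w ^ 2" by (simp add: cmod_power2)
  also have "\<bar>Re w\<bar> ^ 2 \<le> (1 / 2) ^ 2" using re by (intro power_mono) auto
  finally have "(1 / 2)\<^sup>2 \<le> Im w ^ 2" by (simp add: power2_eq_square)
  hence "1 / 2 \<le> Im w" using less_imp_le[OF Imw] by (rule power2_le_imp_le)
  thus ?thesis using \<gamma> re unfolding w_def by blast
qed

text \<open>If \<open>h\<close> does not vanish, its modulus takes its supremum on a compact rectangle, because every orbit meets
  a strip of width 1 above height \<open>1/2\<close>, and \<open>h\<close> is small high up in this strip. The maximum modulus principle makes \<open>h\<close> constant, and decay forces the
  constant to be 0.\<close>

lemma invariant_decaying_eq_0:
  assumes hol: "h holomorphic_on upper_half_plane"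
    and inv: "\<And>\<gamma> z. \<gamma> \<in> SL2Z \<Longrightarrow> Im z > 0 \<Longrightarrow> norm (h (mob \<gamma> z)) = norm (h z)"
    and decay: "\<And>e. e > 0 \<Longrightarrow> \<exists>Y. \<forall>z. Im z \<ge> Y \<longrightarrow> norm (h z) < e"
    and z0: "Im z0 > 0"
  shows "h z0 = 0"
proof (rule ccontr)
  assume nz: "h z0 \<noteq> 0"
  have opn: "open upper_half_plane" unfolding upper_half_plane_def by (rule open_halfspace_Im_gt)
  have conn: "connected upper_half_plane"
    unfolding upper_half_plane_def by (rule convex_connected[OF convex_halfspace_Im_gt])
  obtain Y where Y: "\<And>z. Im z \<ge> Y \<Longrightarrow> norm (h z) < norm (h z0)" using decay[of "norm (h z0)"] nz by auto
  define K where "K = cbox (Complex (-1/2) (1/2)) (Complex (1/2) Y)"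
  have K: "z \<in> K \<longleftrightarrow> \<bar>Re z\<bar> \<le> 1/2 \<and> 1/2 \<le> Im z \<and> Im z \<le> Y" for z
    unfolding K_def by (auto simp: in_cbox_complex_iff abs_le_iff)
  have Ksub: "K \<subseteq> upper_half_plane" by (auto simp: K upper_half_plane_def)
  have to_K: "\<exists>w. norm (h w) = norm (h z) \<and> (w \<in> K \<or> norm (h z) < norm (h z0))" if "Im z > 0" for z
  proof -
    obtain \<gamma> where g: "\<gamma> \<in> SL2Z" "\<bar>Re (mob \<gamma> z)\<bar> \<le> 1 / 2" "Im (mob \<gamma> z) \<ge> 1 / 2" using SL2Z_fundamental[OF \<open>Im z > 0\<close>] by blast
    have "mob \<gamma> z \<in> K \<or> norm (h (mob \<gamma> z)) < norm (h z0)" using g Y[of "mob \<gamma> z"] by (cases "Im (mob \<gamma> z) \<le> Y") (auto simp: K)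
    thus ?thesis using inv[OF g(1) that] by (intro exI[of _ "mob \<gamma> z"]) auto
  qed
  obtain w0 where w0: "w0 \<in> K" "norm (h w0) = norm (h z0)" using to_K[OF z0] by auto
  have "continuous_on K (\<lambda>z. norm (h z))"
    using holomorphic_on_imp_continuous_on[OF hol] Ksub by (intro continuous_on_norm) (auto intro: continuous_on_subset)
  then obtain z1 where z1: "z1 \<in> K" "\<And>z. z \<in> K \<Longrightarrow> norm (h z) \<le> norm (h z1)"
    using continuous_attains_sup[of K "\<lambda>z. norm (h z)"] w0(1) unfolding K_def by (metis compact_cbox empty_iff)
  have max: "norm (h z) \<le> norm (h z1)" if z: "z \<in> upper_half_plane" for z
  proof -
    have "Im z > 0" using z by (simp add: upper_half_plane_def)
    from to_K[OF this] obtain w where "norm (h w) = norm (h z)" "w \<in> K \<or> norm (h z) < norm (h z0)" by blast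
    thus ?thesis using z1(2)[of w] z1(2)[OF w0(1)] w0(2) by auto
  qed
  have "h constant_on upper_half_plane"
    by (rule maximum_modulus_principle[OF hol opn conn opn order_refl _ max]) (use z1 Ksub in auto)
  then obtain c where c: "\<And>z. z \<in> upper_half_plane \<Longrightarrow> h z = c" unfolding constant_on_def by blast
  have "h z0 = c" using z0 by (intro c) (simp add: upper_half_plane_def)
  moreover have "h (Complex 0 (max 1 Y)) = c" by (intro c) (simp add: upper_half_plane_def)
  moreover have "norm (h (Complex 0 (max 1 Y))) < norm (h z0)" by (rule Y) simp
  ultimately show False by simp
qed

lemma holomorphic_prod_eq_0:
  assumes "open S" "connected S" "finite R" "\<And>i. i \<in> R \<Longrightarrow> f i holomorphic_on S"
  assumes "\<And>z. z \<in> S \<Longrightarrow> (\<Prod>i\<in>R. f i z) = 0" "S \<noteq> {}"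
  shows "\<exists>i\<in>R. \<forall>z\<in>S. f i z = 0"
  using assms(3,4,5)
proof (induction R rule: finite_induct)
  case empty
  thus ?case using assms(6) by auto
next
  case (insert i R)
  show ?case
  proof (cases "\<forall>z\<in>S. f i z = 0")
    case False
    then obtain a where a: "a \<in> S" "f i a \<noteq> 0" by blast
    define g where "g z = (\<Prod>i\<in>R. f i z)" for z
    have ghol: "g holomorphic_on S" unfolding g_def using insert.prems by (intro holomorphic_intros) auto
    have "continuous_on S (f i)" using insert.prems by (intro holomorphic_on_imp_continuous_on) auto
    hence "open (S \<inter> f i -` (- {0}))"
      using assms(1) by (intro continuous_open_preimage) auto
    then obtain e where e: "e > 0" "ball a e \<subseteq> S \<inter> f i -` (- {0})"
      using a unfolding open_contains_ball by (metis (no_types, lifting) ComplI IntI singletonD vimageI)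
    have "g z = 0" if "z \<in> ball a e" for z
    proof -
      have "z \<in> S" "f i z \<noteq> 0" using e(2) that by auto
      thus ?thesis using insert.prems(2)[of z] insert.hyps by (simp add: g_def)
    qed
    hence "g z = 0" if "z \<in> S" for z
      using analytic_continuation[OF ghol assms(1,2), of "ball a e" a z] e a that
      by (auto simp: islimpt_ball)
    hence "\<exists>i\<in>R. \<forall>z\<in>S. f i z = 0" using insert.prems by (intro insert.IH) (auto simp: g_def)
    thus ?thesis by blast
  qed auto
qed

section \<open>The vanishing bound for level 24\<close>

text \<open>One matrix for each point of the projective line over the integers modulo 24, which has 48 points; the point
  is given by the lower row.\<close>

definition coset_reps :: "mat2 list"
  where "coset_reps = [(1, 0, 0, 1), (0, -1, 1, 0), (0, -1, 1, 1), (0, -1, 1, 2), (0, -1, 1, 3), (0, -1, 1, 4), (0, -1, 1, 5), (0, -1, 1, 6), (0, -1, 1, 7), (0, -1, 1, 8), (0, -1, 1, 9), (0, -1, 1, 10), (0, -1, 1, 11), (0, -1, 1, 12), (0, -1, 1, 13), (0, -1, 1, 14), (0, -1, 1, 15), (0, -1, 1, 16), (0, -1, 1, 17), (0, -1, 1, 18), (0, -1, 1, 19), (0, -1, 1, 20), (0, -1, 1, 21), (0, -1, 1, 22), (0, -1, 1, 23), (1, -12, 2, -23), (1, -11, 2, -21), (1, -10, 2, -19), (1, -9, 2, -17), (1, -8, 2, -15), (1, -7, 2, -13), (1, -8, 3, -23), (2, -15, 3, -22), (1, -7, 3, -20), (2, -13, 3, -19), (1, -6, 3, -17), (2, -11,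 3, -16), (2, -9, 3, -13), (2, -7, 3, -10), (1, -6, 4, -23), (3, -16, 4, -21), (1, -5, 4, -19), (1, -4, 6, -23), (1, -3, 6, -17), (1, -3, 8, -23), (3, -8, 8, -21), (5, -12, 8, -19), (1, -2, 12, -23)]"

lemma coset_reps_check:
  "list_all (\<lambda>(a, b, c, d). a * d - b * c = 1) coset_reps"
  "distinct coset_reps" "length coset_reps = 48"
  "list_all (\<lambda>(a, b, c, d). list_all (\<lambda>(a', b', c', d'). (a, b, c, d) = (a', b', c', d') \<or> (c * d' - c' * d) mod 24 \<noteq> 0) coset_reps) coset_reps"
  by code_simp+

lemma coset_reps_cover_check:
  "list_all (\<lambda>c. list_all (\<lambda>d. (even c \<and> even d) \<or> (c mod 3 = 0 \<and> d mod 3 = 0) \<or>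
     list_ex (\<lambda>(a', b', c', d'). (c * d' - c' * d) mod 24 = 0) coset_reps) [0..23]) [0..23]"
  by code_simp

lemma coset_reps_SL2Z: "\<rho> \<in> set coset_reps \<Longrightarrow> \<rho> \<in> SL2Z"
  using coset_reps_check(1) by (auto simp: list_all_iff SL2Z_iff)

lemma coset_reps_one: "(1, 0, 0, 1) \<in> set coset_reps"
  by (simp add: coset_reps_def)

text \<open>The lower left entry of \<open>\<gamma> \<rho>^(-1)\<close> is \<open>c d' - d c'\<close>.\<close>

lemma same_coset:
  assumes "\<gamma> \<in> SL2Z" "\<rho> \<in> SL2Z" "\<gamma> = (a, b, c, d)" "\<rho> = (a', b', c', d')" "(c * d' - c' * d) mod 24 = 0"
  shows "\<exists>g\<in>Gamma0 24. \<gamma> = mat_times g \<rho>"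
proof -
  have det: "a * d - b * c = 1" and det': "a' * d' - b' * c' = 1" using assms by (auto simp: SL2Z_iff)
  define g where "g = (a * d' - b * c', b * a' - a * b', c * d' - d * c', d * a' - c * b')"
  have "(a * d' - b * c') * (d * a' - c * b') - (b * a' - a * b') * (c * d' - d * c') =
        (a * d - b * c) * (a' * d' - b' * c')" by (simp add: algebra_simps)
  hence "g \<in> Gamma0 24" using assms(5) det det'
    by (auto simp: Gamma0_def g_def mult.commute dvd_eq_mod_eq_0)
  moreover have "mat_times g \<rho> = \<gamma>"
  proof -
    have "x * d' * a' - y * c' * a' + (y * a' * c' - x * b' * c') = x * (a' * d' - b' * c')" for x y
      by (simp add: algebra_simps)
    have 1: "(x * d' - y * c') * a' + (y * a' - x * b') * c' = x * (a' * d' - b' * c')"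
     and 2: "(x * d' - y * c') * b' + (y * a' - x * b') * d' = y * (a' * d' - b' * c')" for x y
      by (simp_all add: algebra_simps)
    show ?thesis unfolding g_def assms(3,4) mat_times_def prod.case
      using 1[of a b] 1[of c d] 2[of a b] 2[of c d] det' by (simp add: mult.commute)
  qed
  ultimately show ?thesis by metis
qed

text \<open>A lower row is coprime, so its entries are neither both even nor both divisible by 3. For such residues
  modulo 24 a representative is found by inspection.\<close>

lemma coset_reps_cover:
  assumes "\<gamma> \<in> SL2Z"
  shows "\<exists>\<rho>\<in>set coset_reps. \<exists>g\<in>Gamma0 24. \<gamma> = mat_times g \<rho>"
proof -
  obtain a b c d where \<gamma>: "\<gamma> = (a, b, c, d)" by (cases \<gamma>)
  have det: "a * d - b * c = 1" using assms by (simp add: \<gamma> SL2Z_iff)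
  define c0 d0 where "c0 = c mod 24" and "d0 = d mod 24"
  have mem: "c0 \<in> set [0..23]" "d0 \<in> set [0..23]"
    using pos_mod_bound[of 24 c] pos_mod_bound[of 24 d] by (simp_all add: c0_def d0_def set_upto)
  have 2: "\<not> (even c0 \<and> even d0)"
  proof
    assume "even c0 \<and> even d0"
    hence "even c" "even d" by (simp_all add: c0_def d0_def dvd_mod_iff)
    hence "even (a * d - b * c)" by simp
    thus False using det by simp
  qed
  have 3: "\<not> (c0 mod 3 = 0 \<and> d0 mod 3 = 0)"
  proof
    assume "c0 mod 3 = 0 \<and> d0 mod 3 = 0"
    hence "3 dvd c" "3 dvd d" unfolding c0_def d0_def by presburger+
    hence "3 dvd a * d - b * c" by simp
    thus False using det by simp
  qed
  obtain \<rho> where \<rho>: "\<rho> \<in> set coset_reps" "case \<rho> of (a', b', c', d') \<Rightarrow> (c0 * d' - c' * d0) mod 24 = 0"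
  proof -
    note A = coset_reps_cover_check[unfolded list_all_iff, THEN bspec, OF mem(1), THEN bspec, OF mem(2)]
    have "list_ex (\<lambda>(a', b', c', d'). (c0 * d' - c' * d0) mod 24 = 0) coset_reps"
      using A 2 3 by argo
    thus ?thesis using that unfolding list_ex_iff by (elim bexE)
  qed
  obtain a' b' c' d' where r: "\<rho> = (a', b', c', d')" by (cases \<rho>)
  have "(c * d' - c' * d) mod 24 = (c0 * d' - c' * d0) mod 24"
  proof -
    have "[c * d' - c' * d = c0 * d' - c' * d0] (mod 24)"
      by (intro cong_diff cong_mult) (auto simp: cong_def c0_def d0_def)
    thus ?thesis by (simp only: cong_def)
  qed
  hence "(c * d' - c' * d) mod 24 = 0" using \<rho>(2) by (simp add: r)
  from same_coset[OF assms coset_reps_SL2Z[OF \<rho>(1)] \<gamma> r this] show ?thesis using \<rho>(1) by blast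
qed

lemma coset_reps_inequivalent:
  assumes "\<rho> \<in> set coset_reps" "\<rho>' \<in> set coset_reps" "g \<in> Gamma0 24" "\<rho> = mat_times g \<rho>'"
  shows "\<rho> = \<rho>'"
proof -
  obtain a b c d where r: "\<rho> = (a, b, c, d)" by (cases \<rho>)
  obtain a' b' c' d' where r': "\<rho>' = (a', b', c', d')" by (cases \<rho>')
  obtain p q u v where g: "g = (p, q, u, v)" by (cases g)
  have u: "24 dvd u" using assms(3) by (simp add: g Gamma0_def)
  have det: "a' * d' - b' * c' = 1" using coset_reps_SL2Z[OF assms(2)] by (simp add: r' SL2Z_iff)
  have "c = u * a' + v * c'" "d = u * b' + v * d'" using assms(4) by (simp_all add: r r' g mat_times_def)
  hence "c * d' - c' * d = u * (a' * d' - b' * c')" by (simp add: algebra_simps)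
  hence "(c * d' - c' * d) mod 24 = 0" using u det by (simp add: dvd_imp_mod_0)
  moreover have "\<forall>x\<in>set coset_reps. case x of (a', b', c', d') \<Rightarrow> (a, b, c, d) = (a', b', c', d') \<or> (c * d' - c' * d) mod 24 \<noteq> 0"
    using bspec[OF coset_reps_check(4)[unfolded list_all_iff] assms(1)] unfolding r by (simp only: prod.case)
  from bspec[OF this assms(2)] have "(a, b, c, d) = (a', b', c', d') \<or> (c * d' - c' * d) mod 24 \<noteq> 0"
    unfolding r' by (simp only: prod.case)
  ultimately show ?thesis by (simp only: r r') simp
qed

text \<open>Right multiplication acts injectively on the cosets; together with finiteness it permutes them.\<close>

lemma coset_reps_cancel:
  assumes "\<rho> \<in> set coset_reps" "\<rho>' \<in> set coset_reps" "\<gamma> \<in> SL2Z" "g \<in> Gamma0 24" "g' \<in> Gamma0 24" "\<sigma> \<in> SL2Z"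
    "mat_times \<rho> \<gamma> = mat_times g \<sigma>" "mat_times \<rho>' \<gamma> = mat_times g' \<sigma>"
  shows "\<rho> = \<rho>'"
proof -
  have assoc: "mat_times (mat_times x y) w = mat_times x (mat_times y w)" for x y w
    by (cases x; cases y; cases w) (simp add: mat_times_def algebra_simps)
  define adj :: "mat2 \<Rightarrow> mat2" where "adj x = (case x of (a, b, c, d) \<Rightarrow> (d, - b, - c, a))" for x
  have adjr: "mat_times x (adj x) = (1, 0, 0, 1)" "mat_times (adj x) x = (1, 0, 0, 1)" if "x \<in> SL2Z" for x
    using that by (cases x; simp add: adj_def mat_times_def SL2Z_iff algebra_simps)+
  have one: "mat_times x (1, 0, 0, 1) = x" "mat_times (1, 0, 0, 1) x = x" for x
    by (cases x; simp add: mat_times_def)+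
  have g'S: "g' \<in> SL2Z" using assms(5) by (auto simp: Gamma0_def SL2Z_iff)
  have "\<sigma> = mat_times (adj g') (mat_times \<rho>' \<gamma>)"
    unfolding assms(8) assoc[symmetric] adjr(2)[OF g'S] one ..
  hence "mat_times \<rho> \<gamma> = mat_times (mat_times g (adj g')) (mat_times \<rho>' \<gamma>)"
    using assms(7) by (simp add: assoc)
  hence "mat_times (mat_times \<rho> \<gamma>) (adj \<gamma>) = mat_times (mat_times (mat_times g (adj g')) (mat_times \<rho>' \<gamma>)) (adj \<gamma>)" by simp
  hence eq: "\<rho> = mat_times (mat_times g (adj g')) \<rho>'"
    unfolding assoc adjr(1)[OF assms(3)] one .
  have "mat_times g (adj g') \<in> Gamma0 24"
  proof -
    obtain a b c d where 1: "g = (a, b, c, d)" by (cases g)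
    obtain a' b' c' d' where 2: "g' = (a', b', c', d')" by (cases g')
    have "g \<in> SL2Z" "adj g' \<in> SL2Z"
      using assms(4,5) by (auto simp: 1 2 Gamma0_def SL2Z_iff adj_def mult.commute)
    hence "mat_times g (adj g') \<in> SL2Z" by (rule mat_times_SL2Z)
    thus ?thesis using assms(4,5) by (simp add: 1 2 Gamma0_def SL2Z_iff adj_def mat_times_def)
  qed
  from coset_reps_inequivalent[OF assms(1,2) this eq] show ?thesis .
qed

lemma Gamma0_subset_SL2Z: "g \<in> Gamma0 N \<Longrightarrow> g \<in> SL2Z"
  by (auto simp: Gamma0_def SL2Z_iff)

text \<open>The product \<open>P\<close> of the transforms over all cosets has weight \<open>48 k\<close> for the full modular group, up to
  factors of modulus 1, and so has \<open>\<eta>^(96k)\<close>. The coset of the identity contributes the factor \<open>q^m\<close> to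
  \<open>P\<close>, the others are bounded, and \<open>\<eta>^(96k)\<close> is of the order of \<open>q^(4k)\<close>; hence the quotient \<open>h\<close> decays
  if \<open>m > 4 k\<close>.\<close>

theorem sturm_bound:
  assumes hol: "F holomorphic_on upper_half_plane"
    and mod: "\<And>g z. g \<in> Gamma0 24 \<Longrightarrow> Im z > 0 \<Longrightarrow> norm (F (mob g z)) = norm (aut g z) ^ k * norm (F z)"
    and temp: "tempered (real k) F"
    and van: "\<And>z. Im z \<ge> 1 \<Longrightarrow> norm (F z) \<le> C * norm (qexp z) ^ m"
    and m: "m > 4 * k"
    and z: "Im z > 0"
  shows "F z = 0"
proof -
  define R where "R = set coset_reps"
  have finR: "finite R" and cardR: "card R = 48"
    using coset_reps_check(2,3) by (simp_all add: R_def distinct_card)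
  define G where "G \<rho> z = F (mob \<rho> z) / aut \<rho> z ^ k" for \<rho> z
  define P where "P z = (\<Prod>\<rho>\<in>R. G \<rho> z)" for z
  define h where "h z = P z / dedekind_eta z ^ (96 * k)" for z
  have opn: "open upper_half_plane" unfolding upper_half_plane_def by (rule open_halfspace_Im_gt)
  have conn: "connected upper_half_plane"
    unfolding upper_half_plane_def by (rule convex_connected[OF convex_halfspace_Im_gt])
  have mob_hol: "mob \<rho> holomorphic_on upper_half_plane" "aut \<rho> holomorphic_on upper_half_plane" if "\<rho> \<in> SL2Z" for \<rho>
  proof -
    obtain a b c d where r: "\<rho> = (a, b, c, d)" by (cases \<rho>)
    show "mob \<rho> holomorphic_on upper_half_plane" "aut \<rho> holomorphic_on upper_half_plane"
      using aut_nonzero[OF that] unfolding r mob_def aut_def prod.case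
      by (auto intro!: holomorphic_intros simp: upper_half_plane_def)
  qed
  have Ghol: "G \<rho> holomorphic_on upper_half_plane" if "\<rho> \<in> R" for \<rho>
  proof -
    have r: "\<rho> \<in> SL2Z" using that coset_reps_SL2Z by (simp add: R_def)
    have "F \<circ> mob \<rho> holomorphic_on upper_half_plane"
      by (rule holomorphic_on_compose_gen[OF mob_hol(1)[OF r] hol]) (use Im_mob_pos[OF r] in \<open>auto simp: upper_half_plane_def\<close>)
    hence "(\<lambda>z. F (mob \<rho> z)) holomorphic_on upper_half_plane" by (simp add: o_def)
    thus ?thesis unfolding G_def [abs_def] using aut_nonzero[OF r] mob_hol(2)[OF r]
      by (intro holomorphic_intros) (auto simp: upper_half_plane_def)
  qed
  have eta_hol: "dedekind_eta holomorphic_on upper_half_plane"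
    by (rule holomorphic_onI)
       (use has_field_derivative_dedekind_eta in \<open>auto simp: upper_half_plane_def field_differentiable_def intro: field_differentiable_at_within has_field_derivative_at_within\<close>)
  have hhol: "h holomorphic_on upper_half_plane"
    unfolding h_def [abs_def] P_def using eta_hol Ghol dedekind_eta_nonzero
    by (intro holomorphic_intros) (auto simp: upper_half_plane_def)
  have inv: "norm (h (mob \<gamma> z)) = norm (h z)" if g: "\<gamma> \<in> SL2Z" and z: "Im z > 0" for \<gamma> z
  proof -
    have "\<exists>\<sigma>\<in>R. \<exists>g\<in>Gamma0 24. mat_times \<rho> \<gamma> = mat_times g \<sigma>" if "\<rho> \<in> R" for \<rho>
      using coset_reps_cover[OF mat_times_SL2Z[OF coset_reps_SL2Z g]] that by (simp add: R_def)
    then obtain \<sigma> g' where s: "\<And>\<rho>. \<rho> \<in> R \<Longrightarrow> \<sigma> \<rho> \<in> R" "\<And>\<rho>. \<rho> \<in> R \<Longrightarrow> g' \<rho> \<in> Gamma0 24"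
      "\<And>\<rho>. \<rho> \<in> R \<Longrightarrow> mat_times \<rho> \<gamma> = mat_times (g' \<rho>) (\<sigma> \<rho>)" by metis
    have Gn: "norm (G \<rho> (mob \<gamma> z)) = norm (aut \<gamma> z) ^ k * norm (G (\<sigma> \<rho>) z)" if r: "\<rho> \<in> R" for \<rho>
    proof -
      have rS: "\<rho> \<in> SL2Z" "\<sigma> \<rho> \<in> SL2Z" "g' \<rho> \<in> SL2Z"
        using r s(1,2)[OF r] coset_reps_SL2Z Gamma0_subset_SL2Z by (auto simp: R_def)
      have m1: "mob \<rho> (mob \<gamma> z) = mob (g' \<rho>) (mob (\<sigma> \<rho>) z)"
        using mob_mat_times[OF rS(1) g z] mob_mat_times[OF rS(3,2) z] s(3)[OF r] by simp
      have "aut \<rho> (mob \<gamma> z) * aut \<gamma> z = aut (g' \<rho>) (mob (\<sigma> \<rho>) z) * aut (\<sigma> \<rho>) z"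
        using aut_mat_times[OF rS(1) g z] aut_mat_times[OF rS(3,2) z] s(3)[OF r] by simp
      hence "norm (aut \<rho> (mob \<gamma> z)) * norm (aut \<gamma> z) = norm (aut (g' \<rho>) (mob (\<sigma> \<rho>) z)) * norm (aut (\<sigma> \<rho>) z)"
        by (metis norm_mult)
      hence q: "norm (aut (g' \<rho>) (mob (\<sigma> \<rho>) z)) ^ k / norm (aut \<rho> (mob \<gamma> z)) ^ k = norm (aut \<gamma> z) ^ k / norm (aut (\<sigma> \<rho>) z) ^ k"
        using aut_nonzero[OF rS(1) Im_mob_pos[OF g z]] aut_nonzero[OF rS(2) z]
        by (simp add: frac_eq_eq flip: power_mult_distrib) (simp add: mult_ac)
      have "norm (G \<rho> (mob \<gamma> z)) = norm (aut (g' \<rho>) (mob (\<sigma> \<rho>) z)) ^ k / norm (aut \<rho> (mob \<gamma> z)) ^ k * norm (F (mob (\<sigma> \<rho>) z))"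
        unfolding G_def m1 using mod[OF s(2)[OF r] Im_mob_pos[OF rS(2) z]]
        by (simp add: norm_divide norm_power)
      thus ?thesis unfolding q by (simp add: G_def norm_divide norm_power)
    qed
    have inj: "inj_on \<sigma> R"
    proof (rule inj_onI)
      fix \<rho> \<rho>' assume *: "\<rho> \<in> R" "\<rho>' \<in> R" "\<sigma> \<rho> = \<sigma> \<rho>'"
      have r: "\<rho> \<in> set coset_reps" "\<rho>' \<in> set coset_reps" using *(1,2) by (simp_all only: R_def)
      have sS: "\<sigma> \<rho> \<in> SL2Z" by (rule coset_reps_SL2Z) (use s(1)[OF *(1)] in \<open>simp only: R_def\<close>)
      have e: "mat_times \<rho>' \<gamma> = mat_times (g' \<rho>') (\<sigma> \<rho>)" unfolding *(3) by (rule s(3)[OF *(2)])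
      show "\<rho> = \<rho>'" by (rule coset_reps_cancel[OF r g s(2)[OF *(1)] s(2)[OF *(2)] sS s(3)[OF *(1)] e])
    qed
    have img: "\<sigma> ` R = R" by (rule endo_inj_surj[OF finR]) (use s(1) inj in auto)
    have "norm (P (mob \<gamma> z)) = (\<Prod>\<rho>\<in>R. norm (aut \<gamma> z) ^ k * norm (G (\<sigma> \<rho>) z))"
      unfolding P_def prod_norm[symmetric] by (intro prod.cong refl Gn)
    also have "\<dots> = norm (aut \<gamma> z) ^ (48 * k) * (\<Prod>\<rho>\<in>R. norm (G (\<sigma> \<rho>) z))"
      by (simp add: prod.distrib cardR mult.commute flip: power_mult)
    also have "(\<Prod>\<rho>\<in>R. norm (G (\<sigma> \<rho>) z)) = (\<Prod>\<rho>\<in>R. norm (G \<rho> z))"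
      using prod.reindex[OF inj, of "\<lambda>\<rho>. norm (G \<rho> z)"] by (simp add: img)
    also have "\<dots> = norm (P z)" by (simp add: P_def prod_norm)
    finally have 1: "norm (P (mob \<gamma> z)) = norm (aut \<gamma> z) ^ (48 * k) * norm (P z)" .
    have "norm (dedekind_eta (mob \<gamma> z)) ^ (96 * k) = (norm (dedekind_eta (mob \<gamma> z)) ^ 2) ^ (48 * k)"
      by (simp flip: power_mult)
    also have "\<dots> = norm (aut \<gamma> z) ^ (48 * k) * norm (dedekind_eta z) ^ (96 * k)"
      unfolding norm_dedekind_eta_mob[OF g z] by (simp add: power_mult_distrib flip: power_mult)
    finally show ?thesis unfolding h_def norm_divide norm_power 1
      using aut_nonzero[OF g z] by simp
  qed
  have decay: "\<exists>Y. \<forall>z. Im z \<ge> Y \<longrightarrow> norm (h z) < e" if e: "e > 0" for e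
  proof -
    have "\<exists>Y C. Y > 0 \<and> C \<ge> 0 \<and> (\<forall>z. Im z \<ge> Y \<longrightarrow> norm (G \<rho> z) \<le> C)" if r: "\<rho> \<in> R" for \<rho>
    proof -
      have rS: "\<rho> \<in> SL2Z" using r coset_reps_SL2Z by (simp add: R_def)
      obtain Y C where YC: "Y > 0" "C \<ge> 0" "\<And>z. Im z \<ge> Y \<Longrightarrow> norm (F (mob \<rho> z)) \<le> C * norm (aut \<rho> z) powr real k"
        using temp rS unfolding tempered_def by blast
      have "norm (G \<rho> z) \<le> C" if "Im z \<ge> Y" for z
      proof -
        have "norm (aut \<rho> z) > 0" using aut_nonzero[OF rS, of z] that YC(1) by simp
        thus ?thesis using YC(3)[OF that] by (simp add: G_def norm_divide norm_power powr_realpow pos_divide_le_eq)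
      qed
      thus ?thesis using YC by blast
    qed
    then obtain YR CR where YR: "\<And>\<rho>. \<rho> \<in> R \<Longrightarrow> YR \<rho> > 0 \<and> CR \<rho> \<ge> 0 \<and> (\<forall>z. Im z \<ge> YR \<rho> \<longrightarrow> norm (G \<rho> z) \<le> CR \<rho>)" by metis
    \<comment> \<open>Only the coset of the identity sees the vanishing of the \<open>q\<close>-expansion.\<close>
    define I :: mat2 where "I = (1, 0, 0, 1)"
    have I: "I \<in> R" unfolding I_def R_def by (rule coset_reps_one)
    define D where "D = (\<Prod>\<rho>\<in>R - {I}. CR \<rho>)"
    have D: "D \<ge> 0" unfolding D_def using YR by (intro prod_nonneg) auto
    define Y0 where "Y0 = Max (insert 1 (YR ` R))"
    have Y0: "Y0 \<ge> 1" "\<And>\<rho>. \<rho> \<in> R \<Longrightarrow> Y0 \<ge> YR \<rho>" unfolding Y0_def using finR by auto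
    have PB: "norm (P z) \<le> C * norm (qexp z) ^ m * D" if z: "Im z \<ge> Y0" for z
    proof -
      have "norm (P z) = norm (G I z) * (\<Prod>\<rho>\<in>R - {I}. norm (G \<rho> z))"
        unfolding P_def prod_norm[symmetric] by (rule prod.remove[OF finR I])
      also have "\<dots> \<le> (C * norm (qexp z) ^ m) * D"
      proof (rule mult_mono)
        show "norm (G I z) \<le> C * norm (qexp z) ^ m"
          using van[of z] z Y0(1) by (simp add: G_def I_def mob_def aut_def)
        show "(\<Prod>\<rho>\<in>R - {I}. norm (G \<rho> z)) \<le> D" unfolding D_def
          by (rule prod_mono) (use YR Y0(2) z in \<open>fastforce intro: order_trans\<close>)
        show "0 \<le> C * norm (qexp z) ^ m" using van[of z] z Y0(1) norm_ge_zero[of "F z"] by linarith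
        show "0 \<le> (\<Prod>\<rho>\<in>R - {I}. norm (G \<rho> z))" by (intro prod_nonneg) auto
      qed
      finally show ?thesis .
    qed
    obtain l u where lu: "l > 0" "u > 0" "\<And>q. norm q \<le> exp (- (2 * pi)) \<Longrightarrow> l \<le> norm (euler_prod q) \<and> norm (euler_prod q) \<le> u"
      using euler_prod_bounds[of "exp (- (2 * pi))"] by auto
    define B where "B = \<bar>C\<bar> * D / l ^ (96 * k)"
    have B: "B \<ge> 0" using D lu by (simp add: B_def)
    have hB: "norm (h z) \<le> B * norm (qexp z)" if z: "Im z \<ge> Y0" for z
    proof -
      define r where "r = norm (qexp z)"
      have r: "r > 0" "r \<le> 1" "r \<le> exp (- (2 * pi))"
        using norm_qexp_le[of 1 z] z Y0(1) by (auto simp: r_def norm_qexp)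
      have eta: "norm (dedekind_eta z) ^ (96 * k) = r ^ (4 * k) * norm (euler_prod (qexp z)) ^ (96 * k)"
      proof -
        have "norm (exp (of_real pi * \<i> * z / 12)) ^ 24 = r"
          by (simp add: r_def norm_qexp exp_of_nat_mult[symmetric])
        hence "norm (exp (of_real pi * \<i> * z / 12)) ^ (96 * k) = r ^ (4 * k)"
          using power_mult[of "norm (exp (of_real pi * \<i> * z / 12))" 24 "4 * k"] by simp
        thus ?thesis by (simp only: dedekind_eta_eq norm_mult power_mult_distrib)
      qed
      have "l ^ (96 * k) \<le> norm (euler_prod (qexp z)) ^ (96 * k)"
        using lu(3)[of "qexp z"] lu(1) r(3) by (intro power_mono) (auto simp: r_def)
      hence etal: "r ^ (4 * k) * l ^ (96 * k) \<le> norm (dedekind_eta z) ^ (96 * k)"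
        unfolding eta using r by (intro mult_left_mono) auto
      have "norm (h z) = norm (P z) / norm (dedekind_eta z) ^ (96 * k)" by (simp add: h_def norm_divide norm_power)
      also have "\<dots> \<le> (\<bar>C\<bar> * r ^ m * D) / (r ^ (4 * k) * l ^ (96 * k))"
      proof (rule frac_le)
        have "C * r ^ m * D \<le> \<bar>C\<bar> * r ^ m * D" using r D by (intro mult_right_mono) auto
        with PB[OF z, folded r_def] show "norm (P z) \<le> \<bar>C\<bar> * r ^ m * D" by (rule order_trans)
      qed (use r lu D etal in auto)
      also have "\<dots> = B * r ^ (m - 4 * k)"
        using r m by (simp add: B_def power_diff field_simps)
      also have "r ^ (m - 4 * k) \<le> r ^ 1" using r m by (intro power_decreasing) auto
      hence "B * r ^ (m - 4 * k) \<le> B * r ^ 1" using B by (rule mult_left_mono)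
      finally show ?thesis by (simp add: r_def)
    qed
    have "((\<lambda>y. B * exp (- (2 * pi * y))) \<longlongrightarrow> B * 0) at_top"
      by (intro tendsto_mult tendsto_const filterlim_compose[OF exp_at_bot] filterlim_compose[OF filterlim_uminus_at_bot_at_top]
            filterlim_tendsto_pos_mult_at_top[OF tendsto_const _ filterlim_ident]) auto
    hence "eventually (\<lambda>y. B * exp (- (2 * pi * y)) < e) at_top"
      using e by (intro order_tendstoD) auto
    then obtain Y1 where Y1: "\<And>y. y \<ge> Y1 \<Longrightarrow> B * exp (- (2 * pi * y)) < e" by (auto simp: eventually_at_top_linorder)
    have "norm (h z) < e" if "Im z \<ge> max Y0 Y1" for z
      using hB[of z] Y1[of "Im z"] that by (simp add: norm_qexp)
    thus ?thesis by blast
  qed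
  have "P z = 0" if "z \<in> upper_half_plane" for z
    using invariant_decaying_eq_0[OF hhol inv decay, of z] dedekind_eta_nonzero[of z] that
    by (simp add: h_def upper_half_plane_def)
  hence "\<exists>\<rho>\<in>R. \<forall>z\<in>upper_half_plane. G \<rho> z = 0"
    using z by (intro holomorphic_prod_eq_0[OF opn conn finR Ghol]) (auto simp: P_def upper_half_plane_def)
  then obtain \<rho> where r: "\<rho> \<in> R" "\<And>z. Im z > 0 \<Longrightarrow> G \<rho> z = 0" by (auto simp: upper_half_plane_def)
  have rS: "\<rho> \<in> SL2Z" using r coset_reps_SL2Z by (simp add: R_def)
  obtain a b c d where abcd: "\<rho> = (a, b, c, d)" by (cases \<rho>)
  define \<rho>' where "\<rho>' = (d, - b, - c, a)"
  have r'S: "\<rho>' \<in> SL2Z" using rS by (simp add: \<rho>'_def abcd SL2Z_iff mult.commute)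
  have "mat_times \<rho> \<rho>' = (1, 0, 0, 1)" using rS by (simp add: \<rho>'_def abcd SL2Z_iff mat_times_def algebra_simps)
  hence "mob \<rho> (mob \<rho>' z) = z" using mob_mat_times[OF rS r'S z] by (simp add: mob_def)
  moreover have "F (mob \<rho> (mob \<rho>' z)) = 0"
    using r(2)[OF Im_mob_pos[OF r'S z]] aut_nonzero[OF rS Im_mob_pos[OF r'S z]] by (simp add: G_def)
  ultimately show ?thesis by simp
qed

section \<open>Integral expansions in q\<close>

text \<open>Coefficients are integers, so that equalities between them can be decided by computation.\<close>

definition qseries :: "(nat \<Rightarrow> int) \<Rightarrow> (complex \<Rightarrow> complex) \<Rightarrow> bool"
  where "qseries a f \<longleftrightarrow> (\<forall>z. Im z > 0 \<longrightarrow> (\<lambda>n. of_int (a n) * qexp z ^ n) sums f z)"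

lemma qseriesD: "qseries a f \<Longrightarrow> Im z > 0 \<Longrightarrow> (\<lambda>n. of_int (a n) * qexp z ^ n) sums f z"
  by (simp add: qseries_def)

lemma qexp_surj:
  assumes "q \<noteq> 0" "norm q < 1"
  shows "\<exists>z. Im z > 0 \<and> qexp z = q"
proof -
  define z where "z = Ln q / (2 * of_real pi * \<i>)"
  have "qexp z = q" using assms by (simp add: z_def qexp_def)
  moreover from this have "exp (- (2 * pi * Im z)) < exp 0" using assms by (simp flip: norm_qexp)
  hence "Im z > 0" by (simp add: zero_less_mult_iff)
  ultimately show ?thesis by blast
qed

lemma qseries_summable_real:
  assumes "qseries a f" "0 \<le> r" "r < 1"
  shows "summable (\<lambda>n. \<bar>real_of_int (a n)\<bar> * r ^ n)"
proof -
  define s where "s = (1 + r) / 2"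
  have s: "s > 0" "s < 1" "r < s" using assms by (auto simp: s_def)
  obtain z where z: "Im z > 0" "qexp z = of_real s" using qexp_surj[of "of_real s"] s by auto
  have "summable (\<lambda>n. of_int (a n) * complex_of_real s ^ n)"
    using qseriesD[OF assms(1) z(1)] z(2) by (simp add: sums_iff)
  from powser_insidea[OF this, of "of_real r"] show ?thesis
    using s assms by (simp add: norm_mult norm_power)
qed

lemma qseries_abs_summable:
  assumes "qseries a f" "Im z > 0"
  shows "summable (\<lambda>n. norm (of_int (a n) * qexp z ^ n))"
  using qseries_summable_real[OF assms(1), of "norm (qexp z)"] norm_qexp_less_1[OF assms(2)]
  by (simp add: norm_mult norm_power)

lemma qseries_add: "qseries a f \<Longrightarrow> qseries b g \<Longrightarrow> qseries (\<lambda>n. a n + b n) (\<lambda>z. f z + g z)"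
  unfolding qseries_def by (auto simp: distrib_right intro!: sums_add)

lemma qseries_cmult: "qseries a f \<Longrightarrow> qseries (\<lambda>n. c * a n) (\<lambda>z. of_int c * f z)"
  unfolding qseries_def using sums_mult[of "\<lambda>n. of_int (a n) * qexp z ^ n" "f z" "of_int c" for z] by (simp add: mult.assoc)

definition conv :: "(nat \<Rightarrow> int) \<Rightarrow> (nat \<Rightarrow> int) \<Rightarrow> nat \<Rightarrow> int"
  where "conv a b n = (\<Sum>i\<le>n. a i * b (n - i))"

lemma qseries_mult:
  assumes "qseries a f" "qseries b g"
  shows "qseries (conv a b) (\<lambda>z. f z * g z)"
  unfolding qseries_def
proof (intro allI impI)
  fix z assume z: "Im z > 0"
  have "(\<lambda>n. \<Sum>i\<le>n. (of_int (a i) * qexp z ^ i) * (of_int (b (n - i)) * qexp z ^ (n - i))) sums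
          ((\<Sum>n. of_int (a n) * qexp z ^ n) * (\<Sum>n. of_int (b n) * qexp z ^ n))"
    by (rule Cauchy_product_sums[OF qseries_abs_summable[OF assms(1) z] qseries_abs_summable[OF assms(2) z]])
  also have "(\<Sum>n. of_int (a n) * qexp z ^ n) = f z" using qseriesD[OF assms(1) z] by (simp add: sums_iff)
  also have "(\<Sum>n. of_int (b n) * qexp z ^ n) = g z" using qseriesD[OF assms(2) z] by (simp add: sums_iff)
  also have "(\<lambda>n. \<Sum>i\<le>n. (of_int (a i) * qexp z ^ i) * (of_int (b (n - i)) * qexp z ^ (n - i))) = (\<lambda>n. of_int (conv a b n) * qexp z ^ n)"
  proof
    fix n
    have "(\<Sum>i\<le>n. (of_int (a i) * qexp z ^ i) * (of_int (b (n - i)) * qexp z ^ (n - i))) =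
            (\<Sum>i\<le>n. of_int (a i * b (n - i)) * qexp z ^ n)"
    proof (rule sum.cong[OF refl])
      fix i assume "i \<in> {..n}"
      hence "qexp z ^ n = qexp z ^ i * qexp z ^ (n - i)" by (simp flip: power_add)
      thus "(of_int (a i) * qexp z ^ i) * (of_int (b (n - i)) * qexp z ^ (n - i)) = of_int (a i * b (n - i)) * qexp z ^ n"
        by (simp only: of_int_mult mult_ac)
    qed
    also have "\<dots> = of_int (conv a b n) * qexp z ^ n" by (simp add: conv_def sum_distrib_right)
    finally show "(\<Sum>i\<le>n. (of_int (a i) * qexp z ^ i) * (of_int (b (n - i)) * qexp z ^ (n - i))) = of_int (conv a b n) * qexp z ^ n" .
  qed
  finally show "(\<lambda>n. of_int (conv a b n) * qexp z ^ n) sums (f z * g z)" .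
qed

definition dil :: "nat \<Rightarrow> (nat \<Rightarrow> int) \<Rightarrow> nat \<Rightarrow> int"
  where "dil k a n = (if k dvd n then a (n div k) else 0)"

lemma qseries_dil:
  assumes "qseries a f" "k > 0"
  shows "qseries (dil k a) (\<lambda>z. f (of_nat k * z))"
  unfolding qseries_def
proof (intro allI impI)
  fix z assume z: "Im z > 0"
  have "(\<lambda>n. of_int (a n) * qexp (of_nat k * z) ^ n) sums f (of_nat k * z)"
    by (rule qseriesD[OF assms(1)]) (use z assms(2) in simp)
  also have "(\<lambda>n. of_int (a n) * qexp (of_nat k * z) ^ n) = (\<lambda>n. of_int (dil k a (k * n)) * qexp z ^ (k * n))"
    using assms(2) by (simp add: qexp_of_nat_mult power_mult dil_def)
  also have "\<dots> sums f (of_nat k * z) \<longleftrightarrow> (\<lambda>n. of_int (dil k a n) * qexp z ^ n) sums f (of_nat k * z)"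
    by (rule sums_mono_reindex) (use assms(2) in \<open>auto simp: strict_mono_def dil_def dvd_def\<close>)
  finally show "(\<lambda>n. of_int (dil k a n) * qexp z ^ n) sums f (of_nat k * z)" .
qed

lemma qseries_has_derivative:
  assumes "qseries a f" "Im z > 0"
  shows "\<exists>D. (f has_field_derivative 2 * of_real pi * \<i> * D) (at z) \<and> (\<lambda>n. of_int (int n * a n) * qexp z ^ n) sums D"
proof -
  define P where "P x = (\<Sum>n. of_int (a n) * x ^ n)" for x :: complex
  define s where "s = (1 + norm (qexp z)) / 2"
  have q: "norm (qexp z) < 1" by (rule norm_qexp_less_1[OF assms(2)])
  have s: "0 < s" "s < 1" "norm (qexp z) < s" using q by (auto simp: s_def add_pos_nonneg)
  have sm: "summable (\<lambda>n. of_int (a n) * complex_of_real s ^ n)"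
    by (rule summable_norm_cancel) (use qseries_summable_real[OF assms(1), of s] s in \<open>simp add: norm_mult norm_power\<close>)
  have dP: "(P has_field_derivative (\<Sum>n. diffs (\<lambda>n. of_int (a n)) n * qexp z ^ n)) (at (qexp z))"
    unfolding P_def by (rule termdiffs_strong[OF sm]) (use s in auto)
  define D where "D = qexp z * (\<Sum>n. diffs (\<lambda>n. of_int (a n)) n * qexp z ^ n)"
  have "((\<lambda>z. P (qexp z)) has_field_derivative (\<Sum>n. diffs (\<lambda>n. of_int (a n)) n * qexp z ^ n) * (2 * of_real pi * \<i> * 1 * qexp z)) (at z)"
    by (rule DERIV_chain2[where f = P and g = qexp, OF dP]) (auto intro!: derivative_eq_intros)
  hence "((\<lambda>z. P (qexp z)) has_field_derivative 2 * of_real pi * \<i> * D) (at z)" by (simp add: D_def mult_ac)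
  hence d: "(f has_field_derivative 2 * of_real pi * \<i> * D) (at z)"
  proof (rule has_field_derivative_transform_within_open)
    show "open {z. Im z > 0}" by (rule open_halfspace_Im_gt)
    show "P (qexp w) = f w" if "w \<in> {z. Im z > 0}" for w
      using qseriesD[OF assms(1), of w] that by (simp add: P_def sums_iff)
  qed (use assms in auto)
  have "summable (\<lambda>n. diffs (\<lambda>n. of_int (a n)) n * qexp z ^ n)"
  proof (rule termdiff_converges[of _ s])
    fix x :: complex assume "norm x < s"
    hence "summable (\<lambda>n. norm (of_int (a n) * x ^ n))"
      using qseries_summable_real[OF assms(1), of "norm x"] s by (simp add: norm_mult norm_power)
    thus "summable (\<lambda>n. of_int (a n) * x ^ n)" by (rule summable_norm_cancel)
  qed (rule s(3))
  hence "(\<lambda>n. qexp z * (diffs (\<lambda>n. of_int (a n)) n * qexp z ^ n)) sums D"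
    unfolding D_def by (intro sums_mult summable_sums)
  hence "(\<lambda>n. of_int (int (Suc n) * a (Suc n)) * qexp z ^ Suc n) sums D"
    by (simp add: diffs_def mult_ac)
  hence "(\<lambda>n. of_int (int n * a n) * qexp z ^ n) sums D"
    by (subst (asm) sums_Suc_iff) simp
  thus ?thesis using d by blast
qed

lemma qseries_holomorphic:
  assumes "qseries a f"
  shows "f holomorphic_on upper_half_plane"
proof (rule holomorphic_onI)
  fix z assume "z \<in> upper_half_plane"
  hence "Im z > 0" by (simp add: upper_half_plane_def)
  from qseries_has_derivative[OF assms this] show "f field_differentiable at z within upper_half_plane"
    using field_differentiable_at_within field_differentiable_def by blast
qed

lemma qseries_deriv:
  assumes "qseries a f"
  shows "qseries (\<lambda>n. int n * a n) (\<lambda>z. deriv f z / (2 * of_real pi * \<i>))"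
  unfolding qseries_def
proof (intro allI impI)
  fix z assume "Im z > 0"
  from qseries_has_derivative[OF assms this] obtain D where
    "(f has_field_derivative 2 * of_real pi * \<i> * D) (at z)" "(\<lambda>n. of_int (int n * a n) * qexp z ^ n) sums D" by blast
  thus "(\<lambda>n. of_int (int n * a n) * qexp z ^ n) sums (deriv f z / (2 * of_real pi * \<i>))"
    by (simp add: DERIV_imp_deriv)
qed

text \<open>The remaining series is \<open>q^m\<close> times a power series that converges absolutely at \<open>exp (-2\<pi>)\<close>.\<close>

lemma qseries_vanishing_bound:
  assumes "qseries a f" "\<And>n. n < m \<Longrightarrow> a n = 0"
  shows "\<exists>C. \<forall>z. Im z \<ge> 1 \<longrightarrow> norm (f z) \<le> C * norm (qexp z) ^ m"
proof -
  define r where "r = exp (- (2 * pi * 1))"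
  have r: "0 < r" "r < 1" by (auto simp: r_def)
  have "summable (\<lambda>n. \<bar>real_of_int (a (n + m))\<bar> * r ^ (n + m))"
    using qseries_summable_real[OF assms(1), of r] r by (intro summable_ignore_initial_segment) auto
  hence "summable (\<lambda>n. (1 / r ^ m) * (\<bar>real_of_int (a (n + m))\<bar> * r ^ (n + m)))" by (rule summable_mult)
  hence sm: "summable (\<lambda>n. \<bar>real_of_int (a (n + m))\<bar> * r ^ n)" using r by (simp add: power_add field_simps)
  define C where "C = (\<Sum>n. \<bar>real_of_int (a (n + m))\<bar> * r ^ n)"
  have "norm (f z) \<le> C * norm (qexp z) ^ m" if z: "Im z \<ge> 1" for z
  proof -
    have z0: "Im z > 0" using z by simp
    have q: "norm (qexp z) \<le> r" unfolding r_def by (rule norm_qexp_le[OF z])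
    have "(\<Sum>n<m. of_int (a n) * qexp z ^ n) = 0" using assms(2) by (intro sum.neutral) auto
    hence "(\<lambda>n. of_int (a (n + m)) * qexp z ^ (n + m)) sums f z"
      using sums_split_initial_segment[OF qseriesD[OF assms(1) z0], of m] by simp
    hence S: "(\<lambda>n. qexp z ^ m * (of_int (a (n + m)) * qexp z ^ n)) sums f z"
      by (simp add: power_add mult_ac)
    have le: "norm (of_int (a (n + m)) * qexp z ^ n) \<le> \<bar>real_of_int (a (n + m))\<bar> * r ^ n" for n
      using q by (auto simp: norm_mult norm_power intro!: mult_left_mono power_mono)
    have s1: "summable (\<lambda>n. of_int (a (n + m)) * qexp z ^ n)"
      by (rule summable_comparison_test[OF _ sm]) (use le in auto)
    have "f z = qexp z ^ m * (\<Sum>n. of_int (a (n + m)) * qexp z ^ n)"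
      using S suminf_mult[OF s1, of "qexp z ^ m"] by (simp add: sums_iff)
    moreover have "norm (\<Sum>n. of_int (a (n + m)) * qexp z ^ n) \<le> C"
      unfolding C_def by (rule norm_suminf_le[OF le sm])
    ultimately show ?thesis by (simp add: norm_mult norm_power mult_mono mult.commute mult_left_mono)
  qed
  thus ?thesis by blast
qed

section \<open>Coefficients of the theta and Eisenstein series\<close>

definition theta_cf :: "nat \<Rightarrow> int"
  where "theta_cf n = (if n = 0 then 1 else if list_ex (\<lambda>k. k * k = n) [0..<Suc n] then 2 else 0)"

definition divisor_sum :: "(nat \<Rightarrow> int) \<Rightarrow> nat \<Rightarrow> int"
  where "divisor_sum f n = sum_list (map (\<lambda>m. if m dvd n then f m else 0) [1..<Suc n])"

lemma of_int_divisor_sum: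
  assumes "n > 0"
  shows "of_int (divisor_sum f n) = (\<Sum>m | m dvd n. complex_of_int (f m))"
proof -
  have "divisor_sum f n = (\<Sum>m\<in>set [1..<Suc n]. if m dvd n then f m else 0)"
    unfolding divisor_sum_def by (rule sum_list_distinct_conv_sum_set) simp
  also have "set [1..<Suc n] = {1..n}" by auto
  also have "(\<Sum>m\<in>{1..n}. if m dvd n then f m else 0) = (\<Sum>m\<in>{m \<in> {1..n}. m dvd n}. f m)"
    by (rule sum.inter_filter[symmetric]) simp
  also have "{m \<in> {1..n}. m dvd n} = {m. m dvd n}" using assms by (auto intro: dvd_imp_le Suc_leI dvd_pos_nat)
  finally show ?thesis by simp
qed

definition e18_cf :: "nat \<Rightarrow> int"
  where "e18_cf n = divisor_sum (\<lambda>m. int m * kron8 (int (n div m))) n"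

text \<open>The coefficients of \<open>2 E_8_1\<close>; the factor 2 clears the denominator of the constant term.\<close>

definition e81_cf :: "nat \<Rightarrow> int"
  where "e81_cf n = (if n = 0 then - 1 else 2 * divisor_sum (\<lambda>m. kron8 (int m) * int m) n)"

definition e2_cf :: "nat \<Rightarrow> int"
  where "e2_cf n = (if n = 0 then 1 else - 24 * divisor_sum int n)"

lemma qseries_from_lambert:
  assumes A: "\<And>m. norm (A m) \<le> real m" "\<And>m. norm (B m) \<le> real m"
    and f: "\<And>z. Im z > 0 \<Longrightarrow> f z = of_int e + of_int k * lambert A B (qexp z)"
    and a0: "a 0 = e" and a: "\<And>n. n > 0 \<Longrightarrow> of_int (a n) = of_int k * (\<Sum>m | m dvd n. A m * B (n div m))"
  shows "qseries a f"
  unfolding qseries_def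
proof (intro allI impI)
  fix z assume z: "Im z > 0"
  have "((\<lambda>n. (\<Sum>m | m dvd n. A m * B (n div m)) * qexp z ^ n) has_sum lambert A B (qexp z)) {1..}"
    by (rule lambert_has_sum_divisors[OF norm_qexp_less_1[OF z] A])
  from has_sum_imp_sums_Suc[OF this]
  have "(\<lambda>n. of_int k * ((\<Sum>m | m dvd Suc n. A m * B (Suc n div m)) * qexp z ^ Suc n)) sums (of_int k * lambert A B (qexp z))"
    by (rule sums_mult)
  also have "(\<lambda>n. of_int k * ((\<Sum>m | m dvd Suc n. A m * B (Suc n div m)) * qexp z ^ Suc n)) = (\<lambda>n. of_int (a (Suc n)) * qexp z ^ Suc n)"
    by (subst a) (simp_all add: mult_ac)
  finally show "(\<lambda>n. of_int (a n) * qexp z ^ n) sums f z"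
    by (subst (asm) sums_Suc_iff) (simp add: f[OF z] a0 add.commute)
qed

lemma qs_E_1_8: "qseries e18_cf E_1_8"
proof (rule qseries_from_lambert[where A = of_nat and B = "\<lambda>k. chi 8 (int k)" and e = 0 and k = 1])
  show "norm (chi 8 (int m)) \<le> real m" for m
    using norm_chi_8_le[of "int m"] by (cases m) (auto simp: chi_8 kron8_def)
  show "of_int (e18_cf n) = of_int 1 * (\<Sum>m | m dvd n. of_nat m * chi 8 (int (n div m)))" if "n > 0" for n
    by (simp add: e18_cf_def chi_8 of_int_divisor_sum[OF that])
qed (simp_all add: E_1_8_eq_lambert e18_cf_def divisor_sum_def)

lemma qs_E_8_1: "qseries e81_cf (\<lambda>z. 2 * E_8_1 z)"
proof (rule qseries_from_lambert[where A = "\<lambda>m. chi 8 (int m) * of_nat m" and B = one_pos and e = "-1" and k = 2])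
  show "norm (chi 8 (int m) * of_nat m) \<le> real m" for m
    using norm_chi_8_le[of "int m"] by (simp add: norm_mult mult_left_le_one_le)
  show "of_int (e81_cf n) = of_int 2 * (\<Sum>m | m dvd n. chi 8 (int m) * of_nat m * one_pos (n div m))" if "n > 0" for n
  proof -
    have "(\<Sum>m | m dvd n. chi 8 (int m) * of_nat m * one_pos (n div m)) = (\<Sum>m | m dvd n. of_int (kron8 (int m) * int m))"
      using that by (intro sum.cong) (auto simp: one_pos_def chi_8 dvd_div_eq_0_iff)
    thus ?thesis using that by (simp add: e81_cf_def of_int_divisor_sum[OF that])
  qed
qed (simp_all add: E_8_1_eq_lambert e81_cf_def one_pos_def algebra_simps)

lemma qs_E2: "qseries e2_cf E2"
proof (rule qseries_from_lambert[where A = of_nat and B = one_pos and e = 1 and k = "-24"])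
  show "of_int (e2_cf n) = of_int (-24) * (\<Sum>m | m dvd n. of_nat m * one_pos (n div m))" if "n > 0" for n
  proof -
    have "(\<Sum>m | m dvd n. of_nat m * one_pos (n div m)) = (\<Sum>m | m dvd n. of_int (int m))"
      using that by (intro sum.cong) (auto simp: one_pos_def dvd_div_eq_0_iff)
    thus ?thesis using that by (simp add: e2_cf_def of_int_divisor_sum[OF that])
  qed
qed (simp_all add: E2_eq_lambert e2_cf_def one_pos_def)

lemma qseries_theta: "qseries theta_cf ramanujan_phi"
  unfolding qseries_def
proof (intro allI impI)
  fix z assume z: "Im z > 0"
  define q where "q = qexp z"
  have q: "norm q < 1" using norm_qexp_less_1[OF z] by (simp add: q_def)
  have "summable (\<lambda>k. q ^ ((Suc k)\<^sup>2))"
  proof (rule summable_comparison_test)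
    show "summable (\<lambda>k. norm q ^ Suc k)" using q by (subst summable_Suc_iff) (simp add: summable_geometric)
    have *: "norm q ^ ((Suc k)\<^sup>2) \<le> norm q ^ Suc k" for k
      using q by (intro power_decreasing) (auto simp: power2_eq_square)
    show "\<exists>N. \<forall>k\<ge>N. norm (q ^ ((Suc k)\<^sup>2)) \<le> norm q ^ Suc k"
      by (intro exI[of _ 0] allI impI, subst norm_power, rule *)
  qed
  hence "(\<lambda>k. 2 * q ^ ((Suc k)\<^sup>2)) sums (2 * (\<Sum>k. q ^ ((Suc k)\<^sup>2)))" by (intro sums_mult summable_sums)
  also have "(\<lambda>k. 2 * q ^ ((Suc k)\<^sup>2)) = (\<lambda>k. (if (Suc k)\<^sup>2 = 0 then 0 else of_int (theta_cf ((Suc k)\<^sup>2))) * q ^ ((Suc k)\<^sup>2))"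
  proof
    fix k
    have "list_ex (\<lambda>j. j * j = (Suc k)\<^sup>2) [0..<Suc ((Suc k)\<^sup>2)]"
      unfolding list_ex_iff by (rule bexI[of _ "Suc k"]) (auto simp: power2_eq_square)
    thus "2 * q ^ ((Suc k)\<^sup>2) = (if (Suc k)\<^sup>2 = 0 then 0 else of_int (theta_cf ((Suc k)\<^sup>2))) * q ^ ((Suc k)\<^sup>2)"
      by (simp add: theta_cf_def del: upt_Suc)
  qed
  also have "\<dots> sums (2 * (\<Sum>k. q ^ ((Suc k)\<^sup>2))) \<longleftrightarrow> (\<lambda>n. (if n = 0 then 0 else of_int (theta_cf n)) * q ^ n) sums (2 * (\<Sum>k. q ^ ((Suc k)\<^sup>2)))"
  proof (rule sums_mono_reindex[of "\<lambda>k. (Suc k)\<^sup>2"])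
    show "strict_mono (\<lambda>k. (Suc k)\<^sup>2)" by (auto simp: strict_mono_def intro!: power_strict_mono)
    fix n assume n: "n \<notin> range (\<lambda>k. (Suc k)\<^sup>2)"
    show "(if n = 0 then 0 else of_int (theta_cf n)) * q ^ n = 0"
    proof (cases "n = 0")
      case False
      have "\<not> list_ex (\<lambda>k. k * k = n) [0..<Suc n]"
      proof
        assume "list_ex (\<lambda>k. k * k = n) [0..<Suc n]"
        then obtain k where "k * k = n" by (auto simp: list_ex_iff simp del: upt_Suc)
        with False have "n = (Suc (k - 1))\<^sup>2" by (cases k) (auto simp: power2_eq_square)
        with n show False by blast
      qed
      thus ?thesis using False by (simp add: theta_cf_def del: upt_Suc)
    qed simp
  qed
  finally have "(\<lambda>n. (if n = 0 then 1 else 0) * q ^ n + (if n = 0 then 0 else of_int (theta_cf n)) * q ^ n) sums (1 * q ^ 0 + 2 * (\<Sum>k. q ^ ((Suc k)\<^sup>2)))"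
    using sums_single[of 0 "\<lambda>n. q ^ n"] by (intro sums_add) (simp_all add: if_distrib[of "\<lambda>x. x * _"] cong: if_cong)
  also have "(\<lambda>n. (if n = 0 then 1 else 0) * q ^ n + (if n = 0 then 0 else of_int (theta_cf n)) * q ^ n) = (\<lambda>n. of_int (theta_cf n) * q ^ n)"
    by (auto simp: theta_cf_def)
  finally show "(\<lambda>n. of_int (theta_cf n) * qexp z ^ n) sums ramanujan_phi z"
    using ramanujan_phi_eq_theta_series[of z] q by (simp add: q_def theta_series_def)
qed

section \<open>Computation with truncated expansions\<close>

text \<open>Multiplication of power series modulo \<open>q^N\<close>, where \<open>N\<close> is the common length of the lists.\<close>

definition lconv :: "int list \<Rightarrow> int list \<Rightarrow> int list"
  where "lconv xs ys = map (\<lambda>n. sum_list (map (\<lambda>i. xs ! i * ys ! (n - i)) [0..<Suc n])) [0..<length xs]"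

definition trunc :: "nat \<Rightarrow> (nat \<Rightarrow> int) \<Rightarrow> int list"
  where "trunc N a = map a [0..<N]"

lemma trunc_conv: "trunc N (conv a b) = lconv (trunc N a) (trunc N b)"
proof -
  have "conv a b n = sum_list (map (\<lambda>i. trunc N a ! i * trunc N b ! (n - i)) [0..<Suc n])" if "n < N" for n
  proof -
    have "conv a b n = (\<Sum>i\<in>set [0..<Suc n]. a i * b (n - i))"
      unfolding conv_def by (intro sum.cong) auto
    also have "\<dots> = sum_list (map (\<lambda>i. a i * b (n - i)) [0..<Suc n])"
      by (rule sum_list_distinct_conv_sum_set[symmetric]) simp
    also have "map (\<lambda>i. a i * b (n - i)) [0..<Suc n] = map (\<lambda>i. trunc N a ! i * trunc N b ! (n - i)) [0..<Suc n]"
      using that by (intro map_cong) (auto simp: trunc_def)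
    finally show ?thesis .
  qed
  thus ?thesis unfolding lconv_def trunc_def[of N "conv a b"] by (intro map_cong) (auto simp: trunc_def)
qed

lemma trunc_add: "trunc N (\<lambda>n. a n + b n) = map2 (+) (trunc N a) (trunc N b)"
  by (auto simp: trunc_def zip_map1 zip_map2 zip_same_conv_map)

lemma trunc_cmult: "trunc N (\<lambda>n. c * a n) = map ((*) c) (trunc N a)"
  by (simp add: trunc_def)

lemma trunc_deriv: "trunc N (\<lambda>n. int n * a n) = map2 (*) (map int [0..<N]) (trunc N a)"
  by (auto simp: trunc_def zip_map1 zip_map2 zip_same_conv_map)

lemma trunc_zeroD: "trunc N a = replicate N 0 \<Longrightarrow> n < N \<Longrightarrow> a n = 0"
proof -
  assume *: "trunc N a = replicate N 0" "n < N"
  have "trunc N a ! n = a n" using *(2) by (simp add: trunc_def)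
  thus ?thesis using * by simp
qed

section \<open>Theta products of level 24\<close>

text \<open>Holomorphic forms of weight \<open>k\<close> for \<open>Gamma0 24\<close> with the character \<open>\<chi>\<^sub>8\<close>. The condition at the cusps is
  expressed by \<open>tempered\<close>, which is preserved by the products and dilations below.\<close>

definition form24 :: "nat \<Rightarrow> (complex \<Rightarrow> complex) \<Rightarrow> bool"
  where "form24 k f \<longleftrightarrow> f holomorphic_on upper_half_plane \<and>
    (\<forall>g\<in>Gamma0 24. \<forall>z. Im z > 0 \<longrightarrow> f (mob g z) = of_int (kron8 (lower_right g)) * aut g z ^ k * f z) \<and>
    tempered (real k) f"

lemma form24_add: "form24 k f \<Longrightarrow> form24 k g \<Longrightarrow> form24 k (\<lambda>z. f z + g z)"
  unfolding form24_def by (auto intro!: holomorphic_intros tempered_add simp: algebra_simps)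

lemma form24_cmult: "form24 k f \<Longrightarrow> form24 k (\<lambda>z. c * f z)"
  unfolding form24_def by (auto intro!: holomorphic_intros tempered_cmult)

lemma tempered_cong:
  assumes "tempered k f" "\<And>z. Im z > 0 \<Longrightarrow> g z = f z"
  shows "tempered k g"
proof (rule temperedI)
  fix \<gamma> assume \<gamma>: "\<gamma> \<in> SL2Z"
  obtain Y C where YC: "Y > 0" "\<And>z. Im z \<ge> Y \<Longrightarrow> norm (f (mob \<gamma> z)) \<le> C * norm (aut \<gamma> z) powr k"
    using assms(1) \<gamma> unfolding tempered_def by blast
  have "norm (g (mob \<gamma> z)) \<le> C * norm (aut \<gamma> z) powr k" if "Im z \<ge> Y" for z
    using YC(2)[OF that] assms(2)[OF Im_mob_pos[OF \<gamma>, of z]] that YC(1) by simp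
  thus "\<exists>Y>0. \<exists>C. \<forall>z. Im z \<ge> Y \<longrightarrow> norm (g (mob \<gamma> z)) \<le> C * norm (aut \<gamma> z) powr k"
    using YC(1) by blast
qed

lemma Gamma0_24_kron8:
  assumes "g \<in> Gamma0 24"
  shows "\<bar>kron8 (lower_right g)\<bar> = 1"
proof -
  obtain a b c d where g: "g = (a, b, c, d)" by (cases g)
  have "a * d - b * c = 1" "24 dvd c" using assms by (auto simp: g Gamma0_def)
  hence "odd d" by (intro Gamma0_4_odd(2)[of a d b c]) auto
  thus ?thesis by (simp add: g kron8_def)
qed

lemma form24_eq_0:
  assumes "form24 k f" "qseries a f" "trunc N a = replicate N 0" "N = 4 * k + 1" "Im z > 0"
  shows "f z = 0"
proof -
  obtain C where C: "\<And>z. Im z \<ge> 1 \<Longrightarrow> norm (f z) \<le> C * norm (qexp z) ^ N"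
    using qseries_vanishing_bound[OF assms(2) trunc_zeroD[OF assms(3)]] by blast
  show ?thesis
  proof (rule sturm_bound[OF _ _ _ C _ assms(5)])
    show "f holomorphic_on upper_half_plane" "tempered (real k) f" using assms(1) by (auto simp: form24_def)
    fix g z assume g: "g \<in> Gamma0 24" and z: "Im z > 0"
    have "f (mob g z) = of_int (kron8 (lower_right g)) * aut g z ^ k * f z"
      using assms(1) g z unfolding form24_def by blast
    moreover have "norm (complex_of_int (kron8 (lower_right g))) = 1"
      using Gamma0_24_kron8[OF g] by (simp flip: of_int_abs)
    ultimately show "norm (f (mob g z)) = norm (aut g z) ^ k * norm (f z)"
      by (simp add: norm_mult norm_power)
  qed (simp_all add: assms(4))
qed

text \<open>Conjugation by \<open>diag (n, 1)\<close> multiplies \<open>b\<close> by \<open>n\<close> and divides \<open>c\<close> by \<open>n\<close>, and it keeps the automorphy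
  factor and the lower right entry.\<close>

lemma mob_dilation:
  assumes "n > 0"
  shows "of_nat n * mob (a, b, int n * c, d) z = mob (a, int n * b, c, d) (of_nat n * z)"
    and "of_int c * (of_nat n * z) + of_int d = of_int (int n * c) * z + of_int d"
  by (simp_all add: mob_def algebra_simps add_divide_distrib)

lemma Im_dilation: "n > 0 \<Longrightarrow> Im z > 0 \<Longrightarrow> Im (of_nat n * z) > 0"
  by simp

lemma phi_squared_dilated:
  assumes "n > 0" "4 * n dvd 24" "(a, b, c, d) \<in> Gamma0 24" "Im z > 0"
  shows "ramanujan_phi (of_nat n * mob (a, b, c, d) z) ^ 2 =
    of_int (chi_m4 d) * aut (a, b, c, d) z * ramanujan_phi (of_nat n * z) ^ 2"
proof -
  have det: "a * d - b * c = 1" and c: "24 dvd c" using assms(3) by (auto simp: Gamma0_def)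
  have "int (4 * n) dvd int 24" using assms(2) by (simp only: of_nat_dvd_iff)
  hence "int n * 4 dvd c" using c by (auto simp: mult.commute intro: dvd_trans)
  then obtain k' where k': "c = int n * 4 * k'" by (elim dvdE)
  hence k: "c = int n * (4 * k')" by (simp only: mult.assoc)
  show ?thesis unfolding k mob_dilation(1)[OF assms(1)]
    using det k ramanujan_phi_squared_modular[of a d "int n * b" "4 * k'" "of_nat n * z"] Im_dilation[OF assms(1,4)]
      mob_dilation(2)[OF assms(1), of "4 * k'" z d]
    by (simp add: aut_def algebra_simps)
qed

lemma phi_pair_dilated:
  assumes "n > 0" "8 * n dvd 24" "(a, b, c, d) \<in> Gamma0 24" "Im z > 0"
  shows "ramanujan_phi (of_nat n * mob (a, b, c, d) z) * ramanujan_phi (2 * (of_nat n * mob (a, b, c, d) z)) =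
    of_int (chi_m8 d) * aut (a, b, c, d) z * (ramanujan_phi (of_nat n * z) * ramanujan_phi (2 * (of_nat n * z)))"
proof -
  have det: "a * d - b * c = 1" and c: "24 dvd c" using assms(3) by (auto simp: Gamma0_def)
  have "int (8 * n) dvd int 24" using assms(2) by (simp only: of_nat_dvd_iff)
  hence "int n * 8 dvd c" using c by (auto simp: mult.commute intro: dvd_trans)
  then obtain k' where k': "c = int n * 8 * k'" by (elim dvdE)
  hence k: "c = int n * (8 * k')" by (simp only: mult.assoc)
  show ?thesis unfolding k mob_dilation(1)[OF assms(1)]
    using det k ramanujan_phi_pair_modular[of a d "int n * b" "8 * k'" "of_nat n * z"] Im_dilation[OF assms(1,4)]
      mob_dilation(2)[OF assms(1), of "8 * k'" z d]
    by (simp add: aut_def algebra_simps)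
qed

text \<open>All eight theta products have this shape. The square transforms under \<open>Gamma0 (4 m)\<close> and the other pair of
  factors under \<open>Gamma0 (8 n)\<close>.\<close>

definition theta_form :: "nat \<Rightarrow> nat \<Rightarrow> complex \<Rightarrow> complex"
  where "theta_form m n z = ramanujan_phi (of_nat m * z) * ramanujan_phi (of_nat m * z) *
    (ramanujan_phi (of_nat n * z) * ramanujan_phi (of_nat (2 * n) * z))"

definition theta_form_cf :: "nat \<Rightarrow> nat \<Rightarrow> nat \<Rightarrow> int"
  where "theta_form_cf m n = conv (conv (dil m theta_cf) (dil m theta_cf)) (conv (dil n theta_cf) (dil (2 * n) theta_cf))"

lemma qseries_theta_form: "m > 0 \<Longrightarrow> n > 0 \<Longrightarrow> qseries (theta_form_cf m n) (theta_form m n)"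
  unfolding theta_form_cf_def theta_form_def [abs_def] by (intro qseries_mult qseries_dil qseries_theta) auto

lemma form24_theta_form:
  assumes "m > 0" "n > 0" "4 * m dvd 24" "8 * n dvd 24"
  shows "form24 2 (theta_form m n)"
  unfolding form24_def
proof (intro conjI ballI allI impI)
  show "theta_form m n holomorphic_on upper_half_plane" by (rule qseries_holomorphic[OF qseries_theta_form]) fact+
  have t: "tempered (1/2) (\<lambda>z. ramanujan_phi (of_nat k * z))" if "k > 0" for k
    by (rule tempered_dilation[OF ramanujan_phi_tempered that])
  have "tempered (1/2 + 1/2 + (1/2 + 1/2)) (theta_form m n)"
    unfolding theta_form_def [abs_def] by (intro tempered_mult t) (use assms in auto)
  thus "tempered (real 2) (theta_form m n)" by simp
  fix g z assume g: "g \<in> Gamma0 24" and z: "Im z > 0"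
  obtain a b c d where gg: "g = (a, b, c, d)" by (cases g)
  have k: "of_int (kron8 d) = (of_int (chi_m4 d) * of_int (chi_m8 d) :: complex)"
    by (simp flip: chi_m4_mult_chi_m8)
  have tf: "theta_form m n w = ramanujan_phi (of_nat m * w) ^ 2 * (ramanujan_phi (of_nat n * w) * ramanujan_phi (2 * (of_nat n * w)))" for w
    by (simp add: theta_form_def power2_eq_square mult.assoc)
  show "theta_form m n (mob g z) = of_int (kron8 (lower_right g)) * aut g z ^ 2 * theta_form m n z"
    unfolding tf gg phi_squared_dilated[OF assms(1,3) g[unfolded gg] z] phi_pair_dilated[OF assms(2,4) g[unfolded gg] z]
      lower_right.simps k
    by (simp add: power2_eq_square)
qed

section \<open>Eisenstein series of level 24\<close>

lemma odd_mod_8_cases: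
  assumes "odd (a :: int)"
  shows "[a = 1] (mod 8) \<or> [a = -1] (mod 8) \<or> [a = 3] (mod 8) \<or> [a = -3] (mod 8)"
proof -
  have "a mod 8 = 1 \<or> a mod 8 = 7 \<or> a mod 8 = 3 \<or> a mod 8 = 5" using assms by presburger
  thus ?thesis by (simp add: cong_def)
qed

text \<open>Multiplication by an odd \<open>a\<close> permutes the classes \<open>\<plusminus>1\<close> and \<open>\<plusminus>3\<close> modulo 8, and exchanges them exactly
  if \<open>\<chi>\<^sub>8(a) = -1\<close>.\<close>

lemma divval_kron8:
  assumes "odd a"
  shows "divval (a * r) (a * s) z - divval (3 * a * r) (3 * a * s) z =
    of_int (kron8 a) * (divval r s z - divval (3 * r) (3 * s) z)"
proof -
  have c: "divval (x * u) (x * v) z = divval (y * u) (y * v) z" if "[x = y] (mod 8)" for x y u v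
    using that by (intro divval_cong cong_mult) auto
  have m: "divval (- x * u) (- x * v) z = divval (x * u) (x * v) z" for x u v
    using divval_minus[of "x * u" "x * v" z] by simp
  consider "[a = 1] (mod 8)" | "[a = -1] (mod 8)" | "[a = 3] (mod 8)" | "[a = -3] (mod 8)"
    using odd_mod_8_cases[OF assms] by blast
  thus ?thesis
  proof cases
    case 1
    moreover from 1 have "kron8 a = 1" using kron8_mod[of a] by (simp add: cong_def kron8_def split: if_splits)
    ultimately show ?thesis using c[OF 1, of r s] c[OF cong_mult[OF cong_refl 1], of 3 r s] by simp
  next
    case 2
    moreover from 2 have "kron8 a = 1" using kron8_mod[of a] by (simp add: cong_def kron8_def split: if_splits)
    ultimately show ?thesis using c[OF 2, of r s] c[OF cong_mult[OF cong_refl 2], of 3 r s] m[of 1 r s] m[of 3 r s] by simp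
  next
    case 3
    moreover from 3 have "kron8 a = - 1" using kron8_mod[of a] by (simp add: cong_def kron8_def split: if_splits)
    moreover have "[3 * a = 1] (mod 8)" using 3 by (simp add: cong_def) presburger
    ultimately show ?thesis using c[OF 3, of r s] c[of "3 * a" 1 r s] by simp
  next
    case 4
    moreover from 4 have "kron8 a = - 1" using kron8_mod[of a] by (simp add: cong_def kron8_def split: if_splits)
    moreover have "[3 * a = -1] (mod 8)" using 4 by (simp add: cong_def) presburger
    ultimately show ?thesis using c[OF 4, of r s] c[of "3 * a" "-1" r s] m[of 1 r s] m[of 3 r s] by simp
  qed
qed

text \<open>The lattice parameter is \<open>8z\<close>, so \<open>c\<close> is divided by 8. The first coordinate of the division points is
  multiplied by \<open>a\<close>, and \<open>\<chi>\<^sub>8(a) = \<chi>\<^sub>8(d)\<close> since \<open>a d\<close> is 1 modulo 8.\<close>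

lemma E_1_8_modular:
  assumes det: "a * d - b * c = 1" and c: "8 dvd c" and z: "Im z > 0"
  shows "E_1_8 (mob (a, b, c, d) z) = of_int (kron8 d) * (of_int c * z + of_int d) ^ 2 * E_1_8 z"
proof -
  obtain c' where c': "c = int 8 * c'" using c by (auto elim: dvdE)
  have S: "(a, b, c, d) \<in> SL2Z" "(a, int 8 * b, c', d) \<in> SL2Z" using det by (simp_all add: SL2Z_iff c')
  have odd: "odd a" using Gamma0_4_odd(1)[OF det] c' by simp
  have "kron8 a * kron8 d = kron8 ((a * d) mod 8)" by (simp only: kron8_mod kron8_mult)
  also have "a * d = 1 + 8 * (b * c')" using det by (simp add: c')
  hence "(a * d) mod 8 = 1" by simp
  finally have "kron8 a * kron8 d = 1" by (simp add: kron8_def)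
  hence k: "kron8 a = kron8 d" by (auto simp: zmult_eq_1_iff)
  define w where "w = 8 * z"
  have w: "Im w > 0" using z by (simp add: w_def)
  have mw: "8 * mob (a, b, c, d) z = mob (a, int 8 * b, c', d) w" using mob_dilation(1)[of 8 a b c' d z] by (simp add: c' w_def)
  have aw: "of_int c' * w + of_int d = of_int c * z + of_int d" by (simp add: c' w_def)
  have r: "divval (1 * a + 0 * c') (1 * (int 8 * b) + 0 * d) w = divval (a * 1) (a * 0) w"
    "divval (3 * a + 0 * c') (3 * (int 8 * b) + 0 * d) w = divval (3 * a * 1) (3 * a * 0) w"
    by (intro divval_cong; simp add: cong_def)+
  have "divval 1 0 (mob (a, int 8 * b, c', d) w) - divval 3 0 (mob (a, int 8 * b, c', d) w) =
      (of_int c' * w + of_int d)\<^sup>2 * (divval (a * 1) (a * 0) w - divval (3 * a * 1) (3 * a * 0) w)"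
  proof -
    have n: "\<not> (8 dvd (1 :: int) \<and> 8 dvd (0 :: int))" "\<not> (8 dvd (3 :: int) \<and> 8 dvd (0 :: int))" by simp_all
    show ?thesis unfolding divval_mob[OF S(2) w n(1)] divval_mob[OF S(2) w n(2)] r by (simp add: right_diff_distrib)
  qed
  also have "\<dots> = (of_int c' * w + of_int d)\<^sup>2 * (of_int (kron8 d) * (divval 1 0 w - divval 3 0 w))"
    unfolding divval_kron8[OF odd] k by simp
  finally have "- 4 * of_real pi ^ 2 * E_1_8 (mob (a, b, c, d) z) = (of_int c' * w + of_int d)\<^sup>2 * (of_int (kron8 d) * (- 4 * of_real pi ^ 2 * E_1_8 z))"
    unfolding E_1_8_eq_divval[OF z] E_1_8_eq_divval[OF Im_mob_pos[OF S(1) z]] mw w_def .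
  thus ?thesis unfolding aw by simp
qed

text \<open>Since \<open>8\<close> divides \<open>c\<close>, the division point \<open>(0, s)\<close> is sent to \<open>(0, s d)\<close>.\<close>

lemma E_8_1_modular:
  assumes det: "a * d - b * c = 1" and c: "8 dvd c" and z: "Im z > 0"
  shows "E_8_1 (mob (a, b, c, d) z) = of_int (kron8 d) * (of_int c * z + of_int d) ^ 2 * E_8_1 z"
proof -
  have S: "(a, b, c, d) \<in> SL2Z" using det by (simp add: SL2Z_iff)
  have odd: "odd d" using Gamma0_4_odd(2)[OF det] c by auto
  have r: "divval (0 * a + 1 * c) (0 * b + 1 * d) z = divval (d * 0) (d * 1) z"
    "divval (0 * a + 3 * c) (0 * b + 3 * d) z = divval (3 * d * 0) (3 * d * 1) z"
    using c by (intro divval_cong; auto simp: cong_0_iff)+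
  have "divval 0 1 (mob (a, b, c, d) z) - divval 0 3 (mob (a, b, c, d) z) =
      (of_int c * z + of_int d)\<^sup>2 * (divval (d * 0) (d * 1) z - divval (3 * d * 0) (3 * d * 1) z)"
  proof -
    have n: "\<not> (8 dvd (0 :: int) \<and> 8 dvd (1 :: int))" "\<not> (8 dvd (0 :: int) \<and> 8 dvd (3 :: int))" by simp_all
    show ?thesis unfolding divval_mob[OF S z n(1)] divval_mob[OF S z n(2)] r by (simp add: right_diff_distrib)
  qed
  also have "\<dots> = (of_int c * z + of_int d)\<^sup>2 * (of_int (kron8 d) * (divval 0 1 z - divval 0 3 z))"
    unfolding divval_kron8[OF odd] by simp
  finally have "- 8 * of_real (sqrt 2) * of_real pi ^ 2 * E_8_1 (mob (a, b, c, d) z) = (of_int c * z + of_int d)\<^sup>2 * (of_int (kron8 d) * (- 8 * of_real (sqrt 2) * of_real pi ^ 2 * E_8_1 z))"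
    unfolding E_8_1_eq_divval[OF z] E_8_1_eq_divval[OF Im_mob_pos[OF S z]] .
  thus ?thesis by simp
qed

lemma E_1_8_tempered: "tempered 2 E_1_8"
proof (rule tempered_cong)
  have "tempered 2 (\<lambda>z. divval 1 0 (of_nat 8 * z) - divval 3 0 (of_nat 8 * z))"
    by (rule tempered_dilation[OF divval_diff_tempered]) auto
  thus "tempered 2 (\<lambda>z. (- 1 / (4 * of_real pi ^ 2)) * (divval 1 0 (of_nat 8 * z) - divval 3 0 (of_nat 8 * z)))"
    by (rule tempered_cmult)
  show "E_1_8 z = (- 1 / (4 * of_real pi ^ 2)) * (divval 1 0 (of_nat 8 * z) - divval 3 0 (of_nat 8 * z))" if "Im z > 0" for z
    unfolding of_nat_numeral E_1_8_eq_divval[OF that, symmetric] by simp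
qed

lemma E_8_1_tempered: "tempered 2 E_8_1"
proof (rule tempered_cong)
  show "tempered 2 (\<lambda>z. (- 1 / (8 * of_real (sqrt 2) * of_real pi ^ 2)) * (divval 0 1 z - divval 0 3 z))"
    by (rule tempered_cmult[OF divval_diff_tempered]) auto
  show "E_8_1 z = (- 1 / (8 * of_real (sqrt 2) * of_real pi ^ 2)) * (divval 0 1 z - divval 0 3 z)" if "Im z > 0" for z
    unfolding E_8_1_eq_divval[OF that] by simp
qed

lemma form24_dilate:
  assumes "tempered (real k) f" "f holomorphic_on upper_half_plane"
    and mod: "\<And>a b c d z. a * d - b * c = 1 \<Longrightarrow> 8 dvd c \<Longrightarrow> Im z > 0 \<Longrightarrow>
      f (mob (a, b, c, d) z) = of_int (kron8 d) * (of_int c * z + of_int d) ^ k * f z"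
    and n: "n > 0" "8 * n dvd 24"
  shows "form24 k (\<lambda>z. f (of_nat n * z))"
  unfolding form24_def
proof (intro conjI ballI allI impI)
  have "f \<circ> (\<lambda>z. of_nat n * z) holomorphic_on upper_half_plane"
    by (rule holomorphic_on_compose_gen[OF _ assms(2)]) (use n(1) in \<open>auto intro!: holomorphic_intros simp: upper_half_plane_def\<close>)
  thus "(\<lambda>z. f (of_nat n * z)) holomorphic_on upper_half_plane" by (simp add: o_def)
  show "tempered (real k) (\<lambda>z. f (of_nat n * z))" by (rule tempered_dilation[OF assms(1) n(1)])
  fix g z assume g: "g \<in> Gamma0 24" and z: "Im z > 0"
  obtain a b c d where gg: "g = (a, b, c, d)" by (cases g)
  have det: "a * d - b * c = 1" and c: "24 dvd c" using g by (auto simp: gg Gamma0_def)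
  have "int (8 * n) dvd int 24" using n(2) by (simp only: of_nat_dvd_iff)
  hence "int n * 8 dvd c" using c by (auto simp: mult.commute intro: dvd_trans)
  then obtain k' where k': "c = int n * 8 * k'" by (elim dvdE)
  hence k: "c = int n * (8 * k')" by (simp only: mult.assoc)
  show "f (of_nat n * mob g z) = of_int (kron8 (lower_right g)) * aut g z ^ k * f (of_nat n * z)"
    unfolding gg k mob_dilation(1)[OF n(1)]
    using det k mod[of a d "int n * b" "8 * k'" "of_nat n * z"] Im_dilation[OF n(1) z]
      mob_dilation(2)[OF n(1), of "8 * k'" z d]
    by (simp add: aut_def mult_ac)
qed

lemma form24_E_1_8: "n > 0 \<Longrightarrow> 8 * n dvd 24 \<Longrightarrow> form24 2 (\<lambda>z. E_1_8 (of_nat n * z))"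
  using E_1_8_tempered qseries_holomorphic[OF qs_E_1_8] E_1_8_modular by (intro form24_dilate) auto

lemma form24_E_8_1: "n > 0 \<Longrightarrow> 8 * n dvd 24 \<Longrightarrow> form24 2 (\<lambda>z. 2 * E_8_1 (of_nat n * z))"
proof (rule form24_dilate[where f = "\<lambda>z. 2 * E_8_1 z"])
  show "tempered (real 2) (\<lambda>z. 2 * E_8_1 z)" using tempered_cmult[OF E_8_1_tempered, of 2] by simp
qed (use qseries_holomorphic[OF qs_E_8_1] E_8_1_modular in auto)

section \<open>Logarithmic derivatives of eta quotients\<close>

text \<open>An entry \<open>(\<delta>, e)\<close> of the list stands for the factor \<open>\<eta>(\<delta>z)^e\<close>.\<close>

definition eta_quot :: "(nat \<times> int) list \<Rightarrow> complex \<Rightarrow> complex"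
  where "eta_quot r z = (\<Prod>(\<delta>, e)\<leftarrow>r. dedekind_eta (of_nat \<delta> * z) powi e)"

text \<open>The logarithmic derivative of the eta quotient with respect to \<open>2\<pi>iz\<close>, times 24.\<close>

definition eta_logderiv :: "(nat \<times> int) list \<Rightarrow> complex \<Rightarrow> complex"
  where "eta_logderiv r z = (\<Sum>(\<delta>, e)\<leftarrow>r. of_int e * (of_nat \<delta> * E2 (of_nat \<delta> * z)))"

lemma eta_quot_has_derivative:
  assumes "\<forall>(\<delta>, e)\<in>set r. \<delta> > 0" "Im z > 0"
  shows "(eta_quot r has_field_derivative 2 * of_real pi * \<i> / 24 * eta_logderiv r z * eta_quot r z) (at z)"
  using assms(1)
proof (induction r)
  case Nil
  show ?case by (simp add: eta_quot_def [abs_def] eta_logderiv_def)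
next
  case (Cons p r)
  obtain \<delta> e where p: "p = (\<delta>, e)" by (cases p)
  have \<delta>: "\<delta> > 0" using Cons.prems p by simp
  define E where "E = dedekind_eta (of_nat \<delta> * z)"
  have w: "Im (of_nat \<delta> * z) > 0" using \<delta> assms(2) by simp
  have E0: "E \<noteq> 0" unfolding E_def by (rule dedekind_eta_nonzero[OF w])
  have "((\<lambda>z. dedekind_eta (of_nat \<delta> * z)) has_field_derivative of_real pi * \<i> / 12 * E2 (of_nat \<delta> * z) * E * of_nat \<delta>) (at z)"
    unfolding E_def
    by (rule DERIV_chain2[where f = dedekind_eta and g = "\<lambda>z. of_nat \<delta> * z", OF has_field_derivative_dedekind_eta[OF w]]) (auto intro!: derivative_eq_intros)
  hence "((\<lambda>z. dedekind_eta (of_nat \<delta> * z) powi e) has_field_derivative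
      of_int e * E powi (e - 1) * (of_real pi * \<i> / 12 * E2 (of_nat \<delta> * z) * E * of_nat \<delta>)) (at z)"
    using E0 by (auto intro!: derivative_eq_intros simp: E_def)
  moreover have "of_int e * E powi (e - 1) * (of_real pi * \<i> / 12 * E2 (of_nat \<delta> * z) * E * of_nat \<delta>) =
      2 * of_real pi * \<i> / 24 * (of_int e * (of_nat \<delta> * E2 (of_nat \<delta> * z))) * E powi e"
    using E0 by (simp add: power_int_diff field_simps)
  ultimately have d: "((\<lambda>z. dedekind_eta (of_nat \<delta> * z) powi e) has_field_derivative
      2 * of_real pi * \<i> / 24 * (of_int e * (of_nat \<delta> * E2 (of_nat \<delta> * z))) * E powi e) (at z)" by (simp only:)
  have IH: "(eta_quot r has_field_derivative 2 * of_real pi * \<i> / 24 * eta_logderiv r z * eta_quot r z) (at z)"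
    by (rule Cons.IH) (use Cons.prems in auto)
  have "eta_quot (p # r) = (\<lambda>z. dedekind_eta (of_nat \<delta> * z) powi e * eta_quot r z)"
    by (simp add: eta_quot_def [abs_def] p)
  moreover have "eta_logderiv (p # r) z = of_int e * (of_nat \<delta> * E2 (of_nat \<delta> * z)) + eta_logderiv r z"
    by (simp add: eta_logderiv_def p)
  ultimately show ?case using DERIV_mult[OF d IH] by (simp add: E_def algebra_simps)
qed

lemma eta_quot_nonzero: "\<forall>(\<delta>, e)\<in>set r. \<delta> > 0 \<Longrightarrow> Im z > 0 \<Longrightarrow> eta_quot r z \<noteq> 0"
  by (induction r) (auto simp: eta_quot_def dedekind_eta_nonzero)

fun eta_logderiv_cf :: "(nat \<times> int) list \<Rightarrow> nat \<Rightarrow> int"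
  where "eta_logderiv_cf [] = (\<lambda>n. 0)"
  | "eta_logderiv_cf ((\<delta>, e) # r) = (\<lambda>n. (e * int \<delta>) * dil \<delta> e2_cf n + eta_logderiv_cf r n)"

lemma qseries_eta_logderiv: "\<forall>(\<delta>, e)\<in>set r. \<delta> > 0 \<Longrightarrow> qseries (eta_logderiv_cf r) (eta_logderiv r)"
proof (induction r)
  case Nil
  show ?case by (simp add: qseries_def eta_logderiv_def)
next
  case (Cons p r)
  obtain \<delta> e where p: "p = (\<delta>, e)" by (cases p)
  have "qseries (\<lambda>n. (e * int \<delta>) * dil \<delta> e2_cf n) (\<lambda>z. of_int (e * int \<delta>) * E2 (of_nat \<delta> * z))"
    by (intro qseries_cmult qseries_dil qs_E2) (use Cons.prems p in auto)
  from qseries_add[OF this Cons.IH] Cons.prems show ?case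
    by (simp add: p eta_logderiv_def [abs_def] mult.assoc)
qed

text \<open>Whatever the cusp, the anomaly of \<open>\<delta> E2 (\<delta>z)\<close> is that of \<open>E2\<close> itself; the dilation is absorbed by the
  function \<open>H\<close>.\<close>

lemma E2_dilated_mob:
  assumes "\<delta> > 0" "\<gamma> \<in> SL2Z"
  shows "\<exists>Y>0. \<exists>C H. \<forall>z. Im z \<ge> Y \<longrightarrow> norm (H z) \<le> C \<and>
    of_nat \<delta> * E2 (of_nat \<delta> * mob \<gamma> z) =
      aut \<gamma> z ^ 2 * H z - 6 * \<i> / of_real pi * of_int (fst (snd (snd \<gamma>))) * aut \<gamma> z"
proof -
  obtain \<gamma>' :: mat2 and A D B where h: "\<gamma>' \<in> SL2Z" "A > 0" "D > 0" "A * D = int \<delta>"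
    "\<And>z. Im z > 0 \<Longrightarrow> of_nat \<delta> * mob \<gamma> z = mob \<gamma>' ((of_int A * z + of_int B) / of_int D)"
    "\<And>z. Im z > 0 \<Longrightarrow> aut \<gamma> z = of_int D * aut \<gamma>' ((of_int A * z + of_int B) / of_int D)"
    "fst (snd (snd \<gamma>)) = A * fst (snd (snd \<gamma>'))"
    using dilation_hermite[OF assms(2,1)] by metis
  obtain a' b' c' d' where g': "\<gamma>' = (a', b', c', d')" by (cases \<gamma>')
  obtain C where C: "\<And>z. Im z \<ge> 1 \<Longrightarrow> norm (E2 z) \<le> C"
    using qseries_vanishing_bound[OF qs_E2, of 0] by auto
  define w where "w z = (of_int A * z + of_int B) / of_int D" for z :: complex
  define H where "H z = of_int A / of_int D * E2 (w z)" for z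
  have Imw: "Im (w z) = of_int A * Im z / of_int D" for z
  proof -
    define t where "t = 1 / real_of_int D"
    have "w z = complex_of_real t * (of_int A * z + of_int B)" by (simp add: w_def t_def)
    moreover have "Im (complex_of_real t * (of_int A * z + of_int B)) = t * (of_int A * Im z)" by simp
    ultimately show ?thesis by (simp add: t_def)
  qed
  have *: "norm (H z) \<le> of_int A / of_int D * C \<and>
    of_nat \<delta> * E2 (of_nat \<delta> * mob \<gamma> z) =
      aut \<gamma> z ^ 2 * H z - 6 * \<i> / of_real pi * of_int (fst (snd (snd \<gamma>))) * aut \<gamma> z"
    if z: "Im z \<ge> of_int D / of_int A" for z
  proof
    have "of_int D / of_int A > (0 :: real)" using h(2,3) by simp
    hence z0: "Im z > 0" using z by linarith
    have w1: "Im (w z) \<ge> 1" using z h(2,3) by (simp add: Imw field_simps)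
    have "norm (of_int A / of_int D :: complex) = of_int A / of_int D" using h(2,3) by (simp add: norm_divide)
    thus "norm (H z) \<le> of_int A / of_int D * C" unfolding H_def norm_mult
      using C[OF w1] h(2,3) by (simp add: mult_left_mono divide_right_mono)
    have \<delta>: "of_nat \<delta> = (of_int A * of_int D :: complex)"
      by (metis h(4) of_int_mult of_int_of_nat_eq)
    have w0: "Im (w z) > 0" using w1 by simp
    have "of_nat \<delta> * E2 (of_nat \<delta> * mob \<gamma> z) = of_nat \<delta> * (aut \<gamma>' (w z) ^ 2 * E2 (w z) - 6 * \<i> / of_real pi * of_int c' * aut \<gamma>' (w z))"
      unfolding h(5)[OF z0] w_def[symmetric] using E2_mob[OF _ w0, of a' b' c' d'] h(1) by (simp add: g' aut_def)
    also have "\<dots> = aut \<gamma> z ^ 2 * H z - 6 * \<i> / of_real pi * of_int (fst (snd (snd \<gamma>))) * aut \<gamma> z"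
      unfolding h(6)[OF z0] h(7) w_def[symmetric] H_def \<delta> using h(3) by (simp add: g' power2_eq_square field_simps)
    finally show "of_nat \<delta> * E2 (of_nat \<delta> * mob \<gamma> z) = \<dots>" .
  qed
  show ?thesis
    by (rule exI[of _ "of_int D / of_int A"], rule conjI, use h(2,3) in simp,
        rule exI[of _ "of_int A / of_int D * C"], rule exI[of _ H]) (use * in blast)
qed

text \<open>The anomalies add up, weighted by the exponents; their sum is twice the weight of the eta quotient.\<close>

lemma eta_logderiv_mob:
  assumes "\<forall>(\<delta>, e)\<in>set r. \<delta> > 0" "\<gamma> \<in> SL2Z"
  shows "\<exists>Y>0. \<exists>C H. \<forall>z. Im z \<ge> Y \<longrightarrow> norm (H z) \<le> C \<and>
    eta_logderiv r (mob \<gamma> z) =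
      aut \<gamma> z ^ 2 * H z - 6 * \<i> / of_real pi * of_int (\<Sum>(\<delta>, e)\<leftarrow>r. e) * of_int (fst (snd (snd \<gamma>))) * aut \<gamma> z"
  using assms(1)
proof (induction r)
  case Nil
  show ?case by (intro exI[of _ 1] conjI exI[of _ 0] exI[of _ "\<lambda>_. 0"]) (auto simp: eta_logderiv_def)
next
  case (Cons p r)
  obtain \<delta> e where p: "p = (\<delta>, e)" by (cases p)
  have \<delta>: "\<delta> > 0" using Cons.prems p by simp
  obtain Y1 C1 H1 where 1: "Y1 > 0" "\<And>z. Im z \<ge> Y1 \<Longrightarrow> norm (H1 z) \<le> C1"
    "\<And>z. Im z \<ge> Y1 \<Longrightarrow> of_nat \<delta> * E2 (of_nat \<delta> * mob \<gamma> z) =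
      aut \<gamma> z ^ 2 * H1 z - 6 * \<i> / of_real pi * of_int (fst (snd (snd \<gamma>))) * aut \<gamma> z"
    using E2_dilated_mob[OF \<delta> assms(2)] by blast
  have "\<forall>(\<delta>, e)\<in>set r. \<delta> > 0" using Cons.prems by simp
  from Cons.IH[OF this] obtain Y2 C2 H2 where 2: "Y2 > 0" "\<And>z. Im z \<ge> Y2 \<Longrightarrow> norm (H2 z) \<le> C2"
    "\<And>z. Im z \<ge> Y2 \<Longrightarrow> eta_logderiv r (mob \<gamma> z) =
      aut \<gamma> z ^ 2 * H2 z - 6 * \<i> / of_real pi * of_int (\<Sum>(\<delta>, e)\<leftarrow>r. e) * of_int (fst (snd (snd \<gamma>))) * aut \<gamma> z"
    by blast
  have L: "eta_logderiv (p # r) w = of_int e * (of_nat \<delta> * E2 (of_nat \<delta> * w)) + eta_logderiv r w" for w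
    by (simp add: eta_logderiv_def p)
  have S: "(\<Sum>(\<delta>, e)\<leftarrow>p # r. e) = e + (\<Sum>(\<delta>, e)\<leftarrow>r. e)" by (simp add: p)
  have *: "norm (of_int e * H1 z + H2 z) \<le> \<bar>of_int e\<bar> * C1 + C2 \<and>
    eta_logderiv (p # r) (mob \<gamma> z) = aut \<gamma> z ^ 2 * (of_int e * H1 z + H2 z) -
      6 * \<i> / of_real pi * of_int (\<Sum>(\<delta>, e)\<leftarrow>p # r. e) * of_int (fst (snd (snd \<gamma>))) * aut \<gamma> z"
    if z: "Im z \<ge> max Y1 Y2" for z
  proof
    have "norm (of_int e * H1 z + H2 z) \<le> \<bar>of_int e\<bar> * norm (H1 z) + norm (H2 z)"
      using norm_triangle_ineq[of "of_int e * H1 z" "H2 z"] by (simp add: norm_mult)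
    also have "\<dots> \<le> \<bar>of_int e\<bar> * C1 + C2" using 1(2)[of z] 2(2)[of z] z by (intro add_mono mult_left_mono) auto
    finally show "norm (of_int e * H1 z + H2 z) \<le> \<bar>of_int e\<bar> * C1 + C2" .
    have zz: "Im z \<ge> Y1" "Im z \<ge> Y2" using z by auto
    show "eta_logderiv (p # r) (mob \<gamma> z) = aut \<gamma> z ^ 2 * (of_int e * H1 z + H2 z) -
      6 * \<i> / of_real pi * of_int (\<Sum>(\<delta>, e)\<leftarrow>p # r. e) * of_int (fst (snd (snd \<gamma>))) * aut \<gamma> z"
      unfolding L S 1(3)[OF zz(1)] 2(3)[OF zz(2)] by (simp add: algebra_simps)
  qed
  have "max Y1 Y2 > 0" using 1(1) by simp
  thus ?case
    by (intro exI[of _ "max Y1 Y2"] conjI exI[of _ "\<bar>of_int e\<bar> * C1 + C2"] exI[of _ "\<lambda>z. of_int e * H1 z + H2 z"] allI impI)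
       (use * in \<open>simp_all only:\<close>)
qed

lemma eta_logderiv_mob_Gamma0:
  assumes "\<forall>(\<delta>, e)\<in>set r. \<delta> > 0 \<and> \<delta> dvd 24" "(a, b, c, d) \<in> Gamma0 24" "Im z > 0"
  shows "eta_logderiv r (mob (a, b, c, d) z) =
    aut (a, b, c, d) z ^ 2 * eta_logderiv r z - 6 * \<i> / of_real pi * of_int (\<Sum>(\<delta>, e)\<leftarrow>r. e) * of_int c * aut (a, b, c, d) z"
  using assms(1)
proof (induction r)
  case Nil
  show ?case by (simp add: eta_logderiv_def)
next
  case (Cons p r)
  obtain \<delta> e where p: "p = (\<delta>, e)" by (cases p)
  have \<delta>: "\<delta> > 0" "\<delta> dvd 24" using Cons.prems p by auto
  have det: "a * d - b * c = 1" and c: "24 dvd c" using assms(2) by (auto simp: Gamma0_def)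
  have "int \<delta> dvd int 24" using \<delta>(2) by (simp only: of_nat_dvd_iff)
  hence "int \<delta> dvd c" using c by (auto intro: dvd_trans)
  then obtain k where k: "c = int \<delta> * k" by (elim dvdE)
  have S: "(a, int \<delta> * b, k, d) \<in> SL2Z" using det by (simp add: SL2Z_iff k mult_ac)
  have "E2 (of_nat \<delta> * mob (a, b, c, d) z) =
      (of_int c * z + of_int d)\<^sup>2 * E2 (of_nat \<delta> * z) - 6 * \<i> / of_real pi * of_int k * (of_int c * z + of_int d)"
    using E2_mob[OF S Im_dilation[OF \<delta>(1) assms(3)]]
    unfolding mob_dilation(2)[OF \<delta>(1)] mob_dilation(1)[OF \<delta>(1), symmetric] k[symmetric] .
  note E = this
  have 1: "of_nat \<delta> * E2 (of_nat \<delta> * mob (a, b, c, d) z) =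
      aut (a, b, c, d) z ^ 2 * (of_nat \<delta> * E2 (of_nat \<delta> * z)) - 6 * \<i> / of_real pi * of_int c * aut (a, b, c, d) z"
    unfolding E by (simp add: aut_def k algebra_simps)
  have IH: "eta_logderiv r (mob (a, b, c, d) z) =
    aut (a, b, c, d) z ^ 2 * eta_logderiv r z - 6 * \<i> / of_real pi * of_int (\<Sum>(\<delta>, e)\<leftarrow>r. e) * of_int c * aut (a, b, c, d) z"
    by (rule Cons.IH) (use Cons.prems in simp)
  have L: "eta_logderiv (p # r) w = of_int e * (of_nat \<delta> * E2 (of_nat \<delta> * w)) + eta_logderiv r w" for w
    by (simp add: eta_logderiv_def p)
  have S: "(\<Sum>(\<delta>, e)\<leftarrow>p # r. e) = e + (\<Sum>(\<delta>, e)\<leftarrow>r. e)" by (simp add: p)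
  show ?case unfolding L S IH 1 by (simp add: algebra_simps)
qed

lemma has_field_derivative_mob:
  assumes "\<gamma> \<in> SL2Z" "Im z > 0"
  shows "(mob \<gamma> has_field_derivative 1 / aut \<gamma> z ^ 2) (at z)"
proof -
  obtain a b c d where g: "\<gamma> = (a, b, c, d)" by (cases \<gamma>)
  have nz: "of_int c * z + of_int d \<noteq> 0" using aut_nonzero[OF assms] by (simp add: g aut_def)
  have "a * d - b * c = 1" using assms(1) by (simp add: g SL2Z_iff)
  hence det: "of_int a * of_int d - of_int b * of_int c = (1 :: complex)" by (metis of_int_1 of_int_diff of_int_mult)
  have "((\<lambda>z. (of_int a * z + of_int b) / (of_int c * z + of_int d)) has_field_derivative
      (of_int a * (of_int c * z + of_int d) - (of_int a * z + of_int b) * of_int c) / ((of_int c * z + of_int d) * (of_int c * z + of_int d))) (at z)"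
    using nz by (auto intro!: derivative_eq_intros)
  also have "of_int a * (of_int c * z + of_int d) - (of_int a * z + of_int b) * of_int c = of_int a * of_int d - of_int b * of_int c"
    by (simp add: algebra_simps)
  finally show ?thesis by (simp add: g det mob_def [abs_def] aut_def power2_eq_square)
qed

text \<open>Differentiation of \<open>F (\<gamma> z) = (c z + d)\<^sup>2 G z\<close>. The second term is the failure of the derivative to be
  modular.\<close>

lemma deriv_at_mob:
  assumes F: "F holomorphic_on upper_half_plane" and S: "(a, b, c, d) \<in> SL2Z" and z: "Im z > 0"
  defines "G \<equiv> (\<lambda>z. F (mob (a, b, c, d) z) / aut (a, b, c, d) z ^ 2)"
  shows "deriv F (mob (a, b, c, d) z) = aut (a, b, c, d) z ^ 4 * deriv G z + 2 * of_int c * aut (a, b, c, d) z ^ 3 * G z"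
    and "G field_differentiable at z"
proof -
  define j where "j = aut (a, b, c, d)"
  define m where "m = mob (a, b, c, d)"
  have j0: "j z \<noteq> 0" unfolding j_def by (rule aut_nonzero[OF S z])
  have m: "(m has_field_derivative 1 / j z ^ 2) (at z)" unfolding m_def j_def by (rule has_field_derivative_mob[OF S z])
  have j: "(j has_field_derivative of_int c) (at z)"
    unfolding j_def aut_def [abs_def] by (auto intro!: derivative_eq_intros)
  have "m z \<in> upper_half_plane" using Im_mob_pos[OF S z] by (simp add: m_def upper_half_plane_def)
  hence "(F has_field_derivative deriv F (m z)) (at (m z))"
    by (intro holomorphic_derivI[OF F]) (simp_all add: upper_half_plane_def open_halfspace_Im_gt)
  from DERIV_chain2[OF this m] have Fm: "((\<lambda>z. F (m z)) has_field_derivative deriv F (m z) * (1 / j z ^ 2)) (at z)" .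
  have G: "(G has_field_derivative (deriv F (m z) * (1 / j z ^ 2) * j z ^ 2 - F (m z) * (2 * j z * of_int c)) / (j z ^ 2 * j z ^ 2)) (at z)"
    unfolding G_def m_def[symmetric] j_def[symmetric]
    using j0 by (auto intro!: derivative_eq_intros Fm j simp: power2_eq_square)
  thus "G field_differentiable at z" by (auto simp: field_differentiable_def)
  have "deriv G z = (deriv F (m z) * (1 / j z ^ 2) * j z ^ 2 - F (m z) * (2 * j z * of_int c)) / (j z ^ 2 * j z ^ 2)"
    by (rule DERIV_imp_deriv[OF G])
  hence "j z ^ 4 * deriv G z = deriv F (m z) - F (m z) * (2 * j z * of_int c)"
    using j0 by (simp add: field_simps power4_eq_xxxx power2_eq_square)
  moreover have "2 * of_int c * j z ^ 3 * G z = F (m z) * (2 * j z * of_int c)"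
    using j0 by (simp add: G_def m_def j_def power3_eq_cube power2_eq_square)
  ultimately show "deriv F (mob (a, b, c, d) z) = aut (a, b, c, d) z ^ 4 * deriv G z + 2 * of_int c * aut (a, b, c, d) z ^ 3 * G z"
    by (simp add: m_def j_def)
qed

section \<open>Recognising an eta quotient by its logarithmic derivative\<close>

text \<open>This vanishes exactly where \<open>F\<close> satisfies the first order linear differential equation that characterises
  the multiples of the eta quotient.\<close>

definition logderiv_defect :: "(nat \<times> int) list \<Rightarrow> (complex \<Rightarrow> complex) \<Rightarrow> complex \<Rightarrow> complex"
  where "logderiv_defect r F z = 24 * (deriv F z / (2 * of_real pi * \<i>)) - F z * eta_logderiv r z"

text \<open>The anomaly of the derivative and that of \<open>eta_logderiv\<close> cancel; the number 4 is the sum of the exponents of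
  an eta quotient of weight 2.\<close>

lemma logderiv_defect_mob:
  assumes F: "F holomorphic_on upper_half_plane" and S: "(a, b, c, d) \<in> SL2Z" and z: "Im z > 0"
    and H: "eta_logderiv r (mob (a, b, c, d) z) = aut (a, b, c, d) z ^ 2 * H - 6 * \<i> / of_real pi * of_int 4 * of_int c * aut (a, b, c, d) z"
  defines "G \<equiv> (\<lambda>z. F (mob (a, b, c, d) z) / aut (a, b, c, d) z ^ 2)"
  shows "logderiv_defect r F (mob (a, b, c, d) z) = aut (a, b, c, d) z ^ 4 * (24 * (deriv G z / (2 * of_real pi * \<i>)) - G z * H)"
proof -
  define j where "j = aut (a, b, c, d) z"
  have Fj: "F (mob (a, b, c, d) z) = j ^ 2 * G z"
    using aut_nonzero[OF S z] by (simp add: G_def j_def)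
  have i: "x / (2 * of_real pi * \<i>) = - (\<i> / (2 * of_real pi)) * x" for x
    by (simp add: field_simps)
  define p where "p = (\<i> / of_real pi :: complex)"
  have p: "\<i> / (2 * of_real pi) = p / 2" "6 * \<i> / of_real pi = 6 * p" by (simp_all add: p_def)
  show ?thesis
    unfolding logderiv_defect_def deriv_at_mob(1)[OF F S z, folded G_def] H Fj unfolding j_def[symmetric] i p
    by (simp add: algebra_simps power4_eq_xxxx power3_eq_cube power2_eq_square)
qed

text \<open>For growth at a cusp, Cauchy's inequality on discs of radius 1 bounds the derivative of the bounded transform
  \<open>G\<close> of \<open>F\<close>. Under \<open>Gamma0 24\<close> the transform \<open>G\<close> is a multiple of \<open>F\<close>, and modularity follows from
  the same formula.\<close>

theorem form24_logderiv_defect: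
  assumes F: "form24 2 F" and r: "\<forall>(\<delta>, e)\<in>set r. \<delta> > 0 \<and> \<delta> dvd 24" and sum: "(\<Sum>(\<delta>, e)\<leftarrow>r. e) = 4"
  shows "form24 4 (logderiv_defect r F)"
  unfolding form24_def
proof (intro conjI ballI allI impI)
  have hol: "F holomorphic_on upper_half_plane" using F by (simp add: form24_def)
  have opn: "open upper_half_plane" by (simp add: upper_half_plane_def open_halfspace_Im_gt)
  have r0: "\<forall>(\<delta>, e)\<in>set r. \<delta> > 0" using r by auto
  show "logderiv_defect r F holomorphic_on upper_half_plane"
    unfolding logderiv_defect_def [abs_def]
    by (intro holomorphic_intros holomorphic_deriv[OF hol opn] hol qseries_holomorphic[OF qseries_eta_logderiv[OF r0]]) (use opn in auto)
  show "tempered (real 4) (logderiv_defect r F)"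
  proof (rule temperedI)
    fix \<gamma> assume \<gamma>: "\<gamma> \<in> SL2Z"
    obtain a b c d where g: "\<gamma> = (a, b, c, d)" by (cases \<gamma>)
    have S: "(a, b, c, d) \<in> SL2Z" using \<gamma> g by simp
    define G where "G = (\<lambda>z. F (mob (a, b, c, d) z) / aut (a, b, c, d) z ^ 2)"
    obtain Y1 C1 where 1: "Y1 > 0" "C1 \<ge> 0" "\<And>z. Im z \<ge> Y1 \<Longrightarrow> norm (F (mob \<gamma> z)) \<le> C1 * norm (aut \<gamma> z) powr real 2"
      using F \<gamma> unfolding form24_def tempered_def by blast
    obtain Y2 C2 H where 2: "Y2 > 0" "\<And>z. Im z \<ge> Y2 \<Longrightarrow> norm (H z) \<le> C2"
      "\<And>z. Im z \<ge> Y2 \<Longrightarrow> eta_logderiv r (mob \<gamma> z) =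
        aut \<gamma> z ^ 2 * H z - 6 * \<i> / of_real pi * of_int 4 * of_int (fst (snd (snd \<gamma>))) * aut \<gamma> z"
      using eta_logderiv_mob[OF r0 \<gamma>, unfolded sum] by blast
    have GB: "norm (G z) \<le> C1" if "Im z \<ge> Y1" for z
    proof -
      have "norm (aut \<gamma> z) > 0" using aut_nonzero[OF \<gamma>, of z] that 1(1) by simp
      thus ?thesis using 1(3)[OF that] by (simp add: G_def g norm_divide norm_power pos_divide_le_eq)
    qed
    have Ghol: "G holomorphic_on upper_half_plane"
    proof (rule holomorphic_onI)
      fix z assume "z \<in> upper_half_plane"
      hence "Im z > 0" by (simp add: upper_half_plane_def)
      from deriv_at_mob(2)[OF hol S this] show "G field_differentiable at z within upper_half_plane"
        unfolding G_def by (rule field_differentiable_at_within)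
    qed
    have DB: "norm (deriv G z) \<le> C1" if z: "Im z \<ge> Y1 + 1" for z
    proof -
      have sub: "Im x \<ge> Y1" if "dist z x \<le> 1" for x
        using abs_Im_le_cmod[of "z - x"] that z by (simp add: dist_norm)
      have sub': "cball z 1 \<subseteq> upper_half_plane"
        using sub 1(1) by (fastforce simp: upper_half_plane_def)
      have "norm ((deriv ^^ 1) G z) \<le> fact 1 * C1 / 1 ^ 1"
      proof (rule Cauchy_inequality)
        show "G holomorphic_on ball z 1" by (rule holomorphic_on_subset[OF Ghol]) (use sub' ball_subset_cball in blast)
        show "continuous_on (cball z 1) G"
          by (rule holomorphic_on_imp_continuous_on[OF holomorphic_on_subset[OF Ghol sub']])
        show "norm (G x) \<le> C1" if "norm (z - x) = 1" for x
          using that by (intro GB sub) (simp add: dist_norm)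
      qed simp
      thus ?thesis by simp
    qed
    define Y where "Y = max (Y1 + 1) Y2"
    have "norm (logderiv_defect r F (mob \<gamma> z)) \<le> (24 * C1 + C1 * \<bar>C2\<bar>) * norm (aut \<gamma> z) powr real 4" if z: "Im z \<ge> Y" for z
    proof -
      have zz: "Im z \<ge> Y1 + 1" "Im z \<ge> Y1" "Im z \<ge> Y2" "Im z > 0" using z 1(1) 2(1) by (auto simp: Y_def)
      have e: "logderiv_defect r F (mob \<gamma> z) = aut \<gamma> z ^ 4 * (24 * (deriv G z / (2 * of_real pi * \<i>)) - G z * H z)"
        unfolding g G_def by (rule logderiv_defect_mob[OF hol S zz(4)]) (use 2(3)[OF zz(3)] in \<open>simp add: g\<close>)
      have "norm (deriv G z / (2 * of_real pi * \<i>)) = norm (deriv G z) / (2 * pi)"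
        by (simp add: norm_divide norm_mult)
      also have "\<dots> \<le> norm (deriv G z) / 1" using pi_gt3 by (intro divide_left_mono) auto
      also have "\<dots> \<le> C1" using DB[OF zz(1)] by simp
      finally have a: "norm (24 * (deriv G z / (2 * of_real pi * \<i>))) \<le> 24 * C1" unfolding norm_mult by simp
      have "norm (H z) \<le> \<bar>C2\<bar>" using 2(2)[OF zz(3)] by linarith
      hence b: "norm (G z * H z) \<le> C1 * \<bar>C2\<bar>" unfolding norm_mult using GB[OF zz(2)] 1(2) by (intro mult_mono) auto
      have j: "norm (aut \<gamma> z) powr real 4 = norm (aut \<gamma> z) ^ 4"
        using aut_nonzero[OF \<gamma> zz(4)] by (intro powr_realpow) simp
      have "norm (24 * (deriv G z / (2 * of_real pi * \<i>)) - G z * H z) \<le> 24 * C1 + C1 * \<bar>C2\<bar>"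
        by (rule order_trans[OF norm_triangle_ineq4 add_mono[OF a b]])
      thus ?thesis unfolding e norm_mult norm_power j by (simp add: mult.commute mult_left_mono)
    qed
    moreover have "Y > 0" using 2(1) by (simp add: Y_def)
    ultimately show "\<exists>Y>0. \<exists>C. \<forall>z. Im z \<ge> Y \<longrightarrow> norm (logderiv_defect r F (mob \<gamma> z)) \<le> C * norm (aut \<gamma> z) powr real 4" by blast
  qed
  fix g z assume g: "g \<in> Gamma0 24" and z: "Im z > 0"
  obtain a b c d where gg: "g = (a, b, c, d)" by (cases g)
  have S: "(a, b, c, d) \<in> SL2Z" using Gamma0_subset_SL2Z[OF g] gg by simp
  define G where "G = (\<lambda>z. F (mob (a, b, c, d) z) / aut (a, b, c, d) z ^ 2)"
  define x where "x = complex_of_int (kron8 d)"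
  have Gx: "G w = x * F w" if "Im w > 0" for w
    using F g that aut_nonzero[OF S that] unfolding form24_def by (auto simp: G_def x_def gg)
  have "((\<lambda>w. x * F w) has_field_derivative x * deriv F z) (at z)"
    by (intro DERIV_cmult holomorphic_derivI[OF hol opn]) (use z in \<open>simp add: upper_half_plane_def\<close>)
  hence "(G has_field_derivative x * deriv F z) (at z)"
    by (rule has_field_derivative_transform_within_open[OF _ opn]) (use Gx z in \<open>auto simp: upper_half_plane_def\<close>)
  hence dG: "deriv G z = x * deriv F z" by (rule DERIV_imp_deriv)
  have "logderiv_defect r F (mob (a, b, c, d) z) = aut (a, b, c, d) z ^ 4 * (24 * (deriv G z / (2 * of_real pi * \<i>)) - G z * eta_logderiv r z)"
    unfolding G_def
    by (rule logderiv_defect_mob[OF hol S z]) (use eta_logderiv_mob_Gamma0[OF r g[unfolded gg] z] in \<open>simp only: sum\<close>)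
  thus "logderiv_defect r F (mob g z) = of_int (kron8 (lower_right g)) * aut g z ^ 4 * logderiv_defect r F z"
    by (simp add: gg dG Gx[OF z] logderiv_defect_def x_def algebra_simps)
qed

lemma qseries_logderiv_defect:
  assumes "qseries a F" "\<forall>(\<delta>, e)\<in>set r. \<delta> > 0"
  shows "qseries (\<lambda>n. 24 * (int n * a n) + (- 1) * conv a (eta_logderiv_cf r) n) (logderiv_defect r F)"
proof -
  have "qseries (\<lambda>n. 24 * (int n * a n) + (- 1) * conv a (eta_logderiv_cf r) n)
     (\<lambda>z. of_int 24 * (deriv F z / (2 * of_real pi * \<i>)) + of_int (- 1) * (F z * eta_logderiv r z))"
    by (intro qseries_add qseries_cmult qseries_deriv qseries_mult assms(1) qseries_eta_logderiv[OF assms(2)])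
  thus ?thesis by (simp add: logderiv_defect_def [abs_def])
qed

text \<open>The eta quotient without its exponential prefactor, as a function of \<open>q\<close>.\<close>

fun euler_quot :: "(nat \<times> int) list \<Rightarrow> complex \<Rightarrow> complex"
  where "euler_quot [] = (\<lambda>q. 1)"
  | "euler_quot ((\<delta>, e) # r) = (\<lambda>q. euler_prod (q ^ \<delta>) powi e * euler_quot r q)"

lemma euler_prod_0: "euler_prod 0 = 1"
  by (simp add: euler_prod_def)

lemma euler_quot_at_0:
  assumes "\<forall>(\<delta>, e)\<in>set r. \<delta> > 0"
  shows "isCont (euler_quot r) 0 \<and> euler_quot r 0 = 1"
  using assms
proof (induction r)
  case (Cons p r)
  obtain \<delta> e where p: "p = (\<delta>, e)" by (cases p)
  have \<delta>: "\<delta> > 0" using Cons.prems p by simp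
  have IH: "isCont (euler_quot r) 0 \<and> euler_quot r 0 = 1" by (rule Cons.IH) (use Cons.prems in auto)
  have "isCont euler_prod 0"
    using holomorphic_on_imp_continuous_on[OF euler_prod_holomorphic] by (auto simp: continuous_on_eq_continuous_at)
  moreover have "(\<lambda>q. q ^ \<delta>) 0 = (0 :: complex)" using \<delta> by simp
  ultimately have "isCont euler_prod ((\<lambda>q. q ^ \<delta>) 0)" by (simp only:)
  from isCont_o2[where f = "\<lambda>q. q ^ \<delta>" and g = euler_prod, OF _ this] have c: "isCont (\<lambda>q. euler_prod (q ^ \<delta>)) 0" by simp
  have "isCont (\<lambda>q. euler_prod (q ^ \<delta>) powi e) 0"
    using c \<delta> by (intro continuous_intros) (auto simp: euler_prod_0 zero_power)
  thus ?case using IH \<delta> by (auto simp: p euler_prod_0 zero_power)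
qed simp

lemma eta_quot_eq_euler_quot:
  "eta_quot r z = exp (of_real pi * \<i> * z / 12 * of_int (\<Sum>(\<delta>, e)\<leftarrow>r. int \<delta> * e)) * euler_quot r (qexp z)"
proof (induction r)
  case (Cons p r)
  obtain \<delta> e where p: "p = (\<delta>, e)" by (cases p)
  have "dedekind_eta (of_nat \<delta> * z) powi e =
      exp (of_real pi * \<i> * z / 12 * of_int (int \<delta> * e)) * euler_prod (qexp z ^ \<delta>) powi e"
    unfolding dedekind_eta_eq qexp_of_nat_mult power_int_mult_distrib exp_power_int by (simp add: mult_ac)
  thus ?case using Cons by (simp add: p eta_quot_def exp_add ring_distribs mult_ac)
qed (simp add: eta_quot_def)

text \<open>The quotient of the two functions has derivative zero, so it is a constant \<open>c\<close>. Along the points \<open>(n+1)i\<close>,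
  where \<open>q\<close> tends to 0, the eta quotient behaves like \<open>q\<close> because the weighted sum of exponents is 24; so
  \<open>c\<close> is the coefficient of \<open>q\<close> in \<open>F\<close>.\<close>

theorem eq_eta_quot_if_logderiv_defect_eq_0:
  assumes qseries: "qseries a F" and r: "\<forall>(\<delta>, e)\<in>set r. \<delta> > 0" and sum: "(\<Sum>(\<delta>, e)\<leftarrow>r. int \<delta> * e) = 24"
    and a0: "a 0 = 0" and logderiv_defect: "\<And>z. Im z > 0 \<Longrightarrow> logderiv_defect r F z = 0" and z: "Im z > 0"
  shows "F z = of_int (a 1) * eta_quot r z"
proof -
  have hol: "F holomorphic_on upper_half_plane" by (rule qseries_holomorphic[OF qseries])
  have opn: "open upper_half_plane" by (simp add: upper_half_plane_def open_halfspace_Im_gt)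
  have "((\<lambda>w. F w / eta_quot r w) has_field_derivative 0) (at w within upper_half_plane)" if w: "w \<in> upper_half_plane" for w
  proof -
    have w0: "Im w > 0" using w by (simp add: upper_half_plane_def)
    have B0: "eta_quot r w \<noteq> 0" by (rule eta_quot_nonzero[OF r w0])
    have dF: "(F has_field_derivative deriv F w) (at w)" by (rule holomorphic_derivI[OF hol opn w])
    have "24 * (deriv F w / (2 * of_real pi * \<i>)) = F w * eta_logderiv r w"
      using logderiv_defect[OF w0] by (simp add: logderiv_defect_def)
    moreover have t: "x = 24 * (x / t) * t / 24" if "t \<noteq> 0" for x t :: complex using that by simp
    have "deriv F w = 24 * (deriv F w / (2 * of_real pi * \<i>)) * (2 * of_real pi * \<i>) / 24" by (rule t) simp
    ultimately have e: "deriv F w = F w * eta_logderiv r w * (2 * of_real pi * \<i>) / 24" by argo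
    have "((\<lambda>w. F w / eta_quot r w) has_field_derivative
        (deriv F w * eta_quot r w - F w * (2 * of_real pi * \<i> / 24 * eta_logderiv r w * eta_quot r w)) / (eta_quot r w * eta_quot r w)) (at w)"
      by (rule DERIV_divide[OF dF eta_quot_has_derivative[OF r w0] B0])
    also have "deriv F w * eta_quot r w - F w * (2 * of_real pi * \<i> / 24 * eta_logderiv r w * eta_quot r w) = 0"
      unfolding e by simp
    finally show ?thesis by (simp add: has_field_derivative_at_within)
  qed
  moreover have "convex upper_half_plane" by (simp add: upper_half_plane_def convex_halfspace_Im_gt)
  ultimately obtain c where "\<And>w. w \<in> upper_half_plane \<Longrightarrow> F w / eta_quot r w = c"
    using has_field_derivative_zero_constant[of upper_half_plane "\<lambda>w. F w / eta_quot r w"] by blast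
  hence c: "F w = c * eta_quot r w" if "Im w > 0" for w
    using that eta_quot_nonzero[OF r that] by (auto simp: upper_half_plane_def divide_simps)
  have eq: "eta_quot r w = qexp w * euler_quot r (qexp w)" for w
    unfolding eta_quot_eq_euler_quot sum by (simp add: qexp_def mult_ac)
  define q where "q n = qexp (of_nat (Suc n) * \<i>)" for n
  have Im: "Im (of_nat (Suc n) * \<i>) > 0" for n by simp
  have q0: "q \<longlonglongrightarrow> 0"
  proof -
    have "(\<lambda>n. qexp \<i> ^ Suc n) \<longlonglongrightarrow> 0"
      by (rule LIMSEQ_Suc, rule LIMSEQ_power_zero) (simp add: norm_qexp_less_1)
    thus ?thesis unfolding q_def [abs_def] qexp_of_nat_mult .
  qed
  have Fq: "F (of_nat (Suc n) * \<i>) / q n = c * euler_quot r (q n)" for n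
    unfolding c[OF Im] eq q_def using qexp_nonzero by simp
  have cont: "isCont (euler_quot r) 0" "euler_quot r 0 = 1" using euler_quot_at_0[OF r] by auto
  have "(\<lambda>n. c * euler_quot r (q n)) \<longlonglongrightarrow> c * euler_quot r 0"
    by (intro tendsto_mult tendsto_const isCont_tendsto_compose[OF cont(1) q0])
  hence lim1: "(\<lambda>n. F (of_nat (Suc n) * \<i>) / q n) \<longlonglongrightarrow> c" unfolding Fq cont(2) by simp
  have "qseries (\<lambda>n. if n = 1 then 1 else 0) qexp"
    unfolding qseries_def using sums_single[of 1 "\<lambda>n. qexp z ^ n" for z] by (auto simp: if_distrib[of "\<lambda>x. of_int x * _"] cong: if_cong)
  hence qs1: "qseries (\<lambda>n. a n + - a 1 * (if n = 1 then 1 else 0)) (\<lambda>z. F z + of_int (- a 1) * qexp z)"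
    by (intro qseries_add[OF qseries] qseries_cmult)
  have "a n + - a 1 * (if n = 1 then 1 else 0) = 0" if "n < 2" for n
    using less_2_cases[OF that] a0 by auto
  hence "\<exists>C. \<forall>z. Im z \<ge> 1 \<longrightarrow> norm (F z + of_int (- a 1) * qexp z) \<le> C * norm (qexp z) ^ 2"
    by (rule qseries_vanishing_bound[OF qs1])
  then obtain C where C: "\<forall>z. Im z \<ge> 1 \<longrightarrow> norm (F z + of_int (- a 1) * qexp z) \<le> C * norm (qexp z) ^ 2" ..
  have "(\<lambda>n. F (of_nat (Suc n) * \<i>) / q n - of_int (a 1)) \<longlonglongrightarrow> 0"
  proof (rule Lim_null_comparison[OF always_eventually])
    show "(\<lambda>n. C * norm (q n)) \<longlonglongrightarrow> 0" using tendsto_mult_right_zero[OF tendsto_norm_zero[OF q0]] .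
    show "\<forall>n. norm (F (of_nat (Suc n) * \<i>) / q n - of_int (a 1)) \<le> C * norm (q n)"
    proof
      fix n
      have qn: "q n \<noteq> 0" unfolding q_def by (rule qexp_nonzero)
      have "norm (F (of_nat (Suc n) * \<i>) - of_int (a 1) * q n) \<le> C * norm (q n) ^ 2"
        using C[rule_format, of "of_nat (Suc n) * \<i>"] unfolding q_def by simp
      moreover have "F (of_nat (Suc n) * \<i>) / q n - of_int (a 1) = (F (of_nat (Suc n) * \<i>) - of_int (a 1) * q n) / q n"
        using qn by (simp add: field_simps)
      ultimately show "norm (F (of_nat (Suc n) * \<i>) / q n - of_int (a 1)) \<le> C * norm (q n)"
        using qn by (simp add: norm_divide pos_divide_le_eq power2_eq_square mult.assoc)
    qed
  qed
  hence "(\<lambda>n. F (of_nat (Suc n) * \<i>) / q n) \<longlonglongrightarrow> of_int (a 1)" by (simp add: LIM_zero_iff)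
  from LIMSEQ_unique[OF lim1 this] c[OF z] show ?thesis by simp
qed

section \<open>Comparison of coefficients\<close>

lemma trunc_nth: "n < N \<Longrightarrow> trunc N a ! n = a n"
  by (simp add: trunc_def)

text \<open>The substitution of \<open>q^k\<close> for \<open>q\<close>, on truncated expansions.\<close>

definition ldil :: "nat \<Rightarrow> int list \<Rightarrow> int list"
  where "ldil k xs = map (\<lambda>n. if n mod k = 0 then xs ! (n div k) else 0) [0..<length xs]"

lemma trunc_dil: "trunc N (dil k a) = ldil k (trunc N a)"
proof -
  have "dil k a n = (if n mod k = 0 then trunc N a ! (n div k) else 0)" if "n < N" for n
    using le_less_trans[OF div_le_dividend that, of k] by (simp add: dil_def trunc_nth dvd_eq_mod_eq_0)
  thus ?thesis unfolding ldil_def trunc_def[of N "dil k a"] by (intro map_cong) (auto simp: trunc_def)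
qed

text \<open>Weight 4 requires \<open>4 * 4 + 1 = 17\<close> coefficients; the first nine of them are what weight 2 requires.\<close>

lemma trunc_theta_cf: "trunc 17 theta_cf = [1, 2, 0, 0, 2, 0, 0, 0, 0, 2, 0, 0, 0, 0, 0, 0, 2]"
  by code_simp

lemma trunc_e18_cf: "trunc 17 e18_cf = [0, 1, 2, 2, 4, 4, 4, 8, 8, 7, 8, 10, 8, 12, 16, 8, 16]"
  by code_simp

lemma trunc_e81_cf: "trunc 17 e81_cf = [- 1, 2, 2, - 4, 2, - 8, - 4, 16, 2, 14, - 8, - 20, - 4, - 24, 16, 16, 2]"
  by code_simp

lemma trunc_e2_cf: "trunc 17 e2_cf = [1, - 24, - 72, - 96, - 168, - 144, - 288, - 192, - 360, - 312, - 432, - 288, - 672, - 336, - 576, - 576, - 744]"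
  by code_simp

text \<open>Integral combinations of a theta product with the four Eisenstein series. The series \<open>E_8_1\<close> enters with a
  factor 2, to match its integral coefficients.\<close>

definition theta_eis :: "int \<Rightarrow> nat \<Rightarrow> nat \<Rightarrow> int \<Rightarrow> int \<Rightarrow> int \<Rightarrow> int \<Rightarrow> complex \<Rightarrow> complex"
  where "theta_eis t m n b1 b2 b3 b4 z = of_int t * theta_form m n z +
    (of_int b1 * E_1_8 (of_nat 1 * z) + (of_int b2 * E_1_8 (of_nat 3 * z) +
     (of_int b3 * (2 * E_8_1 (of_nat 1 * z)) + of_int b4 * (2 * E_8_1 (of_nat 3 * z)))))"

definition theta_eis_cf :: "int \<Rightarrow> nat \<Rightarrow> nat \<Rightarrow> int \<Rightarrow> int \<Rightarrow> int \<Rightarrow> int \<Rightarrow> nat \<Rightarrow> int"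
  where "theta_eis_cf t m n b1 b2 b3 b4 = (\<lambda>k. t * theta_form_cf m n k +
    (b1 * dil 1 e18_cf k + (b2 * dil 3 e18_cf k + (b3 * dil 1 e81_cf k + b4 * dil 3 e81_cf k))))"

lemma qseries_theta_eis: "m > 0 \<Longrightarrow> n > 0 \<Longrightarrow> qseries (theta_eis_cf t m n b1 b2 b3 b4) (theta_eis t m n b1 b2 b3 b4)"
  unfolding theta_eis_def [abs_def] theta_eis_cf_def
  by (intro qseries_add qseries_cmult qseries_theta_form qseries_dil[OF qs_E_1_8] qseries_dil[OF qs_E_8_1]) auto

lemma form24_theta_eis: "m > 0 \<Longrightarrow> n > 0 \<Longrightarrow> 4 * m dvd 24 \<Longrightarrow> 8 * n dvd 24 \<Longrightarrow> form24 2 (theta_eis t m n b1 b2 b3 b4)"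
  unfolding theta_eis_def [abs_def]
  by (intro form24_add form24_cmult[of _ _ "of_int _"] form24_theta_form form24_E_1_8 form24_E_8_1) auto

lemmas trunc_simps = theta_eis_cf_def theta_form_cf_def trunc_add trunc_cmult trunc_deriv trunc_conv trunc_dil
  trunc_theta_cf trunc_e18_cf trunc_e81_cf trunc_e2_cf

lemma trunc_theta_eis_1: "trunc 17 (theta_eis_cf 5 1 3 (-16) 24 2 3) = [0, 8, - 8, 0, 0, 0, - 8, - 16, 16, - 8, 16, 0, 16, 0, 16, 16, - 32]"
  unfolding trunc_simps by code_simp

lemma trunc_theta_eis_2: "trunc 17 (theta_eis_cf 5 2 3 (-8) 12 2 3) = [0, - 4, 8, 4, - 8, - 8, 0, 8, 0, 4, 0, 0, - 8, 16, - 16, - 8, 16]"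
  unfolding trunc_simps by code_simp

definition eta_list_1 :: "(nat \<times> int) list" where "eta_list_1 = [(1, 1), (6, 4), (8, 2), (2, - 1), (3, - 1), (12, - 1)]"
definition eta_list_2 :: "(nat \<times> int) list" where "eta_list_2 = [(1, 2), (8, 1), (12, 4), (4, - 1), (6, - 1), (24, - 1)]"

lemma trunc_zero: "trunc N (\<lambda>n. 0) = replicate N 0"
  by (simp add: trunc_def map_replicate_const)

lemma trunc_eta_logderiv_1: "trunc 17 (eta_logderiv_cf eta_list_1) = [24, - 24, - 24, - 24, - 24, - 144, - 456, - 192, - 408, - 24, - 144, - 288, - 1032, - 336, - 192, - 144, - 1176]"
  unfolding eta_list_1_def eta_logderiv_cf.simps trunc_simps trunc_zero by code_simp

lemma trunc_eta_logderiv_2: "trunc 17 (eta_logderiv_cf eta_list_2) = [24, - 48, - 144, - 192, - 240, - 288, - 432, - 384, - 624, - 624, - 864, - 576, - 1680, - 672, - 1152, - 1152, - 1392]"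
  unfolding eta_list_2_def eta_logderiv_cf.simps trunc_simps trunc_zero by code_simp

lemma trunc_logderiv_defect_1: "trunc 17 (\<lambda>n. 24 * (int n * theta_eis_cf 5 1 3 (-16) 24 2 3 n) + (- 1) * conv (theta_eis_cf 5 1 3 (-16) 24 2 3) (eta_logderiv_cf eta_list_1) n) = replicate 17 0"
  unfolding trunc_add trunc_cmult trunc_deriv trunc_conv trunc_theta_eis_1 trunc_eta_logderiv_1 by code_simp

lemma trunc_logderiv_defect_2: "trunc 17 (\<lambda>n. 24 * (int n * theta_eis_cf 5 2 3 (-8) 12 2 3 n) + (- 1) * conv (theta_eis_cf 5 2 3 (-8) 12 2 3) (eta_logderiv_cf eta_list_2) n) = replicate 17 0"
  unfolding trunc_add trunc_cmult trunc_deriv trunc_conv trunc_theta_eis_2 trunc_eta_logderiv_2 by code_simp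

lemma eta_quot_1: "eta_quot eta_list_1 z = B1 z"
  by (simp add: eta_quot_def eta_list_1_def B1_def power_int_minus field_simps)

lemma eta_quot_2: "eta_quot eta_list_2 z = B2 z"
  by (simp add: eta_quot_def eta_list_2_def B2_def power_int_minus field_simps)

text \<open>The Eisenstein coefficients are those that make the combination vanish at the cusps; \<open>8\<close> is its
  coefficient of \<open>q\<close>.\<close>

lemma theta_eis_eq_B1:
  assumes z: "Im z > 0"
  shows "theta_eis 5 1 3 (-16) 24 2 3 z = 8 * B1 z"
proof -
  let ?a = "theta_eis_cf 5 1 3 (-16) 24 2 3"
  have q: "qseries ?a (theta_eis 5 1 3 (-16) 24 2 3)" by (rule qseries_theta_eis) auto
  have r: "\<forall>(\<delta>, e)\<in>set eta_list_1. \<delta> > 0 \<and> \<delta> dvd 24" by (simp add: eta_list_1_def)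
  have r': "\<forall>(\<delta>, e)\<in>set eta_list_1. \<delta> > 0" by (simp add: eta_list_1_def)
  have s: "form24 4 (logderiv_defect eta_list_1 (theta_eis 5 1 3 (-16) 24 2 3))"
    by (rule form24_logderiv_defect[OF form24_theta_eis r]) (simp_all add: eta_list_1_def)
  have "theta_eis 5 1 3 (-16) 24 2 3 z = of_int (?a 1) * eta_quot eta_list_1 z"
  proof (rule eq_eta_quot_if_logderiv_defect_eq_0[OF q r' _ _ _ z])
    show "(\<Sum>(\<delta>, e)\<leftarrow>eta_list_1. int \<delta> * e) = 24" by (simp add: eta_list_1_def)
    show "?a 0 = 0" using trunc_nth[of 0 17 ?a, unfolded trunc_theta_eis_1] by simp
    show "logderiv_defect eta_list_1 (theta_eis 5 1 3 (-16) 24 2 3) w = 0" if "Im w > 0" for w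
      by (rule form24_eq_0[OF s qseries_logderiv_defect[OF q r'] trunc_logderiv_defect_1 _ that]) simp
  qed
  moreover have "?a 1 = 8" using trunc_nth[of 1 17 ?a, unfolded trunc_theta_eis_1] by simp
  ultimately show ?thesis by (simp add: eta_quot_1)
qed

lemma theta_eis_eq_B2:
  assumes z: "Im z > 0"
  shows "theta_eis 5 2 3 (-8) 12 2 3 z = - 4 * B2 z"
proof -
  let ?a = "theta_eis_cf 5 2 3 (-8) 12 2 3"
  have q: "qseries ?a (theta_eis 5 2 3 (-8) 12 2 3)" by (rule qseries_theta_eis) auto
  have r: "\<forall>(\<delta>, e)\<in>set eta_list_2. \<delta> > 0 \<and> \<delta> dvd 24" by (simp add: eta_list_2_def)
  have r': "\<forall>(\<delta>, e)\<in>set eta_list_2. \<delta> > 0" by (simp add: eta_list_2_def)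
  have s: "form24 4 (logderiv_defect eta_list_2 (theta_eis 5 2 3 (-8) 12 2 3))"
    by (rule form24_logderiv_defect[OF form24_theta_eis r]) (simp_all add: eta_list_2_def)
  have "theta_eis 5 2 3 (-8) 12 2 3 z = of_int (?a 1) * eta_quot eta_list_2 z"
  proof (rule eq_eta_quot_if_logderiv_defect_eq_0[OF q r' _ _ _ z])
    show "(\<Sum>(\<delta>, e)\<leftarrow>eta_list_2. int \<delta> * e) = 24" by (simp add: eta_list_2_def)
    show "?a 0 = 0" using trunc_nth[of 0 17 ?a, unfolded trunc_theta_eis_2] by simp
    show "logderiv_defect eta_list_2 (theta_eis 5 2 3 (-8) 12 2 3) w = 0" if "Im w > 0" for w
      by (rule form24_eq_0[OF s qseries_logderiv_defect[OF q r'] trunc_logderiv_defect_2 _ that]) simp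
  qed
  moreover have "?a 1 = - 4" using trunc_nth[of 1 17 ?a, unfolded trunc_theta_eis_2] by simp
  ultimately show ?thesis by (simp add: eta_quot_2)
qed

lemma trunc_le: "M \<le> N \<Longrightarrow> trunc N a = replicate N 0 \<Longrightarrow> trunc M a = replicate M 0"
  by (metis min.absorb1 take_map take_replicate take_upt trunc_def add_0 le0 nle_le)

lemma theta_form_1_1: assumes "Im z > 0" shows "theta_eis 1 1 1 (-8) 0 1 0 z = 0"
proof (rule form24_eq_0[OF form24_theta_eis qseries_theta_eis _ _ assms])
  have "trunc 17 (theta_eis_cf 1 1 1 (-8) 0 1 0) = replicate 17 0" unfolding trunc_simps by code_simp
  thus "trunc 9 (theta_eis_cf 1 1 1 (-8) 0 1 0) = replicate 9 0" by (rule trunc_le[rotated]) simp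
qed auto

lemma theta_form_2_1: assumes "Im z > 0" shows "theta_eis 1 2 1 (-4) 0 1 0 z = 0"
proof (rule form24_eq_0[OF form24_theta_eis qseries_theta_eis _ _ assms])
  have "trunc 17 (theta_eis_cf 1 2 1 (-4) 0 1 0) = replicate 17 0" unfolding trunc_simps by code_simp
  thus "trunc 9 (theta_eis_cf 1 2 1 (-4) 0 1 0) = replicate 9 0" by (rule trunc_le[rotated]) simp
qed auto

text \<open>By the identities for \<open>B1\<close> and \<open>B2\<close> the last two summands are \<open>8 B1\<close> and \<open>-8 B2\<close>. In this form the left hand side is
  visibly a form of weight 2.\<close>

lemma theta_form_3_1:
  assumes "Im z > 0"
  shows "theta_eis 5 3 1 (-8) (-48) (-1) 6 z + (theta_eis 5 1 3 (-16) 24 2 3 z + of_int 2 * theta_eis 5 2 3 (-8) 12 2 3 z) = 0"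
proof (rule form24_eq_0[OF form24_add[OF form24_theta_eis form24_add[OF form24_theta_eis form24_cmult[OF form24_theta_eis]]] qseries_add[OF qseries_theta_eis qseries_add[OF qseries_theta_eis qseries_cmult[OF qseries_theta_eis]]] _ _ assms])
  have "trunc 17 (\<lambda>n. theta_eis_cf 5 3 1 (-8) (-48) (-1) 6 n + (theta_eis_cf 5 1 3 (-16) 24 2 3 n + 2 * theta_eis_cf 5 2 3 (-8) 12 2 3 n)) = replicate 17 0"
    unfolding trunc_add trunc_cmult trunc_theta_eis_1 trunc_theta_eis_2 unfolding trunc_simps by code_simp
  thus "trunc 9 (\<lambda>n. theta_eis_cf 5 3 1 (-8) (-48) (-1) 6 n + (theta_eis_cf 5 1 3 (-16) 24 2 3 n + 2 * theta_eis_cf 5 2 3 (-8) 12 2 3 n)) = replicate 9 0"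
    by (rule trunc_le[rotated]) simp
qed auto

lemma theta_form_6_1:
  assumes "Im z > 0"
  shows "theta_eis 5 6 1 (-4) (-24) (-1) 6 z + (of_int (-1) * theta_eis 5 1 3 (-16) 24 2 3 z + of_int (-1) * theta_eis 5 2 3 (-8) 12 2 3 z) = 0"
proof (rule form24_eq_0[OF form24_add[OF form24_theta_eis form24_add[OF form24_cmult[OF form24_theta_eis] form24_cmult[OF form24_theta_eis]]] qseries_add[OF qseries_theta_eis qseries_add[OF qseries_cmult[OF qseries_theta_eis] qseries_cmult[OF qseries_theta_eis]]] _ _ assms])
  have "trunc 17 (\<lambda>n. theta_eis_cf 5 6 1 (-4) (-24) (-1) 6 n + (- 1 * theta_eis_cf 5 1 3 (-16) 24 2 3 n + - 1 * theta_eis_cf 5 2 3 (-8) 12 2 3 n)) = replicate 17 0"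
    unfolding trunc_add trunc_cmult trunc_theta_eis_1 trunc_theta_eis_2 unfolding trunc_simps by code_simp
  thus "trunc 9 (\<lambda>n. theta_eis_cf 5 6 1 (-4) (-24) (-1) 6 n + (- 1 * theta_eis_cf 5 1 3 (-16) 24 2 3 n + - 1 * theta_eis_cf 5 2 3 (-8) 12 2 3 n)) = replicate 9 0"
    by (rule trunc_le[rotated]) simp
qed auto

section \<open>The eight theta products\<close>

text \<open>The bound for the transforms of weight 2 is precisely the growth condition \<open>tempered\<close>.\<close>

lemma form24_imp_modular_form:
  assumes "form24 2 f"
  shows "f \<in> modular_forms 2 24 (chi 8)"
proof -
  have sl: "slash 2 f g z = aut g z powi (- 2) * f (mob g z)" for g z
    by (cases g) (simp add: aut_def mob_def)
  have 1: "slash 2 f g z = chi 8 (lower_right g) * f z" if g: "g \<in> Gamma0 24" and z: "Im z > 0" for g z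
  proof -
    have "aut g z \<noteq> 0" by (rule aut_nonzero[OF Gamma0_subset_SL2Z[OF g] z])
    moreover have "f (mob g z) = of_int (kron8 (lower_right g)) * aut g z ^ 2 * f z"
      using assms g z unfolding form24_def by blast
    ultimately show ?thesis by (simp add: sl chi_8 power_int_minus field_simps)
  qed
  have 2: "\<exists>Y>0. \<exists>C. \<forall>z. Im z \<ge> Y \<longrightarrow> norm (slash 2 f \<gamma> z) \<le> C" if g: "\<gamma> \<in> SL2Z" for \<gamma>
  proof -
    obtain Y C where YC: "Y > 0" "\<And>z. Im z \<ge> Y \<Longrightarrow> norm (f (mob \<gamma> z)) \<le> C * norm (aut \<gamma> z) powr real 2"
      using assms g unfolding form24_def tempered_def by blast
    have "norm (slash 2 f \<gamma> z) \<le> C" if "Im z \<ge> Y" for z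
    proof -
      have j: "norm (aut \<gamma> z) > 0" using aut_nonzero[OF g, of z] YC(1) that by simp
      have "norm (slash 2 f \<gamma> z) = norm (f (mob \<gamma> z)) / norm (aut \<gamma> z) ^ 2"
        by (simp add: sl power_int_minus norm_mult norm_inverse norm_power divide_inverse)
      thus ?thesis using YC(2)[OF that] j by (simp add: pos_divide_le_eq)
    qed
    thus ?thesis using YC(1) by blast
  qed
  show ?thesis unfolding modular_forms_def using assms 1 2 by (auto simp: form24_def upper_half_plane_def)
qed

theorem theorem3p2:
  fixes a1 a2 a3 a4 :: nat and b1 b2 b3 b4 x1 x2 :: complex
  assumes "((a1, a2, a3, a4), (b1, b2, b3, b4, x1, x2)) \<in> theta_table"
  shows "theta_product (a1, a2, a3, a4) \<in> modular_forms 2 24 (chi 8) \<and>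
    (\<forall>z\<in>upper_half_plane.
      theta_product (a1, a2, a3, a4) z =
        b1 * E_1_8 z + b2 * E_1_8 (3 * z) + b3 * E_8_1 z + b4 * E_8_1 (3 * z)
        + x1 * B1 z + x2 * B2 z)"
proof -
  have tp: "theta_product (1, 1, 1, 2) = theta_form 1 1" "theta_product (1, 1, 3, 6) = theta_form 1 3"
    "theta_product (1, 2, 2, 2) = theta_form 2 1" "theta_product (1, 2, 3, 3) = theta_form 3 1"
    "theta_product (1, 2, 6, 6) = theta_form 6 1" "theta_product (2, 2, 3, 6) = theta_form 2 3"
    "theta_product (3, 3, 3, 6) = theta_form 3 3" "theta_product (3, 6, 6, 6) = theta_form 6 3"
    by (rule ext; simp add: theta_form_def mult_ac)+
  have M: "theta_form m n \<in> modular_forms 2 24 (chi 8)" if "m \<in> {1, 2, 3, 6}" "n \<in> {1, 3}" for m n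
    by (rule form24_imp_modular_form[OF form24_theta_form]) (use that in auto)
  have T11: "theta_form 1 1 z = 8 * E_1_8 z - 2 * E_8_1 z" if "Im z > 0" for z
    using theta_form_1_1[OF that] by (simp add: theta_eis_def algebra_simps add_eq_0_iff)
  have T21: "theta_form 2 1 z = 4 * E_1_8 z - 2 * E_8_1 z" if "Im z > 0" for z
    using theta_form_2_1[OF that] by (simp add: theta_eis_def algebra_simps add_eq_0_iff)
  have T13: "5 * theta_form 1 3 z = 16 * E_1_8 z - 24 * E_1_8 (3 * z) - 4 * E_8_1 z - 6 * E_8_1 (3 * z) + 8 * B1 z" if "Im z > 0" for z
    using theta_eis_eq_B1[OF that] by (simp add: theta_eis_def algebra_simps)
  have T23: "5 * theta_form 2 3 z = 8 * E_1_8 z - 12 * E_1_8 (3 * z) - 4 * E_8_1 z - 6 * E_8_1 (3 * z) - 4 * B2 z" if "Im z > 0" for z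
    using theta_eis_eq_B2[OF that] by (simp add: theta_eis_def algebra_simps)
  have T31: "5 * theta_form 3 1 z = 8 * E_1_8 z + 48 * E_1_8 (3 * z) + 2 * E_8_1 z - 12 * E_8_1 (3 * z) - 8 * B1 z + 8 * B2 z" if "Im z > 0" for z
  proof -
    have "theta_eis 5 3 1 (-8) (-48) (-1) 6 z + (8 * B1 z + 2 * (- 4 * B2 z)) = 0"
      using theta_form_3_1[OF that] unfolding theta_eis_eq_B1[OF that] theta_eis_eq_B2[OF that] by simp
    thus ?thesis by (simp add: theta_eis_def algebra_simps)
  qed
  have T61: "5 * theta_form 6 1 z = 4 * E_1_8 z + 24 * E_1_8 (3 * z) + 2 * E_8_1 z - 12 * E_8_1 (3 * z) + 8 * B1 z - 4 * B2 z" if "Im z > 0" for z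
  proof -
    have "theta_eis 5 6 1 (-4) (-24) (-1) 6 z + (- (8 * B1 z) - (- 4 * B2 z)) = 0"
      using theta_form_6_1[OF that] unfolding theta_eis_eq_B1[OF that] theta_eis_eq_B2[OF that] by simp
    thus ?thesis by (simp add: theta_eis_def algebra_simps)
  qed
  \<comment> \<open>Two rows arise from two others by the substitution of \<open>3z\<close> for \<open>z\<close>.\<close>
  have tripled: "theta_form 3 3 z = theta_form 1 1 (3 * z)" "theta_form 6 3 z = theta_form 2 1 (3 * z)" for z
    by (simp_all add: theta_form_def)
  have fifth: "x = y / 5" if "5 * x = y" for x y :: complex
    by (simp flip: that)
  have Im3: "Im (3 * z) > 0" if "Im z > 0" for z using that by simp
  define R where "R f b1 b2 b3 b4 x1 x2 \<longleftrightarrow> f \<in> modular_forms 2 24 (chi 8) \<and>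
    (\<forall>z\<in>upper_half_plane. f z =
        b1 * E_1_8 z + b2 * E_1_8 (3 * z) + b3 * E_8_1 z + b4 * E_8_1 (3 * z) + x1 * B1 z + x2 * B2 z)"
    for f and b1 b2 b3 b4 x1 x2 :: complex
  have rows: "R (theta_form 1 1) 8 0 (-2) 0 0 0"
    "R (theta_form 1 3) (16/5) (-24/5) (-4/5) (-6/5) (8/5) 0"
    "R (theta_form 2 1) 4 0 (-2) 0 0 0"
    "R (theta_form 3 1) (8/5) (48/5) (2/5) (-12/5) (-8/5) (8/5)"
    "R (theta_form 6 1) (4/5) (24/5) (2/5) (-12/5) (8/5) (-4/5)"
    "R (theta_form 2 3) (8/5) (-12/5) (-4/5) (-6/5) 0 (-4/5)"
    "R (theta_form 3 3) 0 8 0 (-2) 0 0"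
    "R (theta_form 6 3) 0 4 0 (-2) 0 0"
    unfolding R_def
    by (intro conjI ballI M; simp del: One_nat_def add: T11[OF Im3] T21[OF Im3] tripled upper_half_plane_def T11 T21 fifth[OF T13] fifth[OF T23] fifth[OF T31]
          fifth[OF T61] add_divide_distrib diff_divide_distrib)+
  have "\<forall>x\<in>theta_table. case x of ((a1, a2, a3, a4), (b1, b2, b3, b4, x1, x2)) \<Rightarrow>
      R (theta_product (a1, a2, a3, a4)) b1 b2 b3 b4 x1 x2"
    unfolding theta_table_def ball_simps prod.case tp using rows by blast
  from bspec[OF this assms] show ?thesis unfolding prod.case R_def .
qed

end
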